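(* Let $L=L(Q,A,h)$ and $\widetilde L=L(\widetilde Q,A,\widetilde h)$ be two problems with the same orthogonal projection matrix $A$. Then for every $x\ge 0$ and every $\lambda\in\mathbb C$, $$\widetilde\varphi(x,\lambda)=\varphi(x,\lambda)+\frac{1}{2\pi i}\int_\gamma\varphi(x,\mu)\,\widetilde r(x,\lambda,\mu)\,d\mu .$$
   Context: Problem $L(Q,A,h)$: $n\ge 1$; $Q$ is a complex $n\times n$ matrix-valued function on $(0,\infty)$ with entries in $L^1(0,\infty)$; $A\in\mathbb C^{n\times n}$ is an orthogonal projection matrix ($A^\dagger=A=A^2$), $A^\perp:=I_n-A$; $h\in\mathbb C^{n\times n}$ satisfies $h=AhA=Ah=hA$ (no self-adjointness of $Q$ or $h$ is assumed). $L(Q,A,h)$ denotes the equation $-Y''+Q(x)Y=\lambda Y$, $x>0$, with boundary condition $T(Y):=A(Y'(0)-hY(0))-A^\perp Y(0)=0$. $\widetilde Q,\widetilde h$ satisfy the same assumptions (with the same $A$); objects with a tilde are those built from $(\widetilde Q,A,\widetilde h)$ in the same way as below. Prime denotes $d/dx$. Weyl matrix. Let $\lambda=\rho^2$, $\Omega:=\{\rho\in\mathbb C:\operatorname{Im}\rho\ge 0,\rho\ne 0\}$. The Jost solution $e(x,\rho)$, $\rho\in\Omega$, is the matrix solution given by $e(x,\rho)=e^{i\rho x}I_n+\int_x^\infty\frac{\sin\rho(t-x)}{\rho}Q(t)e(t,\rho)\,dt$ (with $e^{-i\rho x}e(x,\rho)$ bounded in $x$). Put $J(\rho):=A(e'(0,\rho)-he(0,\rho))-A^\perp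 e(0,\rho)$ and $M(\lambda):=[Ae(0,\rho)+A^\perp e'(0,\rho)]J(\rho)^{-1}$. Put $\Lambda:=\{\lambda=\rho^2:\rho\in\Omega,\ \det J(\rho)=0\}$, which is a bounded set. $\hat M:=M-\widetilde M$. Regular solutions. $\varphi(x,\lambda)$ is the matrix solution of $-Y''+QY=\lambda Y$ with $\varphi(0,\lambda)=A$, $\varphi'(0,\lambda)=A^\perp+h$. $\varphi^*(x,\lambda)$ is the matrix solution of $-Z''+ZQ(x)=\lambda Z$ with $\varphi^*(0,\lambda)=A$, $\varphi^{*\prime}(0,\lambda)=A^\perp+h$. Kernel. $\widetilde D(x,\lambda,\mu):=\int_0^x\widetilde\varphi^*(t,\mu)\widetilde\varphi(t,\lambda)\,dt$, which for $\lambda\neq\mu$ equals $\frac{\widetilde\varphi^{*\prime}(x,\mu)\widetilde\varphi(x,\lambda)-\widetilde\varphi^{*}(x,\mu)\widetilde\varphi'(x,\lambda)}{\lambda-\mu}$; and $\widetilde r(x,\lambda,\mu):=\hat M(\mu)\widetilde D(x,\lambda,\mu)$. Contour. $\gamma=\gamma'\cup\gamma''$ with counterclockwise circuit, where $\gamma'$ is a bounded closed contour in the $\lambda$-plane encircling $\Lambda\cup\widetilde\Lambda\cup\{0\}$, and $\gamma''$ is the two-sided cut along $\{\lambda:\lambda>0,\ \lambda\notin\operatorname{int}\gamma'\}$: the path comes from $+\infty$ along the upper side of the cut, goes around $\gamma'$ counterclockwise, and returns to $+\infty$ along the lower side. On the upper (lower) side of the cut, $M$ and $\widetilde M$ take their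 boundary values, corresponding to $\rho=\sqrt\lambda>0$ (resp. $\rho=-\sqrt\lambda<0$). *)

theory Defs
  imports "HOL-Complex_Analysis.Complex_Analysis"
begin

text \<open>
  Scalar multiples of a matrix are written \<open>mat c ** Y\<close>, where \<open>mat c\<close> is
  \<open>c\<close> times the identity matrix.
\<close>

definition ctranspose :: "complex^'n^'n \<Rightarrow> complex^'n^'n" where
  "ctranspose A = map_matrix cnj (transpose A)"

definition orthogonal_projection :: "complex^'n^'n \<Rightarrow> bool" where
  "orthogonal_projection A \<longleftrightarrow> ctranspose A = A \<and> A ** A = A"

abbreviation perp :: "complex^'n^'n \<Rightarrow> complex^'n^'n" where
  "perp A \<equiv> mat 1 - A"

definition sl_problem ::
  "(real \<Rightarrow> complex^'n^'n) \<Rightarrow> complex^'n^'n \<Rightarrow> complex^'n^'n \<Rightarrow> bool" where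
  "sl_problem Q A h \<longleftrightarrow>
     (\<forall>i j. (\<lambda>x. Q x $ i $ j) absolutely_integrable_on {0<..}) \<and>
     orthogonal_projection A \<and>
     h = A ** h ** A \<and> h = A ** h \<and> h = h ** A"

text \<open>The derivative on the half-line; one-sided at \<open>0\<close>.\<close>

definition dx :: "(real \<Rightarrow> complex^'n^'n) \<Rightarrow> real \<Rightarrow> complex^'n^'n" where
  "dx Y x = vector_derivative Y (at x within {0..})"

text \<open>
  As \<open>Q\<close> is merely integrable, solutions are understood in the usual (Caratheodory)
  sense: \<open>Y\<close> is differentiable on \<open>[0,\<infinity>)\<close>, and \<open>Y'\<close> is locally absolutely continuous
  with \<open>Y'' = Q Y - \<lambda> Y\<close> almost everywhere. Equivalently, \<open>Y'\<close> is the indefinite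
  integral of \<open>Q Y - \<lambda> Y\<close>.
\<close>

definition sl_solution ::
  "(real \<Rightarrow> complex^'n^'n) \<Rightarrow> complex \<Rightarrow> (real \<Rightarrow> complex^'n^'n) \<Rightarrow> bool" where
  "sl_solution Q lam Y \<longleftrightarrow>
     Y differentiable_on {0..} \<and>
     (\<forall>x\<ge>0. ((\<lambda>t. Q t ** Y t - mat lam ** Y t) has_integral (dx Y x - dx Y 0)) {0..x})"

definition sl_solution_dual ::
  "(real \<Rightarrow> complex^'n^'n) \<Rightarrow> complex \<Rightarrow> (real \<Rightarrow> complex^'n^'n) \<Rightarrow> bool" where
  "sl_solution_dual Q lam Z \<longleftrightarrow>
     Z differentiable_on {0..} \<and>
     (\<forall>x\<ge>0. ((\<lambda>t. Z t ** Q t - mat lam ** Z t) has_integral (dx Z x - dx Z 0)) {0..x})"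

definition regular_solution ::
  "(real \<Rightarrow> complex^'n^'n) \<Rightarrow> complex^'n^'n \<Rightarrow> complex^'n^'n \<Rightarrow> complex \<Rightarrow>
   (real \<Rightarrow> complex^'n^'n) \<Rightarrow> bool" where
  "regular_solution Q A h lam Y \<longleftrightarrow>
     sl_solution Q lam Y \<and> Y 0 = A \<and> dx Y 0 = perp A + h"

definition regular_solution_dual ::
  "(real \<Rightarrow> complex^'n^'n) \<Rightarrow> complex^'n^'n \<Rightarrow> complex^'n^'n \<Rightarrow> complex \<Rightarrow>
   (real \<Rightarrow> complex^'n^'n) \<Rightarrow> bool" where
  "regular_solution_dual Q A h lam Z \<longleftrightarrow>
     sl_solution_dual Q lam Z \<and> Z 0 = A \<and> dx Z 0 = perp A + h"

definition Omega :: "complex set" where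
  "Omega = {\<rho>. Im \<rho> \<ge> 0 \<and> \<rho> \<noteq> 0}"

definition jost_solution ::
  "(real \<Rightarrow> complex^'n^'n) \<Rightarrow> complex \<Rightarrow> (real \<Rightarrow> complex^'n^'n) \<Rightarrow> bool" where
  "jost_solution Q \<rho> e \<longleftrightarrow>
     sl_solution Q (\<rho>\<^sup>2) e \<and>
     bounded ((\<lambda>x. mat (exp (- \<i> * \<rho> * of_real x)) ** e x) ` {0..}) \<and>
     (\<forall>x\<ge>0. ((\<lambda>t. mat (sin (\<rho> * of_real (t - x)) / \<rho>) ** Q t ** e t) has_integral
              (e x - mat (exp (\<i> * \<rho> * of_real x)))) {x..})"

definition bc :: "complex^'n^'n \<Rightarrow> complex^'n^'n \<Rightarrow> (real \<Rightarrow> complex^'n^'n) \<Rightarrow> complex^'n^'n" where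
  "bc A h Y = A ** (dx Y 0 - h ** Y 0) - perp A ** Y 0"

text \<open>
  With \<open>e x \<rho>\<close> the Jost solution, \<open>bc A h (\<lambda>x. e x \<rho>)\<close> is \<open>J(\<rho>)\<close>. The Weyl matrix is
  a function of \<open>\<rho> \<in> Omega\<close> rather than of \<open>\<lambda> = \<rho>\<^sup>2\<close>, so that its two boundary values at
  \<open>\<lambda> > 0\<close> are its values at the two real square roots of \<open>\<lambda>\<close>.
\<close>

definition weyl ::
  "complex^'n^'n \<Rightarrow> complex^'n^'n \<Rightarrow> (real \<Rightarrow> complex \<Rightarrow> complex^'n^'n) \<Rightarrow> complex \<Rightarrow>
   complex^'n^'n" where
  "weyl A h e \<rho> =
     (A ** e 0 \<rho> + perp A ** dx (\<lambda>x. e x \<rho>) 0) ** matrix_inv (bc A h (\<lambda>x. e x \<rho>))"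

definition Lambda_set ::
  "complex^'n^'n \<Rightarrow> complex^'n^'n \<Rightarrow> (real \<Rightarrow> complex \<Rightarrow> complex^'n^'n) \<Rightarrow> complex set" where
  "Lambda_set A h e = {\<rho>\<^sup>2 | \<rho>. \<rho> \<in> Omega \<and> det (bc A h (\<lambda>x. e x \<rho>)) = 0}"

definition kernel_D ::
  "(real \<Rightarrow> complex \<Rightarrow> complex^'n^'n) \<Rightarrow> (real \<Rightarrow> complex \<Rightarrow> complex^'n^'n) \<Rightarrow>
   real \<Rightarrow> complex \<Rightarrow> complex \<Rightarrow> complex^'n^'n" where
  "kernel_D \<phi>s \<phi> x lam \<mu> = integral {0..x} (\<lambda>t. \<phi>s t \<mu> ** \<phi> t lam)"

text \<open>
  \<open>g\<close> is the bounded part of the contour: a closed contour, counterclockwise around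
  \<open>S \<union> {0}\<close>. It meets the positive half-line only at its base point, so that the cut
  is a single ray attached to it there.
\<close>

definition loop_around :: "complex set \<Rightarrow> (real \<Rightarrow> complex) \<Rightarrow> bool" where
  "loop_around S g \<longleftrightarrow>
     valid_path g \<and> simple_path g \<and> pathfinish g = pathstart g \<and>
     S \<union> {0} \<subseteq> inside (path_image g) \<and> winding_number g 0 = 1 \<and>
     path_image g \<inter> of_real ` {0<..} = {pathstart g}"

definition cut :: "(real \<Rightarrow> complex) \<Rightarrow> real set" where
  "cut g = {s. s > 0 \<and> of_real s \<notin> inside (path_image g)}"

text \<open>
  The square root with values in \<open>Omega\<close>. On the positive half-line it is the positive
  root, but on a loop as above this concerns only the end points of the parametrization.
\<close>

definition up_sqrt :: "complex \<Rightarrow> complex" where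
  "up_sqrt \<mu> = (if Im (csqrt \<mu>) \<ge> 0 then csqrt \<mu> else - csqrt \<mu>)"

text \<open>
  The integral over the whole contour of a matrix function \<open>F\<close> of \<open>\<rho>\<close>, \<open>\<mu> = \<rho>\<^sup>2\<close>: inwards
  along the upper side of the cut, around \<open>g\<close>, outwards along the lower side. Convergence
  of all three integrals is part of the definition; on the unbounded sides of the cut,
  Henstock-Kurzweil integrals are improper integrals.
\<close>

definition has_gamma_integral ::
  "(complex \<Rightarrow> complex^'n^'n) \<Rightarrow> complex^'n^'n \<Rightarrow> (real \<Rightarrow> complex) \<Rightarrow> bool" where
  "has_gamma_integral F I g \<longleftrightarrow>
     (\<exists>U C L.
        ((\<lambda>s. F (of_real (sqrt s))) has_integral U) (cut g) \<and>
        (\<forall>i j. ((\<lambda>\<mu>. F (up_sqrt \<mu>) $ i $ j) has_contour_integral C $ i $ j) g) \<and>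
        ((\<lambda>s. F (of_real (- sqrt s))) has_integral L) (cut g) \<and>
        I = - U + C + L)"

end

theory Submission
  imports Defs
begin

text \<open>
  The proof works in the plane of \<open>\<rho>\<close>, where \<open>\<mu> = \<rho>\<^sup>2\<close>. The closed upper half-plane is the domain of
  the Jost solution, the two sides of the cut become the two halves of the real axis, and the loop \<open>g\<close>
  lifts to an arc in the upper half-plane from \<open>\<surd>b\<close> to \<open>-\<surd>b\<close>, where \<open>b > 0\<close> is its base point
  (\<open>loop_sqrt_lift\<close>). The integrand is \<open>F(\<rho>) = \<phi>(x,\<rho>\<^sup>2) (M - M~)(\<rho>) D~(x,\<lambda>,\<rho>\<^sup>2)\<close>, with \<open>~\<close> for the objects of the
  second problem. The integral over a large semicircle is computed in two ways.

  The first way is algebraic. The Weyl solution \<open>e J\<^sup>-\<^sup>1\<close> equals \<open>\<phi> M + S\<close> with \<open>S\<close> entire in \<open>\<rho>\<^sup>2\<close>. Let \<open>P\<close> be the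
  matrix that maps the values and derivatives at \<open>x\<close> of the regular and the Weyl solution of the second
  problem to those of the first. It depends on the Weyl matrices through \<open>M - M~\<close> only. With
  \<open>G = P\<^sub>1\<^sub>1 \<phi>~(x,\<lambda>) + P\<^sub>1\<^sub>2 \<phi>~'(x,\<lambda>)\<close>, the Wronskian identity \<open>D~ = (\<phi>~*' \<phi>~ - \<phi>~* \<phi>~') / (\<lambda> - \<mu>)\<close> gives
  \<open>(\<rho>\<^sup>2 - \<lambda>) F(\<rho>) = G(\<rho>) - E(\<rho>\<^sup>2)\<close> with an entire \<open>E\<close> such that \<open>E(\<lambda>) = \<phi>(x,\<lambda>)\<close> (\<open>F_G_E\<close>, \<open>E_lam\<close>). Since
  \<open>P\<^sub>1\<^sub>1 = I + O(1/\<rho>)\<close> and \<open>P\<^sub>1\<^sub>2 = O(1/\<rho>\<^sup>2)\<close> in the closed half-plane (\<open>transfer_asymptotics\<close>), \<open>G\<close> tends to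
  \<open>\<phi>~(x,\<lambda>)\<close>, and Cauchy's formula shows that the integral of \<open>F d\<mu>\<close> over the large semicircle tends to
  \<open>2\<pi>i (\<phi>~(x,\<lambda>) - \<phi>(x,\<lambda>))\<close> (\<open>semicircle_limit\<close>).

  The second way is a deformation. \<open>F\<close> is analytic in the open half-plane and continuous up to the axis,
  away from \<open>0\<close> and from the zeros of the two functions \<open>det J\<close>, whose squares lie inside the loop. Hence the
  semicircle can be contracted to the axis and the lifted loop (\<open>loop_contour_formula\<close>), and
  \<open>F = O(\<rho>\<^sup>-\<^sup>3)\<close> on the axis makes the integrals along the cut converge (\<open>F_decay\<close>).

  Everything about solutions rests on their plane-wave components \<open>e\<^sup>\<minusplus>\<^sup>i\<^sup>\<rho>\<^sup>x (Y' \<plusminus> i\<rho>Y)\<close>, whose increments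
  are integrals of \<open>e\<^sup>\<minusplus>\<^sup>i\<^sup>\<rho>\<^sup>x Q Y\<close> (\<open>wave_integral\<close>). As soon as \<open>|\<rho>|\<close> exceeds twice the integral of \<open>|Q|\<close>, they
  yield bounds that are uniform in \<open>\<rho>\<close> (\<open>solution_growth\<close>, \<open>scaled_asymptotics\<close>, \<open>X_order\<close>). Analyticity in the
  spectral parameter comes from difference quotients for the regular solutions (\<open>ivp_entire\<close>) and from
  locally uniform limits for the Jost solution (\<open>jost_data_uniform_limit\<close>).
\<close>

section \<open>Matrices as a normed algebra\<close>

lemma norm_matrix_mult_le:
  fixes X Y :: "complex^'n^'n"
  shows "norm (X ** Y) \<le> norm X * norm Y"
proof -
  have row: "norm ((X ** Y) $ i) \<le> norm (X $ i) * norm Y" for i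
  proof -
    have "(X ** Y) $ i = (\<Sum>k\<in>UNIV. (\<chi> j. X $ i $ k * Y $ k $ j))"
      by (simp add: vec_eq_iff matrix_matrix_mult_def sum_component)
    also have "norm \<dots> \<le> (\<Sum>k\<in>UNIV. norm (\<chi> j. X $ i $ k * Y $ k $ j))"
      by (rule norm_sum)
    also have "\<dots> = (\<Sum>k\<in>UNIV. \<bar>norm (X $ i $ k)\<bar> * \<bar>norm (Y $ k)\<bar>)"
      by (simp add: norm_vec_def norm_mult L2_set_right_distrib)
    also have "\<dots> \<le> L2_set (\<lambda>k. norm (X $ i $ k)) UNIV * L2_set (\<lambda>k. norm (Y $ k)) UNIV"
      by (rule L2_set_mult_ineq)
    finally show ?thesis by (simp add: norm_vec_def)
  qed
  have "norm (X ** Y) \<le> L2_set (\<lambda>i. norm (X $ i) * norm Y) UNIV"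
    unfolding norm_vec_def[of "X ** Y"] by (intro L2_set_mono row) auto
  also have "\<dots> = norm X * norm Y"
    by (simp add: norm_vec_def[of X] L2_set_left_distrib)
  finally show ?thesis .
qed

lemma matrix_scaleR_left: "(r *\<^sub>R X) ** Y = r *\<^sub>R (X ** (Y :: complex^'n^'n))"
  for X :: "complex^'n^'n"
  by (simp add: vec_eq_iff matrix_matrix_mult_def scaleR_sum_right)

lemma matrix_scaleR_right: "X ** (r *\<^sub>R Y) = r *\<^sub>R (X ** (Y :: complex^'n^'n))"
  for X :: "complex^'n^'n"
  by (simp add: vec_eq_iff matrix_matrix_mult_def scaleR_sum_right)

lemma bounded_bilinear_matrix_mult:
  "bounded_bilinear ((**) :: complex^'n^'n \<Rightarrow> complex^'n^'n \<Rightarrow> complex^'n^'n)"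
proof
  show "(X + X') ** Y = X ** Y + X' ** Y" for X X' Y :: "complex^'n^'n"
    by (simp add: vec_eq_iff matrix_matrix_mult_def sum.distrib algebra_simps)
  show "\<exists>K. \<forall>(X :: complex^'n^'n) (Y :: complex^'n^'n). norm (X ** Y) \<le> norm X * norm Y * K"
    by (rule exI[of _ 1]) (simp add: norm_matrix_mult_le)
qed (simp_all add: matrix_add_ldistrib matrix_scaleR_left matrix_scaleR_right)

interpretation mm: bounded_bilinear "(**) :: complex^'n^'n \<Rightarrow> complex^'n^'n \<Rightarrow> complex^'n^'n"
  by (rule bounded_bilinear_matrix_mult)

definition cscale :: "complex \<Rightarrow> complex^'n^'n \<Rightarrow> complex^'n^'n" (infixr "\<odot>" 75) where
  "c \<odot> X = (\<chi> i j. c * X $ i $ j)"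

lemma cscale_nth [simp]: "(c \<odot> X) $ i $ j = c * X $ i $ j"
  by (simp add: cscale_def)

lemma mat_mult_left: "mat c ** X = c \<odot> (X :: complex^'n^'n)"
proof -
  have "(mat c ** X) $ i $ j = (\<Sum>k\<in>UNIV. if k = i then c * X $ i $ j else 0)" for i j
    unfolding matrix_matrix_mult_def mat_def vec_lambda_beta by (intro sum.cong) auto
  then show ?thesis by (simp add: vec_eq_iff)
qed

lemma mat_mult_right: "X ** mat c = c \<odot> (X :: complex^'n^'n)"
proof -
  have "(X ** mat c) $ i $ j = (\<Sum>k\<in>UNIV. if k = j then c * X $ i $ j else 0)" for i j
    unfolding matrix_matrix_mult_def mat_def vec_lambda_beta by (intro sum.cong) auto
  then show ?thesis by (simp add: vec_eq_iff)
qed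

lemma cscale_mult_left: "(c \<odot> X) ** Y = c \<odot> (X ** Y)"
  by (simp add: vec_eq_iff matrix_matrix_mult_def sum_distrib_left mult.assoc)

lemma cscale_mult_right: "X ** (c \<odot> Y) = c \<odot> (X ** Y)"
  by (simp add: vec_eq_iff matrix_matrix_mult_def sum_distrib_left algebra_simps)

lemma cscale_cscale: "a \<odot> (b \<odot> X) = (a * b) \<odot> X"
  by (simp add: vec_eq_iff)

lemma norm_cscale: "norm (c \<odot> X) = cmod c * norm X"
proof -
  have "norm ((c \<odot> X) $ i) = cmod c * norm (X $ i)" for i
    by (simp add: norm_vec_def norm_mult L2_set_right_distrib)
  then show ?thesis by (simp add: norm_vec_def[of "c \<odot> X"] norm_vec_def[of X] L2_set_right_distrib)
qed

lemma cscale_of_real: "of_real r \<odot> X = r *\<^sub>R X"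
  by (simp add: vec_eq_iff) (simp add: scaleR_conv_of_real)

lemma bounded_bilinear_cscale: "bounded_bilinear (cscale :: complex \<Rightarrow> complex^'n^'n \<Rightarrow> _)"
proof
  show "\<exists>K. \<forall>c (X :: complex^'n^'n). norm (c \<odot> X) \<le> norm c * norm X * K"
    by (rule exI[of _ 1]) (simp add: norm_cscale)
qed (auto simp: vec_eq_iff algebra_simps)

interpretation cs: bounded_bilinear "cscale :: complex \<Rightarrow> complex^'n^'n \<Rightarrow> _"
  by (rule bounded_bilinear_cscale)

lemma cscale_0 [simp]: "0 \<odot> X = 0" and cscale_1 [simp]: "1 \<odot> X = X"
  by (simp_all add: vec_eq_iff)

lemmas mat_distribs = mm.add_left mm.add_right mm.diff_left mm.diff_right mm.minus_left mm.minus_right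
  cs.add_right cs.diff_right cs.minus_right

text \<open>Right-associated normal form of noncommutative products, with scalars in front.\<close>

lemmas mat_normal = matrix_mul_assoc[symmetric] mat_distribs cscale_mult_left cscale_mult_right
  cscale_cscale mat_mult_left mat_mult_right

lemma norm_entry_le: "cmod (X $ i $ j) \<le> norm (X :: complex^'n^'n)"
  by (meson Finite_Cartesian_Product.norm_nth_le order_trans)

lemma bounded_linear_entry: "bounded_linear (\<lambda>X :: complex^'n^'n. X $ i $ j)"
  by (intro bounded_linear_compose[OF bounded_linear_vec_nth bounded_linear_vec_nth])

lemma norm_transpose: "norm (transpose X) = norm (X :: complex^'n^'n)"
proof -
  have "(norm (Y :: complex^'n^'n))\<^sup>2 = (\<Sum>i\<in>UNIV. \<Sum>j\<in>UNIV. (cmod (Y $ i $ j))\<^sup>2)" for Y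
    by (simp add: norm_vec_def L2_set_def sum_nonneg)
  from this[of X] this[of "transpose X"] sum.swap[of "\<lambda>i j. (cmod (X $ i $ j))\<^sup>2" UNIV UNIV]
  have "(norm (transpose X))\<^sup>2 = (norm X)\<^sup>2" by (simp add: transpose_def)
  then show ?thesis by (simp add: power2_eq_iff_nonneg)
qed

lemma bounded_linear_transpose: "bounded_linear (transpose :: complex^'n^'n \<Rightarrow> complex^'n^'n)"
proof (rule bounded_linear_intro[where K = 1])
  show "norm (transpose X) \<le> norm X * 1" for X :: "complex^'n^'n" by (simp add: norm_transpose)
qed (simp_all add: transpose_def vec_eq_iff)

lemma transpose_cscale: "transpose (c \<odot> X) = c \<odot> transpose X"
  by (simp add: vec_eq_iff transpose_def)

lemma Basis_vec_cases:
  "(b :: 'a::euclidean_space^'n) \<in> Basis \<Longrightarrow> \<exists>i u. b = axis i u \<and> u \<in> Basis"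
  by (auto simp: Basis_vec_def)

lemma has_integral_matrix_entries:
  fixes f :: "'a::euclidean_space \<Rightarrow> complex^'n^'n"
  assumes "\<And>i j. ((\<lambda>x. f x $ i $ j) has_integral I $ i $ j) S"
  shows "(f has_integral I) S"
proof -
  have "((\<lambda>x. f x \<bullet> b) has_integral I \<bullet> b) S" if bb: "b \<in> Basis" for b
  proof -
    obtain i u where b1: "b = axis i u" "u \<in> Basis" using Basis_vec_cases[OF bb] by blast
    obtain j c where b2: "u = axis j c" "c \<in> Basis" using Basis_vec_cases[OF b1(2)] by blast
    have "((\<lambda>x. f x $ i $ j \<bullet> c) has_integral I $ i $ j \<bullet> c) S"
      using has_integral_linear[OF assms[of i j] bounded_linear_inner_left[of c]]
      by (simp add: o_def)
    then show ?thesis by (simp only: b1(1) b2(1) inner_axis)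
  qed
  then show ?thesis by (subst has_integral_componentwise_iff) simp
qed

lemma absolutely_integrable_matrix_entries:
  fixes f :: "'a::euclidean_space \<Rightarrow> complex^'n^'n"
  assumes "\<And>i j. (\<lambda>x. f x $ i $ j) absolutely_integrable_on S"
  shows "f absolutely_integrable_on S"
proof -
  have "(\<lambda>x. f x \<bullet> b) absolutely_integrable_on S" if bb: "b \<in> Basis" for b
  proof -
    obtain i u where b1: "b = axis i u" "u \<in> Basis" using Basis_vec_cases[OF bb] by blast
    obtain j c where b2: "u = axis j c" "c \<in> Basis" using Basis_vec_cases[OF b1(2)] by blast
    have "(\<lambda>x. f x $ i $ j \<bullet> c) absolutely_integrable_on S"
      using absolutely_integrable_linear[OF assms[of i j] bounded_linear_inner_left[of c]]
      by (simp add: o_def)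
    then show ?thesis by (simp only: b1(1) b2(1) inner_axis)
  qed
  then show ?thesis by (subst absolutely_integrable_componentwise_iff) simp
qed

section \<open>Indefinite integrals\<close>

lemma absolutely_integrable_continuous_mult:
  fixes P F :: "real \<Rightarrow> complex^'n^'n"
  assumes "continuous_on {a..b} P" and "F absolutely_integrable_on {a..b}"
  shows "(\<lambda>t. P t ** F t) absolutely_integrable_on {a..b}"
    and "(\<lambda>t. F t ** P t) absolutely_integrable_on {a..b}"
proof -
  have m: "P \<in> borel_measurable (lebesgue_on {a..b})"
    by (rule continuous_imp_measurable_on_sets_lebesgue[OF assms(1)]) auto
  have b: "bounded (P ` {a..b})"
    using assms(1) compact_Icc compact_continuous_image compact_imp_bounded by blast
  show "(\<lambda>t. P t ** F t) absolutely_integrable_on {a..b}"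
    by (rule absolutely_integrable_bounded_measurable_product[OF _ m _ b assms(2)])
       (auto simp: bilinear_conv_bounded_bilinear bounded_bilinear_matrix_mult)
  show "(\<lambda>t. F t ** P t) absolutely_integrable_on {a..b}"
    by (rule absolutely_integrable_bounded_measurable_product[OF _ m _ b assms(2), of "\<lambda>x y. y ** x"])
       (auto simp: bilinear_conv_bounded_bilinear intro: bounded_bilinear.flip[OF bounded_bilinear_matrix_mult])
qed

lemma has_integral_norm_le:
  fixes F :: "'a::euclidean_space \<Rightarrow> 'b::euclidean_space"
  assumes "(F has_integral I) S" "(g has_integral J) S" "\<And>t. t \<in> S \<Longrightarrow> norm (F t) \<le> g t"
  shows "norm I \<le> J"
  using integral_norm_bound_integral[of F S g] assms by (auto simp: has_integral_iff)

lemma integral_mult_bound: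
  fixes F :: "real \<Rightarrow> complex^'n^'n"
  assumes "(F has_integral I) S" and "(\<lambda>t. norm (Q t)) integrable_on S"
    and "\<And>t. t \<in> S \<Longrightarrow> norm (F t) \<le> C * norm (Q t :: complex^'n^'n)"
  shows "norm I \<le> C * integral S (\<lambda>t. norm (Q t))"
proof -
  have "norm (integral S F) \<le> integral S (\<lambda>t. C * norm (Q t))"
    using assms by (intro integral_norm_bound_integral) (auto intro: integrable_on_mult_right)
  then show ?thesis using assms(1) by (simp add: integral_unique)
qed

text \<open>
  By continuity of \<open>n\<close> the increments of \<open>\<Phi>\<close> are \<open>o(v - u)\<close>, so that \<open>\<Phi>\<close> has derivative \<open>0\<close> at every point, not
  merely at almost every point.
\<close>

lemma differentiable_constant_if_increments_small:
  fixes \<Phi> :: "real \<Rightarrow> 'a::real_normed_vector" and n :: "real \<Rightarrow> real"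
  assumes n: "continuous_on {a..b} n" and L: "L \<ge> 0"
    and inc: "\<And>u v. a \<le> u \<Longrightarrow> u \<le> v \<Longrightarrow> v \<le> b \<Longrightarrow> norm (\<Phi> v - \<Phi> u) \<le> L * (v - u) * (n v - n u)"
    and ab: "a \<le> b"
  shows "\<Phi> b = \<Phi> a"
proof (rule has_derivative_zero_unique[of "{a..b}"])
  show "(\<Phi> has_derivative (\<lambda>h. 0)) (at t within {a..b})" if t: "t \<in> {a..b}" for t
    unfolding has_derivative_within_alt
  proof (intro conjI allI impI)
    fix \<epsilon> :: real assume \<epsilon>: "\<epsilon> > 0"
    then have "\<epsilon> / (L + 1) > 0" using L by simp
    then obtain d where d: "d > 0" "\<And>y. y \<in> {a..b} \<Longrightarrow> dist y t < d \<Longrightarrow> dist (n y) (n t) < \<epsilon> / (L + 1)"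
      using n t unfolding continuous_on_iff by meson
    have "norm (\<Phi> y - \<Phi> t - 0) \<le> \<epsilon> * norm (y - t)" if y: "y \<in> {a..b}" "norm (y - t) < d" for y
    proof -
      have "\<bar>n y - n t\<bar> \<le> \<epsilon> / (L + 1)"
        using d(2)[OF y(1)] y(2) by (simp add: dist_norm)
      then have "(L + 1) * \<bar>n y - n t\<bar> \<le> \<epsilon>" using L by (simp add: field_simps)
      moreover have "L * \<bar>n y - n t\<bar> \<le> (L + 1) * \<bar>n y - n t\<bar>"
        by (simp add: mult_right_mono)
      ultimately have Ln: "L * \<bar>n y - n t\<bar> \<le> \<epsilon>" by simp
      have "norm (\<Phi> y - \<Phi> t) \<le> L * \<bar>y - t\<bar> * \<bar>n y - n t\<bar>"
      proof (cases "t \<le> y")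
        case True
        then have "norm (\<Phi> y - \<Phi> t) \<le> L * (y - t) * (n y - n t)" using inc[of t y] t y by auto
        also have "\<dots> \<le> L * (y - t) * \<bar>n y - n t\<bar>" using True L by (intro mult_left_mono) auto
        finally show ?thesis using True by simp
      next
        case False
        then have "norm (\<Phi> y - \<Phi> t) \<le> L * (t - y) * (n t - n y)"
          using inc[of y t] t y by (auto simp: norm_minus_commute)
        also have "\<dots> \<le> L * (t - y) * \<bar>n y - n t\<bar>" using False L by (intro mult_left_mono) auto
        finally show ?thesis using False by simp
      qed
      also have "\<dots> = (L * \<bar>n y - n t\<bar>) * \<bar>y - t\<bar>" by simp
      also have "\<dots> \<le> \<epsilon> * \<bar>y - t\<bar>" using Ln by (rule mult_right_mono) simp
      finally show ?thesis by simp
    qed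
    then show "\<exists>d>0. \<forall>y\<in>{a..b}. norm (y - t) < d \<longrightarrow> norm (\<Phi> y - \<Phi> t - 0) \<le> \<epsilon> * norm (y - t)"
      using d(1) by blast
  qed simp
qed (use ab in auto)

lemma has_integral_increment:
  fixes F W :: "real \<Rightarrow> 'a::euclidean_space"
  assumes "\<And>t. t \<in> {a..b} \<Longrightarrow> (F has_integral W t - W a) {a..t}"
    and "a \<le> u" "u \<le> v" "v \<le> b"
  shows "(F has_integral W v - W u) {u..v}"
proof -
  have i: "F integrable_on {a..v}" using assms(1)[of v] assms(2-) by auto
  then have "F integrable_on {u..v}" by (rule integrable_subinterval_real) (use assms in auto)
  moreover have "integral {a..u} F + integral {u..v} F = integral {a..v} F"
    using Henstock_Kurzweil_Integration.integral_combine[OF assms(2,3) i] .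
  ultimately show ?thesis
    using integral_unique[OF assms(1)[of u]] integral_unique[OF assms(1)[of v]] assms(2-)
    by (simp add: has_integral_iff algebra_simps)
qed

text \<open>
  The product of a continuously differentiable \<open>P\<close> and an indefinite integral \<open>W\<close> of a merely
  integrable \<open>F\<close> is the indefinite integral of \<open>P' W + P F\<close>, although \<open>W\<close> may fail to be
  differentiable at many points: since \<open>P\<close> is Lipschitz, the increments of the difference of the
  two sides are \<open>O(v - u)\<close> times the increments of \<open>\<integral> |F|\<close>, so that this difference is
  differentiable everywhere with derivative \<open>0\<close>.
\<close>

lemma bilinear_product_rule:
  fixes P P' F W :: "real \<Rightarrow> complex^'n^'n" and B :: "complex^'n^'n \<Rightarrow> complex^'n^'n \<Rightarrow> complex^'n^'n"
  assumes B: "bounded_bilinear B" and B_le: "\<And>X Y. norm (B X Y) \<le> norm X * norm Y"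
    and BP: "\<And>P c d. continuous_on {c..d} P \<Longrightarrow> F absolutely_integrable_on {c..d} \<Longrightarrow>
        (\<lambda>t. B (P t) (F t)) absolutely_integrable_on {c..d}"
    and ab: "a \<le> b"
    and F: "F absolutely_integrable_on {a..b}"
    and W: "\<And>t. t \<in> {a..b} \<Longrightarrow> (F has_integral W t - W a) {a..t}"
    and P: "\<And>t. t \<in> {a..b} \<Longrightarrow> (P has_vector_derivative P' t) (at t within {a..b})"
    and P': "continuous_on {a..b} P'"
  shows "((\<lambda>t. B (P' t) (W t) + B (P t) (F t)) has_integral B (P b) (W b) - B (P a) (W a)) {a..b}"
proof -
  interpret B: bounded_bilinear B by (rule B)
  let ?G = "\<lambda>t. B (P' t) (W t) + B (P t) (F t)"
  define n where "n t = integral {a..t} (\<lambda>s. norm (F s))" for t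
  have nF: "(\<lambda>s. norm (F s)) integrable_on {a..b}"
    using F by (simp add: absolutely_integrable_on_def)
  have n: "continuous_on {a..b} n"
    unfolding n_def by (rule indefinite_integral_continuous_1[OF nF])
  have W_eq: "W a + integral {a..t} F = W t" if "t \<in> {a..b}" for t
    using integral_unique[OF W[OF that]] by (simp add: algebra_simps)
  have "continuous_on {a..b} (\<lambda>t. W a + integral {a..t} F)"
    using F by (intro continuous_intros indefinite_integral_continuous_1)
      (simp add: absolutely_integrable_on_def)
  then have Wc: "continuous_on {a..b} W"
    by (rule continuous_on_eq) (rule W_eq)
  have Pc: "continuous_on {a..b} P"
    using P by (meson continuous_on_eq_continuous_within has_vector_derivative_continuous)
  obtain L where L: "L \<ge> 0" "\<And>t. t \<in> {a..b} \<Longrightarrow> norm (P' t) \<le> L"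
  proof -
    have "bounded (P' ` {a..b})"
      using P' compact_Icc compact_continuous_image compact_imp_bounded by blast
    then obtain L where L0: "\<forall>x\<in>P' ` {a..b}. norm x \<le> L" unfolding bounded_iff by blast
    then have "\<And>t. t \<in> {a..b} \<Longrightarrow> norm (P' t) \<le> L" by blast
    moreover have "norm (P' a) \<le> L" using L0 ab by simp
    then have "L \<ge> 0" using norm_ge_zero[of "P' a"] by linarith
    ultimately show ?thesis using that by blast
  qed
  have lip: "norm (P v - P u) \<le> L * \<bar>v - u\<bar>" if "u \<in> {a..b}" "v \<in> {a..b}" for u v
  proof -
    have "norm (P v - P u) \<le> L * norm (v - u)"
    proof (rule differentiable_bound[of "{a..b}" P "\<lambda>t h. h *\<^sub>R P' t"])
      show "onorm (\<lambda>h. h *\<^sub>R P' t) \<le> L" if "t \<in> {a..b}" for t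
      proof (rule onorm_bound[OF L(1)])
        show "norm (h *\<^sub>R P' t) \<le> L * norm h" for h
          using mult_left_mono[OF L(2)[OF that], of "\<bar>h\<bar>"] by (simp add: mult.commute)
      qed
    qed (use P that in \<open>auto simp: has_vector_derivative_def\<close>)
    then show ?thesis by simp
  qed
  have cont: "continuous_on {a..b} (\<lambda>t. B (P' t) (W t))" by (rule B.continuous_on[OF P' Wc])
  have PF: "(\<lambda>t. B (P t) (F t)) integrable_on {a..b}"
    using BP[OF Pc F] by (simp add: absolutely_integrable_on_def)
  have G: "?G integrable_on {a..b}"
    by (rule integrable_add[OF integrable_continuous_real[OF cont] PF])
  define \<Phi> where "\<Phi> v = B (P v) (W v) - integral {a..v} ?G" for v
  have "\<Phi> b = \<Phi> a"
  proof (rule differentiable_constant_if_increments_small[OF n, of "2 * L"])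
    fix u v assume uv: "a \<le> u" "u \<le> v" "v \<le> b"
    have sub: "{u..v} \<subseteq> {a..b}" using uv by auto
    have Guv: "(?G has_integral integral {u..v} ?G) {u..v}"
      using G sub uv by (meson integrable_integral integrable_subinterval_real)
    have int_split: "integral {a..u} ?G + integral {u..v} ?G = integral {a..v} ?G"
      by (rule Henstock_Kurzweil_Integration.integral_combine[OF uv(1,2)])
        (rule integrable_subinterval_real[OF G], use uv in auto)
    have FW: "(F has_integral W v - W u) {u..v}" by (rule has_integral_increment[OF W uv])
    have PP: "(P' has_integral P v - P u) {u..v}"
      by (rule fundamental_theorem_of_calculus[OF uv(2)])
        (rule has_vector_derivative_within_subset[OF P], use sub in auto)
    have nn: "((\<lambda>s. norm (F s)) has_integral n v - n u) {u..v}"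
    proof (rule has_integral_increment[OF _ uv])
      fix t assume "t \<in> {a..b}"
      then have "(\<lambda>s. norm (F s)) integrable_on {a..t}"
        by (intro integrable_subinterval_real[OF nF]) auto
      then show "((\<lambda>s. norm (F s)) has_integral n t - n a) {a..t}"
        by (simp add: n_def has_integral_integral)
    qed
    have Wd: "norm (W u - W t) \<le> n v - n u" if t: "t \<in> {u..v}" for t
    proof -
      have "(F has_integral W t - W u) {u..t}"
        by (rule has_integral_increment[OF W]) (use t uv in auto)
      moreover have m: "((\<lambda>s. norm (F s)) has_integral integral {u..t} (\<lambda>s. norm (F s))) {u..t}"
        using nn t by (intro integrable_integral integrable_subinterval_real[OF has_integral_integrable[OF nn]]) auto
      ultimately have "norm (W t - W u) \<le> integral {u..t} (\<lambda>s. norm (F s))"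
        by (rule has_integral_norm_le) simp
      also have "\<dots> \<le> integral {u..v} (\<lambda>s. norm (F s))"
        using m nn t by (intro integral_subset_le) (auto simp: has_integral_iff)
      also have "\<dots> = n v - n u" by (rule integral_unique[OF nn])
      finally show ?thesis by (simp add: norm_minus_commute)
    qed
    have n_mono: "0 \<le> n v - n u" using Wd[of u] uv by (meson atLeastAtMost_iff norm_ge_zero order_refl order_trans)
    have 1: "((\<lambda>t. B (P v) (F t)) has_integral B (P v) (W v - W u)) {u..v}"
      using has_integral_linear[OF FW B.bounded_linear_right[of "P v"]] by (simp add: o_def)
    have 2: "((\<lambda>t. B (P' t) (W u)) has_integral B (P v - P u) (W u)) {u..v}"
      using has_integral_linear[OF PP B.bounded_linear_left[of "W u"]] by (simp add: o_def)
    have "((\<lambda>t. B (P v - P t) (F t) + B (P' t) (W u - W t)) has_integral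
        (B (P v) (W v - W u) + B (P v - P u) (W u) - integral {u..v} ?G)) {u..v}"
      using has_integral_diff[OF has_integral_add[OF 1 2] Guv]
      by (simp add: B.diff_left B.diff_right algebra_simps)
    also have "B (P v) (W v - W u) + B (P v - P u) (W u) - integral {u..v} ?G = \<Phi> v - \<Phi> u"
      by (simp add: \<Phi>_def B.diff_left B.diff_right flip: int_split)
    finally have "((\<lambda>t. B (P v - P t) (F t) + B (P' t) (W u - W t)) has_integral \<Phi> v - \<Phi> u) {u..v}" .
    moreover have "((\<lambda>t. L * (v - u) * norm (F t) + L * (n v - n u)) has_integral
        L * (v - u) * (n v - n u) + (v - u) * (L * (n v - n u))) {u..v}"
      using has_integral_add[OF has_integral_mult_right[OF nn, of "L * (v - u)"]
          has_integral_const_real[of "L * (n v - n u)" u v]] uv by simp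
    moreover have "norm (B (P v - P t) (F t) + B (P' t) (W u - W t)) \<le>
        L * (v - u) * norm (F t) + L * (n v - n u)" if t: "t \<in> {u..v}" for t
    proof -
      have "norm (B (P v - P t) (F t)) \<le> norm (P v - P t) * norm (F t)" by (rule B_le)
      also have "norm (P v - P t) \<le> L * (v - u)"
        using lip[of t v] t uv L(1) by (smt (verit) atLeastAtMost_iff mult_left_mono)
      finally have x: "norm (B (P v - P t) (F t)) \<le> L * (v - u) * norm (F t)"
        by (simp add: mult_right_mono)
      have "norm (B (P' t) (W u - W t)) \<le> norm (P' t) * norm (W u - W t)" by (rule B_le)
      also have "\<dots> \<le> L * (n v - n u)"
        using L Wd t sub by (intro mult_mono) auto
      finally show ?thesis using x norm_triangle_le by (smt (verit))
    qed
    ultimately have "norm (\<Phi> v - \<Phi> u) \<le> L * (v - u) * (n v - n u) + (v - u) * (L * (n v - n u))"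
      by (rule has_integral_norm_le)
    then show "norm (\<Phi> v - \<Phi> u) \<le> 2 * L * (v - u) * (n v - n u)" by (simp add: algebra_simps)
  qed (use L ab in auto)
  then have "integral {a..b} ?G = B (P b) (W b) - B (P a) (W a)" by (simp add: \<Phi>_def algebra_simps)
  then show ?thesis using G by (simp add: has_integral_iff)
qed

lemma product_rule_left:
  fixes P P' F W :: "real \<Rightarrow> complex^'n^'n"
  assumes "a \<le> b" and "F absolutely_integrable_on {a..b}"
    and "\<And>t. t \<in> {a..b} \<Longrightarrow> (F has_integral W t - W a) {a..t}"
    and "\<And>t. t \<in> {a..b} \<Longrightarrow> (P has_vector_derivative P' t) (at t within {a..b})"
    and "continuous_on {a..b} P'"
  shows "((\<lambda>t. P' t ** W t + P t ** F t) has_integral P b ** W b - P a ** W a) {a..b}"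
  by (rule bilinear_product_rule[OF bounded_bilinear_matrix_mult _ _ assms])
     (auto simp: norm_matrix_mult_le intro: absolutely_integrable_continuous_mult)

lemma product_rule_right:
  fixes P P' F W :: "real \<Rightarrow> complex^'n^'n"
  assumes "a \<le> b" and "F absolutely_integrable_on {a..b}"
    and "\<And>t. t \<in> {a..b} \<Longrightarrow> (F has_integral W t - W a) {a..t}"
    and "\<And>t. t \<in> {a..b} \<Longrightarrow> (P has_vector_derivative P' t) (at t within {a..b})"
    and "continuous_on {a..b} P'"
  shows "((\<lambda>t. W t ** P' t + F t ** P t) has_integral W b ** P b - W a ** P a) {a..b}"
proof (rule bilinear_product_rule[where B = "\<lambda>X Y. Y ** X",
        OF bounded_bilinear.flip[OF bounded_bilinear_matrix_mult] _ _ assms])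
  show "norm (Y ** X) \<le> norm X * norm Y" for X Y :: "complex^'n^'n"
    using norm_matrix_mult_le[of Y X] by (simp add: mult.commute)
qed (auto intro: absolutely_integrable_continuous_mult)

lemma mat_eq_cscale: "mat c = c \<odot> (mat 1 :: complex^'n^'n)"
  by (simp add: vec_eq_iff mat_def)

lemma has_vector_derivative_mat:
  assumes "(c has_vector_derivative c') F"
  shows "((\<lambda>t. mat (c t) :: complex^'n^'n) has_vector_derivative mat c') F"
  unfolding mat_eq_cscale[of "c _"] mat_eq_cscale[of c']
  by (rule bounded_linear.has_vector_derivative[OF cs.bounded_linear_left assms])

lemma continuous_on_mat:
  "continuous_on S c \<Longrightarrow> continuous_on S (\<lambda>t. mat (c t) :: complex^'n^'n)"
  unfolding mat_eq_cscale[of "c _"] by (rule cs.continuous_on[OF _ continuous_on_const])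

lemma product_rule_scalar:
  fixes F W :: "real \<Rightarrow> complex^'n^'n"
  assumes "a \<le> b" and "F absolutely_integrable_on {a..b}"
    and "\<And>t. t \<in> {a..b} \<Longrightarrow> (F has_integral W t - W a) {a..t}"
    and "\<And>t. t \<in> {a..b} \<Longrightarrow> (c has_vector_derivative c' t) (at t within {a..b})"
    and "continuous_on {a..b} c'"
  shows "((\<lambda>t. c' t \<odot> W t + c t \<odot> F t) has_integral c b \<odot> W b - c a \<odot> W a) {a..b}"
  using product_rule_left[OF assms(1-3), of "\<lambda>t. mat (c t)" "\<lambda>t. mat (c' t)"] assms(4,5)
  by (simp add: mat_mult_left has_vector_derivative_mat continuous_on_mat)

lemma absolutely_integrable_continuous_cscale:
  fixes F :: "real \<Rightarrow> complex^'n^'n"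
  assumes "continuous_on {a..b} c" and "F absolutely_integrable_on {a..b}"
  shows "(\<lambda>t. c t \<odot> F t) absolutely_integrable_on {a..b}"
  using absolutely_integrable_continuous_mult(1)[OF continuous_on_mat[OF assms(1)] assms(2)]
  by (simp add: mat_mult_left)

section \<open>Solutions of the Sturm--Liouville equation\<close>

lemma sl_problem_absolutely_integrable:
  assumes "sl_problem Q A h"
  shows "Q absolutely_integrable_on {0..}"
proof -
  have "Q absolutely_integrable_on {0<..}"
    using assms by (intro absolutely_integrable_matrix_entries) (auto simp: sl_problem_def)
  moreover have "Q absolutely_integrable_on {0..} \<longleftrightarrow> Q absolutely_integrable_on {0<..}"
  proof (rule absolutely_integrable_spike_set_eq)
    show "negligible {x \<in> {0::real..} - {0<..}. Q x \<noteq> 0}"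
      by (rule negligible_subset[of "{0}"]) auto
    show "negligible {x \<in> {0<..} - {0::real..}. Q x \<noteq> 0}"
      by (rule negligible_subset[of "{}"]) auto
  qed
  ultimately show ?thesis by simp
qed

locale potential =
  fixes Q :: "real \<Rightarrow> complex^'n^'n"
  assumes Q: "Q absolutely_integrable_on {0..}"
begin

lemma Q_Icc: "0 \<le> a \<Longrightarrow> Q absolutely_integrable_on {a..b}"
  by (rule absolutely_integrable_on_subinterval[OF Q]) auto

lemma Q_tail: "0 \<le> a \<Longrightarrow> Q absolutely_integrable_on {a..}"
  by (rule set_integrable_subset[OF Q]) auto

lemma norm_Q_Icc: "0 \<le> a \<Longrightarrow> (\<lambda>t. norm (Q t)) integrable_on {a..b}"
  using Q_Icc by (simp add: absolutely_integrable_on_def)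

lemma norm_Q_tail: "0 \<le> a \<Longrightarrow> (\<lambda>t. norm (Q t)) integrable_on {a..}"
  using Q_tail by (simp add: absolutely_integrable_on_def)

definition mass :: "real \<Rightarrow> real \<Rightarrow> real" where
  "mass a b = integral {a..b} (\<lambda>t. norm (Q t))"

definition tail_mass :: "real \<Rightarrow> real" where
  "tail_mass a = integral {a..} (\<lambda>t. norm (Q t))"

lemma mass_nonneg: "0 \<le> a \<Longrightarrow> 0 \<le> mass a b"
  unfolding mass_def by (rule integral_nonneg[OF norm_Q_Icc]) auto

lemma mass_mono: "\<lbrakk>0 \<le> a; a \<le> c; d \<le> b\<rbrakk> \<Longrightarrow> mass c d \<le> mass a b"
  unfolding mass_def by (rule integral_subset_le) (auto intro: norm_Q_Icc)

lemma mass_le_tail: "\<lbrakk>0 \<le> a; a \<le> c\<rbrakk> \<Longrightarrow> mass c b \<le> tail_mass a"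
  unfolding mass_def tail_mass_def by (rule integral_subset_le) (auto intro: norm_Q_Icc norm_Q_tail)

lemma tail_mass_nonneg: "0 \<le> a \<Longrightarrow> 0 \<le> tail_mass a"
  unfolding tail_mass_def by (rule integral_nonneg[OF norm_Q_tail]) auto

lemma tail_mass_mono: "\<lbrakk>0 \<le> a; a \<le> b\<rbrakk> \<Longrightarrow> tail_mass b \<le> tail_mass a"
  unfolding tail_mass_def by (rule integral_subset_le) (auto intro: norm_Q_tail)

lemma tail_mass_tendsto_0: "(\<lambda>k. tail_mass (real k)) \<longlonglongrightarrow> 0"
proof -
  let ?f = "\<lambda>k t. if t \<in> {real k..} then norm (Q t) else 0"
  have "(\<lambda>k. integral {0..} (?f k)) \<longlonglongrightarrow> integral {0::real..} (\<lambda>t. 0 :: real)"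
  proof (rule dominated_convergence(2)[where f = ?f and g = "\<lambda>t. 0" and h = "\<lambda>t. norm (Q t)"])
    show "?f k integrable_on {0..}" for k
    proof -
      have "{real k..} \<inter> {0..} = {real k..}" by auto
      then show ?thesis using norm_Q_tail[of "real k"] by (simp only: integrable_restrict_Int)
    qed
    show "(\<lambda>k. ?f k t) \<longlonglongrightarrow> 0" if "t \<in> {0..}" for t
    proof (rule tendsto_eventually)
      have "\<forall>\<^sub>F k in sequentially. real k > t" using eventually_gt_at_top
        by (metis (mono_tags, lifting) eventually_at_top_linorder less_le_trans of_nat_le_iff reals_Archimedean2)
      then show "\<forall>\<^sub>F k in sequentially. ?f k t = 0" by eventually_elim auto
    qed
  qed (auto simp: norm_Q_tail)
  moreover have "integral {0..} (?f k) = tail_mass (real k)" for k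
  proof -
    have "{real k..} \<inter> {0..} = {real k..}" by auto
    then show ?thesis unfolding tail_mass_def by (simp only: integral_restrict_Int)
  qed
  ultimately show ?thesis by simp
qed

end

lemma dx_works:
  assumes "Y differentiable_on {0..}" "0 \<le> x"
  shows "(Y has_vector_derivative dx Y x) (at x within {0..})"
  using assms unfolding dx_def differentiable_on_def by (simp flip: vector_derivative_works)

lemma dx_eqI:
  assumes "(Y has_vector_derivative Y') (at x within {0..})" "0 \<le> x"
  shows "dx Y x = Y'"
proof -
  have "at x within {0..} \<noteq> bot"
  proof -
    have "at x within {x..x+1} \<le> at x within {0..}" using assms(2) by (intro at_le) auto
    moreover have "at x within {x..x+1} \<noteq> bot" by (simp add: at_within_Icc_at_right trivial_limit_at_right_real)
    ultimately show ?thesis by (metis bot.extremum_uniqueI)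
  qed
  then show ?thesis unfolding dx_def
    by (rule vector_derivative_within[OF _ assms(1)])
qed

lemma sl_deriv: "sl_solution Q lam Y \<Longrightarrow> 0 \<le> x \<Longrightarrow> (Y has_vector_derivative dx Y x) (at x within {0..})"
  by (simp add: sl_solution_def dx_works)

lemma sl_continuous: "sl_solution Q lam Y \<Longrightarrow> continuous_on {0..} Y"
  by (simp add: sl_solution_def differentiable_imp_continuous_on)

lemma sl_integral:
  assumes "sl_solution Q lam Y" "0 \<le> x"
  shows "((\<lambda>t. Q t ** Y t - lam \<odot> Y t) has_integral (dx Y x - dx Y 0)) {0..x}"
  using assms by (simp add: sl_solution_def mat_mult_left)

lemma sl_integral_between:
  assumes "sl_solution Q lam Y" "0 \<le> a" "a \<le> b"
  shows "((\<lambda>t. Q t ** Y t - lam \<odot> Y t) has_integral (dx Y b - dx Y a)) {a..b}"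
  by (rule has_integral_increment[OF sl_integral[OF assms(1)]]) (use assms in auto)

lemma (in potential) sl_rhs_absolutely_integrable:
  assumes "sl_solution Q lam Y" "0 \<le> a"
  shows "(\<lambda>t. Q t ** Y t - lam \<odot> Y t) absolutely_integrable_on {a..b}"
proof -
  have c: "continuous_on {a..b} Y"
    by (rule continuous_on_subset[OF sl_continuous[OF assms(1)]]) (use assms in auto)
  show ?thesis
    by (intro set_integral_diff absolutely_integrable_continuous_mult c Q_Icc assms
        absolutely_integrable_continuous_real cs.continuous_on continuous_intros)
qed

lemma sl_dx_continuous:
  assumes "sl_solution Q lam Y"
  shows "continuous_on {0..b} (dx Y)"
proof (rule continuous_on_eq)
  let ?F = "\<lambda>t. Q t ** Y t - lam \<odot> Y t"
  show "continuous_on {0..b} (\<lambda>x. dx Y 0 + integral {0..x} ?F)"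
  proof (cases "0 \<le> b")
    case True
    then show ?thesis using sl_integral[OF assms True]
      by (intro continuous_intros indefinite_integral_continuous_1) auto
  qed simp
  show "dx Y 0 + integral {0..x} ?F = dx Y x" if "x \<in> {0..b}" for x
    using integral_unique[OF sl_integral[OF assms]] that by simp
qed

lemma transpose_has_vector_derivative:
  "(Y has_vector_derivative Y') F \<Longrightarrow> ((\<lambda>t. transpose (Y t :: complex^'n^'n)) has_vector_derivative transpose Y') F"
  by (rule bounded_linear.has_vector_derivative[OF bounded_linear_transpose])

lemma dx_transpose:
  assumes "Y differentiable_on {0..}" "0 \<le> x"
  shows "dx (\<lambda>t. transpose (Y t)) x = transpose (dx Y x)"
  by (rule dx_eqI[OF transpose_has_vector_derivative[OF dx_works[OF assms]] assms(2)])

lemma transpose_diff: "transpose (X - Y) = transpose X - transpose (Y :: complex^'n^'n)"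
  by (simp add: vec_eq_iff transpose_def)

text \<open>
  All results on the equation thus hold for the dual equation, with the transposed potential.
\<close>

lemma sl_solution_dual_iff_transpose:
  "sl_solution_dual Q lam Z \<longleftrightarrow> sl_solution (\<lambda>t. transpose (Q t)) lam (\<lambda>t. transpose (Z t))"
proof -
  have diff: "(\<lambda>t. transpose (Z t)) differentiable_on {0..}" if "Z differentiable_on {0..}"
    for Z :: "real \<Rightarrow> complex^'n^'n"
    using that bounded_linear.has_derivative[OF bounded_linear_transpose]
    unfolding differentiable_on_def differentiable_def by blast
  have diff_iff: "(\<lambda>t. transpose (Z t)) differentiable_on {0..} \<longleftrightarrow> Z differentiable_on {0..}"
    using diff[of Z] diff[of "\<lambda>t. transpose (Z t)"] by (auto simp: transpose_transpose)
  have int: "((\<lambda>t. transpose (F t)) has_integral transpose I) S" if "(F has_integral I) S"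
    for F :: "real \<Rightarrow> complex^'n^'n" and I S
    using has_integral_linear[OF that bounded_linear_transpose] by (simp add: o_def)
  have int_iff: "((\<lambda>t. transpose (F t)) has_integral transpose I) S \<longleftrightarrow> (F has_integral I) S"
    for F :: "real \<Rightarrow> complex^'n^'n" and I S
    using int[of F I S] int[of "\<lambda>t. transpose (F t)" "transpose I" S] by (auto simp: transpose_transpose)
  have *: "transpose (Q t) ** transpose (Z t) - mat lam ** transpose (Z t) = transpose (Z t ** Q t - mat lam ** Z t)" for t
    by (simp add: transpose_diff matrix_transpose_mul mat_mult_left transpose_cscale)
  show ?thesis
  proof (cases "Z differentiable_on {0..}")
    case True
    then show ?thesis
      by (simp add: sl_solution_dual_def sl_solution_def diff_iff dx_transpose * int_iff flip: transpose_diff)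
  qed (simp add: sl_solution_dual_def sl_solution_def diff_iff)
qed

lemma (in potential) potential_transpose: "potential (\<lambda>t. transpose (Q t))"
  using absolutely_integrable_linear[OF Q bounded_linear_transpose]
  by (simp add: potential_def o_def)

text \<open>
  The \<open>Q\<close>-terms cancel in \<open>(Z'Y - ZY')'\<close>. In each of the two products one factor is continuously
  differentiable and the other one is an indefinite integral, as the product rule requires.
\<close>

lemma (in potential) wronskian:
  assumes Z: "sl_solution_dual Q mu Z" and Y: "sl_solution Q lam Y" and x: "0 \<le> x"
  shows "((\<lambda>t. (lam - mu) \<odot> (Z t ** Y t)) has_integral
    ((dx Z x ** Y x - Z x ** dx Y x) - (dx Z 0 ** Y 0 - Z 0 ** dx Y 0))) {0..x}"
proof -
  have Zt: "sl_solution (\<lambda>t. transpose (Q t)) mu (\<lambda>t. transpose (Z t))"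
    using Z by (simp add: sl_solution_dual_iff_transpose)
  have Zdiff: "Z differentiable_on {0..}" using Z by (simp add: sl_solution_dual_def)
  have dZt: "dx (\<lambda>t. transpose (Z t)) t = transpose (dx Z t)" if "0 \<le> t" for t
    by (rule dx_transpose[OF Zdiff that])
  have Zc: "continuous_on {0..x} Z" and Yc: "continuous_on {0..x} Y"
    using sl_continuous[OF Y] differentiable_imp_continuous_on[OF Zdiff]
    by (auto intro: continuous_on_subset)
  have dYc: "continuous_on {0..x} (dx Y)" by (rule sl_dx_continuous[OF Y])
  have "continuous_on {0..x} (\<lambda>t. transpose (dx (\<lambda>t. transpose (Z t)) t))"
    by (rule bounded_linear.continuous_on[OF bounded_linear_transpose sl_dx_continuous[OF Zt]])
  then have dZc: "continuous_on {0..x} (dx Z)"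
    by (rule continuous_on_eq) (simp add: dZt transpose_transpose)
  have derZ: "(Z has_vector_derivative dx Z t) (at t within {0..x})" if "t \<in> {0..x}" for t
    by (rule has_vector_derivative_within_subset[OF dx_works[OF Zdiff]]) (use that in auto)
  have derY: "(Y has_vector_derivative dx Y t) (at t within {0..x})" if "t \<in> {0..x}" for t
    by (rule has_vector_derivative_within_subset[OF sl_deriv[OF Y]]) (use that in auto)
  have 1: "((\<lambda>t. dx Z t ** dx Y t + (Z t ** Q t - mu \<odot> Z t) ** Y t) has_integral
      dx Z x ** Y x - dx Z 0 ** Y 0) {0..x}"
  proof (rule product_rule_right[OF x _ _ derY dYc])
    show "(\<lambda>t. Z t ** Q t - mu \<odot> Z t) absolutely_integrable_on {0..x}"
      by (intro set_integral_diff absolutely_integrable_continuous_mult Zc Q_Icc x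
          absolutely_integrable_continuous_real cs.continuous_on continuous_intros) simp
    show "((\<lambda>t. Z t ** Q t - mu \<odot> Z t) has_integral dx Z t - dx Z 0) {0..t}" if "t \<in> {0..x}" for t
      using Z that by (simp add: sl_solution_dual_def mat_mult_left)
  qed
  have 2: "((\<lambda>t. dx Z t ** dx Y t + Z t ** (Q t ** Y t - lam \<odot> Y t)) has_integral
      Z x ** dx Y x - Z 0 ** dx Y 0) {0..x}"
    by (rule product_rule_left[OF x sl_rhs_absolutely_integrable[OF Y] _ derZ dZc])
      (use sl_integral[OF Y] in auto)
  have "(\<lambda>t. dx Z t ** dx Y t + (Z t ** Q t - mu \<odot> Z t) ** Y t -
      (dx Z t ** dx Y t + Z t ** (Q t ** Y t - lam \<odot> Y t))) = (\<lambda>t. (lam - mu) \<odot> (Z t ** Y t))"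
    by (simp add: fun_eq_iff mat_normal cs.diff_left)
  then show ?thesis using has_integral_diff[OF 1 2] by (simp add: algebra_simps)
qed

section \<open>Plane-wave components\<close>

text \<open>
  The amplitude of \<open>e\<^sup>i\<^sup>\<rho>\<^sup>x\<close> in \<open>Y\<close>, up to the factor \<open>2i\<rho>\<close>; it is constant where \<open>Q = 0\<close>. Replacing \<open>\<rho>\<close> by \<open>-\<rho>\<close>
  gives the amplitude of \<open>e\<^sup>-\<^sup>i\<^sup>\<rho>\<^sup>x\<close>.
\<close>

definition wave :: "complex \<Rightarrow> (real \<Rightarrow> complex^'n^'n) \<Rightarrow> real \<Rightarrow> complex^'n^'n" where
  "wave \<rho> Y x = exp (- \<i> * \<rho> * of_real x) \<odot> (dx Y x + (\<i> * \<rho>) \<odot> Y x)"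

lemma from_waves:
  "(2 * \<i> * \<rho>) \<odot> Y x = exp (\<i> * \<rho> * of_real x) \<odot> wave \<rho> Y x - exp (- (\<i> * \<rho> * of_real x)) \<odot> wave (- \<rho>) Y x"
  "2 \<odot> dx Y x = exp (\<i> * \<rho> * of_real x) \<odot> wave \<rho> Y x + exp (- (\<i> * \<rho> * of_real x)) \<odot> wave (- \<rho>) Y x"
  by (simp_all add: wave_def cscale_cscale exp_add[symmetric])
     (simp_all add: vec_eq_iff algebra_simps)

text \<open>
  Variation of constants: \<open>(e\<^sup>-\<^sup>i\<^sup>\<rho>\<^sup>x (Y' + i\<rho>Y))' = e\<^sup>-\<^sup>i\<^sup>\<rho>\<^sup>x Q Y\<close>.
\<close>

lemma (in potential) wave_integral:
  assumes Y: "sl_solution Q (\<rho>\<^sup>2) Y" and ab: "0 \<le> a" "a \<le> b"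
  shows "((\<lambda>t. exp (- \<i> * \<rho> * of_real t) \<odot> (Q t ** Y t)) has_integral wave \<rho> Y b - wave \<rho> Y a) {a..b}"
proof -
  define W where "W t = dx Y t + (\<i> * \<rho>) \<odot> Y t" for t
  define F where "F t = Q t ** Y t - \<rho>\<^sup>2 \<odot> Y t + (\<i> * \<rho>) \<odot> dx Y t" for t
  define c where "c t = exp (- \<i> * \<rho> * of_real t)" for t
  define c' where "c' t = (- \<i> * \<rho>) * c t" for t
  have dYc: "continuous_on {a..b} (dx Y)"
    by (rule continuous_on_subset[OF sl_dx_continuous[OF Y, of b]]) (use ab in auto)
  have "((\<lambda>t. c' t \<odot> W t + c t \<odot> F t) has_integral c b \<odot> W b - c a \<odot> W a) {a..b}"
  proof (rule product_rule_scalar[OF ab(2)])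
    show "F absolutely_integrable_on {a..b}"
      unfolding F_def
      by (intro set_integral_add sl_rhs_absolutely_integrable[OF Y ab(1)]
          absolutely_integrable_continuous_real cs.continuous_on dYc continuous_intros)
    show "(F has_integral W t - W a) {a..t}" if t: "t \<in> {a..b}" for t
    proof -
      have "(dx Y has_integral Y t - Y a) {a..t}"
        by (rule fundamental_theorem_of_calculus)
           (use t ab in \<open>auto intro!: has_vector_derivative_within_subset[OF sl_deriv[OF Y]]\<close>)
      from has_integral_linear[OF this cs.bounded_linear_right[of "\<i> * \<rho>"]]
      have "((\<lambda>t. (\<i> * \<rho>) \<odot> dx Y t) has_integral (\<i> * \<rho>) \<odot> (Y t - Y a)) {a..t}" by (simp add: o_def)
      from has_integral_add[OF sl_integral_between[OF Y ab(1), of t] this] t show ?thesis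
        by (simp add: F_def[abs_def] W_def cs.diff_right algebra_simps)
    qed
    show "(c has_vector_derivative c' t) (at t within {a..b})" for t
    proof -
      have "((\<lambda>z. exp (- \<i> * \<rho> * z)) has_field_derivative c' t) (at (of_real t))"
        unfolding c'_def c_def by (rule derivative_eq_intros refl | simp)+
      then have "((\<lambda>t. exp (- \<i> * \<rho> * of_real t)) has_vector_derivative c' t) (at t)"
        by (rule has_vector_derivative_real_field)
      then show ?thesis unfolding c_def by (rule has_vector_derivative_at_within)
    qed
    show "continuous_on {a..b} c'" unfolding c'_def c_def by (intro continuous_intros)
  qed
  moreover have "c' t \<odot> W t + c t \<odot> F t = c t \<odot> (Q t ** Y t)" for t
    by (simp add: vec_eq_iff c'_def W_def F_def algebra_simps power2_eq_square)
  ultimately show ?thesis by (simp add: wave_def c_def W_def)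
qed

text \<open>
  The role of Gronwall's inequality is played by a comparison of suprema: it suffices that a
  bound \<open>B\<close> implies the bound \<open>M + B / 2\<close>.
\<close>

lemma half_bound:
  fixes z :: "'b \<Rightarrow> 'a::real_normed_vector"
  assumes w: "\<And>t. t \<in> T \<Longrightarrow> w t > (0::real)"
    and bdd: "\<And>t. t \<in> T \<Longrightarrow> norm (z t) \<le> B0 * w t"
    and step: "\<And>B t. \<lbrakk>B \<ge> 0; t \<in> T; \<And>s. s \<in> T \<Longrightarrow> norm (z s) \<le> B * w s\<rbrakk> \<Longrightarrow> norm (z t) \<le> (M + B / 2) * w t"
    and t: "t \<in> T"
  shows "norm (z t) \<le> 2 * M * w t"
proof -
  define B where "B = (SUP t\<in>T. norm (z t) / w t)"
  have "norm (z t) / w t \<le> B0" if "t \<in> T" for t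
    using bdd[OF that] w[OF that] by (simp add: divide_le_eq)
  then have bd: "bdd_above ((\<lambda>t. norm (z t) / w t) ` T)" by (intro bdd_aboveI[of _ B0]) auto
  have up: "norm (z s) / w s \<le> B" if "s \<in> T" for s
    unfolding B_def by (rule cSUP_upper[OF that bd])
  have B0: "0 \<le> B" using up[OF t] w[OF t] by (meson divide_nonneg_pos norm_ge_zero order_trans)
  have "norm (z s) \<le> B * w s" if "s \<in> T" for s
    using up[OF that] w[OF that] by (simp add: divide_le_eq)
  note * = step[OF B0 _ this]
  have "B \<le> M + B / 2"
    unfolding B_def
  proof (rule cSUP_least)
    show "norm (z s) / w s \<le> M + (SUP t\<in>T. norm (z t) / w t) / 2" if "s \<in> T" for s
      using *[OF that] w[OF that] by (simp add: divide_le_eq B_def)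
  qed (use t in auto)
  then have "B \<le> 2 * M" by simp
  then show ?thesis using up[OF t] w[OF t]
    by (smt (verit, best) divide_le_eq)
qed

text \<open>
  The condition on \<open>\<tau>\<close> makes \<open>e\<^sup>(\<^sup>I\<^sup>m\<^sup>\<rho>\<^sup>+\<^sup>\<tau>\<^sup>)\<^sup>t\<close> largest at the right end point. For \<open>-\<rho>\<close> in place of \<open>\<rho>\<close> and
  \<open>\<tau> = Im \<rho>\<close> the exponential disappears.
\<close>

lemma (in potential) wave_diff_bound:
  assumes Y: "sl_solution Q (\<rho>\<^sup>2) Y" and ab: "0 \<le> a" "a \<le> b" and \<tau>: "0 \<le> Im \<rho> + \<tau>"
    and B: "\<And>s. s \<in> {a..b} \<Longrightarrow> norm (Y s) \<le> B * exp (\<tau> * s)" "0 \<le> B"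
  shows "norm (wave \<rho> Y b - wave \<rho> Y a) \<le> exp ((Im \<rho> + \<tau>) * b) * B * mass a b"
  unfolding mass_def
proof (rule integral_mult_bound[OF wave_integral[OF Y ab] norm_Q_Icc[OF ab(1)]])
  fix s assume s: "s \<in> {a..b}"
  have "norm (exp (- \<i> * \<rho> * of_real s) \<odot> (Q s ** Y s)) \<le> exp (Im \<rho> * s) * (norm (Q s) * norm (Y s))"
    by (simp add: norm_cscale norm_matrix_mult_le)
  also have "\<dots> \<le> exp (Im \<rho> * s) * (norm (Q s) * (B * exp (\<tau> * s)))"
    using B(1)[OF s] by (intro mult_left_mono) auto
  also have "\<dots> = exp ((Im \<rho> + \<tau>) * s) * B * norm (Q s)"
    by (simp add: exp_add algebra_simps)
  also have "\<dots> \<le> exp ((Im \<rho> + \<tau>) * b) * B * norm (Q s)"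
    using s \<tau> B(2) by (intro mult_right_mono) (auto intro: mult_left_mono)
  finally show "norm (exp (- \<i> * \<rho> * of_real s) \<odot> (Q s ** Y s)) \<le> exp ((Im \<rho> + \<tau>) * b) * B * norm (Q s)" .
qed

text \<open>
  \<open>Y\<close> is recovered from its plane-wave components through a division by \<open>2i\<rho>\<close>. When the mass of \<open>Q\<close> is
  small against \<open>|\<rho>|\<close>, the change of the components contributes at most half of any bound that is already
  known, so the initial values alone determine the constant.
\<close>

lemma (in potential) solution_growth:
  assumes Y: "sl_solution Q (\<rho>\<^sup>2) Y" and ab: "0 \<le> a" and \<rho>: "0 \<le> Im \<rho>" "\<rho> \<noteq> 0"
    and small: "mass a b \<le> cmod \<rho> / 2"
    and init: "norm (dx Y a + (\<i> * \<rho>) \<odot> Y a) \<le> cmod \<rho> * (M * exp (Im \<rho> * a))"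
      "norm (dx Y a - (\<i> * \<rho>) \<odot> Y a) \<le> cmod \<rho> * (M * exp (Im \<rho> * a))"
    and t: "t \<in> {a..b}"
  shows "norm (Y t) \<le> 2 * M * exp (Im \<rho> * t)"
proof -
  have "continuous_on {a..b} Y"
    by (rule continuous_on_subset[OF sl_continuous[OF Y]]) (use ab in auto)
  then have "bounded (Y ` {a..b})"
    using compact_Icc compact_continuous_image compact_imp_bounded by blast
  then obtain B0 where B0: "\<forall>x\<in>Y ` {a..b}. norm x \<le> B0" unfolding bounded_iff by blast
  have bdd: "norm (Y t) \<le> B0 * exp (Im \<rho> * t)" if "t \<in> {a..b}" for t
  proof -
    have "norm (Y t) \<le> B0" using B0 that by blast
    moreover have "1 \<le> exp (Im \<rho> * t)" using that ab \<rho> by simp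
    ultimately show ?thesis
      by (smt (verit, best) mult_le_cancel_left1 norm_ge_zero)
  qed
  have step: "norm (Y t) \<le> (M + B / 2) * exp (Im \<rho> * t)"
    if B: "0 \<le> B" "\<And>s. s \<in> {a..b} \<Longrightarrow> norm (Y s) \<le> B * exp (Im \<rho> * s)" and t: "t \<in> {a..b}" for B t
  proof -
    have at: "a \<le> t" using t by simp
    define m where "m = B * mass a b"
    have Bt: "norm (Y s) \<le> B * exp (Im \<rho> * s)" if "s \<in> {a..t}" for s using B(2) that t by auto
    have m: "B * mass a t \<le> m" unfolding m_def using t ab B(1) by (intro mult_left_mono mass_mono) auto
    have tau: "0 \<le> Im \<rho>" by (rule \<rho>)
    have 1: "norm (wave \<rho> Y t - wave \<rho> Y a) \<le> exp (2 * Im \<rho> * t) * m"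
    proof -
      have "norm (wave \<rho> Y t - wave \<rho> Y a) \<le> exp (2 * Im \<rho> * t) * (B * mass a t)"
        using wave_diff_bound[OF Y ab at _ Bt B(1)] tau by (simp add: mult.assoc)
      also have "\<dots> \<le> exp (2 * Im \<rho> * t) * m" by (rule mult_left_mono[OF m]) simp
      finally show ?thesis .
    qed
    have Y2: "sl_solution Q ((-\<rho>)\<^sup>2) Y" using Y by simp
    have 2: "norm (wave (-\<rho>) Y t - wave (-\<rho>) Y a) \<le> m"
      using wave_diff_bound[OF Y2 ab at _ Bt B(1)] m by simp
    have 3: "norm (wave \<rho> Y a) \<le> cmod \<rho> * (M * exp (2 * Im \<rho> * a))"
      using mult_left_mono[OF init(1), of "exp (Im \<rho> * a)"]
      by (simp add: wave_def norm_cscale exp_add[symmetric] algebra_simps)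
    have 4: "norm (wave (-\<rho>) Y a) \<le> cmod \<rho> * M"
      using mult_left_mono[OF init(2), of "exp (- (Im \<rho> * a))"]
      by (simp add: wave_def norm_cscale exp_add[symmetric] algebra_simps cs.minus_left)
    have M: "0 \<le> cmod \<rho> * M" using 4 norm_ge_zero order_trans by blast
    have 5: "norm (wave \<rho> Y t) \<le> exp (2 * Im \<rho> * t) * (cmod \<rho> * M + m)"
    proof -
      have "cmod \<rho> * (M * exp (2 * Im \<rho> * a)) \<le> cmod \<rho> * M * exp (2 * Im \<rho> * t)"
        using M at tau by (simp add: mult_left_mono flip: mult.assoc)
      then show ?thesis using 1 3 norm_triangle_sub[of "wave \<rho> Y t" "wave \<rho> Y a"]
        by (simp add: algebra_simps)
    qed
    have 6: "norm (wave (-\<rho>) Y t) \<le> cmod \<rho> * M + m"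
      using 2 4 norm_triangle_sub[of "wave (-\<rho>) Y t" "wave (-\<rho>) Y a"] by simp
    have "2 * cmod \<rho> * norm (Y t) = norm ((2 * \<i> * \<rho>) \<odot> Y t)" by (simp add: norm_cscale norm_mult)
    also have "\<dots> \<le> exp (- (Im \<rho> * t)) * norm (wave \<rho> Y t) + exp (Im \<rho> * t) * norm (wave (-\<rho>) Y t)"
      unfolding from_waves(1)[of \<rho> Y t]
      by (rule order_trans[OF norm_triangle_ineq4]) (simp add: norm_cscale)
    also have "\<dots> \<le> exp (- (Im \<rho> * t)) * (exp (2 * Im \<rho> * t) * (cmod \<rho> * M + m)) + exp (Im \<rho> * t) * (cmod \<rho> * M + m)"
      using 5 6 by (intro add_mono mult_left_mono) auto
    also have "\<dots> = 2 * exp (Im \<rho> * t) * (cmod \<rho> * M + m)"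
      by (simp add: exp_add[symmetric] algebra_simps mult_exp_exp)
    also have "m \<le> cmod \<rho> * (B / 2)"
      unfolding m_def using mult_left_mono[OF small B(1)] by (simp add: algebra_simps)
    finally have "2 * cmod \<rho> * norm (Y t) \<le> 2 * exp (Im \<rho> * t) * (cmod \<rho> * M + cmod \<rho> * (B / 2))" by simp
    then have "cmod \<rho> * norm (Y t) \<le> cmod \<rho> * ((M + B / 2) * exp (Im \<rho> * t))" by (simp add: algebra_simps)
    then show ?thesis using \<rho>(2) by simp
  qed
  show ?thesis
    by (rule half_bound[OF _ bdd step t]) auto
qed

section \<open>Initial value problems\<close>

lemma has_vector_derivative_integral_half_line:
  fixes f :: "real \<Rightarrow> 'a::banach"
  assumes "continuous_on {0..} f" "0 \<le> t"
  shows "((\<lambda>t. integral {0..t} f) has_vector_derivative f t) (at t within {0..})"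
proof -
  have "((\<lambda>t. integral {0..t} f) has_vector_derivative f t) (at t within {0..t+1})"
    by (rule integral_has_vector_derivative)
      (use assms in \<open>auto intro: continuous_on_subset\<close>)
  moreover have "at t within {0..t+1} = at t within {0..}"
    by (rule at_within_nhd[of t "{..<t+1}"]) (use assms in auto)
  ultimately show ?thesis by simp
qed

lemma continuous_on_half_line:
  fixes f :: "real \<Rightarrow> 'a::topological_space"
  assumes "\<And>b. continuous_on {0..b} f"
  shows "continuous_on {0..} f"
  unfolding continuous_on_eq_continuous_within
proof
  fix t :: real assume t: "t \<in> {0..}"
  have "continuous (at t within {0..t+1}) f"
    using assms[of "t + 1"] t by (simp add: continuous_on_eq_continuous_within)
  moreover have "at t within {0..t+1} = at t within {0..}"
    by (rule at_within_nhd[of t "{..<t+1}"]) (use t in auto)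
  ultimately show "continuous (at t within {0..}) f" by (simp add: continuous_within)
qed

text \<open>
  Integration by parts with an integrable \<open>F\<close>: the indefinite integral of \<open>F\<close> is paired with the smooth weight
  \<open>t - s\<close>.
\<close>

lemma iterated_integral:
  fixes F :: "real \<Rightarrow> complex^'n^'n"
  assumes F: "F absolutely_integrable_on {0..t}" and t: "0 \<le> t"
  shows "integral {0..t} (\<lambda>s. (t - s) *\<^sub>R F s) = integral {0..t} (\<lambda>s. integral {0..s} F)"
proof -
  let ?W = "\<lambda>s. integral {0..s} F"
  have Fi: "F integrable_on {0..s}" if "s \<le> t" for s
    using F that by (auto simp: absolutely_integrable_on_def intro: integrable_subinterval_real)
  have Wc: "?W integrable_on {0..t}"
    by (intro integrable_continuous_real indefinite_integral_continuous_1 Fi) simp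
  have "((\<lambda>s. (-1) \<odot> ?W s + of_real (t - s) \<odot> F s) has_integral
      of_real (t - t) \<odot> ?W t - of_real (t - 0) \<odot> ?W 0) {0..t}"
  proof (rule product_rule_scalar[OF t F])
    show "((\<lambda>s. of_real (t - s)) has_vector_derivative - 1) (at s within {0..t})" for s
      by (auto intro!: derivative_eq_intros simp: has_vector_derivative_def scaleR_conv_of_real)
  qed (use Fi in \<open>auto intro: integrable_integral\<close>)
  then have "((\<lambda>s. (t - s) *\<^sub>R F s - ?W s) has_integral 0) {0..t}"
    by (simp only: cscale_of_real cs.minus_left cscale_1) simp
  from has_integral_add[OF this integrable_integral[OF Wc]]
  show ?thesis by (simp add: integral_unique)
qed

lemma ramp_weight_le:
  assumes "K > 0" "s \<le> t"
  shows "(t - s) * exp (K * s) \<le> exp (K * t) / (K :: real)"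
proof -
  have "K * (t - s) \<le> exp (K * (t - s))" using exp_ge_add_one_self[of "K * (t - s)"] by linarith
  then have "K * (t - s) * exp (K * s) \<le> exp (K * (t - s)) * exp (K * s)" by (rule mult_right_mono) simp
  also have "\<dots> = exp (K * t)" by (simp add: exp_add[symmetric] algebra_simps)
  finally show ?thesis using assms(1) by (simp add: field_simps)
qed

lemma ramp_integral:
  assumes K: "K \<ge> 1" and t: "0 \<le> (t::real)"
  shows "(\<lambda>s. (t - s) * exp (K * s)) integrable_on {0..t}"
    and "integral {0..t} (\<lambda>s. (t - s) * exp (K * s)) \<le> exp (K * t) / K"
proof -
  have "((\<lambda>s. (t - s) * exp (K * s)) has_integral
      ((t - t) * exp (K * t) / K + exp (K * t) / K\<^sup>2) - ((t - 0) * exp (K * 0) / K + exp (K * 0) / K\<^sup>2)) {0..t}"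
  proof (rule fundamental_theorem_of_calculus[OF t])
    show "((\<lambda>s. (t - s) * exp (K * s) / K + exp (K * s) / K\<^sup>2) has_vector_derivative (t - s) * exp (K * s))
        (at s within {0..t})" for s
      unfolding has_real_derivative_iff_has_vector_derivative[symmetric] using K
      by (auto intro!: derivative_eq_intros simp: field_simps power2_eq_square)
  qed
  note * = this
  then show "(\<lambda>s. (t - s) * exp (K * s)) integrable_on {0..t}" by blast
  have "integral {0..t} (\<lambda>s. (t - s) * exp (K * s)) \<le> exp (K * t) / K\<^sup>2"
  proof -
    have "0 \<le> t / K + 1 / K\<^sup>2" using K t by simp
    then show ?thesis using integral_unique[OF *] by simp
  qed
  also have "\<dots> \<le> exp (K * t) / K"
    using K by (intro divide_left_mono) (auto simp: power2_eq_square)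
  finally show "integral {0..t} (\<lambda>s. (t - s) * exp (K * s)) \<le> exp (K * t) / K" .
qed

text \<open>
  The second antiderivative of \<open>z\<close> that vanishes at \<open>0\<close> together with its derivative.
\<close>

definition ramp :: "(real \<Rightarrow> complex^'n^'n) \<Rightarrow> real \<Rightarrow> complex^'n^'n" where
  "ramp z t = integral {0..t} (\<lambda>s. (t - s) *\<^sub>R z s)"

lemma ramp_bound:
  assumes z: "continuous_on {0..t} z" and K: "K \<ge> 1" and t: "0 \<le> t"
    and B: "\<And>s. s \<in> {0..t} \<Longrightarrow> norm (z s) \<le> B * exp (K * s)" "0 \<le> B"
  shows "norm (ramp z t) \<le> B * exp (K * t)"
proof -
  have "norm (ramp z t) \<le> integral {0..t} (\<lambda>s. B * ((t - s) * exp (K * s)))"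
    unfolding ramp_def
  proof (rule integral_norm_bound_integral)
    show "(\<lambda>s. (t - s) *\<^sub>R z s) integrable_on {0..t}"
      by (intro integrable_continuous_real continuous_intros z)
    show "(\<lambda>s. B * ((t - s) * exp (K * s))) integrable_on {0..t}"
      by (rule integrable_on_mult_right[OF ramp_integral(1)[OF K t]])
    show "norm ((t - s) *\<^sub>R z s) \<le> B * ((t - s) * exp (K * s))" if "s \<in> {0..t}" for s
      using mult_left_mono[OF B(1)[OF that], of "t - s"] that by (simp add: mult.left_commute)
  qed
  also have "\<dots> \<le> B * (exp (K * t) / K)"
    using mult_left_mono[OF ramp_integral(2)[OF K t] B(2)] by simp
  also have "\<dots> \<le> B * exp (K * t)" using K B(2) by (intro mult_left_mono) (auto simp: field_simps)
  finally show ?thesis .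
qed

context potential begin

text \<open>
  \<open>Y\<close> solves the equation with parameter \<open>\<nu>\<close> if and only if \<open>Y(t) = Y(0) + t Y'(0) + (volterra \<nu> Y)(t)\<close>.
\<close>

definition volterra :: "complex \<Rightarrow> (real \<Rightarrow> complex^'n^'n) \<Rightarrow> real \<Rightarrow> complex^'n^'n" where
  "volterra \<nu> z t = integral {0..t} (\<lambda>s. (t - s) *\<^sub>R (Q s ** z s - \<nu> \<odot> z s))"

lemma rhs_absolutely_integrable:
  assumes "continuous_on {0..t} z"
  shows "(\<lambda>s. Q s ** z s - \<nu> \<odot> z s) absolutely_integrable_on {0..t}"
  by (intro set_integral_diff absolutely_integrable_continuous_mult assms Q_Icc order_refl
      absolutely_integrable_continuous_real cs.continuous_on continuous_intros)

lemma ramp_absolutely_integrable: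
  fixes F :: "real \<Rightarrow> complex^'n^'n"
  assumes "F absolutely_integrable_on {0..t}"
  shows "(\<lambda>s. (t - s) *\<^sub>R F s) absolutely_integrable_on {0..t}"
proof -
  have "(\<lambda>s. of_real (t - s) \<odot> F s) absolutely_integrable_on {0..t}"
    by (rule absolutely_integrable_continuous_cscale[OF _ assms]) (intro continuous_intros)
  then show ?thesis by (simp only: cscale_of_real)
qed

lemma volterra_integrable:
  assumes "continuous_on {0..t} z"
  shows "(\<lambda>s. (t - s) *\<^sub>R (Q s ** z s - \<nu> \<odot> z s)) integrable_on {0..t}"
  using ramp_absolutely_integrable[OF rhs_absolutely_integrable[OF assms]]
  by (simp add: absolutely_integrable_on_def)

lemma volterra_iterated:
  assumes "continuous_on {0..t} z" "0 \<le> t"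
  shows "volterra \<nu> z t = integral {0..t} (\<lambda>s. integral {0..s} (\<lambda>r. Q r ** z r - \<nu> \<odot> z r))"
  unfolding volterra_def by (rule iterated_integral[OF rhs_absolutely_integrable[OF assms(1)] assms(2)])

lemma rhs_integral_continuous:
  assumes "continuous_on {0..} z"
  shows "continuous_on {0..} (\<lambda>s. integral {0..s} (\<lambda>r. Q r ** z r - \<nu> \<odot> z r))"
proof (rule continuous_on_half_line)
  show "continuous_on {0..b} (\<lambda>s. integral {0..s} (\<lambda>r. Q r ** z r - \<nu> \<odot> z r))" for b
    using rhs_absolutely_integrable[OF continuous_on_subset[OF assms, of "{0..b}"], of \<nu>]
    by (intro indefinite_integral_continuous_1) (auto simp: absolutely_integrable_on_def)
qed

lemma volterra_has_vector_derivative: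
  assumes z: "continuous_on {0..} z" and t: "0 \<le> t"
  shows "(volterra \<nu> z has_vector_derivative integral {0..t} (\<lambda>r. Q r ** z r - \<nu> \<odot> z r)) (at t within {0..})"
proof (rule has_vector_derivative_transform[OF _ _ has_vector_derivative_integral_half_line[OF rhs_integral_continuous[OF z] t]])
  show "volterra \<nu> z s = integral {0..s} (\<lambda>s. integral {0..s} (\<lambda>r. Q r ** z r - \<nu> \<odot> z r))" if "s \<in> {0..}" for s
    using that by (intro volterra_iterated continuous_on_subset[OF z]) auto
qed (use t in auto)

lemma volterra_continuous:
  assumes "continuous_on {0..} z"
  shows "continuous_on {0..} (volterra \<nu> z)"
  using volterra_has_vector_derivative[OF assms]
  by (auto simp: continuous_on_eq_continuous_within intro: has_vector_derivative_continuous)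

lemma volterra_diff:
  assumes "continuous_on {0..t} z" "continuous_on {0..t} w"
  shows "volterra \<nu> (\<lambda>s. z s - w s) t = volterra \<nu> z t - volterra \<nu> w t"
  unfolding volterra_def integral_diff[OF volterra_integrable[OF assms(1)] volterra_integrable[OF assms(2)], symmetric]
  by (simp add: mm.diff_right cs.diff_right algebra_simps)

lemma volterra_cscale:
  assumes "continuous_on {0..t} z"
  shows "volterra \<nu> (\<lambda>s. c \<odot> z s) t = c \<odot> volterra \<nu> z t"
proof -
  have "integral {0..t} ((\<lambda>X. c \<odot> X) \<circ> (\<lambda>s. (t - s) *\<^sub>R (Q s ** z s - \<nu> \<odot> z s))) = c \<odot> volterra \<nu> z t"
    unfolding volterra_def
    by (rule integral_linear[OF volterra_integrable[OF assms] cs.bounded_linear_right])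
  moreover have "c \<odot> ((t - s) *\<^sub>R (Q s ** z s - \<nu> \<odot> z s)) = (t - s) *\<^sub>R (Q s ** (c \<odot> z s) - \<nu> \<odot> (c \<odot> z s))" for s
    by (simp add: cs.scaleR_right cs.diff_right cscale_mult_right cscale_cscale mult.commute)
  ultimately show ?thesis by (simp add: o_def volterra_def)
qed

lemma volterra_change_parameter:
  assumes "continuous_on {0..t} z"
  shows "volterra \<mu> z t = volterra \<nu> z t - (\<mu> - \<nu>) \<odot> ramp z t"
proof -
  have "integral {0..t} ((\<lambda>X. (\<mu> - \<nu>) \<odot> X) \<circ> (\<lambda>s. (t - s) *\<^sub>R z s)) = (\<mu> - \<nu>) \<odot> ramp z t"
    unfolding ramp_def
    by (intro integral_linear[OF _ cs.bounded_linear_right] integrable_continuous_real continuous_intros assms)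
  moreover have int: "(\<lambda>X. (\<mu> - \<nu>) \<odot> X) \<circ> (\<lambda>s. (t - s) *\<^sub>R z s) integrable_on {0..t}"
    by (intro integrable_linear[OF _ cs.bounded_linear_right] integrable_continuous_real continuous_intros assms)
  have "(t - s) *\<^sub>R (Q s ** z s - \<mu> \<odot> z s) =
      (t - s) *\<^sub>R (Q s ** z s - \<nu> \<odot> z s) - ((\<lambda>X. (\<mu> - \<nu>) \<odot> X) \<circ> (\<lambda>s. (t - s) *\<^sub>R z s)) s" for s
    by (simp add: cs.scaleR_right cs.diff_left scaleR_diff_right)
  then have "volterra \<mu> z t = volterra \<nu> z t - integral {0..t} ((\<lambda>X. (\<mu> - \<nu>) \<odot> X) \<circ> (\<lambda>s. (t - s) *\<^sub>R z s))"
    unfolding volterra_def using integral_diff[OF volterra_integrable[OF assms, of \<nu>] int] by simp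
  ultimately show ?thesis by simp
qed

text \<open>
  In the norm \<open>sup e\<^sup>-\<^sup>K\<^sup>t |z(t)|\<close> the Volterra operator is a contraction once \<open>K\<close> is large,
  because \<open>(t - s) e\<^sup>-\<^sup>K\<^sup>(\<^sup>t\<^sup>-\<^sup>s\<^sup>) \<le> 1 / K\<close>.
\<close>

definition contracting :: "complex \<Rightarrow> real \<Rightarrow> bool" where
  "contracting \<nu> K \<longleftrightarrow> 1 \<le> K \<and> 2 * (tail_mass 0 + cmod \<nu>) \<le> K"

lemma volterra_bound:
  assumes z: "continuous_on {0..t} z" and K: "contracting \<nu> K" and t: "0 \<le> t"
    and B: "\<And>s. s \<in> {0..t} \<Longrightarrow> norm (z s) \<le> B * exp (K * s)" "0 \<le> B"
  shows "norm (volterra \<nu> z t) \<le> B / 2 * exp (K * t)"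
proof -
  have K1: "1 \<le> K" and K2: "2 * (tail_mass 0 + cmod \<nu>) \<le> K" using K by (auto simp: contracting_def)
  define e where "e = exp (K * t) / K"
  have e: "0 \<le> e" using K1 by (simp add: e_def)
  let ?g = "\<lambda>s. B * e * norm (Q s) + B * cmod \<nu> * ((t - s) * exp (K * s))"
  have g: "(?g has_integral B * e * mass 0 t + B * cmod \<nu> * integral {0..t} (\<lambda>s. (t - s) * exp (K * s))) {0..t}"
    unfolding mass_def
    by (intro has_integral_add has_integral_mult_right integrable_integral norm_Q_Icc ramp_integral K1 t order_refl)
  have "norm (volterra \<nu> z t) \<le> B * e * mass 0 t + B * cmod \<nu> * integral {0..t} (\<lambda>s. (t - s) * exp (K * s))"
    unfolding volterra_def
  proof (rule has_integral_norm_le[OF integrable_integral[OF volterra_integrable[OF z]] g])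
    fix s assume s: "s \<in> {0..t}"
    have "norm (Q s ** z s - \<nu> \<odot> z s) \<le> norm (Q s) * norm (z s) + cmod \<nu> * norm (z s)"
      by (rule order_trans[OF norm_triangle_ineq4]) (simp add: norm_cscale norm_matrix_mult_le)
    also have "\<dots> \<le> norm (Q s) * (B * exp (K * s)) + cmod \<nu> * (B * exp (K * s))"
      using B(1)[OF s] by (intro add_mono mult_left_mono) auto
    finally have "(t - s) * norm (Q s ** z s - \<nu> \<odot> z s) \<le>
        (t - s) * (norm (Q s) * (B * exp (K * s)) + cmod \<nu> * (B * exp (K * s)))"
      using s by (intro mult_left_mono) auto
    also have "\<dots> = B * norm (Q s) * ((t - s) * exp (K * s)) + B * cmod \<nu> * ((t - s) * exp (K * s))"
      by (simp add: algebra_simps)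
    also have "\<dots> \<le> B * norm (Q s) * e + B * cmod \<nu> * ((t - s) * exp (K * s))"
      unfolding e_def using ramp_weight_le[of K s t] K1 s B(2) by (intro add_mono mult_left_mono) auto
    also have "\<dots> = ?g s" by simp
    also have "(t - s) * norm (Q s ** z s - \<nu> \<odot> z s) = norm ((t - s) *\<^sub>R (Q s ** z s - \<nu> \<odot> z s))"
      using s by simp
    finally show "norm ((t - s) *\<^sub>R (Q s ** z s - \<nu> \<odot> z s)) \<le> ?g s" .
  qed
  also have "\<dots> \<le> B * e * tail_mass 0 + B * cmod \<nu> * e"
    using mass_le_tail[of 0 0 t] ramp_integral(2)[OF K1 t, folded e_def] B(2) e
    by (intro add_mono mult_left_mono mult_nonneg_nonneg) auto
  also have "\<dots> = B * e * (tail_mass 0 + cmod \<nu>)" by (simp add: algebra_simps)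
  also have "\<dots> \<le> B * e * (K / 2)" using K2 e B(2) by (intro mult_left_mono) auto
  also have "\<dots> = B / 2 * exp (K * t)" using K1 by (simp add: e_def)
  finally show ?thesis .
qed

lemma volterra_equation_bound:
  assumes z: "continuous_on {0..} z" and K: "contracting \<nu> K"
    and eq: "\<And>t. 0 \<le> t \<Longrightarrow> z t = f t + volterra \<nu> z t"
    and f: "\<And>t. 0 \<le> t \<Longrightarrow> norm (f t) \<le> M * exp (K * t)"
    and t: "0 \<le> t"
  shows "norm (z t) \<le> 2 * M * exp (K * t)"
proof -
  have "bounded (z ` {0..t})"
    by (rule compact_imp_bounded[OF compact_continuous_image[OF continuous_on_subset[OF z]]]) auto
  then obtain B0 where B0: "\<forall>x\<in>z ` {0..t}. norm x \<le> B0" unfolding bounded_iff by blast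
  show ?thesis
  proof (rule half_bound[of "{0..t}" "\<lambda>t. exp (K * t)" z B0 M t])
    show "norm (z s) \<le> B0 * exp (K * s)" if "s \<in> {0..t}" for s
    proof -
      have "norm (z s) \<le> B0" using B0 that by blast
      moreover have "1 \<le> exp (K * s)" using that K by (simp add: contracting_def)
      ultimately show ?thesis by (smt (verit, best) mult_le_cancel_left1 norm_ge_zero)
    qed
    show "norm (z s) \<le> (M + B / 2) * exp (K * s)"
      if B: "0 \<le> B" and s: "s \<in> {0..t}" and zB: "\<And>r. r \<in> {0..t} \<Longrightarrow> norm (z r) \<le> B * exp (K * r)" for B s
    proof -
      have "norm (volterra \<nu> z s) \<le> B / 2 * exp (K * s)"
        by (rule volterra_bound[OF continuous_on_subset[OF z] K _ zB B]) (use s in auto)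
      then have "norm (z s) \<le> M * exp (K * s) + B / 2 * exp (K * s)"
        using eq[of s] f[of s] s norm_triangle_ineq[of "f s" "volterra \<nu> z s"] by simp
      then show ?thesis by (simp add: algebra_simps)
    qed
  qed (use t in auto)
qed

text \<open>
  The Neumann series of the Volterra operator, which converges uniformly on bounded intervals.
\<close>

lemma volterra_equation_solvable:
  assumes f: "continuous_on {0..} f" and K: "contracting \<nu> K"
    and fM: "\<And>t. 0 \<le> t \<Longrightarrow> norm (f t) \<le> M * exp (K * t)"
  obtains z where "continuous_on {0..} z" "\<And>t. 0 \<le> t \<Longrightarrow> z t = f t + volterra \<nu> z t"
proof -
  define y where "y k = (volterra \<nu> ^^ k) f" for k
  define S where "S n t = (\<Sum>k<n. y k t)" for n t
  define z where "z t = (\<Sum>k. y k t)" for t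
  have "norm (f 0) \<le> M" using fM[of 0] by simp
  then have M: "0 \<le> M" using norm_ge_zero order_trans by blast
  have K0: "0 < K" using K by (simp add: contracting_def)
  have y: "continuous_on {0..} (y k)" for k
    by (induct k) (simp_all add: y_def f volterra_continuous)
  have yb: "norm (y k t) \<le> M * (1/2)^k * exp (K * t)" if "0 \<le> t" for k t
    using that
  proof (induct k arbitrary: t)
    case 0
    then show ?case using fM by (simp add: y_def)
  next
    case (Suc k)
    have "norm (volterra \<nu> (y k) t) \<le> M * (1/2)^k / 2 * exp (K * t)"
      by (rule volterra_bound[OF continuous_on_subset[OF y] K Suc(2)]) (use Suc M in auto)
    then show ?case by (simp add: y_def)
  qed
  have unif: "uniform_limit {0..b} S z sequentially" for b
    unfolding S_def[abs_def] z_def[abs_def]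
  proof (rule Weierstrass_m_test)
    show "norm (y k t) \<le> M * exp (K * b) * (1/2)^k" if "t \<in> {0..b}" for k t
    proof -
      have "M * (1/2)^k * exp (K * t) \<le> M * (1/2)^k * exp (K * b)"
        using that K0 M by (intro mult_left_mono) auto
      then show ?thesis using yb[of t k] that by (simp add: algebra_simps)
    qed
    show "summable (\<lambda>k. M * exp (K * b) * (1/2)^k)"
      by (intro summable_mult summable_geometric) simp
  qed
  have S: "continuous_on {0..} (S n)" for n unfolding S_def by (intro continuous_on_sum y)
  have zc: "continuous_on {0..} z"
  proof (rule continuous_on_half_line)
    show "continuous_on {0..b} z" for b
      by (rule uniform_limit_theorem[OF always_eventually unif])
        (auto intro: continuous_on_subset[OF S])
  qed
  have volt_S: "volterra \<nu> (S n) t = S (Suc n) t - f t" if t: "0 \<le> t" for n t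
  proof (induct n)
    case 0
    then show ?case by (simp add: S_def volterra_def y_def cs.zero_right)
  next
    case (Suc n)
    have "S n = (\<lambda>t. S (Suc n) t - y n t)" by (simp add: S_def fun_eq_iff)
    then have "volterra \<nu> (S n) t = volterra \<nu> (S (Suc n)) t - volterra \<nu> (y n) t"
      using volterra_diff[OF continuous_on_subset[OF S[of "Suc n"]] continuous_on_subset[OF y[of n]], of t] by simp
    moreover have "volterra \<nu> (y n) t = y (Suc n) t" by (simp add: y_def)
    moreover have "S (Suc (Suc n)) t = S (Suc n) t + y (Suc n) t" by (simp add: S_def)
    ultimately show ?case using Suc by (simp add: algebra_simps)
  qed
  have "z t = f t + volterra \<nu> z t" if t: "0 \<le> t" for t
  proof -
    have "(\<lambda>n. S (Suc n) t - f t) \<longlonglongrightarrow> volterra \<nu> z t"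
    proof (rule LIMSEQ_I)
      fix \<epsilon> :: real assume "\<epsilon> > 0"
      then have "\<epsilon> / exp (K * t) > 0" by simp
      then obtain N where N: "\<And>n s. n \<ge> N \<Longrightarrow> s \<in> {0..t} \<Longrightarrow> dist (S n s) (z s) < \<epsilon> / exp (K * t)"
        using unif[of t] unfolding uniform_limit_sequentially_iff by meson
      have "norm (S (Suc n) t - f t - volterra \<nu> z t) < \<epsilon>" if n: "n \<ge> N" for n
      proof -
        have "norm (volterra \<nu> (\<lambda>s. S n s - z s) t) \<le> \<epsilon> / exp (K * t) / 2 * exp (K * t)"
        proof (rule volterra_bound[OF _ K t])
          show "continuous_on {0..t} (\<lambda>s. S n s - z s)"
            by (intro continuous_intros continuous_on_subset[OF S] continuous_on_subset[OF zc]) auto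
          show "norm (S n s - z s) \<le> \<epsilon> / exp (K * t) * exp (K * s)" if s: "s \<in> {0..t}" for s
          proof -
            have "norm (S n s - z s) \<le> \<epsilon> / exp (K * t) * 1" using N[OF n s] by (simp add: dist_norm)
            also have "\<dots> \<le> \<epsilon> / exp (K * t) * exp (K * s)"
              using s K0 \<open>\<epsilon> > 0\<close> by (intro mult_left_mono) auto
            finally show ?thesis .
          qed
        qed (use \<open>\<epsilon> > 0\<close> in simp)
        also have "\<dots> < \<epsilon>" using \<open>\<epsilon> > 0\<close> by simp
        finally show ?thesis
          using volterra_diff[OF continuous_on_subset[OF S[of n]] continuous_on_subset[OF zc], of t \<nu>] volt_S[OF t, of n]
          by simp
      qed
      then show "\<exists>N. \<forall>n\<ge>N. norm (S (Suc n) t - f t - volterra \<nu> z t) < \<epsilon>" by blast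
    qed
    moreover have "(\<lambda>n. S (Suc n) t - f t) \<longlonglongrightarrow> z t - f t"
      by (intro tendsto_diff tendsto_const LIMSEQ_Suc tendsto_uniform_limitI[OF unif[of t]]) (use t in simp)
    ultimately show ?thesis using LIMSEQ_unique by (metis add.commute diff_add_cancel)
  qed
  with zc that show thesis by blast
qed

lemma sl_solution_volterra:
  assumes "sl_solution Q \<nu> Y" "0 \<le> t"
  shows "Y t = Y 0 + t *\<^sub>R dx Y 0 + volterra \<nu> Y t"
proof -
  have Yc: "continuous_on {0..t} Y" by (rule continuous_on_subset[OF sl_continuous[OF assms(1)]]) auto
  have "((dx Y) has_integral Y t - Y 0) {0..t}"
    by (rule fundamental_theorem_of_calculus[OF assms(2)])
      (auto intro!: has_vector_derivative_within_subset[OF sl_deriv[OF assms(1)]])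
  moreover have "((\<lambda>s. dx Y 0) has_integral t *\<^sub>R dx Y 0) {0..t}"
    using has_integral_const_real[of "dx Y 0" 0 t] assms(2) by simp
  ultimately have "((\<lambda>s. dx Y s - dx Y 0) has_integral Y t - Y 0 - t *\<^sub>R dx Y 0) {0..t}"
    by (rule has_integral_diff)
  then have "integral {0..t} (\<lambda>s. dx Y s - dx Y 0) = Y t - Y 0 - t *\<^sub>R dx Y 0" by (rule integral_unique)
  moreover have "integral {0..t} (\<lambda>s. dx Y s - dx Y 0) =
      integral {0..t} (\<lambda>s. integral {0..s} (\<lambda>r. Q r ** Y r - \<nu> \<odot> Y r))"
    by (rule integral_cong) (use integral_unique[OF sl_integral[OF assms(1)]] in simp)
  ultimately show ?thesis by (simp add: volterra_iterated[OF Yc assms(2)] algebra_simps)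
qed

lemma volterra_sl_solution:
  assumes z: "continuous_on {0..} z" and eq: "\<And>t. 0 \<le> t \<Longrightarrow> z t = \<alpha> + t *\<^sub>R \<beta> + volterra \<nu> z t"
  shows "sl_solution Q \<nu> z" "z 0 = \<alpha>" "dx z 0 = \<beta>"
proof -
  let ?W = "\<lambda>t. integral {0..t} (\<lambda>r. Q r ** z r - \<nu> \<odot> z r)"
  have d: "(z has_vector_derivative \<beta> + ?W t) (at t within {0..})" if t: "0 \<le> t" for t
  proof (rule has_vector_derivative_transform)
    show "((\<lambda>t. \<alpha> + t *\<^sub>R \<beta> + volterra \<nu> z t) has_vector_derivative \<beta> + ?W t) (at t within {0..})"
      using volterra_has_vector_derivative[OF z t, of \<nu>] by (auto intro!: derivative_eq_intros)
  qed (use eq t in auto)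
  then have dz: "dx z t = \<beta> + ?W t" if "0 \<le> t" for t using that by (intro dx_eqI)
  have int: "((\<lambda>r. Q r ** z r - \<nu> \<odot> z r) has_integral ?W x) {0..x}" for x
    using rhs_absolutely_integrable[OF continuous_on_subset[OF z, of "{0..x}"], of \<nu>]
    by (auto simp: absolutely_integrable_on_def intro: integrable_integral)
  show "z 0 = \<alpha>" using eq[of 0] by (simp add: volterra_def)
  show "dx z 0 = \<beta>" using dz[of 0] by simp
  show "sl_solution Q \<nu> z"
    unfolding sl_solution_def differentiable_on_def
    using d int dz by (auto simp: mat_mult_left has_vector_derivative_def differentiable_def)
qed

lemma ramp_line_bound:
  assumes "K \<ge> 1" "0 \<le> t"
  shows "norm (\<alpha> + t *\<^sub>R \<beta> :: complex^'n^'n) \<le> (norm \<alpha> + norm \<beta>) * exp (K * t)"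
proof -
  have "t \<le> K * t" using assms by (simp add: mult_le_cancel_right1)
  also have "K * t \<le> exp (K * t)" using exp_ge_add_one_self[of "K * t"] by linarith
  finally have "t \<le> exp (K * t)" .
  moreover have "1 \<le> exp (K * t)" using assms by simp
  ultimately have "norm \<alpha> * 1 + t * norm \<beta> \<le> norm \<alpha> * exp (K * t) + exp (K * t) * norm \<beta>"
    by (intro add_mono mult_left_mono mult_right_mono) auto
  then show ?thesis using norm_triangle_ineq[of \<alpha> "t *\<^sub>R \<beta>"] assms by (simp add: algebra_simps)
qed

lemma contracting_exists: "\<exists>K. \<forall>\<nu>. cmod \<nu> \<le> R \<longrightarrow> contracting \<nu> K"
  by (rule exI[of _ "max 1 (2 * (tail_mass 0 + R))"]) (auto simp: contracting_def)

lemma ivp_exists: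
  obtains Y where "sl_solution Q \<nu> Y" "Y 0 = \<alpha>" "dx Y 0 = \<beta>"
proof -
  obtain K where K: "contracting \<nu> K" using contracting_exists[of "cmod \<nu>"] by auto
  have "continuous_on {0..} (\<lambda>t. \<alpha> + t *\<^sub>R \<beta>)" by (intro continuous_intros)
  from volterra_equation_solvable[OF this K, of "norm \<alpha> + norm \<beta>"] ramp_line_bound K
  obtain z where "continuous_on {0..} z" "\<And>t. 0 \<le> t \<Longrightarrow> z t = \<alpha> + t *\<^sub>R \<beta> + volterra \<nu> z t"
    unfolding contracting_def by metis
  then show thesis using volterra_sl_solution that by blast
qed

lemma ivp_bound:
  assumes "sl_solution Q \<nu> Y" "contracting \<nu> K" "0 \<le> t"
  shows "norm (Y t) \<le> 2 * (norm (Y 0) + norm (dx Y 0)) * exp (K * t)"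
  by (rule volterra_equation_bound[OF sl_continuous[OF assms(1)] assms(2) sl_solution_volterra[OF assms(1)] _ assms(3)])
    (use assms in \<open>auto simp: contracting_def intro: ramp_line_bound\<close>)

lemma ivp_zero:
  assumes "sl_solution Q \<nu> Y" "Y 0 = 0" "dx Y 0 = 0" "0 \<le> t"
  shows "Y t = 0"
proof -
  obtain K where K: "contracting \<nu> K" using contracting_exists[of "cmod \<nu>"] by auto
  show ?thesis using ivp_bound[OF assms(1) K assms(4)] assms(2,3) by simp
qed

end

lemma sl_solution_diff:
  assumes Y: "sl_solution Q \<nu> Y" and Z: "sl_solution Q \<nu> Z"
  shows "sl_solution Q \<nu> (\<lambda>t. Y t - Z t)" "0 \<le> x \<Longrightarrow> dx (\<lambda>t. Y t - Z t) x = dx Y x - dx Z x"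
proof -
  have d: "((\<lambda>t. Y t - Z t) has_vector_derivative dx Y x - dx Z x) (at x within {0..})" if "0 \<le> x" for x
    by (intro has_vector_derivative_diff sl_deriv[OF Y] sl_deriv[OF Z] that)
  show dd: "dx (\<lambda>t. Y t - Z t) x = dx Y x - dx Z x" if "0 \<le> x" for x by (rule dx_eqI[OF d[OF that] that])
  have "((\<lambda>t. Q t ** (Y t - Z t) - \<nu> \<odot> (Y t - Z t)) has_integral (dx Y x - dx Z x) - (dx Y 0 - dx Z 0)) {0..x}"
    if "0 \<le> x" for x
    using has_integral_diff[OF sl_integral[OF Y that] sl_integral[OF Z that]]
    by (simp add: mm.diff_right cs.diff_right algebra_simps)
  moreover have "(\<lambda>t. Y t - Z t) differentiable_on {0..}"
    using Y Z by (simp add: sl_solution_def differentiable_on_diff)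
  ultimately show "sl_solution Q \<nu> (\<lambda>t. Y t - Z t)"
    by (auto simp: sl_solution_def dd mat_mult_left)
qed

lemma sl_solution_mult_right:
  assumes Y: "sl_solution Q \<nu> Y"
  shows "sl_solution Q \<nu> (\<lambda>t. Y t ** C)" "0 \<le> x \<Longrightarrow> dx (\<lambda>t. Y t ** C) x = dx Y x ** C"
proof -
  have d: "((\<lambda>t. Y t ** C) has_vector_derivative dx Y x ** C) (at x within {0..})" if "0 \<le> x" for x
    by (rule bounded_linear.has_vector_derivative[OF mm.bounded_linear_left sl_deriv[OF Y that]])
  show dd: "dx (\<lambda>t. Y t ** C) x = dx Y x ** C" if "0 \<le> x" for x by (rule dx_eqI[OF d[OF that] that])
  have "((\<lambda>t. Q t ** (Y t ** C) - \<nu> \<odot> (Y t ** C)) has_integral dx Y x ** C - dx Y 0 ** C) {0..x}"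
    if "0 \<le> x" for x
    using has_integral_linear[OF sl_integral[OF Y that] mm.bounded_linear_left[of C]]
    by (simp add: o_def mat_normal)
  moreover have "(\<lambda>t. Y t ** C) differentiable_on {0..}"
    unfolding differentiable_on_def differentiable_def
    using d by (auto simp: has_vector_derivative_def)
  ultimately show "sl_solution Q \<nu> (\<lambda>t. Y t ** C)"
    by (auto simp: sl_solution_def dd mat_mult_left)
qed

subsection \<open>Dependence on the spectral parameter\<close>

text \<open>
  \<open>Y\<^sub>\<mu> - Y\<^sub>\<nu>\<close> and the deviation of the difference quotient from \<open>Z\<close>, the solution of the formally differentiated
  Volterra equation, themselves solve Volterra equations with small inhomogeneous terms.
\<close>

lemma (in potential) ivp_difference_quotient_bounds:
  fixes Y :: "complex \<Rightarrow> real \<Rightarrow> complex^'n^'n"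
  assumes Y: "\<And>\<mu>. sl_solution Q \<mu> (Y \<mu>)" and Y0: "\<And>\<mu>. Y \<mu> 0 = \<alpha>" and Y1: "\<And>\<mu>. dx (Y \<mu>) 0 = \<beta>"
  obtains Z K C where "continuous_on {0..} Z" "contracting \<nu> K" "0 \<le> C"
    "\<And>t \<mu>. 0 \<le> t \<Longrightarrow> cmod (\<mu> - \<nu>) \<le> 1 \<Longrightarrow> norm (Y \<mu> t - Y \<nu> t) \<le> C * cmod (\<mu> - \<nu>) * exp (K * t)"
    "\<And>t \<mu>. 0 \<le> t \<Longrightarrow> cmod (\<mu> - \<nu>) \<le> 1 \<Longrightarrow> \<mu> \<noteq> \<nu> \<Longrightarrow>
      norm ((1 / (\<mu> - \<nu>)) \<odot> (Y \<mu> t - Y \<nu> t) - Z t) \<le> C * cmod (\<mu> - \<nu>) * exp (K * t)"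
proof -
  obtain K where K: "\<And>\<mu>. cmod \<mu> \<le> cmod \<nu> + 1 \<Longrightarrow> contracting \<mu> K"
    using contracting_exists[of "cmod \<nu> + 1"] by auto
  have K\<nu>: "contracting \<nu> K" by (rule K) simp
  have K\<mu>: "contracting \<mu> K" if "cmod (\<mu> - \<nu>) \<le> 1" for \<mu>
    using that norm_triangle_sub[of \<mu> \<nu>] by (intro K) simp
  have K1: "1 \<le> K" using K\<nu> by (simp add: contracting_def)
  define C where "C = 2 * (norm \<alpha> + norm \<beta>)"
  have C: "0 \<le> C" by (simp add: C_def)
  have Yc: "continuous_on {0..t} (Y \<mu>)" for t \<mu>
    by (rule continuous_on_subset[OF sl_continuous[OF Y]]) auto
  have Yb: "norm (Y \<mu> t) \<le> C * exp (K * t)" if "0 \<le> t" "cmod (\<mu> - \<nu>) \<le> 1" for \<mu> t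
    using ivp_bound[OF Y K\<mu> that(1), OF that(2)] by (simp add: C_def Y0 Y1)
  have Rb: "norm (ramp (Y \<mu>) t) \<le> C * exp (K * t)" if "0 \<le> t" "cmod (\<mu> - \<nu>) \<le> 1" for \<mu> t
    by (rule ramp_bound[OF Yc K1 that(1) Yb C]) (use that in auto)
  have Rc: "continuous_on {0..} (ramp (Y \<mu>))" for \<mu>
  proof -
    have "volterra 0 (Y \<mu>) t - volterra 1 (Y \<mu>) t = ramp (Y \<mu>) t" for t
      using volterra_change_parameter[OF Yc, of 1 \<mu> t 0] by simp
    then show ?thesis
      using continuous_on_diff[OF volterra_continuous[OF sl_continuous[OF Y[of \<mu>]], of 0] volterra_continuous[OF sl_continuous[OF Y[of \<mu>]], of 1]]
      by simp
  qed
  have d_eq: "Y \<mu> t - Y \<nu> t = - ((\<mu> - \<nu>) \<odot> ramp (Y \<mu>) t) + volterra \<nu> (\<lambda>s. Y \<mu> s - Y \<nu> s) t" if "0 \<le> t" for \<mu> t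
    using sl_solution_volterra[OF Y that, of \<mu>] sl_solution_volterra[OF Y that, of \<nu>]
    by (simp add: Y0 Y1 volterra_diff[OF Yc Yc] volterra_change_parameter[OF Yc, of \<mu> \<mu> t \<nu>])
  have dc: "continuous_on {0..} (\<lambda>s. Y \<mu> s - Y \<nu> s)" for \<mu>
    by (intro continuous_intros sl_continuous[OF Y])
  have dc': "continuous_on {0..t} (\<lambda>s. Y \<mu> s - Y \<nu> s)" for \<mu> t
    by (intro continuous_intros Yc)
  have db: "norm (Y \<mu> t - Y \<nu> t) \<le> 2 * (C * cmod (\<mu> - \<nu>)) * exp (K * t)" if "0 \<le> t" "cmod (\<mu> - \<nu>) \<le> 1" for \<mu> t
  proof (rule volterra_equation_bound[OF dc K\<nu> d_eq _ that(1)])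
    show "norm (- ((\<mu> - \<nu>) \<odot> ramp (Y \<mu>) s)) \<le> C * cmod (\<mu> - \<nu>) * exp (K * s)" if "0 \<le> s" for s
      using mult_left_mono[OF Rb[OF that \<open>cmod (\<mu> - \<nu>) \<le> 1\<close>], of "cmod (\<mu> - \<nu>)"]
      by (simp add: norm_cscale algebra_simps)
  qed
  have "continuous_on {0..} (\<lambda>t. - ramp (Y \<nu>) t)" by (intro continuous_intros Rc)
  then obtain Z where Z: "continuous_on {0..} Z" "\<And>t. 0 \<le> t \<Longrightarrow> Z t = - ramp (Y \<nu>) t + volterra \<nu> Z t"
    using volterra_equation_solvable[OF _ K\<nu>, of "\<lambda>t. - ramp (Y \<nu>) t" C] Rb[of _ \<nu>] by auto
  have Zc: "continuous_on {0..t} Z" for t by (rule continuous_on_subset[OF Z(1)]) auto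
  have qb: "norm ((1 / (\<mu> - \<nu>)) \<odot> (Y \<mu> t - Y \<nu> t) - Z t) \<le> 2 * (2 * (C * cmod (\<mu> - \<nu>))) * exp (K * t)"
    if t: "0 \<le> t" and \<mu>: "cmod (\<mu> - \<nu>) \<le> 1" "\<mu> \<noteq> \<nu>" for \<mu> t
  proof (rule volterra_equation_bound[OF _ K\<nu> _ _ t])
    let ?c = "1 / (\<mu> - \<nu>)"
    show "continuous_on {0..} (\<lambda>t. ?c \<odot> (Y \<mu> t - Y \<nu> t) - Z t)"
      by (intro continuous_intros cs.continuous_on dc Z(1))
    show "?c \<odot> (Y \<mu> s - Y \<nu> s) - Z s = - ramp (\<lambda>r. Y \<mu> r - Y \<nu> r) s +
        volterra \<nu> (\<lambda>t. ?c \<odot> (Y \<mu> t - Y \<nu> t) - Z t) s" if s: "0 \<le> s" for s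
    proof -
      have c1: "continuous_on {0..s} (\<lambda>t. ?c \<odot> (Y \<mu> t - Y \<nu> t))"
        by (intro cs.continuous_on continuous_intros dc')
      have "?c \<odot> (Y \<mu> s - Y \<nu> s) = - ramp (Y \<mu>) s + ?c \<odot> volterra \<nu> (\<lambda>s. Y \<mu> s - Y \<nu> s) s"
        by (subst d_eq[OF s]) (use \<mu> in \<open>simp add: cs.add_right cs.minus_right cs.diff_right cscale_cscale\<close>)
      moreover have "ramp (\<lambda>r. Y \<mu> r - Y \<nu> r) s = ramp (Y \<mu>) s - ramp (Y \<nu>) s"
        unfolding ramp_def
        by (subst integral_diff[symmetric])
          (auto intro!: integrable_continuous_real continuous_intros Yc simp: scaleR_diff_right)
      ultimately show ?thesis
        using Z(2)[OF s] by (simp add: volterra_diff[OF c1 Zc] volterra_cscale[OF dc'])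
    qed
    show "norm (- ramp (\<lambda>r. Y \<mu> r - Y \<nu> r) s) \<le> 2 * (C * cmod (\<mu> - \<nu>)) * exp (K * s)" if s: "0 \<le> s" for s
      using ramp_bound[OF dc' K1 s, of \<mu> "2 * (C * cmod (\<mu> - \<nu>))"] db[OF _ \<mu>(1)] C by simp
  qed
  show thesis
  proof (rule that[OF Z(1) K\<nu>, of "4 * C"])
    show "norm (Y \<mu> t - Y \<nu> t) \<le> 4 * C * cmod (\<mu> - \<nu>) * exp (K * t)" if "0 \<le> t" "cmod (\<mu> - \<nu>) \<le> 1" for t \<mu>
    proof -
      have "0 \<le> C * cmod (\<mu> - \<nu>) * exp (K * t)" using C by simp
      then show ?thesis using db[OF that] by linarith
    qed
  qed (use C qb in \<open>auto simp: algebra_simps\<close>)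
qed

lemma has_field_derivative_entry:
  fixes F :: "complex \<Rightarrow> complex^'n^'n"
  assumes "\<And>\<mu>. cmod (\<mu> - \<nu>) \<le> 1 \<Longrightarrow> \<mu> \<noteq> \<nu> \<Longrightarrow> norm ((1 / (\<mu> - \<nu>)) \<odot> (F \<mu> - F \<nu>) - D) \<le> C * cmod (\<mu> - \<nu>)"
  shows "((\<lambda>\<mu>. F \<mu> $ i $ j) has_field_derivative D $ i $ j) (at \<nu>)"
  unfolding has_field_derivative_iff
proof (rule LIM_zero_cancel, rule Lim_null_comparison)
  show "\<forall>\<^sub>F \<mu> in at \<nu>. norm ((F \<mu> $ i $ j - F \<nu> $ i $ j) / (\<mu> - \<nu>) - D $ i $ j) \<le> C * cmod (\<mu> - \<nu>)"
    unfolding eventually_at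
  proof (intro exI[of _ 1] conjI ballI impI)
    fix \<mu> assume "\<mu> \<noteq> \<nu> \<and> dist \<mu> \<nu> < 1"
    then have "norm ((1 / (\<mu> - \<nu>)) \<odot> (F \<mu> - F \<nu>) - D) \<le> C * cmod (\<mu> - \<nu>)"
      using assms by (simp add: dist_norm)
    moreover have "cmod (((1 / (\<mu> - \<nu>)) \<odot> (F \<mu> - F \<nu>) - D) $ i $ j) \<le> norm ((1 / (\<mu> - \<nu>)) \<odot> (F \<mu> - F \<nu>) - D)"
      by (rule norm_entry_le)
    ultimately show "norm ((F \<mu> $ i $ j - F \<nu> $ i $ j) / (\<mu> - \<nu>) - D $ i $ j) \<le> C * cmod (\<mu> - \<nu>)"
      by simp
  qed simp
  show "((\<lambda>\<mu>. C * cmod (\<mu> - \<nu>)) \<longlongrightarrow> 0) (at \<nu>)"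
    by (auto intro!: tendsto_eq_intros)
qed

text \<open>
  The solution at \<open>t\<close> is complex differentiable by the bounds on its difference quotients; its derivative in
  \<open>t\<close> is an integral of the solution, and the bounds pass through that integral.
\<close>

lemma (in potential) ivp_entire:
  fixes Y :: "complex \<Rightarrow> real \<Rightarrow> complex^'n^'n"
  assumes Y: "\<And>\<mu>. sl_solution Q \<mu> (Y \<mu>)" and Y0: "\<And>\<mu>. Y \<mu> 0 = \<alpha>" and Y1: "\<And>\<mu>. dx (Y \<mu>) 0 = \<beta>"
    and t: "0 \<le> t"
  shows "(\<lambda>\<mu>. Y \<mu> t $ i $ j) holomorphic_on UNIV" "(\<lambda>\<mu>. dx (Y \<mu>) t $ i $ j) holomorphic_on UNIV"
proof -
  have "(\<exists>D. ((\<lambda>\<mu>. Y \<mu> t $ i $ j) has_field_derivative D) (at \<nu>)) \<and>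
        (\<exists>D. ((\<lambda>\<mu>. dx (Y \<mu>) t $ i $ j) has_field_derivative D) (at \<nu>))" for \<nu>
  proof -
    obtain Z K C where Z: "continuous_on {0..} Z" and K: "contracting \<nu> K" and C: "0 \<le> C"
      and db: "\<And>t \<mu>. 0 \<le> t \<Longrightarrow> cmod (\<mu> - \<nu>) \<le> 1 \<Longrightarrow> norm (Y \<mu> t - Y \<nu> t) \<le> C * cmod (\<mu> - \<nu>) * exp (K * t)"
      and qb: "\<And>t \<mu>. 0 \<le> t \<Longrightarrow> cmod (\<mu> - \<nu>) \<le> 1 \<Longrightarrow> \<mu> \<noteq> \<nu> \<Longrightarrow>
        norm ((1 / (\<mu> - \<nu>)) \<odot> (Y \<mu> t - Y \<nu> t) - Z t) \<le> C * cmod (\<mu> - \<nu>) * exp (K * t)"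
      using ivp_difference_quotient_bounds[OF Y Y0 Y1, of \<nu>] by metis
    have 1: "((\<lambda>\<mu>. Y \<mu> t $ i $ j) has_field_derivative Z t $ i $ j) (at \<nu>)"
      by (rule has_field_derivative_entry[where C = "C * exp (K * t)"]) (use qb[OF t] in \<open>simp add: algebra_simps\<close>)
    define D where "D = integral {0..t} (\<lambda>s. Q s ** Z s - \<nu> \<odot> Z s - Y \<nu> s)"
    have Yc: "continuous_on {0..t} (Y \<mu>)" for \<mu>
      by (rule continuous_on_subset[OF sl_continuous[OF Y]]) auto
    have Zc: "continuous_on {0..t} Z" by (rule continuous_on_subset[OF Z]) auto
    have Dint: "((\<lambda>s. Q s ** Z s - \<nu> \<odot> Z s - Y \<nu> s) has_integral D) {0..t}"
      unfolding D_def using rhs_absolutely_integrable[OF Zc, of \<nu>]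
      by (intro integrable_integral integrable_diff[OF _ integrable_continuous_real[OF Yc]])
        (simp add: absolutely_integrable_on_def)
    define E where "E = exp (K * t)"
    have E: "exp (K * s) \<le> E" if "s \<in> {0..t}" for s
      using that K by (simp add: E_def contracting_def)
    have 2: "((\<lambda>\<mu>. dx (Y \<mu>) t $ i $ j) has_field_derivative D $ i $ j) (at \<nu>)"
    proof (rule has_field_derivative_entry[where C = "C * E * mass 0 t + t * (C * E * (cmod \<nu> + 1))"])
      fix \<mu> assume \<mu>: "cmod (\<mu> - \<nu>) \<le> 1" "\<mu> \<noteq> \<nu>"
      let ?c = "1 / (\<mu> - \<nu>)" and ?m = "cmod (\<mu> - \<nu>)"
      let ?\<delta> = "\<lambda>s. ?c \<odot> (Y \<mu> s - Y \<nu> s) - Z s"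
      have "((\<lambda>s. ?c \<odot> ((Q s ** Y \<mu> s - \<mu> \<odot> Y \<mu> s) - (Q s ** Y \<nu> s - \<nu> \<odot> Y \<nu> s))) has_integral
          ?c \<odot> ((dx (Y \<mu>) t - dx (Y \<mu>) 0) - (dx (Y \<nu>) t - dx (Y \<nu>) 0))) {0..t}"
        using has_integral_linear[OF has_integral_diff[OF sl_integral[OF Y t] sl_integral[OF Y t]] cs.bounded_linear_right]
        by (simp add: o_def)
      from has_integral_diff[OF this Dint]
      have int: "((\<lambda>s. ?c \<odot> ((Q s ** Y \<mu> s - \<mu> \<odot> Y \<mu> s) - (Q s ** Y \<nu> s - \<nu> \<odot> Y \<nu> s)) -
          (Q s ** Z s - \<nu> \<odot> Z s - Y \<nu> s)) has_integral ?c \<odot> (dx (Y \<mu>) t - dx (Y \<nu>) t) - D) {0..t}"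
        by (simp add: Y1)
      have eq: "?c \<odot> ((Q s ** Y \<mu> s - \<mu> \<odot> Y \<mu> s) - (Q s ** Y \<nu> s - \<nu> \<odot> Y \<nu> s)) -
          (Q s ** Z s - \<nu> \<odot> Z s - Y \<nu> s) = Q s ** ?\<delta> s - \<nu> \<odot> ?\<delta> s - (Y \<mu> s - Y \<nu> s)" for s
      proof -
        have "\<mu> \<odot> Y \<mu> s = (\<mu> - \<nu>) \<odot> Y \<mu> s + \<nu> \<odot> Y \<mu> s" by (simp add: cs.diff_left)
        then show ?thesis using \<mu>(2)
          by (simp add: mm.diff_right cs.diff_right cs.add_right cscale_mult_right cscale_cscale mult.commute)
      qed
      have g: "((\<lambda>s. C * ?m * E * norm (Q s) + C * ?m * E * (cmod \<nu> + 1)) has_integral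
          C * ?m * E * mass 0 t + t * (C * ?m * E * (cmod \<nu> + 1))) {0..t}"
        using has_integral_add[OF has_integral_mult_right[OF integrable_integral[OF norm_Q_Icc[of 0 t]]]
          has_integral_const_real[of "C * ?m * E * (cmod \<nu> + 1)" 0 t]] t by (simp add: mass_def)
      have "norm (?c \<odot> (dx (Y \<mu>) t - dx (Y \<nu>) t) - D) \<le> C * ?m * E * mass 0 t + t * (C * ?m * E * (cmod \<nu> + 1))"
      proof (rule has_integral_norm_le[OF int g])
        fix s assume s: "s \<in> {0..t}"
        have CE: "C * ?m * exp (K * s) \<le> C * ?m * E" using E[OF s] C by (intro mult_left_mono) auto
        have \<delta>: "norm (?\<delta> s) \<le> C * ?m * E" using qb[of s \<mu>] \<mu> s CE by simp
        have d: "norm (Y \<mu> s - Y \<nu> s) \<le> C * ?m * E" using db[of s \<mu>] \<mu> s CE by simp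
        have "norm (Q s ** ?\<delta> s) \<le> norm (Q s) * (C * ?m * E)"
          by (rule order_trans[OF norm_matrix_mult_le mult_left_mono[OF \<delta>]]) simp
        moreover have "norm (\<nu> \<odot> ?\<delta> s) \<le> cmod \<nu> * (C * ?m * E)"
          unfolding norm_cscale by (rule mult_left_mono[OF \<delta>]) simp
        ultimately have "norm (Q s ** ?\<delta> s - \<nu> \<odot> ?\<delta> s - (Y \<mu> s - Y \<nu> s)) \<le>
            norm (Q s) * (C * ?m * E) + cmod \<nu> * (C * ?m * E) + C * ?m * E"
          using d norm_triangle_ineq4[of "Q s ** ?\<delta> s - \<nu> \<odot> ?\<delta> s" "Y \<mu> s - Y \<nu> s"]
            norm_triangle_ineq4[of "Q s ** ?\<delta> s" "\<nu> \<odot> ?\<delta> s"] by linarith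
        then show "norm (?c \<odot> ((Q s ** Y \<mu> s - \<mu> \<odot> Y \<mu> s) - (Q s ** Y \<nu> s - \<nu> \<odot> Y \<nu> s)) -
          (Q s ** Z s - \<nu> \<odot> Z s - Y \<nu> s)) \<le> C * ?m * E * norm (Q s) + C * ?m * E * (cmod \<nu> + 1)"
          unfolding eq by (simp add: algebra_simps)
      qed
      also have "\<dots> = (C * E * mass 0 t + t * (C * E * (cmod \<nu> + 1))) * ?m" by (simp add: algebra_simps)
      finally show "norm (?c \<odot> (dx (Y \<mu>) t - dx (Y \<nu>) t) - D) \<le> (C * E * mass 0 t + t * (C * E * (cmod \<nu> + 1))) * ?m" .
    qed
    show ?thesis using 1 2 by blast
  qed
  then show "(\<lambda>\<mu>. Y \<mu> t $ i $ j) holomorphic_on UNIV" "(\<lambda>\<mu>. dx (Y \<mu>) t $ i $ j) holomorphic_on UNIV"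
    by (auto simp: holomorphic_on_open)
qed

lemma (in potential) ivp_locally_lipschitz_parameter:
  fixes Y :: "complex \<Rightarrow> real \<Rightarrow> complex^'n^'n"
  assumes Y: "\<And>\<mu>. sl_solution Q \<mu> (Y \<mu>)" and Y0: "\<And>\<mu>. Y \<mu> 0 = \<alpha>" and Y1: "\<And>\<mu>. dx (Y \<mu>) 0 = \<beta>"
  obtains C where "0 \<le> C" "\<And>t \<mu>. t \<in> {0..x} \<Longrightarrow> cmod (\<mu> - \<nu>) \<le> 1 \<Longrightarrow> norm (Y \<mu> t - Y \<nu> t) \<le> C * cmod (\<mu> - \<nu>)"
proof -
  obtain K C where K: "contracting \<nu> K" and C: "0 \<le> C"
    and db: "\<And>t \<mu>. 0 \<le> t \<Longrightarrow> cmod (\<mu> - \<nu>) \<le> 1 \<Longrightarrow> norm (Y \<mu> t - Y \<nu> t) \<le> C * cmod (\<mu> - \<nu>) * exp (K * t)"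
    using ivp_difference_quotient_bounds[OF Y Y0 Y1, of \<nu>] by metis
  show thesis
  proof (rule that[of "C * exp (K * x)"])
    fix t \<mu> assume t: "t \<in> {0..x}" and \<mu>: "cmod (\<mu> - \<nu>) \<le> 1"
    have "C * cmod (\<mu> - \<nu>) * exp (K * t) \<le> C * cmod (\<mu> - \<nu>) * exp (K * x)"
      using t K C by (intro mult_left_mono) (auto simp: contracting_def)
    then show "norm (Y \<mu> t - Y \<nu> t) \<le> C * exp (K * x) * cmod (\<mu> - \<nu>)"
      using db[of t \<mu>] t \<mu> by (simp add: algebra_simps)
  qed (use C in simp)
qed

section \<open>Jost solutions\<close>

context potential begin

lemma Q_mult_tail_absolutely_integrable:
  fixes P :: "real \<Rightarrow> complex^'n^'n"
  assumes P: "continuous_on {0..} P" "bounded (P ` {0..})" and x: "0 \<le> x"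
  shows "(\<lambda>t. Q t ** P t) absolutely_integrable_on {x..}"
proof -
  have m: "P \<in> borel_measurable (lebesgue_on {x..})"
    by (rule continuous_imp_measurable_on_sets_lebesgue[OF continuous_on_subset[OF P(1)]]) (use x in auto)
  have b: "bounded (P ` {x..})" by (rule bounded_subset[OF P(2)]) (use x in auto)
  have bl: "bilinear (\<lambda>(x :: complex^'n^'n) (y :: complex^'n^'n). y ** x)"
    unfolding bilinear_conv_bounded_bilinear by (rule bounded_bilinear.flip[OF bounded_bilinear_matrix_mult])
  show ?thesis
    by (rule absolutely_integrable_bounded_measurable_product[OF bl m _ b Q_tail[OF x]]) simp
qed

lemma integral_split_tail:
  fixes F :: "real \<Rightarrow> complex^'n^'n"
  assumes "F integrable_on {0..}" "0 \<le> x"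
  shows "integral {0..} F = integral {0..x} F + integral {x..} F"
proof -
  have i: "F integrable_on {0..x}" using assms(1) by (rule integrable_on_subinterval) auto
  have "{0..} = {0..x} \<union> {x..}" using assms(2) by auto
  moreover have "negligible ({0..x} \<inter> {x..})" by (rule negligible_subset[of "{x}"]) auto
  moreover have "F integrable_on {x..}"
  proof -
    have eq: "{0..x} \<inter> {0..} = {0..x}" "{x<..} \<inter> {0..} = {x<..}" using assms(2) by auto
    have "((\<lambda>t. if t \<in> {0..x} then F t else 0) integrable_on {0..})"
      using i by (simp only: integrable_restrict_Int eq)
    from integrable_diff[OF assms(1) this]
    have "(\<lambda>t. if t \<in> {x<..} then F t else 0) integrable_on {0..}"
      by (rule integrable_eq) auto
    then have "F integrable_on {x<..}"
      by (simp only: integrable_restrict_Int eq)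
    then show ?thesis
      by (rule integrable_spike_set) (auto intro: negligible_subset[of "{x}"])
  qed
  ultimately show ?thesis using integral_Un[of F "{0..x}" "{x..}"] i by simp
qed

end

locale jost = potential Q for Q :: "real \<Rightarrow> complex^'n^'n" +
  fixes \<rho> :: complex and e :: "real \<Rightarrow> complex^'n^'n"
  assumes rho: "\<rho> \<in> Omega" and jost: "jost_solution Q \<rho> e"
begin

lemma Im_rho: "0 \<le> Im \<rho>" and rho_nz: "\<rho> \<noteq> 0"
  using rho by (auto simp: Omega_def)

lemma e_solution: "sl_solution Q (\<rho>\<^sup>2) e"
  using jost by (simp add: jost_solution_def)

lemma e_bounded: obtains C where "\<And>t. 0 \<le> t \<Longrightarrow> norm (e t) \<le> C * exp (- (Im \<rho> * t))"
proof -
  have "bounded ((\<lambda>x. exp (- \<i> * \<rho> * of_real x) \<odot> e x) ` {0..})"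
    using jost by (simp add: jost_solution_def mat_mult_left)
  then obtain C where C: "\<forall>y\<in>(\<lambda>x. exp (- \<i> * \<rho> * of_real x) \<odot> e x) ` {0..}. norm y \<le> C"
    unfolding bounded_iff by blast
  have "norm (e t) \<le> C * exp (- (Im \<rho> * t))" if "0 \<le> t" for t
  proof -
    have "norm (exp (- \<i> * \<rho> * of_real t) \<odot> e t) \<le> C" using C that by blast
    then have "exp (Im \<rho> * t) * norm (e t) * exp (- (Im \<rho> * t)) \<le> C * exp (- (Im \<rho> * t))"
      by (intro mult_right_mono) (simp_all add: norm_cscale)
    then show ?thesis by (simp add: exp_minus field_simps)
  qed
  then show thesis using that by blast
qed

lemma e_exp_absolutely_integrable:
  assumes "\<sigma> = \<rho> \<or> \<sigma> = - \<rho>" "0 \<le> x"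
  shows "(\<lambda>t. exp (- \<i> * \<sigma> * of_real t) \<odot> (Q t ** e t)) absolutely_integrable_on {x..}"
proof -
  obtain C where C: "\<And>t. 0 \<le> t \<Longrightarrow> norm (e t) \<le> C * exp (- (Im \<rho> * t))" using e_bounded by blast
  have "norm (exp (- \<i> * \<sigma> * of_real t) \<odot> e t) \<le> C" if t: "0 \<le> t" for t
  proof -
    have "norm (exp (- \<i> * \<sigma> * of_real t) \<odot> e t) = exp (Im \<sigma> * t) * norm (e t)" by (simp add: norm_cscale)
    also have "\<dots> \<le> exp (Im \<rho> * t) * norm (e t)"
      using assms(1) Im_rho t by (intro mult_right_mono) (auto intro: order_trans[of _ 0])
    also have "\<dots> \<le> exp (Im \<rho> * t) * (C * exp (- (Im \<rho> * t)))" by (intro mult_left_mono C t) simp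
    also have "\<dots> = C" by (simp add: exp_minus)
    finally show ?thesis .
  qed
  then have "bounded ((\<lambda>t. exp (- \<i> * \<sigma> * of_real t) \<odot> e t) ` {0..})"
    unfolding bounded_iff by (intro exI[of _ C]) auto
  moreover have "continuous_on {0..} (\<lambda>t. exp (- \<i> * \<sigma> * of_real t) \<odot> e t)"
    by (intro cs.continuous_on sl_continuous[OF e_solution] continuous_intros)
  ultimately have "(\<lambda>t. Q t ** (exp (- \<i> * \<sigma> * of_real t) \<odot> e t)) absolutely_integrable_on {x..}"
    using assms(2) by (intro Q_mult_tail_absolutely_integrable)
  then show ?thesis by (simp add: cscale_mult_right)
qed

text \<open>
  Both plane-wave components of any solution bounded by \<open>e\<^sup>-\<^sup>I\<^sup>m\<^sup>\<rho>\<^sup>x\<close> converge at infinity; comparing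
  with the integral equation at two points, where \<open>e\<^sup>i\<^sup>\<rho>\<^sup>x\<close> and \<open>e\<^sup>-\<^sup>i\<^sup>\<rho>\<^sup>x\<close> are independent, identifies the
  limits. This also gives the derivative of the Jost solution.
\<close>

lemma waves_at_infinity:
  assumes x: "0 \<le> x"
  shows "((\<lambda>t. exp (- \<i> * \<rho> * of_real t) \<odot> (Q t ** e t)) has_integral (2 * \<i> * \<rho>) \<odot> mat 1 - wave \<rho> e x) {x..}"
    and "((\<lambda>t. exp (- \<i> * (-\<rho>) * of_real t) \<odot> (Q t ** e t)) has_integral - wave (-\<rho>) e x) {x..}"
proof -
  define I where "I \<sigma> x = integral {x..} (\<lambda>t. exp (- \<i> * \<sigma> * of_real t) \<odot> (Q t ** e t))" for \<sigma> x
  have int: "((\<lambda>t. exp (- \<i> * \<sigma> * of_real t) \<odot> (Q t ** e t)) has_integral I \<sigma> x) {x..}"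
    if "\<sigma> = \<rho> \<or> \<sigma> = - \<rho>" "0 \<le> x" for \<sigma> x
    unfolding I_def using e_exp_absolutely_integrable[OF that]
    by (intro integrable_integral) (simp add: absolutely_integrable_on_def)
  have wave_I: "wave \<sigma> e x = (wave \<sigma> e 0 + I \<sigma> 0) - I \<sigma> x"
    if \<sigma>: "\<sigma> = \<rho> \<or> \<sigma> = - \<rho>" and x: "0 \<le> x" for \<sigma> x
  proof -
    have "sl_solution Q (\<sigma>\<^sup>2) e" using \<sigma> e_solution by auto
    from integral_unique[OF wave_integral[OF this order_refl x]]
    have "wave \<sigma> e x - wave \<sigma> e 0 = integral {0..x} (\<lambda>t. exp (- \<i> * \<sigma> * of_real t) \<odot> (Q t ** e t))" by simp
    moreover have "I \<sigma> 0 = integral {0..x} (\<lambda>t. exp (- \<i> * \<sigma> * of_real t) \<odot> (Q t ** e t)) + I \<sigma> x"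
      unfolding I_def by (rule integral_split_tail[OF has_integral_integrable[OF int] x]) (use \<sigma> in auto)
    ultimately show ?thesis by (simp add: algebra_simps)
  qed
  define C1 where "C1 = wave (-\<rho>) e 0 + I (-\<rho>) 0"
  define C2 where "C2 = wave \<rho> e 0 + I \<rho> 0"
  have eq: "exp (\<i> * \<rho> * of_real x) \<odot> (C2 - (2 * \<i> * \<rho>) \<odot> mat 1) = exp (- (\<i> * \<rho> * of_real x)) \<odot> C1"
    if x: "0 \<le> x" for x
  proof -
    have "((\<lambda>t. mat (sin (\<rho> * of_real (t - x)) / \<rho>) ** Q t ** e t) has_integral
        (e x - mat (exp (\<i> * \<rho> * of_real x)))) {x..}"
      using jost x by (simp add: jost_solution_def)
    moreover have "mat (sin (\<rho> * of_real (t - x)) / \<rho>) ** Q t ** e t =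
        (1 / (2 * \<i> * \<rho>)) \<odot> (exp (- (\<i> * \<rho> * of_real x)) \<odot> (exp (- \<i> * (-\<rho>) * of_real t) \<odot> (Q t ** e t)) -
          exp (\<i> * \<rho> * of_real x) \<odot> (exp (- \<i> * \<rho> * of_real t) \<odot> (Q t ** e t)))" for t
    proof -
      have 1: "exp (\<i> * (\<rho> * of_real (t - x))) = exp (- (\<i> * \<rho> * of_real x)) * exp (- \<i> * (-\<rho>) * of_real t)"
        unfolding exp_add[symmetric] by (simp add: algebra_simps)
      have 2: "exp (- (\<i> * (\<rho> * of_real (t - x)))) = exp (\<i> * \<rho> * of_real x) * exp (- \<i> * \<rho> * of_real t)"
        unfolding exp_add[symmetric] by (simp add: algebra_simps)
      have "sin (\<rho> * of_real (t - x)) / \<rho> = 1 / (2 * \<i> * \<rho>) *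
          (exp (- (\<i> * \<rho> * of_real x)) * exp (- \<i> * (-\<rho>) * of_real t) -
           exp (\<i> * \<rho> * of_real x) * exp (- \<i> * \<rho> * of_real t))"
        unfolding sin_exp_eq 1 2 by (simp only: divide_divide_eq_left times_divide_eq_left mult_1_left)
      then show ?thesis
        by (simp only: mat_mult_left cscale_mult_left cscale_cscale cs.diff_left[symmetric])
    qed
    ultimately have h1: "((\<lambda>t. (1 / (2 * \<i> * \<rho>)) \<odot> (exp (- (\<i> * \<rho> * of_real x)) \<odot> (exp (- \<i> * (-\<rho>) * of_real t) \<odot> (Q t ** e t)) -
          exp (\<i> * \<rho> * of_real x) \<odot> (exp (- \<i> * \<rho> * of_real t) \<odot> (Q t ** e t)))) has_integral
        (e x - mat (exp (\<i> * \<rho> * of_real x)))) {x..}" by simp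
    have lin: "((\<lambda>t. c \<odot> F t) has_integral c \<odot> J) {x..}" if "(F has_integral J) {x..}" for c and F :: "real \<Rightarrow> complex^'n^'n" and J
      using has_integral_linear[OF that cs.bounded_linear_right[of c]] by (simp add: o_def)
    have h2: "((\<lambda>t. (1 / (2 * \<i> * \<rho>)) \<odot> (exp (- (\<i> * \<rho> * of_real x)) \<odot> (exp (- \<i> * (-\<rho>) * of_real t) \<odot> (Q t ** e t)) -
          exp (\<i> * \<rho> * of_real x) \<odot> (exp (- \<i> * \<rho> * of_real t) \<odot> (Q t ** e t)))) has_integral
        (1 / (2 * \<i> * \<rho>)) \<odot> (exp (- (\<i> * \<rho> * of_real x)) \<odot> I (-\<rho>) x - exp (\<i> * \<rho> * of_real x) \<odot> I \<rho> x)) {x..}"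
      by (intro lin has_integral_diff int x) auto
    let ?E = "exp (\<i> * \<rho> * of_real x)" and ?E' = "exp (- (\<i> * \<rho> * of_real x))"
    have unscale: "a \<odot> X = Y" if "X = (1 / a) \<odot> Y" "a \<noteq> 0" for a and X Y :: "complex^'n^'n"
      using that by (simp add: cscale_cscale)
    have "(2 * \<i> * \<rho>) \<odot> (e x - mat ?E) = ?E' \<odot> I (-\<rho>) x - ?E \<odot> I \<rho> x"
      by (rule unscale[OF has_integral_unique[OF h1 h2]]) (use rho_nz in simp)
    then have h3: "(2 * \<i> * \<rho>) \<odot> e x - (2 * \<i> * \<rho>) \<odot> (?E \<odot> mat 1) = ?E' \<odot> I (-\<rho>) x - ?E \<odot> I \<rho> x"
      by (simp only: cs.diff_right mat_eq_cscale[of ?E])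
    have h4: "(2 * \<i> * \<rho>) \<odot> e x = ?E \<odot> C2 - ?E \<odot> I \<rho> x - (?E' \<odot> C1 - ?E' \<odot> I (-\<rho>) x)"
      using from_waves(1)[of \<rho> e x] wave_I[of \<rho> x] wave_I[of "-\<rho>" x] x by (simp add: C1_def C2_def cs.diff_right)
    have "?E \<odot> C2 - ?E' \<odot> C1 = (2 * \<i> * \<rho>) \<odot> (?E \<odot> mat 1)"
    proof -
      have *: "X - Y = Z" if "v - Z = p - q" "v = X - q - (Y - p)" for X Y Z v p q :: "complex^'n^'n"
        using that by (simp add: algebra_simps)
      show ?thesis by (rule *[OF h3 h4])
    qed
    then have "?E \<odot> C2 - (2 * \<i> * \<rho>) \<odot> (?E \<odot> mat 1) = ?E' \<odot> C1" by (simp add: algebra_simps)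
    then show ?thesis by (simp add: cs.diff_right cscale_cscale mult.commute)
  qed
  have C12: "C2 - (2 * \<i> * \<rho>) \<odot> mat 1 = C1" using eq[of 0] by simp
  have "C1 = 0"
  proof -
    \<comment> \<open>Then \<open>|\<rho>y| = 1\<close>, whereas the zeros \<open>k\<pi>\<close> of the sine have modulus \<open>0\<close> or at least \<open>\<pi>\<close>.\<close>
    define y where "y = 1 / cmod \<rho>"
    have y: "0 \<le> y" "cmod (\<rho> * of_real y) = 1" using rho_nz by (auto simp: y_def norm_mult norm_divide)
    have s: "sin (\<rho> * of_real y) \<noteq> 0"
    proof
      assume "sin (\<rho> * of_real y) = 0"
      then obtain k :: int where k: "\<rho> * of_real y = of_real (k * pi)" by (auto simp: sin_eq_0)
      then have k1: "\<bar>real_of_int k\<bar> * pi = 1" using y(2) by (simp add: norm_mult abs_mult flip: of_real_mult)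
      have "k \<noteq> 0" using k1 by auto
      then have "1 \<le> \<bar>real_of_int k\<bar>" by linarith
      then have "pi \<le> \<bar>real_of_int k\<bar> * pi" by simp
      then show False using k1 pi_gt3 by simp
    qed
    have "(exp (\<i> * \<rho> * of_real y) - exp (- (\<i> * \<rho> * of_real y))) \<odot> C1 = 0"
      using eq[OF y(1)] by (simp add: C12 cs.diff_left)
    moreover have "exp (\<i> * \<rho> * of_real y) - exp (- (\<i> * \<rho> * of_real y)) = 2 * \<i> * sin (\<rho> * of_real y)"
      by (simp add: sin_exp_eq mult.assoc field_simps)
    ultimately have "norm ((2 * \<i> * sin (\<rho> * of_real y)) \<odot> C1) = 0" by simp
    then show ?thesis using s by (simp add: norm_cscale norm_mult)
  qed
  with C12 have "C2 = (2 * \<i> * \<rho>) \<odot> mat 1" by simp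
  with wave_I[of \<rho> x] x have "I \<rho> x = (2 * \<i> * \<rho>) \<odot> mat 1 - wave \<rho> e x" by (simp add: C2_def)
  then show "((\<lambda>t. exp (- \<i> * \<rho> * of_real t) \<odot> (Q t ** e t)) has_integral (2 * \<i> * \<rho>) \<odot> mat 1 - wave \<rho> e x) {x..}"
    using int[of \<rho> x] x by simp
  from wave_I[of "-\<rho>" x] x \<open>C1 = 0\<close> have "I (-\<rho>) x = - wave (-\<rho>) e x" by (simp add: C1_def)
  then show "((\<lambda>t. exp (- \<i> * (-\<rho>) * of_real t) \<odot> (Q t ** e t)) has_integral - wave (-\<rho>) e x) {x..}"
    using int[of "-\<rho>" x] x by simp
qed

text \<open>
  The decay of \<open>e\<close> bounds the two integrands by constant multiples of \<open>|Q|\<close> and \<open>e\<^sup>-\<^sup>2\<^sup>I\<^sup>m\<^sup>\<rho>\<^sup>t |Q|\<close>.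
\<close>

lemma tail_wave_bounds:
  assumes x: "0 \<le> x" and B: "\<And>t. x \<le> t \<Longrightarrow> norm (e t) \<le> B * exp (- (Im \<rho> * t))" "0 \<le> B"
  shows "norm (wave \<rho> e x - (2 * \<i> * \<rho>) \<odot> mat 1) \<le> B * tail_mass x"
    and "norm (wave (-\<rho>) e x) \<le> B * exp (- (2 * Im \<rho> * x)) * tail_mass x"
proof -
  have "norm ((2 * \<i> * \<rho>) \<odot> mat 1 - wave \<rho> e x) \<le> B * integral {x..} (\<lambda>t. norm (Q t))"
  proof (rule integral_mult_bound[OF waves_at_infinity(1)[OF x] norm_Q_tail[OF x]])
    fix t assume t: "t \<in> {x..}"
    have "norm (exp (- \<i> * \<rho> * of_real t) \<odot> (Q t ** e t)) \<le> exp (Im \<rho> * t) * (norm (Q t) * norm (e t))"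
      by (simp add: norm_cscale norm_matrix_mult_le)
    also have "\<dots> \<le> exp (Im \<rho> * t) * (norm (Q t) * (B * exp (- (Im \<rho> * t))))"
      using t by (intro mult_left_mono B) auto
    also have "\<dots> = B * norm (Q t)" by (simp add: exp_minus)
    finally show "norm (exp (- \<i> * \<rho> * of_real t) \<odot> (Q t ** e t)) \<le> B * norm (Q t)" .
  qed
  then show "norm (wave \<rho> e x - (2 * \<i> * \<rho>) \<odot> mat 1) \<le> B * tail_mass x"
    by (simp add: tail_mass_def norm_minus_commute)
  have "norm (- wave (-\<rho>) e x) \<le> B * exp (- (2 * Im \<rho> * x)) * integral {x..} (\<lambda>t. norm (Q t))"
  proof (rule integral_mult_bound[OF waves_at_infinity(2)[OF x] norm_Q_tail[OF x]])
    fix t assume t: "t \<in> {x..}"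
    have "norm (exp (- \<i> * (-\<rho>) * of_real t) \<odot> (Q t ** e t)) \<le> exp (- (Im \<rho> * t)) * (norm (Q t) * norm (e t))"
      by (simp add: norm_cscale norm_matrix_mult_le)
    also have "\<dots> \<le> exp (- (Im \<rho> * t)) * (norm (Q t) * (B * exp (- (Im \<rho> * t))))"
      using t by (intro mult_left_mono B) auto
    also have "\<dots> = B * exp (- (2 * Im \<rho> * t)) * norm (Q t)" by (simp add: mult_exp_exp)
    also have "\<dots> \<le> B * exp (- (2 * Im \<rho> * x)) * norm (Q t)"
      using t Im_rho B(2) by (intro mult_right_mono mult_left_mono) (auto intro: mult_left_mono)
    finally show "norm (exp (- \<i> * (-\<rho>) * of_real t) \<odot> (Q t ** e t)) \<le> B * exp (- (2 * Im \<rho> * x)) * norm (Q t)" .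
  qed
  then show "norm (wave (-\<rho>) e x) \<le> B * exp (- (2 * Im \<rho> * x)) * tail_mass x"
    by (simp add: tail_mass_def)
qed

text \<open>
  The definition of the Jost solution bounds \<open>e\<^sup>-\<^sup>i\<^sup>\<rho>\<^sup>x e\<close> by a constant that may depend on \<open>\<rho>\<close>; the comparison of
  suprema replaces it by \<open>2 |I|\<close>.
\<close>

lemma e_bound:
  assumes x: "0 \<le> x" and small: "tail_mass x \<le> cmod \<rho> / 2" and t: "x \<le> t"
  shows "norm (e t) \<le> 2 * norm (mat 1 :: complex^'n^'n) * exp (- (Im \<rho> * t))"
proof -
  obtain C where C: "\<And>t. 0 \<le> t \<Longrightarrow> norm (e t) \<le> C * exp (- (Im \<rho> * t))" using e_bounded by blast
  show ?thesis
  proof (rule half_bound[of "{x..}" "\<lambda>t. exp (- (Im \<rho> * t))" e C])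
    show "norm (e s) \<le> C * exp (- (Im \<rho> * s))" if "s \<in> {x..}" for s using that x C by simp
    show "norm (e s) \<le> (norm (mat 1 :: complex^'n^'n) + B / 2) * exp (- (Im \<rho> * s))"
      if B: "0 \<le> B" and s: "s \<in> {x..}" and eB: "\<And>t. t \<in> {x..} \<Longrightarrow> norm (e t) \<le> B * exp (- (Im \<rho> * t))" for B s
    proof -
      have s0: "0 \<le> s" using x s by simp
      have eB': "norm (e t) \<le> B * exp (- (Im \<rho> * t))" if "s \<le> t" for t using eB that s by simp
      have q: "B * tail_mass s \<le> cmod \<rho> * (B / 2)"
        using mult_left_mono[OF order_trans[OF tail_mass_mono small] B, of s] x s by (simp add: algebra_simps)
      have 1: "norm (wave \<rho> e s) \<le> 2 * cmod \<rho> * norm (mat 1 :: complex^'n^'n) + cmod \<rho> * (B / 2)"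
        using tail_wave_bounds(1)[OF s0 eB' B] q norm_triangle_sub[of "wave \<rho> e s" "(2 * \<i> * \<rho>) \<odot> mat 1"]
        by (simp add: norm_cscale norm_mult)
      have 2: "norm (wave (-\<rho>) e s) \<le> exp (- (2 * Im \<rho> * s)) * (cmod \<rho> * (B / 2))"
        using tail_wave_bounds(2)[OF s0 eB' B] mult_left_mono[OF q, of "exp (- (2 * Im \<rho> * s))"]
        by (simp add: mult_ac)
      have "2 * cmod \<rho> * norm (e s) = norm ((2 * \<i> * \<rho>) \<odot> e s)" by (simp add: norm_cscale norm_mult)
      also have "\<dots> \<le> exp (- (Im \<rho> * s)) * norm (wave \<rho> e s) + exp (Im \<rho> * s) * norm (wave (-\<rho>) e s)"
        unfolding from_waves(1)[of \<rho> e s]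
        by (rule order_trans[OF norm_triangle_ineq4]) (simp add: norm_cscale)
      also have "\<dots> \<le> exp (- (Im \<rho> * s)) * (2 * cmod \<rho> * norm (mat 1 :: complex^'n^'n) + cmod \<rho> * (B / 2)) +
          exp (Im \<rho> * s) * (exp (- (2 * Im \<rho> * s)) * (cmod \<rho> * (B / 2)))"
        using 1 2 by (intro add_mono mult_left_mono) auto
      also have "exp (Im \<rho> * s) * (exp (- (2 * Im \<rho> * s)) * (cmod \<rho> * (B / 2))) = exp (- (Im \<rho> * s)) * (cmod \<rho> * (B / 2))"
        unfolding mult.assoc[symmetric] exp_add[symmetric] by simp
      finally have "cmod \<rho> * norm (e s) \<le> cmod \<rho> * ((norm (mat 1 :: complex^'n^'n) + B / 2) * exp (- (Im \<rho> * s)))"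
        by (simp add: algebra_simps)
      then show ?thesis using rho_nz by simp
    qed
  qed (use t in auto)
qed

lemma wave_bounds:
  assumes x: "0 \<le> x" and small: "tail_mass x \<le> cmod \<rho> / 2"
  shows "norm (wave \<rho> e x - (2 * \<i> * \<rho>) \<odot> mat 1) \<le> 2 * norm (mat 1 :: complex^'n^'n) * tail_mass x"
    and "norm (wave (-\<rho>) e x) \<le> 2 * norm (mat 1 :: complex^'n^'n) * exp (- (2 * Im \<rho> * x)) * tail_mass x"
  using tail_wave_bounds[OF x e_bound[OF x small]] by simp_all

end

subsection \<open>Analyticity in the spectral parameter\<close>

lemma wave_transpose:
  assumes "Y differentiable_on {0..}" "0 \<le> x"
  shows "wave \<rho> (\<lambda>t. transpose (Y t)) x = transpose (wave \<rho> Y x)"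
  by (simp add: wave_def dx_transpose[OF assms] transpose_cscale vec_eq_iff) (simp add: transpose_def)

lemma wronskian_waves:
  "(2 * \<i> * \<rho>) \<odot> (dx Z x ** Y x - Z x ** dx Y x) = wave (-\<rho>) Z x ** wave \<rho> Y x - wave \<rho> Z x ** wave (-\<rho>) Y x"
proof -
  have e: "exp (\<i> * \<rho> * of_real x) * exp (- (\<i> * \<rho> * of_real x)) = 1"
    "exp (- (\<i> * \<rho> * of_real x)) * exp (\<i> * \<rho> * of_real x) = 1"
    by (simp_all add: exp_minus)
  have w1: "wave (-\<rho>) Z x ** wave \<rho> Y x =
      (dx Z x - (\<i> * \<rho>) \<odot> Z x) ** (dx Y x + (\<i> * \<rho>) \<odot> Y x)"
    using e by (simp add: wave_def cscale_mult_left cscale_mult_right cscale_cscale cs.minus_left)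
  have w2: "wave \<rho> Z x ** wave (-\<rho>) Y x =
      (dx Z x + (\<i> * \<rho>) \<odot> Z x) ** (dx Y x - (\<i> * \<rho>) \<odot> Y x)"
    using e by (simp add: wave_def cscale_mult_left cscale_mult_right cscale_cscale cs.minus_left)
  show ?thesis unfolding w1 w2
    by (simp add: mat_normal vec_eq_iff algebra_simps)
qed

lemma continuous_on_matrix_entries:
  fixes F :: "'a::topological_space \<Rightarrow> complex^'n^'n"
  assumes "\<And>i j. continuous_on S (\<lambda>z. F z $ i $ j)"
  shows "continuous_on S F"
proof -
  have "continuous_on S (\<lambda>z. \<chi> i j. F z $ i $ j)"
    by (intro continuous_on_vec_lambda assms)
  then show ?thesis by (simp add: vec_lambda_eta)
qed

lemma (in potential) dual_ivp_exists:
  obtains Z where "sl_solution_dual Q \<nu> Z" "Z 0 = \<alpha>" "dx Z 0 = \<beta>"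
proof -
  interpret T: potential "\<lambda>t. transpose (Q t)" by (rule potential_transpose)
  obtain Y where Y: "sl_solution (\<lambda>t. transpose (Q t)) \<nu> Y" "Y 0 = transpose \<alpha>" "dx Y 0 = transpose \<beta>"
    using T.ivp_exists by metis
  define Z where "Z t = transpose (Y t)" for t
  have "dx Z 0 = \<beta>" unfolding Z_def using dx_transpose[of Y 0] Y by (simp add: sl_solution_def)
  moreover have "sl_solution_dual Q \<nu> Z"
    using Y(1) by (simp add: sl_solution_dual_iff_transpose Z_def)
  ultimately show thesis using that Y(2) by (simp add: Z_def)
qed

lemma (in potential) dual_transpose_properties:
  assumes Z: "sl_solution_dual Q \<nu> Z"
  shows "sl_solution (\<lambda>t. transpose (Q t)) \<nu> (\<lambda>t. transpose (Z t))"
    "0 \<le> x \<Longrightarrow> dx (\<lambda>t. transpose (Z t)) x = transpose (dx Z x)"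
    "0 \<le> x \<Longrightarrow> wave \<rho> (\<lambda>t. transpose (Z t)) x = transpose (wave \<rho> Z x)"
  using Z by (auto simp: sl_solution_dual_iff_transpose)
    (use Z in \<open>auto simp: sl_solution_dual_def intro: dx_transpose wave_transpose\<close>)

lemma (in potential) dual_ivp_entire:
  fixes Z :: "complex \<Rightarrow> real \<Rightarrow> complex^'n^'n"
  assumes Z: "\<And>\<mu>. sl_solution_dual Q \<mu> (Z \<mu>)" and Z0: "\<And>\<mu>. Z \<mu> 0 = \<alpha>" and Z1: "\<And>\<mu>. dx (Z \<mu>) 0 = \<beta>"
    and t: "0 \<le> t"
  shows "(\<lambda>\<mu>. Z \<mu> t $ i $ j) holomorphic_on UNIV" "(\<lambda>\<mu>. dx (Z \<mu>) t $ i $ j) holomorphic_on UNIV"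
proof -
  interpret T: potential "\<lambda>t. transpose (Q t)" by (rule potential_transpose)
  note * = T.ivp_entire[of "\<lambda>\<mu> t. transpose (Z \<mu> t)" "transpose \<alpha>" "transpose \<beta>" t j i]
  show "(\<lambda>\<mu>. Z \<mu> t $ i $ j) holomorphic_on UNIV"
    using *(1) dual_transpose_properties[OF Z] Z0 Z1 t by (simp add: transpose_def)
  show "(\<lambda>\<mu>. dx (Z \<mu>) t $ i $ j) holomorphic_on UNIV"
    using *(2) dual_transpose_properties[OF Z] Z0 Z1 t by (simp add: transpose_def)
qed

locale jost_family = potential Q for Q :: "real \<Rightarrow> complex^'n^'n" +
  fixes e :: "real \<Rightarrow> complex \<Rightarrow> complex^'n^'n"
  assumes jost: "\<And>\<rho>. \<rho> \<in> Omega \<Longrightarrow> jost_solution Q \<rho> (\<lambda>t. e t \<rho>)"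
begin

lemma jost_locale: "\<rho> \<in> Omega \<Longrightarrow> jost Q \<rho> (\<lambda>t. e t \<rho>)"
  by unfold_locales (simp_all add: jost)

text \<open>
  By the Wronskian identity with a solution \<open>Z\<close> of the dual equation, the data of the Jost solution
  at \<open>0\<close> are expressed by its plane-wave components at any \<open>N\<close>. Replacing the latter by their limits
  at infinity, that is, cutting \<open>Q\<close> off at \<open>N\<close>, leaves an entire function of \<open>\<rho>\<close>.
\<close>

lemma jost_data_uniform_limit:
  fixes R :: real
  assumes Z: "\<And>\<mu>. sl_solution_dual Q \<mu> (Z \<mu>)" and Z0: "\<And>\<mu>. Z \<mu> 0 = \<alpha>" and Z1: "\<And>\<mu>. dx (Z \<mu>) 0 = \<beta>"
    and \<delta>: "0 < \<delta>"
  defines "K \<equiv> {\<rho>. 0 \<le> Im \<rho> \<and> \<delta> \<le> cmod \<rho> \<and> cmod \<rho> \<le> R}"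
  shows "uniform_limit K (\<lambda>N \<rho>. wave (-\<rho>) (Z (\<rho>\<^sup>2)) (real N)) (\<lambda>\<rho>. \<beta> ** e 0 \<rho> - \<alpha> ** dx (\<lambda>t. e t \<rho>) 0) sequentially"
proof -
  interpret T: potential "\<lambda>t. transpose (Q t)" by (rule potential_transpose)
  let ?c = "norm (mat 1 :: complex^'n^'n)"
  let ?X = "\<lambda>\<rho>. \<beta> ** e 0 \<rho> - \<alpha> ** dx (\<lambda>t. e t \<rho>) 0"
  have Tmass: "T.mass a b = mass a b" for a b by (simp add: T.mass_def mass_def norm_transpose)
  \<comment> \<open>Beyond \<open>a\<close> the mass of \<open>Q\<close> is small against every \<open>|\<rho>| \<ge> \<delta>\<close>.\<close>
  obtain a :: nat where a: "tail_mass (real a) \<le> \<delta> / 2"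
  proof -
    have "\<forall>\<^sub>F k in sequentially. tail_mass (real k) < \<delta> / 2"
      by (rule order_tendstoD(2)[OF tail_mass_tendsto_0]) (use \<delta> in simp)
    then show thesis using that by (meson eventually_sequentially less_imp_le order_refl)
  qed
  have KO: "\<rho> \<in> Omega" if "\<rho> \<in> K" for \<rho> using that \<delta> by (auto simp: K_def Omega_def)
  have compact: "compact K"
  proof -
    have "K = {\<rho>. 0 \<le> Im \<rho>} \<inter> {\<rho>. \<delta> \<le> cmod \<rho>} \<inter> cball 0 R" by (auto simp: K_def)
    moreover have "closed ({\<rho>. 0 \<le> Im \<rho>} \<inter> {\<rho>. \<delta> \<le> cmod \<rho>})"
      by (intro closed_Int closed_Collect_le continuous_intros)
    ultimately show ?thesis by (simp add: closed_Int_compact)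
  qed
  have cont: "continuous_on K (\<lambda>\<rho>. Z (\<rho>\<^sup>2) (real a))" "continuous_on K (\<lambda>\<rho>. dx (Z (\<rho>\<^sup>2)) (real a))"
    by (rule continuous_on_matrix_entries,
        rule continuous_on_compose2[OF holomorphic_on_imp_continuous_on[OF dual_ivp_entire(1)[OF Z Z0 Z1]]],
        auto intro!: continuous_intros,
        rule continuous_on_matrix_entries,
        rule continuous_on_compose2[OF holomorphic_on_imp_continuous_on[OF dual_ivp_entire(2)[OF Z Z0 Z1]]],
        auto intro!: continuous_intros)
  obtain M0 where M0: "0 \<le> M0"
    "\<And>\<rho>. \<rho> \<in> K \<Longrightarrow> norm (dx (Z (\<rho>\<^sup>2)) a + (\<i> * \<rho>) \<odot> Z (\<rho>\<^sup>2) a) \<le> M0"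
    "\<And>\<rho>. \<rho> \<in> K \<Longrightarrow> norm (dx (Z (\<rho>\<^sup>2)) a - (\<i> * \<rho>) \<odot> Z (\<rho>\<^sup>2) a) \<le> M0"
  proof -
    let ?f = "\<lambda>\<rho>. norm (dx (Z (\<rho>\<^sup>2)) a + (\<i> * \<rho>) \<odot> Z (\<rho>\<^sup>2) a) + norm (dx (Z (\<rho>\<^sup>2)) a - (\<i> * \<rho>) \<odot> Z (\<rho>\<^sup>2) a)"
    have "continuous_on K ?f" by (intro continuous_intros cs.continuous_on cont)
    then have "bounded (?f ` K)" using compact compact_continuous_image compact_imp_bounded by blast
    then obtain M where "\<forall>y\<in>?f ` K. norm y \<le> M" unfolding bounded_iff by blast
    then have M: "?f \<rho> \<le> M" if "\<rho> \<in> K" for \<rho> using that by fastforce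
    show thesis
    proof (rule that[of "max 0 M"])
      show "norm (dx (Z (\<rho>\<^sup>2)) a + (\<i> * \<rho>) \<odot> Z (\<rho>\<^sup>2) a) \<le> max 0 M" if "\<rho> \<in> K" for \<rho>
        using M[OF that] norm_ge_zero[of "dx (Z (\<rho>\<^sup>2)) a - (\<i> * \<rho>) \<odot> Z (\<rho>\<^sup>2) a"] by linarith
      show "norm (dx (Z (\<rho>\<^sup>2)) a - (\<i> * \<rho>) \<odot> Z (\<rho>\<^sup>2) a) \<le> max 0 M" if "\<rho> \<in> K" for \<rho>
        using M[OF that] norm_ge_zero[of "dx (Z (\<rho>\<^sup>2)) a + (\<i> * \<rho>) \<odot> Z (\<rho>\<^sup>2) a"] by linarith
    qed simp
  qed
  define B where "B = 2 * (M0 / \<delta>)"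
  have B: "0 \<le> B" using M0(1) \<delta> by (simp add: B_def)
  define M1 where "M1 = M0 + B * tail_mass 0"
  have M1: "0 \<le> M1" using M0(1) B tail_mass_nonneg[of 0] by (simp add: M1_def)
  have bound: "norm (?X \<rho> - wave (-\<rho>) (Z (\<rho>\<^sup>2)) (real N)) \<le> 2 * M1 * ?c * tail_mass (real N) / \<delta>"
    if \<rho>: "\<rho> \<in> K" and N: "a \<le> N" for \<rho> N
  proof -
    interpret jost Q \<rho> "\<lambda>t. e t \<rho>" by (rule jost_locale[OF KO[OF \<rho>]])
    let ?Z = "Z (\<rho>\<^sup>2)" and ?e = "\<lambda>t. e t \<rho>" and ?n = "real N"
    define Zt where "Zt t = transpose (?Z t)" for t
    note Zt = dual_transpose_properties[OF Z[of "\<rho>\<^sup>2"], folded Zt_def[abs_def]]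
    have \<rho>\<delta>: "\<delta> \<le> cmod \<rho>" and \<tau>: "0 \<le> Im \<rho>" using \<rho> by (auto simp: K_def)
    have an: "0 \<le> real a" "real a \<le> ?n" using N by auto
    have "M0 \<le> cmod \<rho> * (M0 / \<delta> * exp (Im \<rho> * real a))"
    proof -
      have "\<delta> * (M0 / \<delta> * 1) \<le> cmod \<rho> * (M0 / \<delta> * exp (Im \<rho> * real a))"
        using \<rho>\<delta> \<tau> \<delta> M0(1) by (intro mult_mono mult_nonneg_nonneg) auto
      then show ?thesis using \<delta> by simp
    qed
    note init = order_trans[OF M0(2)[OF \<rho>] this] order_trans[OF M0(3)[OF \<rho>] this]
    have tr: "dx Zt a + (\<i> * \<rho>) \<odot> Zt a = transpose (dx ?Z a + (\<i> * \<rho>) \<odot> ?Z a)"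
      "dx Zt a - (\<i> * \<rho>) \<odot> Zt a = transpose (dx ?Z a - (\<i> * \<rho>) \<odot> ?Z a)"
      using Zt(2)[of "real a"] by (simp_all add: vec_eq_iff transpose_def Zt_def[abs_def])
    have Zb: "norm (Zt t) \<le> B * exp (Im \<rho> * t)" if "t \<in> {real a..?n}" for t
      unfolding B_def
    proof (rule T.solution_growth[OF Zt(1) an(1) \<tau> rho_nz _ _ _ that])
      show "T.mass (real a) ?n \<le> cmod \<rho> / 2"
        unfolding Tmass using mass_le_tail[OF an(1) order_refl, of ?n] a \<rho>\<delta> by simp
    qed (use init in \<open>simp_all only: tr norm_transpose\<close>)
    have m: "T.mass (real a) ?n \<le> tail_mass 0" unfolding Tmass by (rule mass_le_tail) auto
    have Zt': "sl_solution (\<lambda>t. transpose (Q t)) ((-\<rho>)\<^sup>2) Zt" using Zt(1) by simp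
    have 1: "norm (wave (-\<rho>) ?Z ?n) \<le> M1"
    proof -
      have "norm (wave (-\<rho>) Zt ?n - wave (-\<rho>) Zt a) \<le> B * tail_mass 0"
        using T.wave_diff_bound[OF Zt' an _ Zb B] mult_left_mono[OF m B] by simp
      moreover have "norm (wave (-\<rho>) Zt a) = exp (- (Im \<rho> * a)) * norm (dx ?Z a - (\<i> * \<rho>) \<odot> ?Z a)"
        using Zt(3)[of "real a" "-\<rho>"] by (simp add: norm_transpose) (simp add: wave_def norm_cscale cs.minus_left)
      moreover have "exp (- (Im \<rho> * a)) * norm (dx ?Z a - (\<i> * \<rho>) \<odot> ?Z a) \<le> 1 * M0"
        using \<tau> M0(3)[OF \<rho>] by (intro mult_mono) auto
      ultimately have "norm (wave (-\<rho>) Zt ?n) \<le> M1"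
        using norm_triangle_sub[of "wave (-\<rho>) Zt ?n" "wave (-\<rho>) Zt a"] by (simp add: M1_def)
      then show ?thesis using Zt(3)[of ?n "-\<rho>"] by (simp add: norm_transpose)
    qed
    have 2: "norm (wave \<rho> ?Z ?n) \<le> M1 * exp (2 * Im \<rho> * ?n)"
    proof -
      have "norm (wave \<rho> Zt ?n - wave \<rho> Zt a) \<le> exp (2 * Im \<rho> * ?n) * B * T.mass a ?n"
        using T.wave_diff_bound[OF Zt(1) an _ Zb B] \<tau> by simp
      also have "\<dots> \<le> exp (2 * Im \<rho> * ?n) * B * tail_mass 0" using m B by (intro mult_left_mono) auto
      finally have x: "norm (wave \<rho> Zt ?n - wave \<rho> Zt a) \<le> exp (2 * Im \<rho> * ?n) * B * tail_mass 0" .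
      have "norm (wave \<rho> Zt a) = exp (Im \<rho> * a) * norm (dx ?Z a + (\<i> * \<rho>) \<odot> ?Z a)"
        using Zt(3)[of "real a" "\<rho>"] by (simp add: norm_transpose) (simp add: wave_def norm_cscale)
      also have "\<dots> \<le> exp (2 * Im \<rho> * ?n) * M0"
      proof (intro mult_mono)
        have "Im \<rho> * a \<le> Im \<rho> * (2 * ?n)" using an \<tau> by (intro mult_left_mono) auto
        then show "exp (Im \<rho> * a) \<le> exp (2 * Im \<rho> * ?n)" by simp
      qed (use M0(2)[OF \<rho>] in auto)
      finally have "norm (wave \<rho> Zt ?n) \<le> M1 * exp (2 * Im \<rho> * ?n)"
        using x norm_triangle_sub[of "wave \<rho> Zt ?n" "wave \<rho> Zt a"] by (simp add: M1_def algebra_simps)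
      then show ?thesis using Zt(3)[of ?n \<rho>] by (simp add: norm_transpose)
    qed
    have q: "tail_mass ?n \<le> cmod \<rho> / 2" using tail_mass_mono[OF an] a \<rho>\<delta> by simp
    note w = wave_bounds[OF _ q]
    have "dx ?Z ?n ** ?e ?n - ?Z ?n ** dx ?e ?n = ?X \<rho>"
    proof -
      have "((\<lambda>t. 0) has_integral (dx ?Z ?n ** ?e ?n - ?Z ?n ** dx ?e ?n) - (dx ?Z 0 ** ?e 0 - ?Z 0 ** dx ?e 0)) {0..?n}"
        using wronskian[OF Z[of "\<rho>\<^sup>2"] e_solution, of ?n] by simp
      from has_integral_unique[OF this has_integral_0] show ?thesis by (simp add: Z0 Z1)
    qed
    then have "(2 * \<i> * \<rho>) \<odot> ?X \<rho> = wave (-\<rho>) ?Z ?n ** wave \<rho> ?e ?n - wave \<rho> ?Z ?n ** wave (-\<rho>) ?e ?n"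
      using wronskian_waves[of \<rho> ?Z ?n ?e] by simp
    moreover have "(2 * \<i> * \<rho>) \<odot> wave (-\<rho>) ?Z ?n = wave (-\<rho>) ?Z ?n ** ((2 * \<i> * \<rho>) \<odot> mat 1)"
      by (simp add: cscale_mult_right)
    ultimately have "(2 * \<i> * \<rho>) \<odot> (?X \<rho> - wave (-\<rho>) ?Z ?n) =
        wave (-\<rho>) ?Z ?n ** (wave \<rho> ?e ?n - (2 * \<i> * \<rho>) \<odot> mat 1) - wave \<rho> ?Z ?n ** wave (-\<rho>) ?e ?n"
      by (simp add: cs.diff_right mm.diff_right)
    note scaled = this
    have "2 * cmod \<rho> * norm (?X \<rho> - wave (-\<rho>) ?Z ?n) = norm ((2 * \<i> * \<rho>) \<odot> (?X \<rho> - wave (-\<rho>) ?Z ?n))"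
      by (simp add: norm_cscale norm_mult)
    also have "\<dots> \<le> M1 * (2 * ?c * tail_mass ?n) + (M1 * exp (2 * Im \<rho> * ?n)) * (2 * ?c * exp (- (2 * Im \<rho> * ?n)) * tail_mass ?n)"
      unfolding scaled
      by (rule order_trans[OF norm_triangle_ineq4], intro add_mono order_trans[OF norm_matrix_mult_le] mult_mono 1 2 w)
        (use M1 in auto)
    also have "\<dots> = 4 * M1 * ?c * tail_mass ?n" by (simp add: exp_minus)
    finally have le: "cmod \<rho> * norm (?X \<rho> - wave (-\<rho>) ?Z ?n) \<le> 2 * M1 * ?c * tail_mass ?n" by simp
    have "\<delta> * norm (?X \<rho> - wave (-\<rho>) ?Z ?n) \<le> cmod \<rho> * norm (?X \<rho> - wave (-\<rho>) ?Z ?n)"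
      using \<rho>\<delta> by (intro mult_right_mono) auto
    with le show ?thesis using \<delta> by (simp add: field_simps)
  qed
  have lim: "(\<lambda>N. 2 * M1 * ?c * tail_mass (real N) / \<delta>) \<longlonglongrightarrow> 0"
    using tendsto_mult_left[OF tail_mass_tendsto_0, of "2 * M1 * ?c / \<delta>"] by (simp add: field_simps)
  show ?thesis
  proof (rule uniform_limitI)
    fix \<epsilon> :: real assume "0 < \<epsilon>"
    then have "\<forall>\<^sub>F N in sequentially. 2 * M1 * ?c * tail_mass (real N) / \<delta> < \<epsilon>"
      by (rule order_tendstoD(2)[OF lim])
    with eventually_ge_at_top[of a]
    show "\<forall>\<^sub>F N in sequentially. \<forall>\<rho>\<in>K. dist (wave (-\<rho>) (Z (\<rho>\<^sup>2)) (real N)) (?X \<rho>) < \<epsilon>"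
    proof eventually_elim
      case (elim N)
      show ?case
      proof
        fix \<rho> assume "\<rho> \<in> K"
        from bound[OF this elim(1)] elim(2) show "dist (wave (-\<rho>) (Z (\<rho>\<^sup>2)) (real N)) (?X \<rho>) < \<epsilon>"
          by (simp add: dist_norm norm_minus_commute)
      qed
    qed
  qed
qed

text \<open>
  Every point of \<open>Omega\<close> is interior, relative to \<open>Omega\<close>, to some half-annulus on which the entire
  approximations converge uniformly.
\<close>

lemma jost_data_analytic:
  fixes \<alpha> \<beta> :: "complex^'n^'n"
  shows
  "continuous_on Omega (\<lambda>\<rho>. (\<beta> ** e 0 \<rho> - \<alpha> ** dx (\<lambda>t. e t \<rho>) 0) $ i $ j)" (is "continuous_on _ ?X")
  "(\<lambda>\<rho>. (\<beta> ** e 0 \<rho> - \<alpha> ** dx (\<lambda>t. e t \<rho>) 0) $ i $ j) holomorphic_on {\<rho>. 0 < Im \<rho>}"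
proof -
  have "\<exists>Z. sl_solution_dual Q \<mu> Z \<and> Z 0 = \<alpha> \<and> dx Z 0 = \<beta>" for \<mu> using dual_ivp_exists by metis
  then obtain Z where Z: "\<And>\<mu>. sl_solution_dual Q \<mu> (Z \<mu>)" and Z0: "\<And>\<mu>. Z \<mu> 0 = \<alpha>" and Z1: "\<And>\<mu>. dx (Z \<mu>) 0 = \<beta>"
    by metis
  let ?f = "\<lambda>N \<rho>. wave (-\<rho>) (Z (\<rho>\<^sup>2)) (real N) $ i $ j"
  let ?K = "\<lambda>\<delta> R. {\<rho>. 0 \<le> Im \<rho> \<and> \<delta> \<le> cmod \<rho> \<and> cmod \<rho> \<le> R}"
  have lim: "uniform_limit (?K \<delta> R) ?f ?X sequentially" if "0 < \<delta>" for \<delta> R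
    by (rule bounded_linear.uniform_limit[OF bounded_linear_entry jost_data_uniform_limit[OF Z Z0 Z1 that]])
  have hol: "?f N holomorphic_on S" for N S
  proof -
    have sq: "(\<lambda>\<rho>. g (\<rho>\<^sup>2)) holomorphic_on S" if "g holomorphic_on UNIV" for g :: "complex \<Rightarrow> complex"
    proof -
      have "(g \<circ> (\<lambda>\<rho>. \<rho>\<^sup>2)) holomorphic_on S"
        by (rule holomorphic_on_compose[OF _ holomorphic_on_subset[OF that]]) (auto intro!: holomorphic_intros)
      then show ?thesis by (simp add: o_def)
    qed
    show ?thesis unfolding wave_def cscale_nth vector_add_component
      by (intro holomorphic_intros sq dual_ivp_entire[OF Z Z0 Z1]) auto
  qed
  have contK: "continuous_on (?K \<delta> R) ?X" if "0 < \<delta>" for \<delta> R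
    by (rule uniform_limit_theorem[OF always_eventually lim[OF that]])
      (auto intro: holomorphic_on_imp_continuous_on hol)
  show "continuous_on Omega ?X"
    unfolding continuous_on_eq_continuous_within
  proof
    fix \<rho> assume \<rho>: "\<rho> \<in> Omega"
    then have nz: "0 < cmod \<rho>" and im: "0 \<le> Im \<rho>" by (auto simp: Omega_def)
    let ?L = "?K (cmod \<rho> / 2) (2 * cmod \<rho>)"
    have "continuous (at \<rho> within ?L) ?X"
      using contK[of "cmod \<rho> / 2" "2 * cmod \<rho>"] nz im by (auto simp: continuous_on_eq_continuous_within)
    moreover have "at \<rho> within ?L = at \<rho> within Omega"
    proof (rule at_within_nhd[of \<rho> "{z. cmod \<rho> / 2 < cmod z} \<inter> {z. cmod z < 2 * cmod \<rho>}"])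
      show "open ({z. cmod \<rho> / 2 < cmod z} \<inter> {z. cmod z < 2 * cmod \<rho>})"
        by (intro open_Int open_Collect_less continuous_intros)
    qed (use nz im in \<open>auto simp: Omega_def\<close>)
    ultimately show "continuous (at \<rho> within Omega) ?X" by (simp add: continuous_within)
  qed
  show "?X holomorphic_on {\<rho>. 0 < Im \<rho>}"
  proof (rule holomorphic_uniform_sequence[where f = ?f])
    show "open {\<rho>. 0 < Im \<rho>}" by (rule open_halfspace_Im_gt)
    show "\<exists>d>0. cball \<rho> d \<subseteq> {\<rho>. 0 < Im \<rho>} \<and> uniform_limit (cball \<rho> d) ?f ?X sequentially"
      if "\<rho> \<in> {\<rho>. 0 < Im \<rho>}" for \<rho>
    proof (intro exI conjI)
      let ?d = "Im \<rho> / 2"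
      show d: "0 < ?d" using that by simp
      have sub: "?d \<le> Im z \<and> cmod z \<le> cmod \<rho> + ?d" if "z \<in> cball \<rho> ?d" for z
      proof
        have "cmod (\<rho> - z) \<le> ?d" using that by (simp add: dist_norm)
        with abs_Im_le_cmod[of "\<rho> - z"] have "\<bar>Im \<rho> - Im z\<bar> \<le> ?d" by simp
        then show "?d \<le> Im z" by linarith
        show "cmod z \<le> cmod \<rho> + ?d" using that norm_triangle_sub[of z \<rho>]
          by (simp add: dist_norm norm_minus_commute)
      qed
      then show "cball \<rho> ?d \<subseteq> {\<rho>. 0 < Im \<rho>}" using d by fastforce
      have "cball \<rho> ?d \<subseteq> ?K ?d (cmod \<rho> + ?d)"
      proof
        fix z assume z: "z \<in> cball \<rho> ?d"
        have "?d \<le> cmod z" using sub[OF z] abs_Im_le_cmod[of z] by linarith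
        then show "z \<in> ?K ?d (cmod \<rho> + ?d)" using sub[OF z] d by simp
      qed
      then show "uniform_limit (cball \<rho> ?d) ?f ?X sequentially"
        by (rule uniform_limit_on_subset[OF lim[OF d]])
    qed
  qed (rule hol)
qed

lemma jost_initial_analytic:
  "continuous_on Omega (\<lambda>\<rho>. e 0 \<rho> $ i $ j)" "(\<lambda>\<rho>. e 0 \<rho> $ i $ j) holomorphic_on {\<rho>. 0 < Im \<rho>}"
  "continuous_on Omega (\<lambda>\<rho>. dx (\<lambda>t. e t \<rho>) 0 $ i $ j)" "(\<lambda>\<rho>. dx (\<lambda>t. e t \<rho>) 0 $ i $ j) holomorphic_on {\<rho>. 0 < Im \<rho>}"
  using jost_data_analytic[of "mat 1" 0 i j] jost_data_analytic[of 0 "- mat 1" i j]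
  by (simp_all add: mm.zero_left mm.minus_left)

end

lemmas [simp] = cs.zero_right mm.zero_left mm.zero_right

section \<open>Growth orders in the closed upper half-plane\<close>

definition uhp :: "complex filter" where
  "uhp = inf at_infinity (principal {\<rho>. 0 \<le> Im \<rho>})"

lemma eventually_uhp: "eventually P uhp \<longleftrightarrow> (\<exists>R. \<forall>\<rho>. 0 \<le> Im \<rho> \<longrightarrow> R \<le> cmod \<rho> \<longrightarrow> P \<rho>)"
  unfolding uhp_def eventually_inf_principal eventually_at_infinity by blast

lemma eventually_uhp_ge: "eventually (\<lambda>\<rho>. 0 \<le> Im \<rho> \<and> R \<le> cmod \<rho>) uhp"
  unfolding eventually_uhp by blast

definition grows :: "int \<Rightarrow> (complex \<Rightarrow> 'a::real_normed_vector) \<Rightarrow> bool" where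
  "grows k f \<longleftrightarrow> (\<exists>C. eventually (\<lambda>\<rho>. norm (f \<rho>) \<le> C * cmod \<rho> powi k) uhp)"

lemma growsI: "eventually (\<lambda>\<rho>. norm (f \<rho>) \<le> C * cmod \<rho> powi k) uhp \<Longrightarrow> grows k f"
  unfolding grows_def by blast

lemma growsE:
  assumes "grows k f"
  obtains C where "0 \<le> C" "eventually (\<lambda>\<rho>. norm (f \<rho>) \<le> C * cmod \<rho> powi k) uhp"
proof -
  obtain C where C: "eventually (\<lambda>\<rho>. norm (f \<rho>) \<le> C * cmod \<rho> powi k) uhp"
    using assms grows_def by blast
  have "eventually (\<lambda>\<rho>. norm (f \<rho>) \<le> max 0 C * cmod \<rho> powi k) uhp"
    using C
  proof eventually_elim
    case (elim \<rho>)
    have "C * cmod \<rho> powi k \<le> max 0 C * cmod \<rho> powi k" by (intro mult_right_mono) auto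
    then show ?case using elim by linarith
  qed
  then show thesis using that[of "max 0 C"] by simp
qed

lemma grows_const: "grows 0 (\<lambda>\<rho>. c)"
  by (rule growsI[of _ "norm c"]) simp

lemma grows_bounded: "eventually (\<lambda>\<rho>. norm (f \<rho>) \<le> C) uhp \<Longrightarrow> grows 0 f"
  by (rule growsI[of _ C]) simp

lemma grows_dominated:
  assumes "grows k g" "eventually (\<lambda>\<rho>. norm (f \<rho>) \<le> norm (g \<rho>)) uhp"
  shows "grows k f"
proof -
  obtain C where "eventually (\<lambda>\<rho>. norm (g \<rho>) \<le> C * cmod \<rho> powi k) uhp" using growsE[OF assms(1)] by blast
  with assms(2) have "eventually (\<lambda>\<rho>. norm (f \<rho>) \<le> C * cmod \<rho> powi k) uhp"
    by eventually_elim linarith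
  then show ?thesis by (rule growsI)
qed

lemma grows_cong:
  assumes "grows k g" "eventually (\<lambda>\<rho>. f \<rho> = g \<rho>) uhp"
  shows "grows k f"
  by (rule grows_dominated[OF assms(1) eventually_mono[OF assms(2)]]) simp

lemma grows_add:
  assumes "grows k f" "grows k g"
  shows "grows k (\<lambda>\<rho>. f \<rho> + g \<rho>)"
proof -
  obtain C where C: "eventually (\<lambda>\<rho>. norm (f \<rho>) \<le> C * cmod \<rho> powi k) uhp" using growsE[OF assms(1)] by blast
  obtain D where D: "eventually (\<lambda>\<rho>. norm (g \<rho>) \<le> D * cmod \<rho> powi k) uhp" using growsE[OF assms(2)] by blast
  have "eventually (\<lambda>\<rho>. norm (f \<rho> + g \<rho>) \<le> (C + D) * cmod \<rho> powi k) uhp"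
    using C D
  proof eventually_elim
    case (elim \<rho>)
    then show ?case using norm_triangle_ineq[of "f \<rho>" "g \<rho>"] by (simp add: distrib_right)
  qed
  then show ?thesis by (rule growsI)
qed

lemma grows_minus: "grows k f \<Longrightarrow> grows k (\<lambda>\<rho>. - f \<rho>)"
  unfolding grows_def by simp

lemma grows_diff: "grows k f \<Longrightarrow> grows k g \<Longrightarrow> grows k (\<lambda>\<rho>. f \<rho> - g \<rho>)"
  using grows_add[OF _ grows_minus, of k f g] by simp

lemma grows_mono:
  assumes "grows k f" "k \<le> l"
  shows "grows l f"
proof -
  obtain C where C: "0 \<le> C" "eventually (\<lambda>\<rho>. norm (f \<rho>) \<le> C * cmod \<rho> powi k) uhp" using growsE[OF assms(1)] by blast
  have "eventually (\<lambda>\<rho>. norm (f \<rho>) \<le> C * cmod \<rho> powi l) uhp"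
    using C(2) eventually_uhp_ge[of 1]
  proof eventually_elim
    case (elim \<rho>)
    have "C * cmod \<rho> powi k \<le> C * cmod \<rho> powi l"
      using elim assms(2) C(1) by (intro mult_left_mono power_int_increasing) auto
    then show ?case using elim by linarith
  qed
  then show ?thesis by (rule growsI)
qed

lemma grows_product:
  assumes B: "\<And>x y. norm (B x y) \<le> norm x * norm y" and "grows k f" "grows l g"
  shows "grows (k + l) (\<lambda>\<rho>. B (f \<rho>) (g \<rho>))"
proof -
  obtain C where C: "0 \<le> C" "eventually (\<lambda>\<rho>. norm (f \<rho>) \<le> C * cmod \<rho> powi k) uhp" using growsE[OF assms(2)] by blast
  obtain D where D: "0 \<le> D" "eventually (\<lambda>\<rho>. norm (g \<rho>) \<le> D * cmod \<rho> powi l) uhp" using growsE[OF assms(3)] by blast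
  have "eventually (\<lambda>\<rho>. norm (B (f \<rho>) (g \<rho>)) \<le> (C * D) * cmod \<rho> powi (k + l)) uhp"
    using C(2) D(2) eventually_uhp_ge[of 1]
  proof eventually_elim
    case (elim \<rho>)
    then have "\<rho> \<noteq> 0" by auto
    have "norm (B (f \<rho>) (g \<rho>)) \<le> (C * cmod \<rho> powi k) * (D * cmod \<rho> powi l)"
      using elim C(1) by (intro order_trans[OF B] mult_mono) auto
    also have "\<dots> = (C * D) * cmod \<rho> powi (k + l)" using \<open>\<rho> \<noteq> 0\<close> by (simp add: power_int_add)
    finally show ?case .
  qed
  then show ?thesis by (rule growsI)
qed

lemma grows_mm:
  "grows k f \<Longrightarrow> grows l g \<Longrightarrow> grows (k + l) (\<lambda>\<rho>. f \<rho> ** (g \<rho> :: complex^'n^'n))" for f :: "complex \<Rightarrow> complex^'n^'n"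
  by (rule grows_product) (rule norm_matrix_mult_le)

lemma grows_cs:
  "grows k f \<Longrightarrow> grows l g \<Longrightarrow> grows (k + l) (\<lambda>\<rho>. f \<rho> \<odot> (g \<rho> :: complex^'n^'n))"
  by (rule grows_product) (simp add: norm_cscale)

lemma grows_times:
  "grows k f \<Longrightarrow> grows l g \<Longrightarrow> grows (k + l) (\<lambda>\<rho>. f \<rho> * (g \<rho> :: complex))"
  by (rule grows_product) (simp add: norm_mult)

lemma grows_rho: "grows 1 (\<lambda>\<rho>. \<rho>)"
  by (rule growsI[of _ 1]) simp

lemma grows_inverse: "grows (-1) (\<lambda>\<rho>. 1 / \<rho>)"
  by (rule growsI[of _ 1]) (simp add: norm_inverse divide_inverse)

lemma grows_irho: "grows (-1) (\<lambda>\<rho>. 1 / (\<i> * \<rho>))"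
  by (rule growsI[of _ 1]) (simp add: norm_divide norm_mult norm_inverse divide_inverse)

lemma grows_transpose: "grows k (\<lambda>\<rho>. transpose (f \<rho> :: complex^'n^'n)) \<longleftrightarrow> grows k f"
  by (simp add: grows_def norm_transpose)

lemma grows_exp2: "0 \<le> a \<Longrightarrow> grows 0 (\<lambda>\<rho>. exp (2 * (\<i> * \<rho> * of_real a)))"
  by (rule grows_bounded[of _ 1], rule eventually_mono[OF eventually_uhp_ge[of 0]]) simp

lemma eventually_potential_small: "eventually (\<lambda>\<rho>. \<rho> \<in> Omega \<and> m \<le> cmod \<rho> / 2 \<and> 1 \<le> cmod \<rho>) uhp"
  by (rule eventually_mono[OF eventually_uhp_ge[of "max 1 (2 * m)"]]) (auto simp: Omega_def)

section \<open>Asymptotics of the regular solution\<close>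

text \<open>The scaling that turns the initial values \<open>A\<close>, \<open>A\<^sup>\<bottom> + h\<close> into ones of equal order.\<close>

definition scl :: "complex^'n^'n \<Rightarrow> complex \<Rightarrow> complex^'n^'n" where
  "scl A \<rho> = A + \<rho> \<odot> perp A"

locale regular = potential Q for Q :: "real \<Rightarrow> complex^'n^'n" +
  fixes A h :: "complex^'n^'n" and \<phi> :: "real \<Rightarrow> complex \<Rightarrow> complex^'n^'n"
  assumes AA: "A ** A = A" and hA: "h ** A = h"
    and reg: "\<And>\<mu>. regular_solution Q A h \<mu> (\<lambda>t. \<phi> t \<mu>)"
begin

definition \<phi>N :: "complex \<Rightarrow> real \<Rightarrow> complex^'n^'n" where
  "\<phi>N \<rho> t = \<phi> t (\<rho>\<^sup>2) ** scl A \<rho>"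

lemma \<phi>N_solution: "sl_solution Q (\<rho>\<^sup>2) (\<phi>N \<rho>)"
  unfolding \<phi>N_def[abs_def] using reg by (intro sl_solution_mult_right) (simp add: regular_solution_def)

lemma dx_\<phi>N: "0 \<le> t \<Longrightarrow> dx (\<phi>N \<rho>) t = dx (\<lambda>t. \<phi> t (\<rho>\<^sup>2)) t ** scl A \<rho>"
  unfolding \<phi>N_def[abs_def] using reg
  by (intro sl_solution_mult_right(2)[where Q = Q and \<nu> = "\<rho>\<^sup>2"]) (simp_all add: regular_solution_def)

lemma \<phi>N_0: "\<phi>N \<rho> 0 = A" "dx (\<phi>N \<rho>) 0 = \<rho> \<odot> perp A + h"
proof -
  have "\<phi> 0 (\<rho>\<^sup>2) = A" "dx (\<lambda>t. \<phi> t (\<rho>\<^sup>2)) 0 = perp A + h"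
    using reg by (auto simp: regular_solution_def)
  then show "\<phi>N \<rho> 0 = A" "dx (\<phi>N \<rho>) 0 = \<rho> \<odot> perp A + h"
    by (simp_all add: \<phi>N_def dx_\<phi>N scl_def mat_normal AA hA)
qed

text \<open>
  The components at \<open>x\<close> differ by \<open>O(1)\<close> from their explicit values at \<open>0\<close>. The exponential factors compensate the
  growth \<open>e\<^sup>I\<^sup>m\<^sup>\<rho>\<^sup>x\<close> of the solution.
\<close>

lemma scaled_asymptotics:
  assumes x: "0 \<le> x"
  shows "grows 0 (\<lambda>\<rho>. wave (-\<rho>) (\<phi>N \<rho>) x - (\<rho> \<odot> perp A - (\<i> * \<rho>) \<odot> A))" (is ?W)
    and "grows 0 (\<lambda>\<rho>. exp (2 * (\<i> * \<rho> * of_real x)) \<odot> wave \<rho> (\<phi>N \<rho>) x -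
      exp (2 * (\<i> * \<rho> * of_real x)) \<odot> (\<rho> \<odot> perp A + (\<i> * \<rho>) \<odot> A))" (is ?U)
    and "grows 0 (\<lambda>\<rho>. exp (\<i> * \<rho> * of_real x) \<odot> \<phi>N \<rho> x)" (is ?Y)
proof -
  define m where "m = norm (perp A) + norm h + norm A"
  have m: "0 \<le> m" by (simp add: m_def)
  define q where "q = mass 0 x"
  have q: "0 \<le> q" unfolding q_def by (rule mass_nonneg) simp
  have b: "norm (\<phi>N \<rho> t) \<le> 2 * m * exp (Im \<rho> * t)"
    if \<rho>: "\<rho> \<in> Omega" "q \<le> cmod \<rho> / 2" "1 \<le> cmod \<rho>" and t: "t \<in> {0..x}" for \<rho> t
  proof (rule solution_growth[OF \<phi>N_solution order_refl _ _ _ _ _ t])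
    have h: "norm h \<le> cmod \<rho> * norm h" using \<rho>(3) by (simp add: mult_le_cancel_right1)
    have "norm (\<rho> \<odot> perp A + h) \<le> cmod \<rho> * norm (perp A) + cmod \<rho> * norm h"
      using norm_triangle_ineq[of "\<rho> \<odot> perp A" h] h by (simp add: norm_cscale)
    moreover have "norm ((\<i> * \<rho>) \<odot> A) = cmod \<rho> * norm A" by (simp add: norm_cscale norm_mult)
    ultimately show "norm (dx (\<phi>N \<rho>) 0 + (\<i> * \<rho>) \<odot> \<phi>N \<rho> 0) \<le> cmod \<rho> * (m * exp (Im \<rho> * 0))"
      "norm (dx (\<phi>N \<rho>) 0 - (\<i> * \<rho>) \<odot> \<phi>N \<rho> 0) \<le> cmod \<rho> * (m * exp (Im \<rho> * 0))"
      using norm_triangle_ineq[of "\<rho> \<odot> perp A + h" "(\<i> * \<rho>) \<odot> A"]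
        norm_triangle_ineq4[of "\<rho> \<odot> perp A + h" "(\<i> * \<rho>) \<odot> A"]
      by (simp_all add: \<phi>N_0 m_def distrib_left)
  qed (use \<rho> q_def in \<open>auto simp: Omega_def\<close>)
  have W: "norm (wave (-\<rho>) (\<phi>N \<rho>) x - wave (-\<rho>) (\<phi>N \<rho>) 0) \<le> 2 * m * q"
    and U: "norm (wave \<rho> (\<phi>N \<rho>) x - wave \<rho> (\<phi>N \<rho>) 0) \<le> exp (2 * Im \<rho> * x) * (2 * m) * q"
    if \<rho>: "\<rho> \<in> Omega" "q \<le> cmod \<rho> / 2" "1 \<le> cmod \<rho>" for \<rho>
  proof -
    have s: "sl_solution Q ((-\<rho>)\<^sup>2) (\<phi>N \<rho>)" using \<phi>N_solution[of \<rho>] by simp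
    show "norm (wave (-\<rho>) (\<phi>N \<rho>) x - wave (-\<rho>) (\<phi>N \<rho>) 0) \<le> 2 * m * q"
      using wave_diff_bound[OF s order_refl x _ b[OF \<rho>]] m by (simp add: q_def)
    show "norm (wave \<rho> (\<phi>N \<rho>) x - wave \<rho> (\<phi>N \<rho>) 0) \<le> exp (2 * Im \<rho> * x) * (2 * m) * q"
      using wave_diff_bound[OF \<phi>N_solution order_refl x _ b[OF \<rho>]] m \<rho>(1)
      by (simp add: q_def Omega_def)
  qed
  have W0: "wave (-\<rho>) (\<phi>N \<rho>) 0 = (\<rho> \<odot> perp A - (\<i> * \<rho>) \<odot> A) + h"
    and U0: "wave \<rho> (\<phi>N \<rho>) 0 = (\<rho> \<odot> perp A + (\<i> * \<rho>) \<odot> A) + h" for \<rho>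
    by (simp_all add: wave_def \<phi>N_0 cs.minus_left)
  have ev: "eventually (\<lambda>\<rho>. \<rho> \<in> Omega \<and> q \<le> cmod \<rho> / 2 \<and> 1 \<le> cmod \<rho>) uhp"
    by (rule eventually_potential_small)
  have "eventually (\<lambda>\<rho>. norm (wave (-\<rho>) (\<phi>N \<rho>) x - wave (-\<rho>) (\<phi>N \<rho>) 0) \<le> 2 * m * q) uhp"
    by (rule eventually_mono[OF ev]) (use W in blast)
  from grows_add[OF grows_bounded[OF this] grows_const[of h]] show ?W
    by (simp add: W0 algebra_simps)
  have "eventually (\<lambda>\<rho>. norm (exp (2 * (\<i> * \<rho> * of_real x)) \<odot> (wave \<rho> (\<phi>N \<rho>) x - wave \<rho> (\<phi>N \<rho>) 0)) \<le> 2 * m * q) uhp"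
    using ev
  proof eventually_elim
    case (elim \<rho>)
    have "exp (- (2 * Im \<rho> * x)) * norm (wave \<rho> (\<phi>N \<rho>) x - wave \<rho> (\<phi>N \<rho>) 0) \<le>
        exp (- (2 * Im \<rho> * x)) * (exp (2 * Im \<rho> * x) * (2 * m) * q)"
      using U[of \<rho>] elim by (intro mult_left_mono) auto
    then show ?case by (simp add: norm_cscale exp_minus algebra_simps)
  qed
  moreover have "grows 0 (\<lambda>\<rho>. exp (2 * (\<i> * \<rho> * of_real x)) \<odot> h)"
    using grows_cs[OF grows_exp2[OF x] grows_const[of h]] by simp
  ultimately show ?U
    using grows_add[OF grows_bounded] by (force simp: U0 cs.diff_right cs.add_right algebra_simps)
  have "eventually (\<lambda>\<rho>. norm (exp (\<i> * \<rho> * of_real x) \<odot> \<phi>N \<rho> x) \<le> 2 * m) uhp"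
    using ev
  proof eventually_elim
    case (elim \<rho>)
    have "exp (- (Im \<rho> * x)) * norm (\<phi>N \<rho> x) \<le> exp (- (Im \<rho> * x)) * (2 * m * exp (Im \<rho> * x))"
      using b[of \<rho> x] elim x by (intro mult_left_mono) auto
    then show ?case by (simp add: norm_cscale exp_minus algebra_simps)
  qed
  then show ?Y by (rule grows_bounded)
qed

lemma scaled_orders:
  assumes x: "0 \<le> x"
  shows "grows 1 (\<lambda>\<rho>. wave (-\<rho>) (\<phi>N \<rho>) x)"
    and "grows 1 (\<lambda>\<rho>. exp (2 * (\<i> * \<rho> * of_real x)) \<odot> wave \<rho> (\<phi>N \<rho>) x)"
    and "grows 1 (\<lambda>\<rho>. exp (\<i> * \<rho> * of_real x) \<odot> dx (\<phi>N \<rho>) x)"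
proof -
  have r: "grows 1 (\<lambda>\<rho>. (c * \<rho>) \<odot> B)" for c and B :: "complex^'n^'n"
    using grows_cs[OF grows_times[OF grows_const grows_rho] grows_const] by simp
  have r1: "grows 1 (\<lambda>\<rho>. \<rho> \<odot> B)" for B :: "complex^'n^'n" using r[of 1] by simp
  have g1: "grows 1 (\<lambda>\<rho>. \<rho> \<odot> perp A - (\<i> * \<rho>) \<odot> A)" by (intro grows_diff r r1)
  have g2: "grows 1 (\<lambda>\<rho>. exp (2 * (\<i> * \<rho> * of_real x)) \<odot> (\<rho> \<odot> perp A + (\<i> * \<rho>) \<odot> A))"
    using grows_cs[OF grows_exp2[OF x] grows_add[OF r1[of "perp A"] r[of "\<i>" A]]] by simp
  show W: "grows 1 (\<lambda>\<rho>. wave (-\<rho>) (\<phi>N \<rho>) x)"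
    using grows_add[OF grows_mono[OF scaled_asymptotics(1)[OF x]] g1] by simp
  show U: "grows 1 (\<lambda>\<rho>. exp (2 * (\<i> * \<rho> * of_real x)) \<odot> wave \<rho> (\<phi>N \<rho>) x)"
    using grows_add[OF grows_mono[OF scaled_asymptotics(2)[OF x]] g2] by simp
  have "exp (\<i> * \<rho> * of_real x) \<odot> dx (\<phi>N \<rho>) x =
      (1 / 2) \<odot> (exp (2 * (\<i> * \<rho> * of_real x)) \<odot> wave \<rho> (\<phi>N \<rho>) x + wave (-\<rho>) (\<phi>N \<rho>) x)" for \<rho>
  proof -
    let ?E = "exp (\<i> * \<rho> * of_real x)" and ?E' = "exp (- (\<i> * \<rho> * of_real x))"
    have e: "exp (2 * (\<i> * \<rho> * of_real x)) = ?E * ?E" "?E * ?E' = 1"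
      by (simp_all add: exp_double power2_eq_square exp_minus)
    have "exp (2 * (\<i> * \<rho> * of_real x)) \<odot> wave \<rho> (\<phi>N \<rho>) x + wave (-\<rho>) (\<phi>N \<rho>) x =
        ?E \<odot> (?E \<odot> wave \<rho> (\<phi>N \<rho>) x + ?E' \<odot> wave (-\<rho>) (\<phi>N \<rho>) x)"
      by (simp only: cs.add_right cscale_cscale e cscale_1)
    also have "\<dots> = ?E \<odot> (2 \<odot> dx (\<phi>N \<rho>) x)" by (simp only: from_waves(2)[symmetric])
    finally show ?thesis by (simp add: cscale_cscale)
  qed
  then show "grows 1 (\<lambda>\<rho>. exp (\<i> * \<rho> * of_real x) \<odot> dx (\<phi>N \<rho>) x)"
    using grows_cs[OF grows_const[of "1/2"] grows_add[OF U W]] by simp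
qed

lemma regular_entire:
  assumes "0 \<le> t"
  shows "(\<lambda>\<mu>. \<phi> t \<mu> $ i $ j) holomorphic_on UNIV" "(\<lambda>\<mu>. dx (\<lambda>t. \<phi> t \<mu>) t $ i $ j) holomorphic_on UNIV"
  using ivp_entire[of "\<lambda>\<mu> t. \<phi> t \<mu>" A "perp A + h" t i j] reg assms by (auto simp: regular_solution_def)

end

section \<open>Asymptotics of the Weyl solution\<close>

lemma projection_simps:
  fixes A X :: "complex^'n^'n"
  assumes "A ** A = A"
  shows "A ** perp A = 0" "perp A ** A = 0" "perp A ** perp A = perp A"
    "A ** (A ** X) = A ** X" "A ** (perp A ** X) = 0" "perp A ** (A ** X) = 0" "perp A ** (perp A ** X) = perp A ** X"
proof -
  show p: "A ** perp A = 0" "perp A ** A = 0" "perp A ** perp A = perp A"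
    using assms by (simp_all add: mm.diff_left mm.diff_right)
  show "A ** (A ** X) = A ** X" "A ** (perp A ** X) = 0" "perp A ** (A ** X) = 0" "perp A ** (perp A ** X) = perp A ** X"
    by (simp_all only: matrix_mul_assoc p assms mm.zero_left)
qed

text \<open>
  \<open>J(\<rho>)\<close> is \<open>i\<rho>A - A\<^sup>\<bottom>\<close> up to a right factor \<open>1 + O(1/\<rho>)\<close>; the Weyl solution \<open>e J\<^sup>-\<^sup>1\<close>, multiplied by
  this matrix, is therefore the Jost solution up to such a factor.
\<close>

definition bscl :: "complex^'n^'n \<Rightarrow> complex \<Rightarrow> complex^'n^'n" where
  "bscl A \<rho> = (\<i> * \<rho>) \<odot> A - perp A"

definition bscl_inv :: "complex^'n^'n \<Rightarrow> complex \<Rightarrow> complex^'n^'n" where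
  "bscl_inv A \<rho> = (1 / (\<i> * \<rho>)) \<odot> A - perp A"

lemma bscl_inv_bscl:
  assumes "A ** A = A" "\<rho> \<noteq> 0"
  shows "bscl_inv A \<rho> ** bscl A \<rho> = mat 1" "bscl A \<rho> ** bscl_inv A \<rho> = mat 1"
  using assms(2) by (simp_all add: bscl_def bscl_inv_def mat_distribs cscale_mult_left cscale_mult_right cscale_cscale
      projection_simps[OF assms(1)] assms(1))

lemma scl_inverse:
  assumes "A ** A = A" "\<rho> \<noteq> 0"
  shows "scl A \<rho> ** scl A (1 / \<rho>) = mat 1" "scl A (1 / \<rho>) ** scl A \<rho> = mat 1"
  using assms(2) by (simp_all add: scl_def mm.add_left mm.add_right cscale_mult_left cscale_mult_right cscale_cscale
      projection_simps[OF assms(1)] assms(1))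

lemma matrix_inv_inverse:
  assumes "invertible (B :: complex^'n^'n)"
  shows "B ** matrix_inv B = mat 1" "matrix_inv B ** B = mat 1"
proof -
  have "B ** matrix_inv B = mat 1 \<and> matrix_inv B ** B = mat 1"
    using assms unfolding invertible_def matrix_inv_def by (rule someI_ex)
  then show "B ** matrix_inv B = mat 1" "matrix_inv B ** B = mat 1" by auto
qed

locale weyl_family = jost_family Q e for Q :: "real \<Rightarrow> complex^'n^'n" and e +
  fixes A h :: "complex^'n^'n"
  assumes AA: "A ** A = A"
    and nonsingular: "eventually (\<lambda>\<rho>. det (bc A h (\<lambda>x. e x \<rho>)) \<noteq> 0) uhp"
begin

definition J :: "complex \<Rightarrow> complex^'n^'n" where "J \<rho> = bc A h (\<lambda>x. e x \<rho>)"

definition X :: "complex \<Rightarrow> complex^'n^'n" where "X \<rho> = matrix_inv (J \<rho>) ** bscl A \<rho>"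

definition \<Phi>N :: "complex \<Rightarrow> real \<Rightarrow> complex^'n^'n" where "\<Phi>N \<rho> t = e t \<rho> ** X \<rho>"

lemma jost_wave_orders:
  assumes x: "0 \<le> x"
  shows "grows 0 (\<lambda>\<rho>. wave \<rho> (\<lambda>t. e t \<rho>) x - (2 * \<i> * \<rho>) \<odot> mat 1)"
    and "grows 0 (\<lambda>\<rho>. exp (- (2 * (\<i> * \<rho> * of_real x))) \<odot> wave (-\<rho>) (\<lambda>t. e t \<rho>) x)"
proof -
  have ev: "eventually (\<lambda>\<rho>. \<rho> \<in> Omega \<and> tail_mass x \<le> cmod \<rho> / 2 \<and> 1 \<le> cmod \<rho>) uhp"
    by (rule eventually_potential_small)
  let ?c = "norm (mat 1 :: complex^'n^'n)"
  show "grows 0 (\<lambda>\<rho>. wave \<rho> (\<lambda>t. e t \<rho>) x - (2 * \<i> * \<rho>) \<odot> mat 1)"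
    by (rule grows_bounded[of _ "2 * ?c * tail_mass x"], rule eventually_mono[OF ev])
      (use jost.wave_bounds(1)[OF jost_locale x] in blast)
  show "grows 0 (\<lambda>\<rho>. exp (- (2 * (\<i> * \<rho> * of_real x))) \<odot> wave (-\<rho>) (\<lambda>t. e t \<rho>) x)"
  proof (rule grows_bounded[of _ "2 * ?c * tail_mass x"], rule eventually_mono[OF ev])
    fix \<rho> assume \<rho>: "\<rho> \<in> Omega \<and> tail_mass x \<le> cmod \<rho> / 2 \<and> 1 \<le> cmod \<rho>"
    have "norm (exp (- (2 * (\<i> * \<rho> * of_real x))) \<odot> wave (-\<rho>) (\<lambda>t. e t \<rho>) x) =
        exp (2 * Im \<rho> * x) * norm (wave (-\<rho>) (\<lambda>t. e t \<rho>) x)"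
      by (simp add: norm_cscale)
    also have "\<dots> \<le> exp (2 * Im \<rho> * x) * (2 * ?c * exp (- (2 * Im \<rho> * x)) * tail_mass x)"
      using jost.wave_bounds(2)[OF jost_locale x] \<rho> by (intro mult_left_mono) auto
    also have "\<dots> = 2 * ?c * tail_mass x" by (simp add: exp_minus)
    finally show "norm (exp (- (2 * (\<i> * \<rho> * of_real x))) \<odot> wave (-\<rho>) (\<lambda>t. e t \<rho>) x) \<le> 2 * ?c * tail_mass x" .
  qed
qed

lemma eventually_nz: "eventually (\<lambda>\<rho>. \<rho> \<noteq> 0) uhp"
  by (rule eventually_mono[OF eventually_uhp_ge[of 1]]) auto

lemma jost_initial_orders:
  "grows (-1) (\<lambda>\<rho>. e 0 \<rho> - mat 1)" "grows 0 (\<lambda>\<rho>. dx (\<lambda>t. e t \<rho>) 0 - (\<i> * \<rho>) \<odot> mat 1)"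
proof -
  have W: "grows 0 (\<lambda>\<rho>. wave (-\<rho>) (\<lambda>t. e t \<rho>) 0)" using jost_wave_orders(2)[of 0] by simp
  note U = jost_wave_orders(1)[OF order_refl]
  have c: "grows (-1) (\<lambda>\<rho>. 1 / (2 * \<i> * \<rho>))"
    using grows_times[OF grows_const[of "1/2"] grows_irho] by (simp add: mult.assoc)
  have "eventually (\<lambda>\<rho>. e 0 \<rho> - mat 1 =
      (1 / (2 * \<i> * \<rho>)) \<odot> ((wave \<rho> (\<lambda>t. e t \<rho>) 0 - (2 * \<i> * \<rho>) \<odot> mat 1) - wave (-\<rho>) (\<lambda>t. e t \<rho>) 0)) uhp"
    using eventually_nz
  proof eventually_elim
    case (elim \<rho>)
    have "(2 * \<i> * \<rho>) \<odot> e 0 \<rho> = wave \<rho> (\<lambda>t. e t \<rho>) 0 - wave (-\<rho>) (\<lambda>t. e t \<rho>) 0"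
      using from_waves(1)[of \<rho> "\<lambda>t. e t \<rho>" 0] by simp
    then have "(wave \<rho> (\<lambda>t. e t \<rho>) 0 - (2 * \<i> * \<rho>) \<odot> mat 1) - wave (-\<rho>) (\<lambda>t. e t \<rho>) 0 = (2 * \<i> * \<rho>) \<odot> (e 0 \<rho> - mat 1)"
      by (simp add: cs.diff_right algebra_simps)
    then show ?case using elim by (simp add: cscale_cscale)
  qed
  from grows_cong[OF _ this] grows_cs[OF c grows_diff[OF U W]]
  show "grows (-1) (\<lambda>\<rho>. e 0 \<rho> - mat 1)" by simp
  have "dx (\<lambda>t. e t \<rho>) 0 - (\<i> * \<rho>) \<odot> mat 1 =
      (1 / 2) \<odot> ((wave \<rho> (\<lambda>t. e t \<rho>) 0 - (2 * \<i> * \<rho>) \<odot> mat 1) + wave (-\<rho>) (\<lambda>t. e t \<rho>) 0)" for \<rho>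
  proof -
    have "2 \<odot> dx (\<lambda>t. e t \<rho>) 0 = wave \<rho> (\<lambda>t. e t \<rho>) 0 + wave (-\<rho>) (\<lambda>t. e t \<rho>) 0"
      using from_waves(2)[of "\<lambda>t. e t \<rho>" 0 \<rho>] by simp
    then have "(wave \<rho> (\<lambda>t. e t \<rho>) 0 - (2 * \<i> * \<rho>) \<odot> mat 1) + wave (-\<rho>) (\<lambda>t. e t \<rho>) 0 =
        2 \<odot> (dx (\<lambda>t. e t \<rho>) 0 - (\<i> * \<rho>) \<odot> mat 1)"
      by (simp add: cs.diff_right cscale_cscale mult.assoc algebra_simps)
    then show ?thesis by (simp add: cscale_cscale)
  qed
  then show "grows 0 (\<lambda>\<rho>. dx (\<lambda>t. e t \<rho>) 0 - (\<i> * \<rho>) \<odot> mat 1)"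
    using grows_cs[OF grows_const[of "1/2"] grows_add[OF U W]] by simp
qed

text \<open>
  With \<open>\<Delta> = bscl\<^sup>-\<^sup>1 J - I\<close>, which is \<open>O(1/\<rho>)\<close>, one has \<open>X = I - \<Delta> X\<close>. Once \<open>|\<Delta>| \<le> 1/2\<close>, this equation first bounds
  \<open>X\<close> and then gives the order of \<open>X - I\<close>.
\<close>

lemma X_order: "grows (-1) (\<lambda>\<rho>. X \<rho> - mat 1)"
proof -
  define \<Delta> where "\<Delta> \<rho> = bscl_inv A \<rho> ** J \<rho> - mat 1" for \<rho>
  let ?e = "\<lambda>\<rho>. e 0 \<rho>" and ?d = "\<lambda>\<rho>. dx (\<lambda>t. e t \<rho>) 0"
  let ?c = "norm (mat 1 :: complex^'n^'n)"
  have "eventually (\<lambda>\<rho>. \<Delta> \<rho> = (1 / (\<i> * \<rho>)) \<odot> (A ** ((?d \<rho> - (\<i> * \<rho>) \<odot> mat 1) - h ** ?e \<rho>)) + perp A ** (?e \<rho> - mat 1)) uhp"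
    using eventually_nz
  proof eventually_elim
    case (elim \<rho>)
    have "bscl_inv A \<rho> ** J \<rho> = (1 / (\<i> * \<rho>)) \<odot> (A ** (?d \<rho> - h ** ?e \<rho>)) + perp A ** ?e \<rho>"
      unfolding J_def bc_def bscl_inv_def
      by (simp only: mm.diff_left[of "_ \<odot> _"] mm.diff_right[of _ "A ** _"] cscale_mult_left projection_simps[OF AA]) simp
    moreover have "(1 / (\<i> * \<rho>)) \<odot> (A ** ((\<i> * \<rho>) \<odot> mat 1)) = A"
      using elim by (simp add: cscale_mult_right cscale_cscale)
    ultimately show ?case
      by (simp add: \<Delta>_def mm.diff_right cs.diff_right)
  qed
  moreover have e0: "grows 0 ?e"
    using grows_add[OF grows_mono[OF jost_initial_orders(1), of 0] grows_const[of "mat 1"]] by simp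
  have "grows (-1) (\<lambda>\<rho>. (1 / (\<i> * \<rho>)) \<odot> (A ** ((?d \<rho> - (\<i> * \<rho>) \<odot> mat 1) - h ** ?e \<rho>)) + perp A ** (?e \<rho> - mat 1))"
    using grows_add[OF grows_cs[OF grows_irho grows_mm[OF grows_const[of A] grows_diff[OF jost_initial_orders(2) grows_mm[OF grows_const[of h] e0, simplified]]], simplified]
        grows_mm[OF grows_const[of "perp A"] jost_initial_orders(1), simplified]] by simp
  ultimately have \<Delta>: "grows (-1) \<Delta>" by (intro grows_cong[of "-1" _ \<Delta>])
  then obtain C where C: "0 \<le> C" "eventually (\<lambda>\<rho>. norm (\<Delta> \<rho>) \<le> C * cmod \<rho> powi (-1)) uhp" by (rule growsE)
  have "eventually (\<lambda>\<rho>. X \<rho> - mat 1 = - (\<Delta> \<rho> ** X \<rho>) \<and> norm (\<Delta> \<rho>) \<le> 1 / 2) uhp"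
    using C(2) nonsingular eventually_uhp_ge[of "max 1 (2 * C)"]
  proof eventually_elim
    case (elim \<rho>)
    have "\<rho> \<noteq> 0" using elim by auto
    have "invertible (J \<rho>)" using elim by (simp add: invertible_det_nz J_def)
    then have "J \<rho> ** X \<rho> = bscl A \<rho>" by (simp add: X_def matrix_mul_assoc matrix_inv_inverse)
    then have "bscl_inv A \<rho> ** J \<rho> ** X \<rho> = mat 1"
      using bscl_inv_bscl[OF AA \<open>\<rho> \<noteq> 0\<close>] by (simp flip: matrix_mul_assoc)
    then have "X \<rho> - mat 1 = - (\<Delta> \<rho> ** X \<rho>)" by (simp add: \<Delta>_def mm.diff_left)
    moreover have "C * cmod \<rho> powi (-1) \<le> 1 / 2" using elim \<open>\<rho> \<noteq> 0\<close> by (simp add: field_simps)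
    ultimately show ?case using elim by linarith
  qed
  note ev = this
  have "eventually (\<lambda>\<rho>. norm (X \<rho>) \<le> 2 * ?c) uhp"
    using ev
  proof eventually_elim
    case (elim \<rho>)
    have "X \<rho> = mat 1 - \<Delta> \<rho> ** X \<rho>" using elim by (simp add: diff_eq_eq)
    then have "norm (X \<rho>) \<le> ?c + norm (\<Delta> \<rho> ** X \<rho>)"
      using norm_triangle_ineq4[of "mat 1" "\<Delta> \<rho> ** X \<rho>"] by simp
    also have "norm (\<Delta> \<rho> ** X \<rho>) \<le> 1 / 2 * norm (X \<rho>)"
      using elim by (intro order_trans[OF norm_matrix_mult_le] mult_right_mono) auto
    finally show ?case by simp
  qed
  then have "grows 0 X" by (rule grows_bounded)
  from grows_minus[OF grows_mm[OF \<Delta> this]] have "grows (-1) (\<lambda>\<rho>. - (\<Delta> \<rho> ** X \<rho>))" by simp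
  then show ?thesis by (rule grows_cong) (rule eventually_mono[OF ev], simp)
qed

lemma X_bounded: "grows 0 X"
  using grows_add[OF grows_mono[OF X_order, of 0] grows_const[of "mat 1"]] by simp

lemma \<Phi>N_solution: "\<rho> \<in> Omega \<Longrightarrow> sl_solution Q (\<rho>\<^sup>2) (\<Phi>N \<rho>)"
  and dx_\<Phi>N: "\<rho> \<in> Omega \<Longrightarrow> 0 \<le> t \<Longrightarrow> dx (\<Phi>N \<rho>) t = dx (\<lambda>t. e t \<rho>) t ** X \<rho>"
  unfolding \<Phi>N_def[abs_def] using sl_solution_mult_right[OF jost.e_solution[OF jost_locale]] by blast+

lemma wave_\<Phi>N: "\<rho> \<in> Omega \<Longrightarrow> 0 \<le> t \<Longrightarrow> wave \<sigma> (\<Phi>N \<rho>) t = wave \<sigma> (\<lambda>t. e t \<rho>) t ** X \<rho>"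
  by (simp add: wave_def dx_\<Phi>N \<Phi>N_def cscale_mult_left mm.add_left)

lemma weyl_wave_orders:
  assumes x: "0 \<le> x"
  shows "grows 0 (\<lambda>\<rho>. wave \<rho> (\<Phi>N \<rho>) x - (2 * \<i> * \<rho>) \<odot> mat 1)"
    and "grows 0 (\<lambda>\<rho>. exp (- (2 * (\<i> * \<rho> * of_real x))) \<odot> wave (-\<rho>) (\<Phi>N \<rho>) x)"
proof -
  have ev: "eventually (\<lambda>\<rho>. \<rho> \<in> Omega) uhp"
    using eventually_potential_small[of 0] by eventually_elim simp
  have r: "grows 1 (\<lambda>\<rho>. 2 * \<i> * \<rho>)" using grows_times[OF grows_const[of "2 * \<i>"] grows_rho] by simp
  have "grows 0 (\<lambda>\<rho>. (wave \<rho> (\<lambda>t. e t \<rho>) x - (2 * \<i> * \<rho>) \<odot> mat 1) ** X \<rho> + (2 * \<i> * \<rho>) \<odot> (X \<rho> - mat 1))"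
    using grows_add[OF grows_mm[OF jost_wave_orders(1)[OF x] X_bounded, simplified] grows_cs[OF r X_order, simplified]] .
  then show "grows 0 (\<lambda>\<rho>. wave \<rho> (\<Phi>N \<rho>) x - (2 * \<i> * \<rho>) \<odot> mat 1)"
    by (rule grows_cong[OF _ eventually_mono[OF ev]])
      (simp add: wave_\<Phi>N x mm.diff_left cscale_mult_left cs.diff_right)
  show "grows 0 (\<lambda>\<rho>. exp (- (2 * (\<i> * \<rho> * of_real x))) \<odot> wave (-\<rho>) (\<Phi>N \<rho>) x)"
    using grows_mm[OF jost_wave_orders(2)[OF x] X_bounded, simplified]
    by (rule grows_cong[OF _ eventually_mono[OF ev]]) (simp add: wave_\<Phi>N x cscale_mult_left)
qed

text \<open>
  The limit depends on \<open>A\<close> only, so it cancels in the difference of two Weyl matrices.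
\<close>

lemma weyl_order:
  "grows (-1) (\<lambda>\<rho>. scl A (1 / \<rho>) ** weyl A h e \<rho> ** bscl A \<rho> - (A + \<i> \<odot> perp A))"
proof -
  let ?e = "\<lambda>\<rho>. e 0 \<rho>" and ?d = "\<lambda>\<rho>. dx (\<lambda>t. e t \<rho>) 0"
  have r: "grows 1 (\<lambda>\<rho>. \<i> * \<rho>)" using grows_times[OF grows_const[of "\<i>"] grows_rho] by simp
  have 1: "grows (-1) (\<lambda>\<rho>. ?e \<rho> ** X \<rho> - mat 1)"
  proof -
    have "grows (-1) (\<lambda>\<rho>. (?e \<rho> - mat 1) ** X \<rho> + (X \<rho> - mat 1))"
      using grows_add[OF grows_mm[OF jost_initial_orders(1) X_bounded, simplified] X_order] .
    then show ?thesis by (simp add: mm.diff_left)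
  qed
  have 2: "grows 0 (\<lambda>\<rho>. ?d \<rho> ** X \<rho> - (\<i> * \<rho>) \<odot> mat 1)"
  proof -
    have "grows 0 (\<lambda>\<rho>. (?d \<rho> - (\<i> * \<rho>) \<odot> mat 1) ** X \<rho> + (\<i> * \<rho>) \<odot> (X \<rho> - mat 1))"
      using grows_add[OF grows_mm[OF jost_initial_orders(2) X_bounded, simplified] grows_cs[OF r X_order, simplified]] .
    then show ?thesis by (simp add: mm.diff_left cscale_mult_left cs.diff_right)
  qed
  have "grows (-1) (\<lambda>\<rho>. A ** (?e \<rho> ** X \<rho> - mat 1) + (1 / \<rho>) \<odot> (perp A ** (?d \<rho> ** X \<rho> - (\<i> * \<rho>) \<odot> mat 1)))"
    using grows_add[OF grows_mm[OF grows_const[of A] 1, simplified] grows_cs[OF grows_inverse grows_mm[OF grows_const[of "perp A"] 2, simplified], simplified]] .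
  then show ?thesis
  proof (rule grows_cong, intro eventually_mono[OF eventually_nz])
    fix \<rho> :: complex assume \<rho>: "\<rho> \<noteq> 0"
    have "scl A (1 / \<rho>) ** weyl A h e \<rho> ** bscl A \<rho> = scl A (1 / \<rho>) ** ((A ** ?e \<rho> + perp A ** ?d \<rho>) ** X \<rho>)"
      by (simp add: weyl_def X_def J_def matrix_mul_assoc)
    also have "\<dots> = A ** (?e \<rho> ** X \<rho>) + (1 / \<rho>) \<odot> (perp A ** (?d \<rho> ** X \<rho>))"
      by (simp only: scl_def mm.add_left mm.add_right cscale_mult_left matrix_mul_assoc[symmetric] projection_simps[OF AA])
         (simp add: cs.zero_right)
    finally show "scl A (1 / \<rho>) ** weyl A h e \<rho> ** bscl A \<rho> - (A + \<i> \<odot> perp A) =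
        A ** (?e \<rho> ** X \<rho> - mat 1) + (1 / \<rho>) \<odot> (perp A ** (?d \<rho> ** X \<rho> - (\<i> * \<rho>) \<odot> mat 1))"
      using \<rho> by (simp add: mm.diff_right cs.diff_right cscale_mult_right cscale_cscale)
  qed
qed

end

section \<open>The transfer matrix between the two problems\<close>

text \<open>
  \<open>R\<^sub>1, R\<^sub>2\<close> solve a linear system whose matrix, in the coordinates of incoming and outgoing waves, is
  triangular with invertible diagonal of order \<open>\<rho>\<close>, up to bounded terms.
\<close>

lemma triangular_system_order:
  fixes R1 R2 U1 W1 U2 W2 d1 d2 :: "complex \<Rightarrow> complex^'n^'n"
  assumes A: "A ** A = A"
    and eq1: "eventually (\<lambda>\<rho>. R1 \<rho> ** U1 \<rho> + R2 \<rho> ** W1 \<rho> = d1 \<rho>) uhp"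
    and eq2: "eventually (\<lambda>\<rho>. R1 \<rho> ** U2 \<rho> + R2 \<rho> ** W2 \<rho> = d2 \<rho>) uhp"
    and U1: "grows 1 U1" and W1: "grows 0 (\<lambda>\<rho>. W1 \<rho> - (\<rho> \<odot> perp A - (\<i> * \<rho>) \<odot> A))"
    and U2: "grows 0 (\<lambda>\<rho>. U2 \<rho> - (2 * \<i> * \<rho>) \<odot> mat 1)" and W2: "grows 0 W2"
    and d1: "grows 0 d1" and d2: "grows 0 d2"
  shows "grows (-1) R1" "grows (-1) R2"
proof -
  \<comment> \<open>Up to the factor \<open>\<rho>\<close>, \<open>V\<close> inverts the leading term of \<open>W1\<close>.\<close>
  define V where "V = perp A + \<i> \<odot> A"
  have V: "(\<rho> \<odot> perp A - (\<i> * \<rho>) \<odot> A) ** V = \<rho> \<odot> mat 1" for \<rho>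
    unfolding V_def
    by (simp only: mm.diff_left mm.add_right cscale_mult_left cscale_mult_right cscale_cscale projection_simps[OF A] A)
       (simp add: vec_eq_iff algebra_simps)
  obtain a where a: "0 \<le> a" "eventually (\<lambda>\<rho>. norm (U1 \<rho>) \<le> a * cmod \<rho> powi 1) uhp" using growsE[OF U1] by blast
  obtain b where b: "0 \<le> b" "eventually (\<lambda>\<rho>. norm (W1 \<rho> - (\<rho> \<odot> perp A - (\<i> * \<rho>) \<odot> A)) \<le> b * cmod \<rho> powi 0) uhp"
    using growsE[OF W1] by blast
  obtain c where c: "0 \<le> c" "eventually (\<lambda>\<rho>. norm (U2 \<rho> - (2 * \<i> * \<rho>) \<odot> mat 1) \<le> c * cmod \<rho> powi 0) uhp"
    using growsE[OF U2] by blast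
  obtain d where d: "0 \<le> d" "eventually (\<lambda>\<rho>. norm (W2 \<rho>) \<le> d * cmod \<rho> powi 0) uhp" using growsE[OF W2] by blast
  obtain p where p: "0 \<le> p" "eventually (\<lambda>\<rho>. norm (d1 \<rho>) \<le> p * cmod \<rho> powi 0) uhp" using growsE[OF d1] by blast
  obtain q where q: "0 \<le> q" "eventually (\<lambda>\<rho>. norm (d2 \<rho>) \<le> q * cmod \<rho> powi 0) uhp" using growsE[OF d2] by blast
  define v where "v = norm V"
  have v: "0 \<le> v" by (simp add: v_def)
  define L where "L = max (max (a * v) (b * v)) (max (p * v) (max (max c d) q))"
  have L: "0 \<le> L" "a * v \<le> L" "b * v \<le> L" "p * v \<le> L" "c \<le> L" "d \<le> L" "q \<le> L"
    using a(1) v c(1) by (auto simp: L_def le_max_iff_disj)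
  define T where "T = max 1 (max (2 * L) (2 * (L * (1 + 2 * L))))"
  have final: "eventually (\<lambda>\<rho>. norm (R1 \<rho>) \<le> (2 * L * (1 + 2 * L)) * cmod \<rho> powi (-1) \<and>
      norm (R2 \<rho>) \<le> (2 * L * (1 + 2 * L * (1 + 2 * L))) * cmod \<rho> powi (-1)) uhp"
    using eq1 eq2 a(2) b(2) c(2) d(2) p(2) q(2) eventually_uhp_ge[of T]
  proof eventually_elim
    case (elim \<rho>)
    define r1 r2 k where "r1 = norm (R1 \<rho>)" and "r2 = norm (R2 \<rho>)" and "k = cmod \<rho>"
    have nn: "0 \<le> r1" "0 \<le> r2" by (simp_all add: r1_def r2_def)
    have k: "1 \<le> k" "2 * L \<le> k" "2 * (L * (1 + 2 * L)) \<le> k" using elim by (auto simp: k_def T_def)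
    have "(2 * \<i> * \<rho>) \<odot> R1 \<rho> = d2 \<rho> - R1 \<rho> ** (U2 \<rho> - (2 * \<i> * \<rho>) \<odot> mat 1) - R2 \<rho> ** W2 \<rho>"
      using elim(2) by (simp add: mm.diff_right cscale_mult_right algebra_simps)
    then have "norm ((2 * \<i> * \<rho>) \<odot> R1 \<rho>) \<le> norm (d2 \<rho>) + norm (R1 \<rho> ** (U2 \<rho> - (2 * \<i> * \<rho>) \<odot> mat 1)) + norm (R2 \<rho> ** W2 \<rho>)"
      by (simp only:) (meson add_right_mono norm_triangle_ineq4 order_trans)
    also have "\<dots> \<le> q + r1 * c + r2 * d"
      using elim by (intro add_mono order_trans[OF norm_matrix_mult_le]) (auto simp: r1_def r2_def intro: mult_left_mono)
    also have "\<dots> \<le> L + r1 * L + r2 * L" using L nn by (intro add_mono mult_left_mono) auto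
    finally have e1: "2 * k * r1 \<le> L + r1 * L + r2 * L" by (simp add: norm_cscale norm_mult k_def r1_def)
    have "\<rho> \<odot> R2 \<rho> = R2 \<rho> ** ((\<rho> \<odot> perp A - (\<i> * \<rho>) \<odot> A) ** V)" by (simp only: V cscale_mult_right) simp
    also have "\<dots> = (d1 \<rho> - R1 \<rho> ** U1 \<rho> - R2 \<rho> ** (W1 \<rho> - (\<rho> \<odot> perp A - (\<i> * \<rho>) \<odot> A))) ** V"
      unfolding elim(1)[symmetric] by (simp add: matrix_mul_assoc mm.diff_right mm.diff_left)
    finally have "norm (\<rho> \<odot> R2 \<rho>) \<le> norm (d1 \<rho> - R1 \<rho> ** U1 \<rho> - R2 \<rho> ** (W1 \<rho> - (\<rho> \<odot> perp A - (\<i> * \<rho>) \<odot> A))) * v"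
      by (simp only: v_def norm_matrix_mult_le)
    also have "\<dots> \<le> (norm (d1 \<rho>) + norm (R1 \<rho> ** U1 \<rho>) + norm (R2 \<rho> ** (W1 \<rho> - (\<rho> \<odot> perp A - (\<i> * \<rho>) \<odot> A)))) * v"
      by (intro mult_right_mono[OF _ v]) (meson add_right_mono norm_triangle_ineq4 order_trans)
    also have "\<dots> \<le> (p + r1 * (a * k) + r2 * b) * v"
      using elim by (intro mult_right_mono[OF _ v] add_mono order_trans[OF norm_matrix_mult_le])
        (auto simp: r1_def r2_def k_def intro: mult_left_mono)
    also have "\<dots> = p * v + r1 * (a * v) * k + r2 * (b * v)" by (simp add: algebra_simps)
    also have "\<dots> \<le> L + r1 * L * k + r2 * L" using L nn k by (intro add_mono mult_left_mono mult_right_mono) auto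
    finally have e2: "k * r2 \<le> L + r1 * L * k + r2 * L" by (simp add: norm_cscale k_def r2_def)
    have h2: "k * r2 \<le> 2 * L * (1 + k * r1)"
    proof -
      have "2 * (r2 * L) \<le> k * r2" using mult_right_mono[OF k(2) nn(2)] by (simp add: algebra_simps)
      with e2 show ?thesis by (simp add: algebra_simps)
    qed
    have h1: "k * r1 \<le> 2 * L * (1 + 2 * L)"
    proof -
      have "r2 \<le> 2 * L * (1 + r1)"
      proof -
        have "k * r2 \<le> k * (2 * L * (1 + r1))"
          using h2 k L(1) mult_left_mono[OF k(1), of "2 * L"] by (simp add: algebra_simps)
        then show ?thesis using k by simp
      qed
      then have "r2 * L \<le> 2 * L * (1 + r1) * L" using L(1) by (rule mult_right_mono)
      then have "2 * k * r1 \<le> L * (1 + 2 * L) + (L * (1 + 2 * L)) * r1" using e1 by (simp add: algebra_simps)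
      moreover have "2 * ((L * (1 + 2 * L)) * r1) \<le> k * r1" using mult_right_mono[OF k(3) nn(1)] by simp
      moreover have "0 \<le> k * r1" using k nn by simp
      moreover have "0 \<le> L * (1 + 2 * L)" using L by simp
      ultimately show ?thesis by linarith
    qed
    have h3: "k * r2 \<le> 2 * L * (1 + 2 * L * (1 + 2 * L))"
      using h2 mult_left_mono[OF h1, of "2 * L"] L(1) by (simp add: algebra_simps)
    have "0 < k" using k by simp
    with h1 h3 show ?case
      by (simp add: k_def[symmetric] r1_def[symmetric] r2_def[symmetric] power_int_minus field_simps)
  qed
  show "grows (-1) R1" by (rule growsI, rule eventually_mono[OF final]) blast
  show "grows (-1) R2" by (rule growsI, rule eventually_mono[OF final]) blast
qed

lemma projection_h_simps:
  fixes A h :: "complex^'n^'n"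
  assumes "sl_problem Q A h"
  shows "A ** A = A" "A ** h = h" "h ** A = h" "perp A ** h = 0" "h ** perp A = 0"
proof -
  show 1: "A ** A = A" "A ** h = h" "h ** A = h"
    using assms by (auto simp: sl_problem_def orthogonal_projection_def)
  show "perp A ** h = 0" "h ** perp A = 0" by (simp_all add: mm.diff_left mm.diff_right 1)
qed

locale sl_pair =
  fixes Q Q1 :: "real \<Rightarrow> complex^'n^'n"
    and A h h1 :: "complex^'n^'n"
    and e e1 \<phi> \<phi>1 \<phi>s1 :: "real \<Rightarrow> complex \<Rightarrow> complex^'n^'n"
    and x :: real and lam :: complex
  assumes prob: "sl_problem Q A h" and prob1: "sl_problem Q1 A h1"
    and jost: "\<And>\<rho>. \<rho> \<in> Omega \<Longrightarrow> jost_solution Q \<rho> (\<lambda>t. e t \<rho>)"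
    and jost1: "\<And>\<rho>. \<rho> \<in> Omega \<Longrightarrow> jost_solution Q1 \<rho> (\<lambda>t. e1 t \<rho>)"
    and reg: "\<And>\<mu>. regular_solution Q A h \<mu> (\<lambda>t. \<phi> t \<mu>)"
    and reg1: "\<And>\<mu>. regular_solution Q1 A h1 \<mu> (\<lambda>t. \<phi>1 t \<mu>)"
    and regs1: "\<And>\<mu>. regular_solution_dual Q1 A h1 \<mu> (\<lambda>t. \<phi>s1 t \<mu>)"
    and bounded_Lambda: "bounded (Lambda_set A h e \<union> Lambda_set A h1 e1)"
    and x: "0 \<le> x"
begin

lemma AA: "A ** A = A" by (rule projection_h_simps(1)[OF prob])

definition nonsing :: "complex \<Rightarrow> bool" where
  "nonsing \<rho> \<longleftrightarrow> \<rho> \<in> Omega \<and> det (bc A h (\<lambda>x. e x \<rho>)) \<noteq> 0 \<and> det (bc A h1 (\<lambda>x. e1 x \<rho>)) \<noteq> 0"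

lemma nonsingI: "\<rho> \<in> Omega \<Longrightarrow> \<rho>\<^sup>2 \<notin> Lambda_set A h e \<union> Lambda_set A h1 e1 \<Longrightarrow> nonsing \<rho>"
  unfolding nonsing_def Lambda_set_def by blast

lemma eventually_nonsing: "eventually nonsing uhp"
proof -
  obtain R where R: "\<forall>\<mu>\<in>Lambda_set A h e \<union> Lambda_set A h1 e1. cmod \<mu> \<le> R"
    using bounded_Lambda unfolding bounded_iff by blast
  show ?thesis
    using eventually_uhp_ge[of "max 1 (R + 1)"]
  proof eventually_elim
    case (elim \<rho>)
    have "R < cmod \<rho> * 1" using elim by simp
    also have "\<dots> \<le> cmod \<rho> * cmod \<rho>" using elim by (intro mult_left_mono) auto
    also have "\<dots> = cmod (\<rho>\<^sup>2)" by (simp add: norm_mult power2_eq_square)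
    finally have "\<not> cmod (\<rho>\<^sup>2) \<le> R" by simp
    then have "\<rho>\<^sup>2 \<notin> Lambda_set A h e \<union> Lambda_set A h1 e1" using R by blast
    moreover have "\<rho> \<in> Omega" using elim by (auto simp: Omega_def)
    ultimately show "nonsing \<rho>" by (rule nonsingI[rotated])
  qed
qed

sublocale P: regular Q A h \<phi>
  by (unfold_locales) (use sl_problem_absolutely_integrable[OF prob] AA projection_h_simps[OF prob] reg in auto)

sublocale P1: regular Q1 A h1 \<phi>1
  by (unfold_locales) (use sl_problem_absolutely_integrable[OF prob1] AA projection_h_simps[OF prob1] reg1 in auto)

sublocale W: weyl_family Q e A h
proof
  show "\<forall>\<^sub>F \<rho> in uhp. det (bc A h (\<lambda>x. e x \<rho>)) \<noteq> 0"
    by (rule eventually_mono[OF eventually_nonsing]) (simp add: nonsing_def)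
qed (use jost AA in auto)

sublocale W1: weyl_family Q1 e1 A h1
proof
  show "\<forall>\<^sub>F \<rho> in uhp. det (bc A h1 (\<lambda>x. e1 x \<rho>)) \<noteq> 0"
    by (rule eventually_mono[OF eventually_nonsing]) (simp add: nonsing_def)
qed (use jost1 AA in auto)

lemma regs1_solution: "sl_solution_dual Q1 \<mu> (\<lambda>t. \<phi>s1 t \<mu>)" "\<phi>s1 0 \<mu> = A" "dx (\<lambda>t. \<phi>s1 t \<mu>) 0 = perp A + h1"
  using regs1 by (auto simp: regular_solution_dual_def)

sublocale DT: regular "\<lambda>t. transpose (Q1 t)" "transpose A" "transpose h1" "\<lambda>t \<mu>. transpose (\<phi>s1 t \<mu>)"
proof
  show "(\<lambda>t. transpose (Q1 t)) absolutely_integrable_on {0..}"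
    using P1.potential_transpose by (simp add: potential_def)
  show "transpose A ** transpose A = transpose A" by (simp add: AA flip: matrix_transpose_mul)
  show "transpose h1 ** transpose A = transpose h1"
    using projection_h_simps[OF prob1] by (simp flip: matrix_transpose_mul)
  have "transpose (perp A + h1) = perp (transpose A) + transpose h1"
    by (simp add: vec_eq_iff transpose_def mat_def)
  then show "regular_solution (\<lambda>t. transpose (Q1 t)) (transpose A) (transpose h1) \<mu> (\<lambda>t. transpose (\<phi>s1 t \<mu>))" for \<mu>
    using P1.dual_transpose_properties(1,2)[OF regs1_solution(1)] regs1_solution(2,3)
    by (simp add: regular_solution_def)
qed

text \<open>
  Companions of \<open>\<phi>\<close> and of \<open>\<phi>s1\<close>, entire in the spectral parameter, that complete them to fundamental systems.
  The initial values of \<open>S\<close> are those left over in \<open>e J\<^sup>-\<^sup>1 = \<phi> M + S\<close>.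
\<close>

definition S :: "complex \<Rightarrow> real \<Rightarrow> complex^'n^'n" where
  "S \<mu> = (SOME Y. sl_solution Q \<mu> Y \<and> Y 0 = - perp A \<and> dx Y 0 = A)"

definition Ss :: "complex \<Rightarrow> real \<Rightarrow> complex^'n^'n" where
  "Ss \<mu> = (SOME Z. sl_solution_dual Q1 \<mu> Z \<and> Z 0 = - perp A \<and> dx Z 0 = A)"

lemma S: "sl_solution Q \<mu> (S \<mu>)" "S \<mu> 0 = - perp A" "dx (S \<mu>) 0 = A"
proof -
  have "\<exists>Y. sl_solution Q \<mu> Y \<and> Y 0 = - perp A \<and> dx Y 0 = A" using P.ivp_exists by metis
  from someI_ex[OF this, folded S_def] show "sl_solution Q \<mu> (S \<mu>)" "S \<mu> 0 = - perp A" "dx (S \<mu>) 0 = A" by auto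
qed

lemma Ss: "sl_solution_dual Q1 \<mu> (Ss \<mu>)" "Ss \<mu> 0 = - perp A" "dx (Ss \<mu>) 0 = A"
proof -
  have "\<exists>Z. sl_solution_dual Q1 \<mu> Z \<and> Z 0 = - perp A \<and> dx Z 0 = A" using P1.dual_ivp_exists by metis
  from someI_ex[OF this, folded Ss_def] show "sl_solution_dual Q1 \<mu> (Ss \<mu>)" "Ss \<mu> 0 = - perp A" "dx (Ss \<mu>) 0 = A" by auto
qed

abbreviation M :: "complex \<Rightarrow> complex^'n^'n" where "M \<rho> \<equiv> weyl A h e \<rho>"
abbreviation M1 :: "complex \<Rightarrow> complex^'n^'n" where "M1 \<rho> \<equiv> weyl A h1 e1 \<rho>"
abbreviation Mhat :: "complex \<Rightarrow> complex^'n^'n" where "Mhat \<rho> \<equiv> M \<rho> - M1 \<rho>"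

end

text \<open>
  Multiplied by \<open>A\<close> and by \<open>A\<^sup>\<bottom>\<close>, the identity \<open>J J\<^sup>-\<^sup>1 = I\<close> yields two of the four blocks of the initial values of
  \<open>e J\<^sup>-\<^sup>1\<close>; the other two are collected in \<open>M\<close>.
\<close>

lemma weyl_solution_initial:
  fixes A h :: "complex^'n^'n" and e :: "real \<Rightarrow> complex \<Rightarrow> complex^'n^'n"
  assumes A: "A ** A = A" "A ** h = h" "h ** A = h" and det: "det (bc A h (\<lambda>x. e x \<rho>)) \<noteq> 0"
  defines "K \<equiv> matrix_inv (bc A h (\<lambda>x. e x \<rho>))" and "M \<equiv> weyl A h e \<rho>"
  shows "e 0 \<rho> ** K = A ** M - perp A" "dx (\<lambda>x. e x \<rho>) 0 ** K = (perp A + h) ** M + A"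
proof -
  define E E' where "E = e 0 \<rho> ** K" and "E' = dx (\<lambda>x. e x \<rho>) 0 ** K"
  have "bc A h (\<lambda>x. e x \<rho>) ** K = mat 1"
    unfolding K_def using det by (simp add: matrix_inv_inverse invertible_det_nz)
  then have I: "A ** E' - h ** E - perp A ** E = mat 1"
    by (simp add: bc_def E_def E'_def mm.diff_left mm.diff_right matrix_mul_assoc A(2))
  have M: "M = A ** E + perp A ** E'"
    by (simp add: M_def weyl_def K_def E_def E'_def mm.add_left matrix_mul_assoc)
  note p = projection_simps[OF A(1)]
  have ph: "perp A ** h = 0" "h ** perp A = 0" by (simp_all add: mm.diff_left mm.diff_right A)
  have ph': "perp A ** (h ** Y) = 0" "h ** (perp A ** Y) = 0" "A ** (h ** Y) = h ** Y" "h ** (A ** Y) = h ** Y" for Y :: "complex^'n^'n"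
    by (simp_all only: matrix_mul_assoc ph A mm.zero_left)
  have pI: "perp A ** (A ** E' - h ** E - perp A ** E) = perp A" using I by simp
  have 1: "perp A ** E = - perp A"
    using pI by (simp only: mm.diff_right p ph') (simp add: minus_equation_iff[of "perp A ** E"])
  have aI: "A ** (A ** E' - h ** E - perp A ** E) = A" using I by simp
  have 2: "A ** E' = A + h ** E"
    using aI by (simp only: mm.diff_right[of A] p ph') (simp add: algebra_simps)
  have "A ** M = A ** E" unfolding M by (simp only: mm.add_right p) simp
  then show "e 0 \<rho> ** K = A ** M - perp A"
    using 1 by (simp add: mm.diff_left E_def[symmetric] algebra_simps)
  have hM: "h ** M = h ** E" unfolding M by (simp only: mm.add_right ph') simp
  have "perp A ** M = perp A ** E'" unfolding M by (simp only: mm.add_right p) simp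
  then have "(perp A + h) ** M + A = perp A ** E' + (A + h ** E)" by (simp add: mm.add_left[of "perp A"] hM)
  also have "\<dots> = perp A ** E' + A ** E'" by (simp only: 2)
  also have "\<dots> = E'" by (simp add: mm.diff_left)
  finally show "dx (\<lambda>x. e x \<rho>) 0 ** K = (perp A + h) ** M + A" by (simp add: E'_def)
qed

context sl_pair begin

lemma weyl_solution_eq:
  assumes "nonsing \<rho>"
  shows "W.\<Phi>N \<rho> x = (\<phi> x (\<rho>\<^sup>2) ** M \<rho> + S (\<rho>\<^sup>2) x) ** bscl A \<rho>"
proof -
  define K where "K = matrix_inv (bc A h (\<lambda>x. e x \<rho>))"
  have \<rho>: "\<rho> \<in> Omega" and det: "det (bc A h (\<lambda>x. e x \<rho>)) \<noteq> 0" using assms by (auto simp: nonsing_def)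
  note p = projection_h_simps[OF prob]
  note init = weyl_solution_initial[of A h e \<rho>, OF p(1-3) det, folded K_def]
  have e: "sl_solution Q (\<rho>\<^sup>2) (\<lambda>t. e t \<rho>)" using jost[OF \<rho>] by (simp add: jost_solution_def)
  have f: "sl_solution Q (\<rho>\<^sup>2) (\<lambda>t. \<phi> t (\<rho>\<^sup>2))" "\<phi> 0 (\<rho>\<^sup>2) = A" "dx (\<lambda>t. \<phi> t (\<rho>\<^sup>2)) 0 = perp A + h"
    using reg by (auto simp: regular_solution_def)
  note eK = sl_solution_mult_right[OF e, where C = K] and fM = sl_solution_mult_right[OF f(1), where C = "M \<rho>"]
  note d1 = sl_solution_diff[OF eK(1) fM(1)]
  note d2 = sl_solution_diff[OF d1(1) S(1)]
  have "e x \<rho> ** K - \<phi> x (\<rho>\<^sup>2) ** M \<rho> - S (\<rho>\<^sup>2) x = 0"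
  proof (rule P.ivp_zero[OF d2(1) _ _ x])
    show "e 0 \<rho> ** K - \<phi> 0 (\<rho>\<^sup>2) ** M \<rho> - S (\<rho>\<^sup>2) 0 = 0" by (simp add: init(1) f S)
    show "dx (\<lambda>t. e t \<rho> ** K - \<phi> t (\<rho>\<^sup>2) ** M \<rho> - S (\<rho>\<^sup>2) t) 0 = 0"
      using d2(2)[of 0] d1(2)[of 0] eK(2)[of 0] fM(2)[of 0] by (simp add: init(2) f S)
  qed
  then have "e x \<rho> ** K = \<phi> x (\<rho>\<^sup>2) ** M \<rho> + S (\<rho>\<^sup>2) x" by (simp add: algebra_simps)
  then show ?thesis by (simp add: W.\<Phi>N_def W.X_def W.J_def K_def matrix_mul_assoc)
qed

text \<open>
  Constant in \<open>t\<close> for two solutions with the same spectral parameter.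
\<close>

definition br :: "(real \<Rightarrow> complex^'n^'n) \<Rightarrow> (real \<Rightarrow> complex^'n^'n) \<Rightarrow> real \<Rightarrow> complex^'n^'n" where
  "br Z Y t = dx Z t ** Y t - Z t ** dx Y t"

lemma br_const:
  assumes "sl_solution_dual Q1 \<mu> Z" "sl_solution Q1 \<mu> Y"
  shows "br Z Y x = br Z Y 0"
proof -
  have "((\<lambda>t. 0) has_integral br Z Y x - br Z Y 0) {0..x}"
    using P1.wronskian[OF assms x] by (simp add: br_def)
  from has_integral_unique[OF this has_integral_0] show ?thesis by simp
qed

lemma br_mult_right:
  assumes "sl_solution Q1 \<mu> Y" "0 \<le> t"
  shows "br Z (\<lambda>t. Y t ** C) t = br Z Y t ** C"
  by (simp add: br_def sl_solution_mult_right[OF assms(1)] assms(2) mm.diff_left matrix_mul_assoc)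

lemma \<phi>1_solution: "sl_solution Q1 \<mu> (\<lambda>t. \<phi>1 t \<mu>)" "\<phi>1 0 \<mu> = A" "dx (\<lambda>t. \<phi>1 t \<mu>) 0 = perp A + h1"
  using reg1 by (auto simp: regular_solution_def)

lemma br_regular:
  "br (Ss \<mu>) (\<lambda>t. \<phi>1 t \<mu>) x = mat 1" "br (\<lambda>t. \<phi>s1 t \<mu>) (\<lambda>t. \<phi>1 t \<mu>) x = 0"
proof -
  note p = projection_h_simps[OF prob1]
  show "br (Ss \<mu>) (\<lambda>t. \<phi>1 t \<mu>) x = mat 1"
    unfolding br_const[OF Ss(1) \<phi>1_solution(1)]
    by (simp only: br_def Ss \<phi>1_solution p mm.add_right mm.minus_left projection_simps[OF AA]) simp
  show "br (\<lambda>t. \<phi>s1 t \<mu>) (\<lambda>t. \<phi>1 t \<mu>) x = 0"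
    unfolding br_const[OF regs1_solution(1) \<phi>1_solution(1)]
    by (simp add: br_def regs1_solution \<phi>1_solution p mm.add_right mm.add_left projection_simps[OF AA])
qed

lemma br_weyl:
  assumes "nonsing \<rho>"
  shows "br (Ss (\<rho>\<^sup>2)) (W1.\<Phi>N \<rho>) x = M1 \<rho> ** bscl A \<rho>" "br (\<lambda>t. \<phi>s1 t (\<rho>\<^sup>2)) (W1.\<Phi>N \<rho>) x = - bscl A \<rho>"
proof -
  define K where "K = matrix_inv (bc A h1 (\<lambda>x. e1 x \<rho>))"
  have \<rho>: "\<rho> \<in> Omega" and det: "det (bc A h1 (\<lambda>x. e1 x \<rho>)) \<noteq> 0" using assms by (auto simp: nonsing_def)
  note p = projection_h_simps[OF prob1]
  note q = projection_simps[OF AA]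
  have ph': "perp A ** (h1 ** Y) = 0" "h1 ** (perp A ** Y) = 0" "A ** (h1 ** Y) = h1 ** Y" "h1 ** (A ** Y) = h1 ** Y" for Y :: "complex^'n^'n"
    by (simp_all only: matrix_mul_assoc p mm.zero_left)
  note init = weyl_solution_initial[of A h1 e1 \<rho>, OF p(1-3) det, folded K_def]
  have e: "sl_solution Q1 (\<rho>\<^sup>2) (\<lambda>t. e1 t \<rho>)" using jost1[OF \<rho>] by (simp add: jost_solution_def)
  note eK = sl_solution_mult_right[OF e, where C = K]
  have \<Phi>: "W1.\<Phi>N \<rho> = (\<lambda>t. (e1 t \<rho> ** K) ** bscl A \<rho>)"
    by (simp add: W1.\<Phi>N_def[abs_def] W1.X_def W1.J_def K_def matrix_mul_assoc)
  have "br (Ss (\<rho>\<^sup>2)) (\<lambda>t. e1 t \<rho> ** K) x = M1 \<rho>"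
    unfolding br_const[OF Ss(1) eK(1)]
    by (simp only: br_def eK(2) order_refl init Ss mm.diff_right mm.add_right mm.add_left mm.minus_left
        p q ph' matrix_mul_assoc[symmetric]) (simp add: mm.diff_left)
  then show "br (Ss (\<rho>\<^sup>2)) (W1.\<Phi>N \<rho>) x = M1 \<rho> ** bscl A \<rho>"
    unfolding \<Phi> by (simp add: br_mult_right[OF eK(1) x])
  have "br (\<lambda>t. \<phi>s1 t (\<rho>\<^sup>2)) (\<lambda>t. e1 t \<rho> ** K) x = - mat 1"
    unfolding br_const[OF regs1_solution(1) eK(1)]
    by (simp only: br_def eK(2) order_refl init regs1_solution mm.diff_right mm.add_right mm.add_left[of "perp A"] mm.add_left[of "perp A ** _"]
        p q ph' matrix_mul_assoc[symmetric]) simp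
  then show "br (\<lambda>t. \<phi>s1 t (\<rho>\<^sup>2)) (W1.\<Phi>N \<rho>) x = - bscl A \<rho>"
    unfolding \<Phi> by (simp add: br_mult_right[OF eK(1) x] mm.minus_left)
qed

text \<open>
  The first row of the matrix that maps \<open>(Y, Y')\<close> at \<open>x\<close>, for \<open>Y\<close> the regular and the Weyl solution
  of the problem with tilde, to the corresponding values for the other problem. The pairings with
  \<open>Ss\<close> and \<open>\<phi>s1\<close> read off the coefficients of \<open>Y\<close> in the fundamental system, which is why the inverse
  of a fundamental matrix appears here in terms of dual solutions.
\<close>

definition P11 :: "complex \<Rightarrow> complex^'n^'n" where
  "P11 \<rho> = \<phi> x (\<rho>\<^sup>2) ** dx (Ss (\<rho>\<^sup>2)) x - (S (\<rho>\<^sup>2) x + \<phi> x (\<rho>\<^sup>2) ** Mhat \<rho>) ** dx (\<lambda>t. \<phi>s1 t (\<rho>\<^sup>2)) x"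

definition P12 :: "complex \<Rightarrow> complex^'n^'n" where
  "P12 \<rho> = (S (\<rho>\<^sup>2) x + \<phi> x (\<rho>\<^sup>2) ** Mhat \<rho>) ** \<phi>s1 x (\<rho>\<^sup>2) - \<phi> x (\<rho>\<^sup>2) ** Ss (\<rho>\<^sup>2) x"

lemma transfer_apply:
  "P11 \<rho> ** Y x + P12 \<rho> ** dx Y x =
   \<phi> x (\<rho>\<^sup>2) ** br (Ss (\<rho>\<^sup>2)) Y x - (S (\<rho>\<^sup>2) x + \<phi> x (\<rho>\<^sup>2) ** Mhat \<rho>) ** br (\<lambda>t. \<phi>s1 t (\<rho>\<^sup>2)) Y x"
  unfolding P11_def P12_def br_def mm.diff_left mm.diff_right matrix_mul_assoc by simp

lemma transfer_regular: "P11 \<rho> ** P1.\<phi>N \<rho> x + P12 \<rho> ** dx (P1.\<phi>N \<rho>) x = P.\<phi>N \<rho> x"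
proof -
  have "br (Ss (\<rho>\<^sup>2)) (P1.\<phi>N \<rho>) x = scl A \<rho>" "br (\<lambda>t. \<phi>s1 t (\<rho>\<^sup>2)) (P1.\<phi>N \<rho>) x = 0"
    unfolding P1.\<phi>N_def[abs_def] br_mult_right[OF \<phi>1_solution(1) x] br_regular by simp_all
  then show ?thesis by (simp add: transfer_apply P.\<phi>N_def)
qed

lemma transfer_weyl:
  assumes "nonsing \<rho>"
  shows "P11 \<rho> ** W1.\<Phi>N \<rho> x + P12 \<rho> ** dx (W1.\<Phi>N \<rho>) x = W.\<Phi>N \<rho> x"
  unfolding transfer_apply br_weyl[OF assms] weyl_solution_eq[OF assms]
  by (simp add: mm.add_left mm.diff_right mm.diff_left mm.minus_right matrix_mul_assoc)

text \<open>
  \<open>R\<^sub>1, R\<^sub>2\<close> express the row \<open>(P\<^sub>1\<^sub>1 - I, P\<^sub>1\<^sub>2)\<close> in the coordinates \<open>Y' \<plusminus> i\<rho>Y\<close>. The solutions of the two problems have the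
  same leading terms, so the linear system for \<open>R\<^sub>1, R\<^sub>2\<close> has bounded right-hand sides, whereas its
  coefficients have order \<open>\<rho>\<close>.
\<close>

lemma transfer_asymptotics:
  "grows (-1) (\<lambda>\<rho>. P11 \<rho> - mat 1)" "grows (-1) (\<lambda>\<rho>. \<rho> \<odot> P12 \<rho>)"
proof -
  define R1 where "R1 \<rho> = P11 \<rho> + (\<i> * \<rho>) \<odot> P12 \<rho> - mat 1" for \<rho>
  define R2 where "R2 \<rho> = (\<i> * \<rho>) \<odot> P12 \<rho> - P11 \<rho> + mat 1" for \<rho>
  let ?E = "\<lambda>\<rho>. exp (\<i> * \<rho> * of_real x)" and ?E' = "\<lambda>\<rho>. exp (- (\<i> * \<rho> * of_real x))"
  let ?E2 = "\<lambda>\<rho>. exp (2 * (\<i> * \<rho> * of_real x))" and ?E2' = "\<lambda>\<rho>. exp (- (2 * (\<i> * \<rho> * of_real x)))"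
  have key: "R1 \<rho> ** (?E \<rho> \<odot> wave \<rho> V x) + R2 \<rho> ** (?E' \<rho> \<odot> wave (-\<rho>) V x) =
      (?E \<rho> \<odot> wave \<rho> Y x - ?E' \<rho> \<odot> wave (-\<rho>) Y x) - (?E \<rho> \<odot> wave \<rho> V x - ?E' \<rho> \<odot> wave (-\<rho>) V x)"
    if "P11 \<rho> ** V x + P12 \<rho> ** dx V x = Y x" for \<rho> and Y V :: "real \<Rightarrow> complex^'n^'n"
  proof -
    let ?u = "?E \<rho> \<odot> wave \<rho> V x" and ?w = "?E' \<rho> \<odot> wave (-\<rho>) V x"
    have u: "?u = dx V x + (\<i> * \<rho>) \<odot> V x" and w: "?w = dx V x - (\<i> * \<rho>) \<odot> V x"
      by (simp_all add: wave_def cscale_cscale exp_add[symmetric] cs.minus_left)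
    have "R1 \<rho> ** ?u + R2 \<rho> ** ?w = (2 * \<i> * \<rho>) \<odot> (P11 \<rho> ** V x + P12 \<rho> ** dx V x) - (2 * \<i> * \<rho>) \<odot> V x"
      unfolding u w R1_def R2_def
      by (simp add: mat_normal vec_eq_iff algebra_simps)
    also have "\<dots> = (2 * \<i> * \<rho>) \<odot> Y x - (2 * \<i> * \<rho>) \<odot> V x" by (simp only: that)
    finally show ?thesis by (simp only: from_waves(1))
  qed
  have e: "?E \<rho> * ?E \<rho> = ?E2 \<rho>" "?E' \<rho> * ?E' \<rho> = ?E2' \<rho>" "?E \<rho> * ?E' \<rho> = 1" "?E' \<rho> * ?E \<rho> = 1" for \<rho>
  proof -
    show "?E \<rho> * ?E \<rho> = ?E2 \<rho>" "?E' \<rho> * ?E' \<rho> = ?E2' \<rho>"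
      by (simp_all only: mult_2 minus_add_distrib exp_add)
    show "?E \<rho> * ?E' \<rho> = 1" "?E' \<rho> * ?E \<rho> = 1" by (simp_all add: exp_minus)
  qed
  \<comment> \<open>The regular solution grows like \<open>e\<^sup>-\<^sup>i\<^sup>\<rho>\<^sup>x\<close> and the Weyl solution decays like \<open>e\<^sup>i\<^sup>\<rho>\<^sup>x\<close>; the inverse factors make the coefficients of the system comparable.\<close>
  have "R1 \<rho> ** (?E2 \<rho> \<odot> wave \<rho> (P1.\<phi>N \<rho>) x) + R2 \<rho> ** wave (-\<rho>) (P1.\<phi>N \<rho>) x =
      (?E2 \<rho> \<odot> wave \<rho> (P.\<phi>N \<rho>) x - ?E2 \<rho> \<odot> wave \<rho> (P1.\<phi>N \<rho>) x) - (wave (-\<rho>) (P.\<phi>N \<rho>) x - wave (-\<rho>) (P1.\<phi>N \<rho>) x)" for \<rho>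
  proof -
    have "?E \<rho> \<odot> (R1 \<rho> ** (?E \<rho> \<odot> wave \<rho> (P1.\<phi>N \<rho>) x) + R2 \<rho> ** (?E' \<rho> \<odot> wave (-\<rho>) (P1.\<phi>N \<rho>) x)) =
      ?E \<rho> \<odot> ((?E \<rho> \<odot> wave \<rho> (P.\<phi>N \<rho>) x - ?E' \<rho> \<odot> wave (-\<rho>) (P.\<phi>N \<rho>) x) -
        (?E \<rho> \<odot> wave \<rho> (P1.\<phi>N \<rho>) x - ?E' \<rho> \<odot> wave (-\<rho>) (P1.\<phi>N \<rho>) x))"
      by (simp only: key[where Y = "P.\<phi>N \<rho>" and V = "P1.\<phi>N \<rho>" and \<rho> = \<rho>, OF transfer_regular])
    then show ?thesis
      by (simp only: cs.add_right cs.diff_right cscale_mult_right cscale_cscale e cscale_1) (simp only: algebra_simps)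
  qed
  note eq1 = this
  have eq2: "R1 \<rho> ** wave \<rho> (W1.\<Phi>N \<rho>) x + R2 \<rho> ** (?E2' \<rho> \<odot> wave (-\<rho>) (W1.\<Phi>N \<rho>) x) =
      (wave \<rho> (W.\<Phi>N \<rho>) x - wave \<rho> (W1.\<Phi>N \<rho>) x) - (?E2' \<rho> \<odot> wave (-\<rho>) (W.\<Phi>N \<rho>) x - ?E2' \<rho> \<odot> wave (-\<rho>) (W1.\<Phi>N \<rho>) x)"
    if "nonsing \<rho>" for \<rho>
  proof -
    have "?E' \<rho> \<odot> (R1 \<rho> ** (?E \<rho> \<odot> wave \<rho> (W1.\<Phi>N \<rho>) x) + R2 \<rho> ** (?E' \<rho> \<odot> wave (-\<rho>) (W1.\<Phi>N \<rho>) x)) =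
      ?E' \<rho> \<odot> ((?E \<rho> \<odot> wave \<rho> (W.\<Phi>N \<rho>) x - ?E' \<rho> \<odot> wave (-\<rho>) (W.\<Phi>N \<rho>) x) -
        (?E \<rho> \<odot> wave \<rho> (W1.\<Phi>N \<rho>) x - ?E' \<rho> \<odot> wave (-\<rho>) (W1.\<Phi>N \<rho>) x))"
      by (simp only: key[where Y = "W.\<Phi>N \<rho>" and V = "W1.\<Phi>N \<rho>" and \<rho> = \<rho>, OF transfer_weyl[OF that]])
    then show ?thesis
      by (simp only: cs.add_right cs.diff_right cscale_mult_right cscale_cscale e cscale_1) (simp only: algebra_simps)
  qed
  have diff: "grows 0 (\<lambda>\<rho>. f \<rho> - g \<rho>)" if "grows 0 (\<lambda>\<rho>. f \<rho> - l \<rho>)" "grows 0 (\<lambda>\<rho>. g \<rho> - l \<rho>)"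
    for f g l :: "complex \<Rightarrow> complex^'n^'n"
    using grows_diff[OF that] by simp
  note a = P.scaled_asymptotics[OF x] and a1 = P1.scaled_asymptotics[OF x]
  note w = W.weyl_wave_orders[OF x] and w1 = W1.weyl_wave_orders[OF x]
  have d1: "grows 0 (\<lambda>\<rho>. (?E2 \<rho> \<odot> wave \<rho> (P.\<phi>N \<rho>) x - ?E2 \<rho> \<odot> wave \<rho> (P1.\<phi>N \<rho>) x) - (wave (-\<rho>) (P.\<phi>N \<rho>) x - wave (-\<rho>) (P1.\<phi>N \<rho>) x))"
    by (rule grows_diff[OF diff[OF a(2) a1(2)] diff[OF a(1) a1(1)]])
  have d2: "grows 0 (\<lambda>\<rho>. (wave \<rho> (W.\<Phi>N \<rho>) x - wave \<rho> (W1.\<Phi>N \<rho>) x) - (?E2' \<rho> \<odot> wave (-\<rho>) (W.\<Phi>N \<rho>) x - ?E2' \<rho> \<odot> wave (-\<rho>) (W1.\<Phi>N \<rho>) x))"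
    by (rule grows_diff[OF diff[OF w(1) w1(1)] grows_diff[OF w(2) w1(2)]])
  have R: "grows (-1) R1" "grows (-1) R2"
    using triangular_system_order[OF AA always_eventually eventually_mono[OF eventually_nonsing eq2]
        P1.scaled_orders(2)[OF x] a1(1) w1(1) w1(2) d1 d2] eq1 by auto
  have "(1/2) \<odot> (R1 \<rho> - R2 \<rho>) = P11 \<rho> - mat 1" "(1 / (2 * \<i>)) \<odot> (R1 \<rho> + R2 \<rho>) = \<rho> \<odot> P12 \<rho>" for \<rho>
    by (simp_all add: R1_def R2_def vec_eq_iff algebra_simps)
  then show "grows (-1) (\<lambda>\<rho>. P11 \<rho> - mat 1)" "grows (-1) (\<lambda>\<rho>. \<rho> \<odot> P12 \<rho>)"
    using grows_cs[OF grows_const[of "1/2"] grows_diff[OF R]] grows_cs[OF grows_const[of "1/(2*\<i>)"] grows_add[OF R]] by simp_all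
qed

definition D :: "complex \<Rightarrow> complex^'n^'n" where "D \<mu> = kernel_D \<phi>s1 \<phi>1 x lam \<mu>"

text \<open>
  The integrand of the contour integral. Multiplied by \<open>\<rho>\<^sup>2 - \<lambda>\<close> it splits into \<open>G\<close>, which has a limit at
  infinity, and \<open>E\<close>, which is a function of \<open>\<rho>\<^sup>2\<close> without singularities.
\<close>

definition F :: "complex \<Rightarrow> complex^'n^'n" where
  "F \<rho> = \<phi> x (\<rho>\<^sup>2) ** (Mhat \<rho> ** D (\<rho>\<^sup>2))"

definition E :: "complex \<Rightarrow> complex^'n^'n" where
  "E \<mu> = \<phi> x \<mu> ** br (Ss \<mu>) (\<lambda>t. \<phi>1 t lam) x - S \<mu> x ** br (\<lambda>t. \<phi>s1 t \<mu>) (\<lambda>t. \<phi>1 t lam) x"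

definition G :: "complex \<Rightarrow> complex^'n^'n" where
  "G \<rho> = P11 \<rho> ** \<phi>1 x lam + P12 \<rho> ** dx (\<lambda>t. \<phi>1 t lam) x"

lemma br_D: "br (\<lambda>t. \<phi>s1 t \<mu>) (\<lambda>t. \<phi>1 t lam) x = (lam - \<mu>) \<odot> D \<mu>"
proof -
  have c: "continuous_on {0..x} (\<lambda>t. \<phi>s1 t \<mu> ** \<phi>1 t lam)"
    using regs1_solution(1) sl_continuous[OF \<phi>1_solution(1)]
    by (intro mm.continuous_on continuous_on_subset[of "{0..}" _ "{0..x}"])
      (auto simp: sl_solution_dual_def intro: differentiable_imp_continuous_on)
  note p = projection_h_simps[OF prob1]
  have "br (\<lambda>t. \<phi>s1 t \<mu>) (\<lambda>t. \<phi>1 t lam) 0 = 0"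
    by (simp add: br_def regs1_solution \<phi>1_solution p mm.add_right mm.add_left projection_simps[OF AA])
  then have "((\<lambda>t. (lam - \<mu>) \<odot> (\<phi>s1 t \<mu> ** \<phi>1 t lam)) has_integral br (\<lambda>t. \<phi>s1 t \<mu>) (\<lambda>t. \<phi>1 t lam) x) {0..x}"
    using P1.wronskian[OF regs1_solution(1)[of \<mu>] \<phi>1_solution(1)[of lam] x] by (simp add: br_def)
  moreover have "((\<lambda>t. (lam - \<mu>) \<odot> (\<phi>s1 t \<mu> ** \<phi>1 t lam)) has_integral (lam - \<mu>) \<odot> D \<mu>) {0..x}"
    using has_integral_linear[OF integrable_integral[OF integrable_continuous_real[OF c]] cs.bounded_linear_right]
    by (simp add: o_def D_def kernel_D_def)
  ultimately show ?thesis by (rule has_integral_unique)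
qed

text \<open>
  The terms of \<open>G\<close> that do not contain \<open>M - M~\<close> are exactly those of \<open>E\<close>, and the pairing that remains is
  \<open>(\<lambda> - \<rho>\<^sup>2) D\<close>.
\<close>

lemma F_G_E: "(\<rho>\<^sup>2 - lam) \<odot> F \<rho> = G \<rho> - E (\<rho>\<^sup>2)"
proof -
  have "G \<rho> - E (\<rho>\<^sup>2) = - (\<phi> x (\<rho>\<^sup>2) ** Mhat \<rho> ** br (\<lambda>t. \<phi>s1 t (\<rho>\<^sup>2)) (\<lambda>t. \<phi>1 t lam) x)"
    unfolding G_def E_def using transfer_apply[of \<rho> "\<lambda>t. \<phi>1 t lam"] by (simp add: mm.add_left)
  also have "\<dots> = (\<rho>\<^sup>2 - lam) \<odot> F \<rho>"
    by (simp add: br_D F_def cscale_mult_right matrix_mul_assoc cs.diff_left mm.diff_right)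
  finally show ?thesis by simp
qed

lemma E_lam: "E lam = \<phi> x lam"
  by (simp add: E_def br_regular)

lemma G_asymptotics: "grows (-1) (\<lambda>\<rho>. G \<rho> - \<phi>1 x lam)"
proof -
  have "grows (-1) (\<lambda>\<rho>. P12 \<rho>)"
  proof -
    have "grows (-1) (\<lambda>\<rho>. (1 / \<rho>) \<odot> (\<rho> \<odot> P12 \<rho>))"
      using grows_mono[OF grows_cs[OF grows_inverse transfer_asymptotics(2)], of "-1"] by simp
    then show ?thesis
      by (rule grows_cong) (rule eventually_mono[OF W.eventually_nz], simp add: cscale_cscale)
  qed
  from grows_add[OF grows_mm[OF transfer_asymptotics(1) grows_const[of "\<phi>1 x lam"], simplified]
      grows_mm[OF this grows_const[of "dx (\<lambda>t. \<phi>1 t lam) x"], simplified]]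
  show ?thesis by (simp add: G_def mm.diff_left algebra_simps)
qed

end

section \<open>Analyticity and decay of the integrand\<close>

definition mholo :: "(complex \<Rightarrow> complex^'n^'n) \<Rightarrow> complex set \<Rightarrow> bool" where
  "mholo F T \<longleftrightarrow> (\<forall>i j. (\<lambda>z. F z $ i $ j) holomorphic_on T)"

lemma mholo_const: "mholo (\<lambda>z. c) T" by (simp add: mholo_def)

lemma mholo_add: "mholo F T \<Longrightarrow> mholo G T \<Longrightarrow> mholo (\<lambda>z. F z + G z) T"
  by (simp add: mholo_def holomorphic_on_add)

lemma mholo_diff: "mholo F T \<Longrightarrow> mholo G T \<Longrightarrow> mholo (\<lambda>z. F z - G z) T"
  by (simp add: mholo_def holomorphic_on_diff)

lemma mholo_mult: "mholo F T \<Longrightarrow> mholo G T \<Longrightarrow> mholo (\<lambda>z. F z ** G z) T"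
  unfolding mholo_def matrix_matrix_mult_def
  by (auto intro!: holomorphic_on_sum holomorphic_on_mult)

lemma mholo_subset: "mholo F T \<Longrightarrow> T' \<subseteq> T \<Longrightarrow> mholo F T'"
  unfolding mholo_def using holomorphic_on_subset by blast

lemma mholo_square: "mholo F UNIV \<Longrightarrow> mholo (\<lambda>\<rho>. F (\<rho>\<^sup>2)) T"
proof -
  assume F: "mholo F UNIV"
  have "(\<lambda>\<rho>. F (\<rho>\<^sup>2) $ i $ j) holomorphic_on T" for i j
  proof -
    have "((\<lambda>z. F z $ i $ j) \<circ> (\<lambda>\<rho>. \<rho>\<^sup>2)) holomorphic_on T"
      by (rule holomorphic_on_compose[OF _ holomorphic_on_subset[of _ UNIV]])
        (use F in \<open>auto simp: mholo_def intro!: holomorphic_intros\<close>)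
    then show ?thesis by (simp add: o_def)
  qed
  then show ?thesis by (simp add: mholo_def)
qed

lemma mholo_continuous: "mholo F T \<Longrightarrow> continuous_on T F"
  by (rule continuous_on_matrix_entries) (simp add: mholo_def holomorphic_on_imp_continuous_on)

lemma matrix_inv_nth:
  assumes "det (B :: complex^'n^'n) \<noteq> 0"
  shows "matrix_inv B $ i $ j = det (\<chi> r c. if c = i then axis j 1 $ r else B $ r $ c) / det B"
proof -
  have "B ** matrix_inv B = mat 1" using assms by (simp add: matrix_inv_inverse invertible_det_nz)
  then have "B *v column j (matrix_inv B) = axis j 1"
    by (simp add: vec_eq_iff matrix_matrix_mult_def matrix_vector_mult_def column_def mat_def axis_def)
  then have "column j (matrix_inv B) = (\<chi> k. det (\<chi> r c. if c = k then axis j 1 $ r else B $ r $ c) / det B)"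
    using cramer[OF assms] by blast
  then have "column j (matrix_inv B) $ i = det (\<chi> r c. if c = i then axis j 1 $ r else B $ r $ c) / det B" by simp
  then show ?thesis by (simp add: column_def)
qed

lemma det_holomorphic: "mholo F T \<Longrightarrow> (\<lambda>z. det (F z)) holomorphic_on T"
  unfolding det_def mholo_def by (intro holomorphic_on_sum holomorphic_on_mult holomorphic_on_prod holomorphic_on_const) auto

lemma det_continuous:
  fixes F :: "'a::topological_space \<Rightarrow> complex^'n^'n"
  assumes "continuous_on T F"
  shows "continuous_on T (\<lambda>z. det (F z))"
proof -
  have e: "continuous_on T (\<lambda>z. F z $ i $ j)" for i j
    by (rule bounded_linear.continuous_on[OF bounded_linear_entry assms])
  show ?thesis unfolding det_def
    by (intro continuous_on_sum continuous_on_mult continuous_on_prod continuous_on_const e)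
qed

lemma mholo_matrix_inv:
  fixes F :: "complex \<Rightarrow> complex^'n^'n"
  assumes F: "mholo F T" and nz: "\<And>z. z \<in> T \<Longrightarrow> det (F z) \<noteq> 0"
  shows "mholo (\<lambda>z. matrix_inv (F z)) T"
  unfolding mholo_def
proof (intro allI)
  fix i j :: 'n
  have "mholo (\<lambda>z. \<chi> r c. if c = i then axis j 1 $ r else F z $ r $ c) T"
    unfolding mholo_def
  proof (intro allI)
    fix r c show "(\<lambda>z. (\<chi> r c. if c = i then axis j 1 $ r else F z $ r $ c) $ r $ c) holomorphic_on T"
      using F by (cases "c = i") (auto simp: mholo_def)
  qed
  then have "(\<lambda>z. det (\<chi> r c. if c = i then axis j 1 $ r else F z $ r $ c) / det (F z)) holomorphic_on T"
    by (intro holomorphic_on_divide det_holomorphic F nz)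
  then show "(\<lambda>z. matrix_inv (F z) $ i $ j) holomorphic_on T"
    by (rule holomorphic_transform) (simp add: matrix_inv_nth nz)
qed

lemma matrix_inv_continuous:
  fixes F :: "'a::topological_space \<Rightarrow> complex^'n^'n"
  assumes F: "continuous_on T F" and nz: "\<And>z. z \<in> T \<Longrightarrow> det (F z) \<noteq> 0"
  shows "continuous_on T (\<lambda>z. matrix_inv (F z))"
proof (rule continuous_on_matrix_entries)
  fix i j :: 'n
  have e: "continuous_on T (\<lambda>z. F z $ i $ j)" for i j
    by (rule bounded_linear.continuous_on[OF bounded_linear_entry F])
  have "continuous_on T (\<lambda>z. \<chi> r c. if c = i then axis j 1 $ r else F z $ r $ c)"
  proof (rule continuous_on_matrix_entries)
    fix r c show "continuous_on T (\<lambda>z. (\<chi> r c. if c = i then axis j 1 $ r else F z $ r $ c) $ r $ c)"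
      using e by (cases "c = i") auto
  qed
  then have "continuous_on T (\<lambda>z. det (\<chi> r c. if c = i then axis j 1 $ r else F z $ r $ c) / det (F z))"
    using nz by (intro continuous_on_divide det_continuous F) auto
  then show "continuous_on T (\<lambda>z. matrix_inv (F z) $ i $ j)"
    by (rule continuous_on_eq) (simp add: matrix_inv_nth nz)
qed

context jost_family begin

lemma initial_continuous: "continuous_on Omega (e 0)" "continuous_on Omega (\<lambda>\<rho>. dx (\<lambda>t. e t \<rho>) 0)"
  by (rule continuous_on_matrix_entries, rule jost_initial_analytic)+

lemma initial_mholo: "mholo (e 0) {\<rho>. 0 < Im \<rho>}" "mholo (\<lambda>\<rho>. dx (\<lambda>t. e t \<rho>) 0) {\<rho>. 0 < Im \<rho>}"
  unfolding mholo_def using jost_initial_analytic by auto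

lemma bc_continuous: "continuous_on Omega (\<lambda>\<rho>. bc A h (\<lambda>x. e x \<rho>))"
  unfolding bc_def by (intro continuous_on_diff mm.continuous_on continuous_on_const initial_continuous)

lemma bc_mholo: "mholo (\<lambda>\<rho>. bc A h (\<lambda>x. e x \<rho>)) {\<rho>. 0 < Im \<rho>}"
  unfolding bc_def by (intro mholo_diff mholo_mult mholo_const initial_mholo)

lemma weyl_continuous:
  assumes "T \<subseteq> Omega" "\<And>\<rho>. \<rho> \<in> T \<Longrightarrow> det (bc A h (\<lambda>x. e x \<rho>)) \<noteq> 0"
  shows "continuous_on T (weyl A h e)"
  unfolding weyl_def
  by (intro mm.continuous_on continuous_on_add continuous_on_const matrix_inv_continuous
      continuous_on_subset[OF _ assms(1)] bc_continuous initial_continuous assms(2))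

lemma weyl_mholo:
  assumes "T \<subseteq> {\<rho>. 0 < Im \<rho>}" "\<And>\<rho>. \<rho> \<in> T \<Longrightarrow> det (bc A h (\<lambda>x. e x \<rho>)) \<noteq> 0"
  shows "mholo (weyl A h e) T"
  unfolding weyl_def
  by (intro mholo_mult mholo_add mholo_const mholo_matrix_inv mholo_subset[OF _ assms(1)]
      bc_mholo initial_mholo assms(2))

end

context sl_pair begin

lemma entire_solutions:
  "mholo (\<lambda>\<mu>. \<phi> x \<mu>) UNIV" "mholo (\<lambda>\<mu>. S \<mu> x) UNIV" "mholo (\<lambda>\<mu>. Ss \<mu> x) UNIV" "mholo (\<lambda>\<mu>. dx (Ss \<mu>) x) UNIV"
  "mholo (\<lambda>\<mu>. \<phi>s1 x \<mu>) UNIV" "mholo (\<lambda>\<mu>. dx (\<lambda>t. \<phi>s1 t \<mu>) x) UNIV"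
  unfolding mholo_def
  using P.regular_entire[OF x] P.ivp_entire[of S, OF S x] P1.dual_ivp_entire[of Ss, OF Ss x]
    P1.dual_ivp_entire[of "\<lambda>\<mu> t. \<phi>s1 t \<mu>", OF regs1_solution x] by auto

lemma E_entire: "mholo E UNIV"
  unfolding E_def br_def by (intro mholo_diff mholo_mult mholo_const entire_solutions)

lemma D_continuous_at: "isCont (\<lambda>\<mu>. D \<mu> $ i $ j) \<nu>"
proof -
  note t = P1.dual_transpose_properties[OF regs1_solution(1)]
  obtain C where C: "0 \<le> C" "\<And>t \<mu>. t \<in> {0..x} \<Longrightarrow> cmod (\<mu> - \<nu>) \<le> 1 \<Longrightarrow>
      norm (transpose (\<phi>s1 t \<mu>) - transpose (\<phi>s1 t \<nu>)) \<le> C * cmod (\<mu> - \<nu>)"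
    using DT.ivp_locally_lipschitz_parameter[of "\<lambda>\<mu> t. transpose (\<phi>s1 t \<mu>)" "transpose A" "transpose (perp A + h1)" x \<nu>]
      t regs1_solution by auto
  have c: "continuous_on {0..x} (\<lambda>t. \<phi>1 t lam)"
    by (rule continuous_on_subset[OF sl_continuous[OF \<phi>1_solution(1)]]) auto
  then have "bounded ((\<lambda>t. \<phi>1 t lam) ` {0..x})"
    using compact_Icc compact_continuous_image compact_imp_bounded by blast
  then obtain m where m: "\<forall>y\<in>(\<lambda>t. \<phi>1 t lam) ` {0..x}. norm y \<le> m" unfolding bounded_iff by blast
  have cs: "continuous_on {0..x} (\<lambda>t. \<phi>s1 t \<mu>)" for \<mu>
    using regs1_solution(1)[of \<mu>]
    by (auto simp: sl_solution_dual_def intro: differentiable_imp_continuous_on continuous_on_subset)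
  have int: "(\<lambda>t. \<phi>s1 t \<mu> ** \<phi>1 t lam) integrable_on {0..x}" for \<mu>
    by (intro integrable_continuous_real mm.continuous_on c cs)
  have bound: "norm (D \<mu> - D \<nu>) \<le> x * (C * m) * cmod (\<mu> - \<nu>)" if \<mu>: "cmod (\<mu> - \<nu>) \<le> 1" for \<mu>
  proof -
    have "((\<lambda>t. \<phi>s1 t \<mu> ** \<phi>1 t lam - \<phi>s1 t \<nu> ** \<phi>1 t lam) has_integral D \<mu> - D \<nu>) {0..x}"
      unfolding D_def kernel_D_def by (intro has_integral_diff integrable_integral int)
    moreover have "((\<lambda>t. C * cmod (\<mu> - \<nu>) * m) has_integral x * (C * cmod (\<mu> - \<nu>) * m)) {0..x}"
      using has_integral_const_real[of "C * cmod (\<mu> - \<nu>) * m" 0 x] x by simp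
    ultimately have "norm (D \<mu> - D \<nu>) \<le> x * (C * cmod (\<mu> - \<nu>) * m)"
    proof (rule has_integral_norm_le)
      fix t assume t: "t \<in> {0..x}"
      have "norm ((\<phi>s1 t \<mu> - \<phi>s1 t \<nu>) ** \<phi>1 t lam) \<le> (C * cmod (\<mu> - \<nu>)) * m"
      proof (intro order_trans[OF norm_matrix_mult_le] mult_mono)
        have "norm (\<phi>s1 t \<mu> - \<phi>s1 t \<nu>) = norm (transpose (\<phi>s1 t \<mu>) - transpose (\<phi>s1 t \<nu>))"
          by (simp add: norm_transpose flip: transpose_diff)
        then show "norm (\<phi>s1 t \<mu> - \<phi>s1 t \<nu>) \<le> C * cmod (\<mu> - \<nu>)" using C(2)[OF t \<mu>] by simp
      qed (use m t C in auto)
      then show "norm (\<phi>s1 t \<mu> ** \<phi>1 t lam - \<phi>s1 t \<nu> ** \<phi>1 t lam) \<le> C * cmod (\<mu> - \<nu>) * m"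
        by (simp add: mm.diff_left)
    qed
    then show ?thesis by (simp add: algebra_simps)
  qed
  show ?thesis unfolding isCont_def
  proof (rule LIM_zero_cancel, rule Lim_null_comparison)
    show "\<forall>\<^sub>F \<mu> in at \<nu>. norm (D \<mu> $ i $ j - D \<nu> $ i $ j) \<le> x * (C * m) * cmod (\<mu> - \<nu>)"
      unfolding eventually_at
    proof (intro exI[of _ 1] conjI ballI impI)
      fix \<mu> assume "\<mu> \<noteq> \<nu> \<and> dist \<mu> \<nu> < 1"
      then have "norm (D \<mu> - D \<nu>) \<le> x * (C * m) * cmod (\<mu> - \<nu>)" by (intro bound) (simp add: dist_norm)
      with norm_entry_le[of "D \<mu> - D \<nu>" i j]
      show "norm (D \<mu> $ i $ j - D \<nu> $ i $ j) \<le> x * (C * m) * cmod (\<mu> - \<nu>)" by simp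
    qed simp
    show "((\<lambda>\<mu>. x * (C * m) * cmod (\<mu> - \<nu>)) \<longlongrightarrow> 0) (at \<nu>)" by (auto intro!: tendsto_eq_intros)
  qed
qed

text \<open>
  Away from \<open>\<lambda>\<close> the kernel is a quotient of entire functions; continuity removes the singularity.
\<close>

lemma D_entire: "mholo D UNIV"
  unfolding mholo_def
proof (intro allI)
  fix i j
  let ?B = "\<lambda>\<mu>. br (\<lambda>t. \<phi>s1 t \<mu>) (\<lambda>t. \<phi>1 t lam) x"
  show "(\<lambda>\<mu>. D \<mu> $ i $ j) holomorphic_on UNIV"
  proof (rule no_isolated_singularity)
    show "continuous_on UNIV (\<lambda>\<mu>. D \<mu> $ i $ j)"
      by (rule continuous_at_imp_continuous_on) (simp add: D_continuous_at)
    have "mholo ?B (UNIV - {lam})"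
      unfolding br_def by (rule mholo_subset[of _ UNIV]) (auto intro!: mholo_diff mholo_mult mholo_const entire_solutions)
    then have "(\<lambda>\<mu>. ?B \<mu> $ i $ j / (lam - \<mu>)) holomorphic_on UNIV - {lam}"
      unfolding mholo_def by (intro holomorphic_intros) auto
    then show "(\<lambda>\<mu>. D \<mu> $ i $ j) holomorphic_on UNIV - {lam}"
      by (rule holomorphic_transform) (simp add: br_D)
  qed auto
qed

lemma F_continuous: "continuous_on {\<rho>. nonsing \<rho>} F"
  unfolding F_def
  by (intro mm.continuous_on continuous_on_diff W.weyl_continuous W1.weyl_continuous
      mholo_continuous mholo_square entire_solutions D_entire) (auto simp: nonsing_def)

lemma F_mholo: "mholo F {\<rho>. 0 < Im \<rho> \<and> nonsing \<rho>}"
  unfolding F_def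
  by (intro mholo_mult mholo_diff W.weyl_mholo W1.weyl_mholo mholo_square entire_solutions D_entire)
    (auto simp: nonsing_def)

lemma singular_closed: "closed ({\<rho> \<in> Omega. \<not> nonsing \<rho>} \<union> {0})"
proof -
  let ?d = "\<lambda>\<rho>. det (bc A h (\<lambda>x. e x \<rho>)) * det (bc A h1 (\<lambda>x. e1 x \<rho>))"
  have "continuous_on Omega ?d"
    by (intro continuous_intros det_continuous W.bc_continuous W1.bc_continuous)
  then have "closedin (top_of_set Omega) (Omega \<inter> ?d -` {0})"
    by (rule continuous_closedin_preimage) simp
  then obtain T where T: "closed T" "Omega \<inter> ?d -` {0} = Omega \<inter> T" by (auto simp: closedin_closed)
  have "{\<rho> \<in> Omega. \<not> nonsing \<rho>} = Omega \<inter> ?d -` {0}" by (auto simp: nonsing_def)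
  then have "{\<rho> \<in> Omega. \<not> nonsing \<rho>} \<union> {0} = ({\<rho>. 0 \<le> Im \<rho>} \<inter> T) \<union> {0}"
    unfolding T(2) by (auto simp: Omega_def)
  moreover have "closed (({\<rho>. 0 \<le> Im \<rho>} \<inter> T) \<union> {0})"
    by (intro closed_Un closed_Int T(1) closed_halfspace_Im_ge closed_singleton)
  ultimately show ?thesis by simp
qed

lemma bscl_inv_scl: "\<rho> \<noteq> 0 \<Longrightarrow> bscl_inv A \<rho> = (1 / (\<i> * \<rho>)) \<odot> ((A - \<i> \<odot> perp A) ** scl A \<rho>)"
  unfolding bscl_inv_def scl_def
  by (simp only: mm.diff_left mm.add_right cscale_mult_left cscale_mult_right projection_simps[OF AA] AA cscale_cscale)
     (simp add: cs.add_right cs.diff_right cscale_cscale)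

lemma dual_scaled:
  "DT.\<phi>N \<rho> t = transpose (scl A \<rho> ** \<phi>s1 t (\<rho>\<^sup>2))"
  "0 \<le> t \<Longrightarrow> dx (DT.\<phi>N \<rho>) t = transpose (scl A \<rho> ** dx (\<lambda>t. \<phi>s1 t (\<rho>\<^sup>2)) t)"
proof -
  have s: "scl (transpose A) \<rho> = transpose (scl A \<rho>)"
    by (simp add: scl_def vec_eq_iff transpose_def mat_def)
  show "DT.\<phi>N \<rho> t = transpose (scl A \<rho> ** \<phi>s1 t (\<rho>\<^sup>2))"
    by (simp add: DT.\<phi>N_def s matrix_transpose_mul)
  show "dx (DT.\<phi>N \<rho>) t = transpose (scl A \<rho> ** dx (\<lambda>t. \<phi>s1 t (\<rho>\<^sup>2)) t)" if "0 \<le> t"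
    using P1.dual_transpose_properties(2)[OF regs1_solution(1) that]
    by (simp add: DT.dx_\<phi>N[OF that] s matrix_transpose_mul)
qed

text \<open>
  Two of the three orders come from the denominator \<open>\<lambda> - \<rho>\<^sup>2\<close> of the kernel and one from the difference of the
  Weyl matrices. On the real axis the factor \<open>e\<^sup>2\<^sup>i\<^sup>\<rho>\<^sup>x\<close> has modulus \<open>1\<close>; there the integrand
  \<open>F d\<mu> = 2\<rho> F d\<rho>\<close> is \<open>O(\<rho>\<^sup>-\<^sup>2) d\<rho>\<close>.
\<close>

lemma F_decay: "grows (-3) (\<lambda>\<rho>. exp (2 * (\<i> * \<rho> * of_real x)) \<odot> F \<rho>)"
proof -
  let ?E = "\<lambda>\<rho>. exp (\<i> * \<rho> * of_real x)"
  let ?s = "\<lambda>\<rho>. \<phi>s1 x (\<rho>\<^sup>2)" and ?s' = "\<lambda>\<rho>. dx (\<lambda>t. \<phi>s1 t (\<rho>\<^sup>2)) x"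
  let ?b = "\<lambda>\<rho>. (lam - \<rho>\<^sup>2) \<odot> D (\<rho>\<^sup>2)"
  have "grows 0 (\<lambda>\<rho>. transpose (?E \<rho> \<odot> DT.\<phi>N \<rho> x))" "grows 1 (\<lambda>\<rho>. transpose (?E \<rho> \<odot> dx (DT.\<phi>N \<rho>) x))"
    unfolding grows_transpose using DT.scaled_asymptotics(3)[OF x] DT.scaled_orders(3)[OF x] by auto
  then have s: "grows 0 (\<lambda>\<rho>. ?E \<rho> \<odot> (scl A \<rho> ** ?s \<rho>))" "grows 1 (\<lambda>\<rho>. ?E \<rho> \<odot> (scl A \<rho> ** ?s' \<rho>))"
    by (simp_all add: transpose_cscale dual_scaled x transpose_transpose)
  have "grows 0 (\<lambda>\<rho>. (1 / (\<i> * \<rho>)) \<odot> ((A - \<i> \<odot> perp A) **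
      ((?E \<rho> \<odot> (scl A \<rho> ** ?s' \<rho>)) ** \<phi>1 x lam - (?E \<rho> \<odot> (scl A \<rho> ** ?s \<rho>)) ** dx (\<lambda>t. \<phi>1 t lam) x)))"
    using grows_cs[OF grows_irho grows_mm[OF grows_const[of "A - \<i> \<odot> perp A"] grows_diff[OF
        grows_mm[OF s(2) grows_const[of "\<phi>1 x lam"], simplified]
        grows_mono[OF grows_mm[OF s(1) grows_const[of "dx (\<lambda>t. \<phi>1 t lam) x"], simplified], of 1]]]] by simp
  then have b: "grows 0 (\<lambda>\<rho>. ?E \<rho> \<odot> (bscl_inv A \<rho> ** ?b \<rho>))"
  proof (rule grows_cong, intro eventually_mono[OF W.eventually_nz])
    fix \<rho> :: complex assume "\<rho> \<noteq> 0"
    then show "?E \<rho> \<odot> (bscl_inv A \<rho> ** ?b \<rho>) = (1 / (\<i> * \<rho>)) \<odot> ((A - \<i> \<odot> perp A) **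
      ((?E \<rho> \<odot> (scl A \<rho> ** ?s' \<rho>)) ** \<phi>1 x lam - (?E \<rho> \<odot> (scl A \<rho> ** ?s \<rho>)) ** dx (\<lambda>t. \<phi>1 t lam) x))"
      unfolding br_D[symmetric] br_def bscl_inv_scl[OF \<open>\<rho> \<noteq> 0\<close>]
      by (simp only: cscale_mult_left cscale_mult_right mm.diff_right cs.diff_right matrix_mul_assoc[symmetric] cscale_cscale mult.commute)
  qed
  have l: "grows (-2) (\<lambda>\<rho>. 1 / (lam - \<rho>\<^sup>2))"
  proof (rule growsI[of _ 2], rule eventually_mono[OF eventually_uhp_ge[of "max 1 (2 * cmod lam)"]])
    fix \<rho> :: complex assume \<rho>: "0 \<le> Im \<rho> \<and> max 1 (2 * cmod lam) \<le> cmod \<rho>"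
    then have r: "0 < cmod \<rho>" "cmod \<rho> * 1 \<le> cmod \<rho> * cmod \<rho>" by (linarith, intro mult_left_mono) auto
    have "cmod (\<rho>\<^sup>2) - cmod lam \<le> cmod (lam - \<rho>\<^sup>2)" using norm_triangle_ineq2[of "\<rho>\<^sup>2" lam] by (simp add: norm_minus_commute)
    moreover have "cmod \<rho> \<le> (cmod \<rho>)\<^sup>2" using r(2) by (simp only: power2_eq_square mult_1_right)
    then have "2 * cmod lam \<le> (cmod \<rho>)\<^sup>2" using \<rho> by linarith
    ultimately have "(cmod \<rho>)\<^sup>2 / 2 \<le> cmod (lam - \<rho>\<^sup>2)" by (simp add: norm_power)
    moreover have "0 < (cmod \<rho>)\<^sup>2 / 2" using r by simp
    ultimately have le: "1 / cmod (lam - \<rho>\<^sup>2) \<le> 1 / ((cmod \<rho>)\<^sup>2 / 2)" by (intro divide_left_mono mult_pos_pos) linarith+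
    have p: "cmod \<rho> powi -2 = 1 / (cmod \<rho>)\<^sup>2" by (simp add: power_int_minus divide_inverse)
    have "norm (1 / (lam - \<rho>\<^sup>2)) = 1 / cmod (lam - \<rho>\<^sup>2)" by (simp only: norm_divide norm_one)
    also note le
    also have "1 / ((cmod \<rho>)\<^sup>2 / 2) = 2 * cmod \<rho> powi -2" unfolding p by simp
    finally show "norm (1 / (lam - \<rho>\<^sup>2)) \<le> 2 * cmod \<rho> powi -2" .
  qed
  have M: "grows (-1) (\<lambda>\<rho>. scl A (1 / \<rho>) ** Mhat \<rho> ** bscl A \<rho>)"
    using grows_diff[OF W.weyl_order W1.weyl_order] by (simp add: mm.diff_left mm.diff_right)
  have "grows (-3) (\<lambda>\<rho>. (1 / (lam - \<rho>\<^sup>2)) \<odot> ((?E \<rho> \<odot> P.\<phi>N \<rho> x) ** (scl A (1 / \<rho>) ** Mhat \<rho> ** bscl A \<rho>) ** (?E \<rho> \<odot> (bscl_inv A \<rho> ** ?b \<rho>))))"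
    using grows_cs[OF l grows_mm[OF grows_mm[OF P.scaled_asymptotics(3)[OF x] M] b]] by simp
  then show ?thesis
  proof (rule grows_cong, intro eventually_mono[OF eventually_conj[OF W.eventually_nz eventually_uhp_ge[of "cmod lam + 1"]]])
    fix \<rho> :: complex assume a: "\<rho> \<noteq> 0 \<and> 0 \<le> Im \<rho> \<and> cmod lam + 1 \<le> cmod \<rho>"
    then have nz: "\<rho> \<noteq> 0" by simp
    have "lam \<noteq> \<rho>\<^sup>2"
    proof
      assume "lam = \<rho>\<^sup>2"
      then have "cmod lam = cmod \<rho> * cmod \<rho>" by (simp add: norm_mult power2_eq_square)
      moreover have "1 \<le> cmod \<rho>" using a norm_ge_zero[of lam] by linarith
      then have "cmod \<rho> * 1 \<le> cmod \<rho> * cmod \<rho>" by (intro mult_left_mono) auto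
      ultimately show False using a by simp
    qed
    then have l: "(1 / (lam - \<rho>\<^sup>2)) * (lam - \<rho>\<^sup>2) = 1" by simp
    have e2: "exp (2 * (\<i> * \<rho> * of_real x)) = ?E \<rho> * ?E \<rho>" by (simp only: mult_2 exp_add)
    have i1: "scl A \<rho> ** (scl A (1 / \<rho>) ** Y) = Y" "bscl A \<rho> ** (bscl_inv A \<rho> ** Y) = Y" for Y :: "complex^'n^'n"
      using scl_inverse[OF AA nz] bscl_inv_bscl[OF AA nz] by (simp_all add: matrix_mul_assoc)
    have "(1 / (lam - \<rho>\<^sup>2)) \<odot> ((?E \<rho> \<odot> P.\<phi>N \<rho> x) ** (scl A (1 / \<rho>) ** Mhat \<rho> ** bscl A \<rho>) ** (?E \<rho> \<odot> (bscl_inv A \<rho> ** ?b \<rho>))) =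
       (?E \<rho> * ?E \<rho> * ((1 / (lam - \<rho>\<^sup>2)) * (lam - \<rho>\<^sup>2))) \<odot> (P.\<phi>N \<rho> x ** (scl A (1 / \<rho>) ** (Mhat \<rho> ** (bscl A \<rho> ** (bscl_inv A \<rho> ** D (\<rho>\<^sup>2))))))"
      by (simp only: cscale_mult_left cscale_mult_right cscale_cscale matrix_mul_assoc[symmetric] mult_ac)
    also have "\<dots> = exp (2 * (\<i> * \<rho> * of_real x)) \<odot> F \<rho>"
      unfolding e2 l by (simp only: i1 P.\<phi>N_def F_def matrix_mul_assoc[symmetric] mult_1_right)
    finally show "exp (2 * (\<i> * \<rho> * of_real x)) \<odot> F \<rho> = (1 / (lam - \<rho>\<^sup>2)) \<odot> ((?E \<rho> \<odot> P.\<phi>N \<rho> x) ** (scl A (1 / \<rho>) ** Mhat \<rho> ** bscl A \<rho>) ** (?E \<rho> \<odot> (bscl_inv A \<rho> ** ?b \<rho>)))" ..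
  qed
qed

end

section \<open>The contour in the plane of the square root\<close>

lemma up_sqrt_square: "0 < Im z \<Longrightarrow> up_sqrt (z\<^sup>2) = z"
proof -
  assume z: "0 < Im z"
  define w where "w = csqrt (z\<^sup>2)"
  have "w\<^sup>2 = z\<^sup>2" by (simp add: w_def)
  then have "w = z \<or> w = - z" by (simp only: power2_eq_iff)
  moreover have "up_sqrt (z\<^sup>2) = (if 0 \<le> Im w then w else - w)" by (simp only: up_sqrt_def w_def)
  ultimately show ?thesis using z by auto
qed

lemma loop_start:
  assumes "loop_around S g"
  obtains b where "0 < b" "pathstart g = of_real b"
  using assms unfolding loop_around_def by blast

lemma loop_avoids_nonneg:
  assumes g: "loop_around S g" and t: "t \<in> {0<..<1}" and s: "0 \<le> s"
  shows "g t \<noteq> of_real s"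
proof
  assume eq: "g t = of_real s"
  have sp: "simple_path g" and m: "path_image g \<inter> of_real ` {0<..} = {pathstart g}" and i: "0 \<in> inside (path_image g)"
    using g by (auto simp: loop_around_def)
  have gt: "g t \<in> path_image g" using t by (auto simp: path_image_def)
  have "0 \<notin> path_image g" using i inside_no_overlap by blast
  then have "s > 0" using s gt eq by (cases "s = 0") auto
  then have "g t \<in> path_image g \<inter> of_real ` {0<..}" using gt eq by auto
  then have "g t = g 0" using m by (simp add: pathstart_def)
  then show False using sp t unfolding simple_path_def loop_free_def
    by (metis atLeastAtMost_iff greaterThanLessThan_iff less_eq_real_def less_irrefl zero_le_one)
qed

text \<open>
  The winding number \<open>1\<close> about \<open>0\<close> fixes the total change of the argument along the loop, and since
  the loop meets the positive half-line only at its ends, the argument stays strictly between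
  \<open>0\<close> and \<open>2\<pi>\<close>: the loop lifts to a path in the upper half-plane from \<open>\<surd>b\<close> to \<open>-\<surd>b\<close>.
\<close>

lemma loop_sqrt_lift:
  assumes g: "loop_around S g" and b: "0 < b" "pathstart g = of_real b"
  obtains \<sigma> where "valid_path \<sigma>" "pathstart \<sigma> = of_real (sqrt b)" "pathfinish \<sigma> = - of_real (sqrt b)"
    "\<And>t. t \<in> {0..1} \<Longrightarrow> (\<sigma> t)\<^sup>2 = g t" "\<And>t. t \<in> {0<..<1} \<Longrightarrow> 0 < Im (\<sigma> t)"
proof -
  have vg: "valid_path g" and w: "winding_number g 0 = 1" and i: "0 \<in> inside (path_image g)"
    using g by (auto simp: loop_around_def)
  have pg: "path g" by (rule valid_path_imp_path[OF vg])
  have "0 \<notin> path_image g" using i inside_no_overlap by blast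
  then obtain q where q: "path q" "pathfinish q - pathstart q = 2 * of_real pi * \<i> * winding_number g 0"
    and gq: "\<And>t. t \<in> {0..1} \<Longrightarrow> g t = 0 + exp (q t)"
    using winding_number_as_continuous_log[OF pg] by blast
  define \<sigma> where "\<sigma> t = of_real (sqrt b) * exp ((q t - q 0) / 2)" for t
  define \<theta> where "\<theta> t = Im (q t - q 0) / 2" for t
  have eq0: "exp (q 0) = of_real b" using gq[of 0] b by (simp add: pathstart_def)
  have sq: "(\<sigma> t)\<^sup>2 = g t" if "t \<in> {0..1}" for t
  proof -
    have "(\<sigma> t)\<^sup>2 = of_real (sqrt b * sqrt b) * (exp ((q t - q 0) / 2) * exp ((q t - q 0) / 2))"
      by (simp only: \<sigma>_def power2_eq_square of_real_mult mult_ac)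
    also have "\<dots> = of_real b * exp (q t - q 0)" using b by (simp flip: exp_add)
    also have "\<dots> = g t" using gq[OF that] eq0 b by (simp add: exp_diff)
    finally show ?thesis .
  qed
  have qc: "continuous_on {0..1} q" using q(1) by (simp add: path_def)
  have \<theta>c: "continuous_on {0..1} \<theta>" unfolding \<theta>_def by (intro continuous_intros qc) auto
  have \<theta>0: "\<theta> 0 = 0" by (simp add: \<theta>_def)
  have q1: "q 1 - q 0 = 2 * of_real pi * \<i>" using q(2) w by (simp add: pathstart_def pathfinish_def)
  have \<theta>1: "\<theta> 1 = pi" by (simp add: \<theta>_def q1)
  have nz: "sin (\<theta> t) \<noteq> 0" if t: "t \<in> {0<..<1}" for t
  proof
    assume s: "sin (\<theta> t) = 0"
    let ?z = "(q t - q 0) / 2"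
    have "Im (exp ?z) = 0" using s by (simp add: Im_exp \<theta>_def)
    then have "exp ?z = of_real (Re (exp ?z))" by (simp add: complex_eq_iff)
    then have "\<sigma> t = of_real (sqrt b * Re (exp ?z))" by (simp add: \<sigma>_def)
    then have "g t = of_real ((sqrt b * Re (exp ?z))\<^sup>2)" using sq[of t] t by simp
    then show False using loop_avoids_nonneg[OF g t, of "(sqrt b * Re (exp ?z))\<^sup>2"] by simp
  qed
  have \<theta>pos: "0 < \<theta> t \<and> \<theta> t < pi" if t: "t \<in> {0<..<1}" for t
  proof (rule ccontr)
    assume "\<not> (0 < \<theta> t \<and> \<theta> t < pi)"
    moreover have "\<theta> t \<noteq> 0" "\<theta> t \<noteq> pi" using nz[OF t] by auto
    ultimately consider "\<theta> t < 0" | "pi < \<theta> t" by linarith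
    then show False
    proof cases
      case 1
      obtain s where "t \<le> s" "s \<le> 1" "\<theta> s = 0"
        using IVT'[of \<theta> t 0 1] 1 \<theta>1 t continuous_on_subset[OF \<theta>c, of "{t..1}"] by force
      moreover then have "s \<noteq> 1" using \<theta>1 by auto
      ultimately show False using nz[of s] t by auto
    next
      case 2
      obtain s where "0 \<le> s" "s \<le> t" "\<theta> s = pi"
        using IVT'[of \<theta> 0 pi t] 2 \<theta>0 t continuous_on_subset[OF \<theta>c, of "{0..t}"] by force
      moreover then have "s \<noteq> 0" using \<theta>0 by auto
      ultimately show False using nz[of s] t by auto
    qed
  qed
  have Im: "0 < Im (\<sigma> t)" if t: "t \<in> {0<..<1}" for t
  proof -
    have "Im (\<sigma> t) = sqrt b * (exp (Re ((q t - q 0) / 2)) * sin (\<theta> t))"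
      by (simp add: \<sigma>_def Im_exp \<theta>_def)
    moreover have "0 < sin (\<theta> t)" using \<theta>pos[OF t] sin_gt_zero by blast
    ultimately show ?thesis using b by simp
  qed
  have ends: "\<sigma> 0 = of_real (sqrt b)" "\<sigma> 1 = - of_real (sqrt b)"
    by (simp_all add: \<sigma>_def q1 exp_pi_i')
  have c: "continuous_on {0..1} \<sigma>" unfolding \<sigma>_def by (intro continuous_intros qc) auto
  \<comment> \<open>An explicit analytic branch of the square root transfers the smoothness of \<open>g\<close> to \<open>\<sigma>\<close>.\<close>
  have csq: "\<sigma> t = \<i> * csqrt (- g t)" "- g t \<notin> \<real>\<^sub>\<le>\<^sub>0" if t: "t \<in> {0<..<1}" for t
  proof -
    show np: "- g t \<notin> \<real>\<^sub>\<le>\<^sub>0"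
    proof
      assume "- g t \<in> \<real>\<^sub>\<le>\<^sub>0"
      then obtain r where "- g t = of_real r" "r \<le> 0" by (auto simp: nonpos_Reals_def)
      then have "g t = of_real (- r)" "0 \<le> - r" by (auto simp: minus_equation_iff[of "g t"])
      then show False using loop_avoids_nonneg[OF g t] by blast
    qed
    have "- g t \<noteq> 0" using np by auto
    then have "0 < Re (csqrt (- g t))"
      using np csqrt_principal[of "- g t"] by (metis Re_csqrt complex_nonpos_Reals_iff csqrt_of_real_nonpos less_eq_real_def power2_csqrt Im_power2 mult_zero_left mult_zero_right power2_eq_square Re_power2 zero_le_square diff_0 neg_le_0_iff_le)
    moreover define w where "w = csqrt (- g t)"
    ultimately have w: "0 < Re w" by simp
    have "w\<^sup>2 = - g t" by (simp add: w_def)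
    then have "(\<i> * w)\<^sup>2 = (\<sigma> t)\<^sup>2" using sq[of t] t by (simp add: power_mult_distrib)
    then have "\<i> * w = \<sigma> t \<or> \<i> * w = - \<sigma> t" by (simp only: power2_eq_iff)
    moreover have "\<i> * w \<noteq> - \<sigma> t"
    proof
      assume "\<i> * w = - \<sigma> t"
      then have "Im (\<i> * w) = Im (- \<sigma> t)" by (rule arg_cong)
      then show False using w Im[OF t] by simp
    qed
    ultimately show "\<sigma> t = \<i> * csqrt (- g t)" by (simp add: w_def)
  qed
  obtain s where s: "finite s" "g C1_differentiable_on ({0..1} - s)"
    using vg unfolding valid_path_def piecewise_C1_differentiable_on_def by blast
  then obtain D where D: "\<And>t. t \<in> {0..1} - s \<Longrightarrow> (g has_vector_derivative D t) (at t)" "continuous_on ({0..1} - s) D"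
    unfolding C1_differentiable_on_def by blast
  have "\<sigma> C1_differentiable_on ({0..1} - (s \<union> {0,1}))"
    unfolding C1_differentiable_on_def
  proof (intro exI conjI ballI)
    fix t assume "t \<in> {0..1} - (s \<union> {0,1})"
    then have t: "t \<in> {0<..<1}" "t \<in> {0..1} - s" by auto
    have "((\<lambda>z. csqrt (- z)) has_field_derivative inverse (2 * csqrt (- g t)) * (-1)) (at (g t))"
      by (rule DERIV_chain2[where f = csqrt and g = "\<lambda>z. - z"], rule has_field_derivative_csqrt[OF csq(2)[OF t(1)]])
        (auto intro!: derivative_eq_intros)
    then have "((\<lambda>z. \<i> * csqrt (- z)) has_field_derivative \<i> * (inverse (2 * csqrt (- g t)) * (-1))) (at (g t))"
      by (rule DERIV_cmult)
    from field_vector_diff_chain_at[OF D(1)[OF t(2)] this]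
    have d: "((\<lambda>t. \<i> * csqrt (- g t)) has_vector_derivative D t * (\<i> * (inverse (2 * csqrt (- g t)) * (-1)))) (at t)"
      by (simp only: o_def)
    have coeff: "\<i> * (inverse (2 * csqrt (- g t)) * (-1)) = 1 / (2 * \<sigma> t)"
    proof -
      have "\<i> * (inverse (2 * w) * (-1)) = 1 / (2 * (\<i> * w))" if "w \<noteq> 0" for w :: complex
        using that by (simp add: field_simps)
      moreover have "csqrt (- g t) \<noteq> 0" using csq(1)[OF t(1)] Im[OF t(1)] by (metis complex_Im_of_int mult_zero_right of_int_0 less_irrefl)
      ultimately show ?thesis by (simp only: csq(1)[OF t(1)])
    qed
    have "((\<lambda>t. \<i> * csqrt (- g t)) has_vector_derivative D t / (2 * \<sigma> t)) (at t)"
      using d by (simp only: coeff times_divide_eq_right mult_1_right)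
    then show "(\<sigma> has_vector_derivative D t / (2 * \<sigma> t)) (at t)"
      by (rule has_vector_derivative_transform_within_open[of _ _ _ "{0<..<1}"]) (use t csq in auto)
  next
    show "continuous_on ({0..1} - (s \<union> {0,1})) (\<lambda>t. D t / (2 * \<sigma> t))"
    proof (intro continuous_intros continuous_on_subset[OF D(2)] continuous_on_subset[OF c] ballI)
      fix t assume "t \<in> {0..1} - (s \<union> {0,1})"
      then have "0 < Im (\<sigma> t)" by (intro Im) auto
      then show "2 * \<sigma> t \<noteq> 0" by auto
    qed auto
  qed
  then have "valid_path \<sigma>"
    unfolding valid_path_def piecewise_C1_differentiable_on_def using c s(1)
    by (intro conjI exI[of _ "s \<union> {0,1}"]) auto
  then show thesis
    using that[of \<sigma>] ends sq Im by (simp add: pathstart_def pathfinish_def)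
qed

lemma contour_integral_lift:
  assumes v: "valid_path \<sigma>" and sq: "\<And>t. t \<in> {0..1} \<Longrightarrow> (\<sigma> t)\<^sup>2 = g t" and Im: "\<And>t. t \<in> {0<..<1} \<Longrightarrow> 0 < Im (\<sigma> t)"
    and k: "((\<lambda>z. 2 * z * f z) has_contour_integral c) \<sigma>"
  shows "((\<lambda>\<mu>. f (up_sqrt \<mu>)) has_contour_integral c) g"
proof -
  obtain s where s: "finite s" "\<sigma> C1_differentiable_on ({0..1} - s)"
    using v unfolding valid_path_def piecewise_C1_differentiable_on_def by blast
  have "((\<lambda>t. 2 * \<sigma> t * f (\<sigma> t) * vector_derivative \<sigma> (at t)) has_integral c) {0..1}"
    using k by (simp add: has_contour_integral)
  then have "((\<lambda>t. f (up_sqrt (g t)) * vector_derivative g (at t)) has_integral c) {0..1}"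
  proof (rule has_integral_spike_finite[rotated 2])
    show "finite (s \<union> {0,1})" using s by simp
    fix t assume "t \<in> {0..1} - (s \<union> {0,1})"
    then have t: "t \<in> {0<..<1}" "t \<in> {0..1} - s" by auto
    have d: "(\<sigma> has_vector_derivative vector_derivative \<sigma> (at t)) (at t)"
      using s(2) t(2) by (auto simp: C1_differentiable_on_eq vector_derivative_works)
    have "((\<lambda>t. (\<sigma> t)\<^sup>2) has_vector_derivative 2 * \<sigma> t * vector_derivative \<sigma> (at t)) (at t)"
      using has_vector_derivative_mult[OF d d] by (simp add: power2_eq_square algebra_simps)
    then have "(g has_vector_derivative 2 * \<sigma> t * vector_derivative \<sigma> (at t)) (at t)"
      by (rule has_vector_derivative_transform_within_open[of _ _ _ "{0<..<1}"]) (use t sq in auto)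
    then have "vector_derivative g (at t) = 2 * \<sigma> t * vector_derivative \<sigma> (at t)"
      by (rule vector_derivative_at)
    moreover have "up_sqrt (g t) = \<sigma> t" using up_sqrt_square[OF Im[OF t(1)]] sq[of t] t by simp
    ultimately show "f (up_sqrt (g t)) * vector_derivative g (at t) = 2 * \<sigma> t * f (\<sigma> t) * vector_derivative \<sigma> (at t)"
      by simp
  qed
  then show ?thesis by (simp add: has_contour_integral)
qed

text \<open>
  The half-line beyond the base point misses the loop and is unbounded.
\<close>

lemma loop_half_line_outside:
  assumes g: "loop_around S g" and b: "pathstart g = of_real b" and s: "b \<le> s"
  shows "of_real s \<notin> inside (path_image g)"
proof
  assume i: "of_real s \<in> inside (path_image g)"
  have m: "path_image g \<inter> of_real ` {0<..} = {of_real b}" using g b by (auto simp: loop_around_def)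
  have b0: "0 < b" using loop_start[OF g] b by (metis of_real_eq_iff)
  have "s \<noteq> b" using i m inside_no_overlap by blast
  then have sb: "b < s" using s by simp
  let ?R = "of_real ` {s..} :: complex set"
  have "of_real ` {s..} \<inter> path_image g = {}"
  proof (rule ccontr)
    assume "of_real ` {s..} \<inter> path_image g \<noteq> {}"
    then obtain u where u: "s \<le> u" "of_real u \<in> path_image g" by auto
    then have "of_real u \<in> path_image g \<inter> of_real ` {0<..}" using sb b0 by auto
    then show False using m u sb by auto
  qed
  then have "?R \<subseteq> - path_image g" by auto
  moreover have "connected ?R" by (intro connected_continuous_image continuous_intros) auto
  ultimately have "?R \<subseteq> connected_component_set (- path_image g) (of_real s)"
    by (intro connected_component_maximal) auto
  moreover have "bounded (connected_component_set (- path_image g) (of_real s))"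
    using i by (simp add: inside_def)
  ultimately have "bounded ?R" using bounded_subset by blast
  then obtain K where K: "\<And>z. z \<in> ?R \<Longrightarrow> cmod z \<le> K" unfolding bounded_iff by blast
  have "cmod (of_real (max s (K + 1))) \<le> K" by (rule K) auto
  then show False using sb b0 by (simp add: max_def split: if_splits)
qed

lemma cut_loop:
  assumes g: "loop_around S g" and b: "pathstart g = of_real b"
  shows "cut g = {b..}"
proof
  have m: "path_image g \<inter> of_real ` {0<..} = {of_real b}" and i: "0 \<in> inside (path_image g)"
    using g b by (auto simp: loop_around_def)
  have b0: "0 < b" using loop_start[OF g] b by (metis of_real_eq_iff)
  show "{b..} \<subseteq> cut g"
    using loop_half_line_outside[OF g b] b0 by (auto simp: cut_def)
  show "cut g \<subseteq> {b..}"
  proof (rule ccontr)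
    assume "\<not> cut g \<subseteq> {b..}"
    then obtain s where "s \<in> cut g" "\<not> b \<le> s" by blast
    then have s: "0 < s" "s < b" "of_real s \<notin> inside (path_image g)" by (auto simp: cut_def)
    let ?C = "of_real ` {0..s} :: complex set"
    have "?C \<inter> path_image g = {}"
    proof (rule ccontr)
      assume "?C \<inter> path_image g \<noteq> {}"
      then obtain u where u: "0 \<le> u" "u \<le> s" "of_real u \<in> path_image g" by auto
      have "0 \<notin> path_image g" using i inside_no_overlap by blast
      then have "u \<noteq> 0" using u(3) by auto
      then have "of_real u \<in> path_image g \<inter> of_real ` {0<..}" using u by auto
      then show False using m u s by auto
    qed
    moreover have "connected ?C" by (intro connected_continuous_image continuous_intros) auto
    ultimately have "connected_component (- path_image g) 0 (of_real s)"
      unfolding connected_component_def using s by (intro exI[of _ ?C]) (auto simp: image_iff)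
    then show False using inside_same_component[OF _ i] s by blast
  qed
qed

subsection \<open>Deformation into the open half-plane\<close>

text \<open>
  A function that is analytic in the open half-plane and continuous up to the real axis has
  primitives on convex subsets of the closed half-plane. So the parts of a contour near the axis may
  be replaced by paths inside. The loop itself may have infinite length, and only primitives give a
  meaning to the integral along it.
\<close>

locale upper_half_plane =
  fixes T :: "complex set"
  assumes T: "closed T"
begin

abbreviation H :: "complex set" where "H \<equiv> {z. 0 \<le> Im z}"

definition half_plane_analytic :: "(complex \<Rightarrow> complex) \<Rightarrow> bool" where
  "half_plane_analytic k \<longleftrightarrow> continuous_on (H - T) k \<and> k holomorphic_on {z. 0 < Im z} - T"

lemma open_domain: "open ({z. 0 < Im z} - T)"
  by (intro open_Diff open_halfspace_Im_gt T)

lemma half_plane_primitive: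
  assumes k: "half_plane_analytic k" and N: "convex N" "N \<inter> T = {}"
  obtains \<Phi> where "\<And>z. z \<in> N \<inter> H \<Longrightarrow> (\<Phi> has_field_derivative k z) (at z within N \<inter> H)"
proof -
  have "convex (N \<inter> H)" by (intro convex_Int N convex_halfspace_Im_ge)
  moreover have "continuous_on (N \<inter> H) k"
    using k N by (auto simp: half_plane_analytic_def intro: continuous_on_subset)
  moreover have "k field_differentiable at z" if z: "z \<in> interior (N \<inter> H) - {}" for z
  proof -
    have "z \<in> interior (N \<inter> H)" using z by simp
    then obtain \<epsilon> where \<epsilon>: "0 < \<epsilon>" "ball z \<epsilon> \<subseteq> N \<inter> H" unfolding mem_interior by blast
    have "z - \<i> * of_real (\<epsilon> / 2) \<in> ball z \<epsilon>" using \<epsilon>(1) by (simp add: dist_norm norm_mult)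
    then have "z - \<i> * of_real (\<epsilon> / 2) \<in> H" using \<epsilon>(2) by blast
    then have "0 < Im z" using \<epsilon>(1) by simp
    moreover have "z \<in> N" using z interior_subset by blast
    ultimately have "z \<in> {z. 0 < Im z} - T" using N by auto
    then show ?thesis using k open_domain by (auto simp: half_plane_analytic_def holomorphic_on_imp_differentiable_at)
  qed
  ultimately show thesis using holomorphic_convex_primitive[of "N \<inter> H" "{}" k] that by blast
qed

lemma half_plane_contour_integrable:
  assumes k: "half_plane_analytic k" and p: "valid_path p" "path_image p \<subseteq> H - T"
  shows "k contour_integrable_on p"
proof (rule contour_integral_local_primitive[OF p])
  fix x assume x: "x \<in> H - T"
  have "open (- T)" "x \<in> - T" using T x by auto
  then obtain d where "0 < d" "ball x d \<subseteq> - T" using open_contains_ball by blast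
  then have d: "0 < d" "ball x d \<inter> T = {}" by auto
  obtain \<Phi> where \<Phi>: "\<And>z. z \<in> ball x d \<inter> H \<Longrightarrow> (\<Phi> has_field_derivative k z) (at z within ball x d \<inter> H)"
    using half_plane_primitive[OF k convex_ball d(2)] by blast
  show "\<exists>d h. 0 < d \<and> (\<forall>y. norm (y - x) < d \<longrightarrow> (h has_field_derivative k y) (at y within H - T))"
  proof (intro exI[of _ d] exI[of _ \<Phi>] conjI allI impI d)
    fix y assume "norm (y - x) < d"
    then have yb: "y \<in> ball x d" by (simp add: dist_norm norm_minus_commute)
    have eq: "at y within H - T = at y within ball x d \<inter> H"
      by (rule at_within_nhd[of y "ball x d"]) (use yb d in auto)
    show "(\<Phi> has_field_derivative k y) (at y within H - T)"
    proof (cases "y \<in> H")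
      case True
      then show ?thesis unfolding eq using \<Phi> yb by auto
    next
      case False
      have "- H = {z. Im z < 0}" by auto
      then have "open (- H)" by (simp add: open_halfspace_Im_lt)
      then have "at y within H - T = at y within {}"
        by (intro at_within_nhd[of y "- H"]) (use False in auto)
      then have "at y within H - T = bot" by simp
      then show ?thesis by (simp add: has_field_derivative_def has_derivative_def bounded_linear_mult_right)
    qed
  qed
qed

lemma half_plane_same_ends:
  assumes k: "half_plane_analytic k" and N: "convex N" "N \<inter> T = {}"
  obtains \<Phi> where "\<And>p. valid_path p \<Longrightarrow> path_image p \<subseteq> N \<inter> H \<Longrightarrow> contour_integral p k = \<Phi> (pathfinish p) - \<Phi> (pathstart p)"
proof -
  obtain \<Phi> where "\<And>z. z \<in> N \<inter> H \<Longrightarrow> (\<Phi> has_field_derivative k z) (at z within N \<inter> H)"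
    using half_plane_primitive[OF assms] by blast
  then show thesis using that contour_integral_unique[OF contour_integral_primitive] by metis
qed

lemma segment_neighbourhood:
  assumes "closed_segment a c \<inter> T = {}"
  obtains N \<delta> where "convex N" "N \<inter> T = {}" "0 < \<delta>" "ball a \<delta> \<subseteq> N" "ball c \<delta> \<subseteq> N" "closed_segment a c \<subseteq> N"
proof -
  obtain d where d: "0 < d" "\<And>x y. x \<in> closed_segment a c \<Longrightarrow> y \<in> T \<Longrightarrow> d \<le> dist x y"
    using separate_compact_closed[OF compact_segment T assms] by blast
  define N where "N = (\<Union>x\<in>closed_segment a c. \<Union>y\<in>ball 0 d. {x + y})"
  have sub: "ball x d \<subseteq> N" if "x \<in> closed_segment a c" for x
  proof
    fix z assume "z \<in> ball x d"
    then have "z - x \<in> ball 0 d" "z = x + (z - x)" by (auto simp: dist_norm norm_minus_commute)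
    then show "z \<in> N" unfolding N_def using that by blast
  qed
  have "convex N" unfolding N_def by (intro convex_sums convex_closed_segment convex_ball)
  moreover have "N \<inter> T = {}"
    unfolding N_def using d by (fastforce simp: dist_norm)
  moreover have "closed_segment a c \<subseteq> N" using sub d(1) centre_in_ball by blast
  ultimately show thesis using that[of N d] d(1) sub by auto
qed

text \<open>
  The arc \<open>\<sigma>\<close> and the semicircle meet the axis at \<open>\<plusminus>\<beta>\<close> and \<open>\<plusminus>r\<close>. On each side, a short initial or final piece of
  \<open>\<sigma>\<close>, the segment of the axis and a short piece of the semicircle lie in a convex set that admits
  primitives, and a chord inside the open half-plane replaces them.
\<close>

lemma deformation:
  assumes \<sigma>: "valid_path \<sigma>" "pathstart \<sigma> = of_real \<beta>" "pathfinish \<sigma> = - of_real \<beta>"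
    and Im: "\<And>t. t \<in> {0<..<1} \<Longrightarrow> 0 < Im (\<sigma> t)" and \<sigma>T: "path_image \<sigma> \<inter> T = {}"
    and \<beta>: "0 < \<beta>" "\<beta> \<le> r"
    and sT: "\<And>s. s \<in> {\<beta>..r} \<Longrightarrow> of_real s \<notin> T \<and> - of_real s \<notin> T"
    and rT: "\<And>z. z \<in> T \<Longrightarrow> cmod z < r"
  obtains \<Gamma> where "valid_path \<Gamma>" "pathfinish \<Gamma> = pathstart \<Gamma>" "path_image \<Gamma> \<subseteq> {z. 0 < Im z} - T"
    "\<And>k. half_plane_analytic k \<Longrightarrow> contour_integral \<Gamma> k = contour_integral (part_circlepath 0 r 0 pi) k +
      contour_integral (linepath (- of_real r) (- of_real \<beta>)) k - contour_integral \<sigma> k +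
      contour_integral (linepath (of_real \<beta>) (of_real r)) k"
proof -
  define \<kappa> where "\<kappa> = part_circlepath 0 r 0 pi"
  have \<kappa>t: "\<kappa> t = of_real r * exp (\<i> * of_real (pi * t))" for t
    by (simp add: \<kappa>_def part_circlepath_def linepath_def mult.commute)
  have \<kappa>v: "valid_path \<kappa>" by (simp add: \<kappa>_def)
  have r: "0 < r" using \<beta> by simp
  have \<kappa>ends: "\<kappa> 0 = of_real r" "\<kappa> 1 = - of_real r" by (simp_all add: \<kappa>t exp_pi_i')
  have \<kappa>n: "cmod (\<kappa> t) = r" for t using r by (simp add: \<kappa>t norm_mult)
  have \<kappa>Im: "0 < Im (\<kappa> t)" if "t \<in> {0<..<1}" for t
  proof -
    have "Im (\<kappa> t) = r * sin (pi * t)" by (simp add: \<kappa>t Im_exp)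
    moreover have "0 < sin (pi * t)" using that by (intro sin_gt_zero) auto
    ultimately show ?thesis using r by simp
  qed
  have \<kappa>T: "\<kappa> t \<notin> T" for t using rT[of "\<kappa> t"] \<kappa>n[of t] by auto
  have seg: "closed_segment (of_real \<beta>) (of_real r) = (of_real ` {\<beta>..r} :: complex set)"
    "closed_segment (- of_real r) (- of_real \<beta>) = ((\<lambda>s. - of_real s) ` {\<beta>..r} :: complex set)"
  proof -
    show 1: "closed_segment (of_real \<beta>) (of_real r) = (of_real ` {\<beta>..r} :: complex set)"
      using \<beta> by (simp add: closed_segment_of_real closed_segment_eq_real_ivl)
    have "closed_segment (- of_real r) (- of_real \<beta>) = uminus ` closed_segment (of_real r) (of_real \<beta> :: complex)"
      using closed_segment_linear_image[of "uminus :: complex \<Rightarrow> complex" "of_real r" "of_real \<beta>"]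
      by (simp add: linear_uminus)
    also have "\<dots> = uminus ` (of_real ` {\<beta>..r})" by (simp add: closed_segment_commute 1)
    finally show "closed_segment (- of_real r) (- of_real \<beta>) = ((\<lambda>s. - of_real s) ` {\<beta>..r} :: complex set)"
      by (simp add: image_image)
  qed
  obtain N1 \<delta>1 where N1: "convex N1" "N1 \<inter> T = {}" "0 < \<delta>1" "ball (of_real \<beta>) \<delta>1 \<subseteq> N1" "ball (of_real r) \<delta>1 \<subseteq> N1"
      "closed_segment (of_real \<beta>) (of_real r) \<subseteq> N1"
    using segment_neighbourhood[of "of_real \<beta>" "of_real r"] sT unfolding seg by blast
  obtain N2 \<delta>2 where N2: "convex N2" "N2 \<inter> T = {}" "0 < \<delta>2" "ball (- of_real r) \<delta>2 \<subseteq> N2" "ball (- of_real \<beta>) \<delta>2 \<subseteq> N2"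
      "closed_segment (- of_real r) (- of_real \<beta>) \<subseteq> N2"
    using segment_neighbourhood[of "- of_real r" "- of_real \<beta>"] sT unfolding seg by blast
  have near0: "\<exists>u. 0 < u \<and> u < 1/2 \<and> (\<forall>t. 0 \<le> t \<longrightarrow> t \<le> u \<longrightarrow> p t \<in> N)"
    if h: "path p" "0 < d" "ball (p 0) d \<subseteq> N" for p :: "real \<Rightarrow> complex" and d N
  proof -
    obtain e where e: "0 < e" "\<And>t. t \<in> {0..1} \<Longrightarrow> dist t 0 < e \<Longrightarrow> dist (p t) (p 0) < d"
      using h(1,2) unfolding path_def continuous_on_iff by (metis atLeastAtMost_iff order_refl zero_le_one)
    show ?thesis
    proof (intro exI[of _ "min (e / 2) (1 / 3)"] conjI allI impI)
      fix t :: real assume t: "0 \<le> t" "t \<le> min (e / 2) (1 / 3)"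
      have "dist (p t) (p 0) < d" using e(1) t by (intro e(2)) (auto simp: dist_real_def)
      then show "p t \<in> N" using h(3) by (auto simp: dist_commute)
    qed (use e(1) in auto)
  qed
  have near1: "\<exists>u. 1/2 < u \<and> u < 1 \<and> (\<forall>t. u \<le> t \<longrightarrow> t \<le> 1 \<longrightarrow> p t \<in> N)"
    if h: "path p" "0 < d" "ball (p 1) d \<subseteq> N" for p :: "real \<Rightarrow> complex" and d N
  proof -
    have rp: "path (reversepath p)" using h(1) by simp
    have rb: "ball (reversepath p 0) d \<subseteq> N" using h(3) by (simp add: reversepath_def)
    from near0[OF rp h(2) rb] obtain u where u: "0 < u" "u < 1/2" "\<And>t. 0 \<le> t \<Longrightarrow> t \<le> u \<Longrightarrow> p (1 - t) \<in> N"
      by (auto simp: reversepath_def)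
    show ?thesis
    proof (intro exI[of _ "1 - u"] conjI allI impI)
      fix t assume "1 - u \<le> t" "t \<le> 1"
      then show "p t \<in> N" using u(3)[of "1 - t"] by simp
    qed (use u in auto)
  qed
  have \<sigma>p: "path \<sigma>" and \<kappa>p: "path \<kappa>" using \<sigma>(1) \<kappa>v by (auto intro: valid_path_imp_path)
  have \<sigma>e: "\<sigma> 0 = of_real \<beta>" "\<sigma> 1 = - of_real \<beta>" using \<sigma> by (auto simp: pathstart_def pathfinish_def)
  obtain t0 where t0: "0 < t0" "t0 < 1/2" "\<And>t. 0 \<le> t \<Longrightarrow> t \<le> t0 \<Longrightarrow> \<sigma> t \<in> N1"
    using near0[OF \<sigma>p N1(3), of N1] N1(4) \<sigma>e by auto
  obtain t1 where t1: "1/2 < t1" "t1 < 1" "\<And>t. t1 \<le> t \<Longrightarrow> t \<le> 1 \<Longrightarrow> \<sigma> t \<in> N2"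
    using near1[OF \<sigma>p N2(3), of N2] N2(5) \<sigma>e by auto
  obtain s0 where s0: "0 < s0" "s0 < 1/2" "\<And>t. 0 \<le> t \<Longrightarrow> t \<le> s0 \<Longrightarrow> \<kappa> t \<in> N1"
    using near0[OF \<kappa>p N1(3), of N1] N1(5) \<kappa>ends by auto
  obtain s1 where s1: "1/2 < s1" "s1 < 1" "\<And>t. s1 \<le> t \<Longrightarrow> t \<le> 1 \<Longrightarrow> \<kappa> t \<in> N2"
    using near1[OF \<kappa>p N2(3), of N2] N2(4) \<kappa>ends by auto
  have \<sigma>H: "\<sigma> t \<in> H" if "t \<in> {0..1}" for t
    using Im[of t] \<sigma>e that by (cases "t = 0 \<or> t = 1") (auto simp: less_eq_real_def)
  have \<kappa>H: "\<kappa> t \<in> H" if "t \<in> {0..1}" for t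
    using \<kappa>Im[of t] \<kappa>ends that by (cases "t = 0 \<or> t = 1") (auto simp: less_eq_real_def)
  have \<sigma>T': "\<sigma> t \<notin> T" if "t \<in> {0..1}" for t using \<sigma>T that unfolding path_image_def by blast
  let ?p = "\<sigma> t0" and ?p' = "\<sigma> t1" and ?c = "\<kappa> s0" and ?c' = "\<kappa> s1"
  let ?L1 = "linepath ?p ?c" and ?L2 = "linepath ?c' ?p'"
  define \<Gamma> where "\<Gamma> = subpath s0 s1 \<kappa> +++ ?L2 +++ reversepath (subpath t0 t1 \<sigma>) +++ ?L1"
  have P: "0 < Im ?p" "0 < Im ?p'" "0 < Im ?c" "0 < Im ?c'"
    using t0 t1 s0 s1 by (auto intro!: Im \<kappa>Im)
  have "path_image ?L1 \<subseteq> N1 \<inter> {z. 0 < Im z}"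
    unfolding path_image_linepath
    by (intro closed_segment_subset convex_Int N1(1) convex_halfspace_Im_gt) (use P t0 s0 in auto)
  moreover have "path_image ?L2 \<subseteq> N2 \<inter> {z. 0 < Im z}"
    unfolding path_image_linepath
    by (intro closed_segment_subset convex_Int N2(1) convex_halfspace_Im_gt) (use P t1 s1 in auto)
  ultimately have L1: "path_image ?L1 \<subseteq> N1 \<inter> {z. 0 < Im z}" "path_image ?L2 \<subseteq> N2 \<inter> {z. 0 < Im z}"
    by auto
  have m: "t0 \<in> {0..1}" "t1 \<in> {0..1}" "s0 \<in> {0..1}" "s1 \<in> {0..1}" "(0::real) \<in> {0..1}" "(1::real) \<in> {0..1}"
    using t0(1,2) t1(1,2) s0(1,2) s1(1,2) by auto
  have vs: "valid_path (subpath s0 s1 \<kappa>)" "valid_path (subpath t0 t1 \<sigma>)" "valid_path (subpath 0 t0 \<sigma>)"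
      "valid_path (subpath t1 1 \<sigma>)" "valid_path (subpath 0 s0 \<kappa>)" "valid_path (subpath s1 1 \<kappa>)"
    by (intro valid_path_subpath \<sigma>(1) \<kappa>v m)+
  have im: "path_image (subpath s0 s1 \<kappa>) \<subseteq> {z. 0 < Im z} - T" "path_image (subpath t0 t1 \<sigma>) \<subseteq> {z. 0 < Im z} - T"
    using t0 t1 s0 s1 \<kappa>T \<sigma>T' \<kappa>Im Im by (auto simp: path_image_subpath)
  have ends: "path_image (subpath 0 t0 \<sigma>) \<subseteq> N1 \<inter> H" "path_image (subpath 0 s0 \<kappa>) \<subseteq> N1 \<inter> H"
      "path_image (subpath t1 1 \<sigma>) \<subseteq> N2 \<inter> H" "path_image (subpath s1 1 \<kappa>) \<subseteq> N2 \<inter> H"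
    using t0 t1 s0 s1 \<sigma>H \<kappa>H by (auto simp: path_image_subpath)
  have v: "valid_path \<Gamma>" unfolding \<Gamma>_def using vs by (auto intro!: valid_path_join)
  have closed: "pathfinish \<Gamma> = pathstart \<Gamma>" by (simp add: \<Gamma>_def)
  have L1T: "path_image ?L1 \<subseteq> {z. 0 < Im z} - T" "path_image ?L2 \<subseteq> {z. 0 < Im z} - T"
    using L1 N1(2) N2(2) by auto
  have image: "path_image \<Gamma> \<subseteq> {z. 0 < Im z} - T"
    unfolding \<Gamma>_def using im L1T by (simp add: path_image_join)
  have val: "contour_integral \<Gamma> k = contour_integral \<kappa> k +
      contour_integral (linepath (- of_real r) (- of_real \<beta>)) k - contour_integral \<sigma> k +
      contour_integral (linepath (of_real \<beta>) (of_real r)) k" if k: "half_plane_analytic k" for k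
  proof -
    obtain \<Phi>1 where \<Phi>1: "\<And>p. valid_path p \<Longrightarrow> path_image p \<subseteq> N1 \<inter> H \<Longrightarrow> contour_integral p k = \<Phi>1 (pathfinish p) - \<Phi>1 (pathstart p)"
      using half_plane_same_ends[OF k N1(1,2)] by blast
    obtain \<Phi>2 where \<Phi>2: "\<And>p. valid_path p \<Longrightarrow> path_image p \<subseteq> N2 \<inter> H \<Longrightarrow> contour_integral p k = \<Phi>2 (pathfinish p) - \<Phi>2 (pathstart p)"
      using half_plane_same_ends[OF k N2(1,2)] by blast
    have a1: "contour_integral (subpath 0 t0 \<sigma>) k = \<Phi>1 ?p - \<Phi>1 (of_real \<beta>)"
      using \<Phi>1[OF vs(3) ends(1)] by (simp add: \<sigma>e)
    have a2: "contour_integral (subpath 0 s0 \<kappa>) k = \<Phi>1 ?c - \<Phi>1 (of_real r)"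
      using \<Phi>1[OF vs(5) ends(2)] by (simp add: \<kappa>ends)
    have a3: "contour_integral (linepath (of_real \<beta>) (of_real r)) k = \<Phi>1 (of_real r) - \<Phi>1 (of_real \<beta>)"
    proof -
      have "path_image (linepath (of_real \<beta>) (of_real r)) \<subseteq> N1 \<inter> H"
        unfolding path_image_linepath using N1(6) seg(1) by auto
      from \<Phi>1[OF valid_path_linepath this] show ?thesis by simp
    qed
    have a4: "contour_integral ?L1 k = \<Phi>1 ?c - \<Phi>1 ?p"
    proof -
      have "path_image ?L1 \<subseteq> N1 \<inter> H" using L1(1) by force
      from \<Phi>1[OF valid_path_linepath this] show ?thesis by simp
    qed
    have b1: "contour_integral (subpath t1 1 \<sigma>) k = \<Phi>2 (- of_real \<beta>) - \<Phi>2 ?p'"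
      using \<Phi>2[OF vs(4) ends(3)] by (simp add: \<sigma>e)
    have b2: "contour_integral (subpath s1 1 \<kappa>) k = \<Phi>2 (- of_real r) - \<Phi>2 ?c'"
      using \<Phi>2[OF vs(6) ends(4)] by (simp add: \<kappa>ends)
    have b3: "contour_integral (linepath (- of_real r) (- of_real \<beta>)) k = \<Phi>2 (- of_real \<beta>) - \<Phi>2 (- of_real r)"
    proof -
      have "path_image (linepath (- of_real r) (- of_real \<beta>)) \<subseteq> N2 \<inter> H"
        unfolding path_image_linepath using N2(6) seg(2) by auto
      from \<Phi>2[OF valid_path_linepath this] show ?thesis by simp
    qed
    have b4: "contour_integral ?L2 k = \<Phi>2 ?p' - \<Phi>2 ?c'"
    proof -
      have "path_image ?L2 \<subseteq> N2 \<inter> H" using L1(2) by force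
      from \<Phi>2[OF valid_path_linepath this] show ?thesis by simp
    qed
    have i\<sigma>: "k contour_integrable_on \<sigma>" and i\<kappa>: "k contour_integrable_on \<kappa>"
      by (rule half_plane_contour_integrable[OF k \<sigma>(1)], use \<sigma>H \<sigma>T' in \<open>auto simp: path_image_def\<close>)
        (rule half_plane_contour_integrable[OF k \<kappa>v], use \<kappa>H \<kappa>T in \<open>auto simp: path_image_def\<close>)
    have c1: "contour_integral \<sigma> k = contour_integral (subpath 0 t0 \<sigma>) k + contour_integral (subpath t0 t1 \<sigma>) k + contour_integral (subpath t1 1 \<sigma>) k"
      using contour_integral_subpath_combine[OF i\<sigma> \<sigma>(1), of 0 t0 t1] contour_integral_subpath_combine[OF i\<sigma> \<sigma>(1), of 0 t1 1] t0 t1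
      by (simp add: subpath_trivial)
    have c2: "contour_integral \<kappa> k = contour_integral (subpath 0 s0 \<kappa>) k + contour_integral (subpath s0 s1 \<kappa>) k + contour_integral (subpath s1 1 \<kappa>) k"
      using contour_integral_subpath_combine[OF i\<kappa> \<kappa>v, of 0 s0 s1] contour_integral_subpath_combine[OF i\<kappa> \<kappa>v, of 0 s1 1] s0 s1
      by (simp add: subpath_trivial)
    have ii: "k contour_integrable_on p" if "valid_path p" "path_image p \<subseteq> {z. 0 < Im z} - T" for p
      by (rule half_plane_contour_integrable[OF k that(1)]) (use that(2) in force)
    let ?R = "reversepath (subpath t0 t1 \<sigma>)"
    have v34: "valid_path (?R +++ ?L1)" using vs by (auto intro!: valid_path_join)
    have v234: "valid_path (?L2 +++ ?R +++ ?L1)" using v34 by (auto intro!: valid_path_join)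
    have i34: "path_image (?R +++ ?L1) \<subseteq> {z. 0 < Im z} - T" using im L1T by (simp add: path_image_join)
    have i234: "path_image (?L2 +++ ?R +++ ?L1) \<subseteq> {z. 0 < Im z} - T" using im L1T by (simp add: path_image_join)
    have vR: "valid_path ?R" "path_image ?R \<subseteq> {z. 0 < Im z} - T" using vs im by auto
    have "contour_integral \<Gamma> k = contour_integral (subpath s0 s1 \<kappa>) k + contour_integral (?L2 +++ ?R +++ ?L1) k"
      unfolding \<Gamma>_def by (rule contour_integral_join[OF ii[OF vs(1) im(1)] ii[OF v234 i234] vs(1) v234])
    also have "contour_integral (?L2 +++ ?R +++ ?L1) k = contour_integral ?L2 k + contour_integral (?R +++ ?L1) k"
      by (rule contour_integral_join[OF ii[OF valid_path_linepath L1T(2)] ii[OF v34 i34] valid_path_linepath v34])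
    also have "contour_integral (?R +++ ?L1) k = contour_integral ?R k + contour_integral ?L1 k"
      by (rule contour_integral_join[OF ii[OF vR] ii[OF valid_path_linepath L1T(1)] vR(1) valid_path_linepath])
    also have "contour_integral (reversepath (subpath t0 t1 \<sigma>)) k = - contour_integral (subpath t0 t1 \<sigma>) k"
      by (rule contour_integral_reversepath[OF vs(2)])
    finally show ?thesis unfolding c1 c2 a1 a2 a3 a4 b1 b2 b3 b4 by simp
  qed
  show thesis using that[OF v closed image] val unfolding \<kappa>_def by blast
qed

end

lemma contour_integral_semicircle:
  "contour_integral (part_circlepath 0 r 0 pi) (\<lambda>z. 2 * z * q (z\<^sup>2)) = contour_integral (circlepath 0 (r\<^sup>2)) q"
proof -
  have "(\<lambda>z. z\<^sup>2) \<circ> part_circlepath 0 r 0 pi = circlepath 0 (r\<^sup>2)"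
    by (simp add: fun_eq_iff circlepath_def part_circlepath_def linepath_def power_mult_distrib exp_double[symmetric] mult_ac)
  moreover have "contour_integral ((\<lambda>z. z\<^sup>2) \<circ> part_circlepath 0 r 0 pi) q =
      contour_integral (part_circlepath 0 r 0 pi) (\<lambda>w. deriv (\<lambda>z. z\<^sup>2) w * q (w\<^sup>2))"
    by (rule contour_integral_comp_analyticW[where s = UNIV]) (auto intro!: analytic_intros)
  moreover have "deriv (\<lambda>z. z\<^sup>2) w = 2 * w" for w :: complex
    by (rule DERIV_imp_deriv) (auto intro!: derivative_eq_intros)
  ultimately show ?thesis by simp
qed

lemma integral_square_substitution:
  fixes F :: "real \<Rightarrow> complex"
  assumes \<beta>: "0 < \<beta>" "\<beta> \<le> r" and F: "continuous_on {\<beta>..r} F"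
  shows "integral {\<beta>..r} (\<lambda>x. 2 * of_real x * F x) = integral {\<beta>\<^sup>2..r\<^sup>2} (\<lambda>s. F (sqrt s))"
proof -
  have m: "sqrt s \<in> {\<beta>..r}" if "s \<in> {\<beta>\<^sup>2..r\<^sup>2}" for s
    using that \<beta> by (auto intro: real_le_rsqrt real_le_lsqrt)
  have "((\<lambda>x. (2 * x) *\<^sub>R F (sqrt (x\<^sup>2))) has_integral integral {\<beta>\<^sup>2..r\<^sup>2} (\<lambda>s. F (sqrt s))) {\<beta>..r}"
  proof (rule has_integral_substitution)
    show "\<beta>\<^sup>2 \<le> r\<^sup>2" using \<beta> by (intro power_mono) auto
    show "(\<lambda>x. x\<^sup>2) ` {\<beta>..r} \<subseteq> {\<beta>\<^sup>2..r\<^sup>2}" using \<beta> by (auto intro: power_mono)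
    show "continuous_on {\<beta>\<^sup>2..r\<^sup>2} (\<lambda>s. F (sqrt s))"
      by (rule continuous_on_compose2[OF F]) (use m in \<open>auto intro!: continuous_intros\<close>)
    show "((\<lambda>x. x\<^sup>2) has_field_derivative 2 * x) (at x within {\<beta>..r})" for x
      by (auto intro!: derivative_eq_intros)
  qed (use \<beta> in auto)
  then have "((\<lambda>x. 2 * of_real x * F x) has_integral integral {\<beta>\<^sup>2..r\<^sup>2} (\<lambda>s. F (sqrt s))) {\<beta>..r}"
    by (rule has_integral_eq[rotated]) (use \<beta> in \<open>auto simp: scaleR_conv_of_real\<close>)
  then show ?thesis by (rule integral_unique)
qed

lemma contour_integral_positive_axis:
  assumes "0 < \<beta>" "\<beta> < r"
  shows "contour_integral (linepath (of_real \<beta>) (of_real r)) (\<lambda>z. 2 * z * f z) = integral {\<beta>..r} (\<lambda>x. 2 * of_real x * f (of_real x))"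
  by (subst contour_integral_linepath_Reals_eq) (use assms in auto)

lemma contour_integral_negative_axis:
  assumes "0 < \<beta>" "\<beta> < r"
  shows "contour_integral (linepath (- of_real r) (- of_real \<beta>)) (\<lambda>z. 2 * z * f z) = - integral {\<beta>..r} (\<lambda>x. 2 * of_real x * f (- of_real x))"
proof -
  have "contour_integral (linepath (- of_real r) (- of_real \<beta>)) (\<lambda>z. 2 * z * f z) =
      integral {- r..- \<beta>} (\<lambda>x. - (2 * of_real (- x) * f (- of_real (- x))))"
    by (subst contour_integral_linepath_Reals_eq) (use assms in auto)
  also have "\<dots> = integral {\<beta>..r} (\<lambda>x. - (2 * of_real x * f (- of_real x)))"
    by (rule Henstock_Kurzweil_Integration.integral_reflect_real)
  finally show ?thesis by simp
qed

text \<open>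
  Cauchy's theorem for the deformed contour requires its winding number about each singularity \<open>w\<close> to
  vanish. The function \<open>2z / (z\<^sup>2 - w\<^sup>2) = 1 / (z - w) + 1 / (z + w)\<close> is odd, so its integrals along the two halves
  of the axis cancel, while those along the semicircle and the lifted loop are integrals of
  \<open>1 / (\<mu> - w\<^sup>2)\<close> along the large circle and the loop, which both wind once around \<open>w\<^sup>2\<close>.
\<close>

lemma loop_contour_formula:
  fixes f :: "complex \<Rightarrow> complex"
  assumes g: "loop_around S g" and b: "0 < b" "pathstart g = of_real b"
    and B: "\<And>z. z \<in> B \<Longrightarrow> 0 \<le> Im z" "\<And>z. z \<in> B \<Longrightarrow> z\<^sup>2 \<in> inside (path_image g)" "closed (B \<union> {0})"
    and fc: "continuous_on ({z. 0 \<le> Im z} - (B \<union> {0})) f"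
    and fh: "f holomorphic_on {z. 0 < Im z} - (B \<union> {0})"
  obtains C R where "((\<lambda>\<mu>. f (up_sqrt \<mu>)) has_contour_integral C) g"
    "\<And>r. R \<le> r \<Longrightarrow> contour_integral (part_circlepath 0 r 0 pi) (\<lambda>z. 2 * z * f z) =
      C - integral {b..r\<^sup>2} (\<lambda>s. f (of_real (sqrt s))) + integral {b..r\<^sup>2} (\<lambda>s. f (- of_real (sqrt s)))"
proof -
  define T where "T = B \<union> {0}"
  interpret upper_half_plane T by unfold_locales (unfold T_def, rule B(3))
  define \<beta> where "\<beta> = sqrt b"
  have \<beta>: "0 < \<beta>" "\<beta>\<^sup>2 = b" using b by (auto simp: \<beta>_def)
  have i0: "0 \<in> inside (path_image g)" and sp: "simple_path g" "pathfinish g = pathstart g" and w1: "winding_number g 0 = 1" and vg: "valid_path g"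
    using g by (auto simp: loop_around_def)
  obtain \<sigma> where \<sigma>: "valid_path \<sigma>" "pathstart \<sigma> = of_real \<beta>" "pathfinish \<sigma> = - of_real \<beta>"
    and sq: "\<And>t. t \<in> {0..1} \<Longrightarrow> (\<sigma> t)\<^sup>2 = g t" and Im: "\<And>t. t \<in> {0<..<1} \<Longrightarrow> 0 < Im (\<sigma> t)"
    using loop_sqrt_lift[OF g b] unfolding \<beta>_def by blast
  have disj: "inside (path_image g) \<inter> path_image g = {}" by (rule inside_no_overlap)
  have \<sigma>T: "path_image \<sigma> \<inter> T = {}"
  proof (rule ccontr)
    assume "path_image \<sigma> \<inter> T \<noteq> {}"
    then obtain t where t: "t \<in> {0..1}" "\<sigma> t \<in> B \<or> \<sigma> t = 0" unfolding path_image_def T_def by blast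
    then have "g t \<in> inside (path_image g)" using sq[OF t(1)] B(2)[of "\<sigma> t"] i0 by auto
    moreover have "g t \<in> path_image g" using t(1) by (auto simp: path_image_def)
    ultimately show False using disj by blast
  qed
  have sT: "of_real s \<notin> T \<and> - of_real s \<notin> T" if "\<beta> \<le> s" for s :: real
  proof -
    have "b \<le> s\<^sup>2" using that \<beta> by (metis less_eq_real_def power_mono)
    then have "of_real (s\<^sup>2) \<notin> inside (path_image g)" by (rule loop_half_line_outside[OF g b(2)])
    then show ?thesis using that \<beta>(1) B(2)[of "of_real s"] B(2)[of "- of_real s"] by (auto simp: T_def)
  qed
  have "bounded (inside (path_image g))" using Jordan_inside_outside[OF sp] by blast
  then obtain K where K: "\<And>z. z \<in> inside (path_image g) \<Longrightarrow> cmod z \<le> K" unfolding bounded_iff by blast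
  have K0: "0 \<le> K" using K[OF i0] by simp
  define R where "R = \<beta> + K + 1"
  have rT: "cmod z < r" if "z \<in> T" "R \<le> r" for z r
  proof (rule ccontr)
    assume "\<not> cmod z < r"
    then have r: "r \<le> cmod z" by simp
    have "1 \<le> r" "K < r" using that(2) \<beta> K0 by (auto simp: R_def)
    then have "z \<noteq> 0" using r by auto
    then have "cmod (z\<^sup>2) \<le> K" using that(1) by (intro K B(2)) (auto simp: T_def)
    moreover have "cmod z \<le> cmod (z\<^sup>2)" using r \<open>1 \<le> r\<close> by (simp only: norm_power) (intro self_le_power, auto)
    ultimately show False using \<open>K < r\<close> r by linarith
  qed
  have half_plane_analytic: "half_plane_analytic (\<lambda>z. 2 * z * q z)" if "continuous_on (H - T) q" "q holomorphic_on {z. 0 < Im z} - T" for q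
    unfolding half_plane_analytic_def using that by (auto intro!: continuous_intros holomorphic_intros)
  have kn: "half_plane_analytic (\<lambda>z. 2 * z * f z)" using half_plane_analytic[of f] fc fh by (simp add: T_def)
  have \<sigma>H: "path_image \<sigma> \<subseteq> H - T"
  proof
    fix z assume z: "z \<in> path_image \<sigma>"
    then obtain t where t: "t \<in> {0..1}" "z = \<sigma> t" by (auto simp: path_image_def)
    have "0 \<le> Im z"
      using Im[of t] \<sigma>(2,3) t by (cases "t = 0 \<or> t = 1") (auto simp: pathstart_def pathfinish_def less_eq_real_def)
    then show "z \<in> H - T" using z \<sigma>T by blast
  qed
  define C where "C = contour_integral \<sigma> (\<lambda>z. 2 * z * f z)"
  have "((\<lambda>z. 2 * z * f z) has_contour_integral C) \<sigma>"
    unfolding C_def by (intro has_contour_integral_integral half_plane_contour_integrable[OF kn \<sigma>(1) \<sigma>H])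
  from contour_integral_lift[OF \<sigma>(1) sq Im this]
  have C: "((\<lambda>\<mu>. f (up_sqrt \<mu>)) has_contour_integral C) g" .
  have main: "contour_integral (part_circlepath 0 r 0 pi) (\<lambda>z. 2 * z * f z) =
      C - integral {b..r\<^sup>2} (\<lambda>s. f (of_real (sqrt s))) + integral {b..r\<^sup>2} (\<lambda>s. f (- of_real (sqrt s)))"
    if r: "R \<le> r" for r
  proof -
    have \<beta>r: "\<beta> < r" "\<beta> \<le> r" using r \<beta> K0 by (auto simp: R_def)
    obtain \<Gamma> where \<Gamma>: "valid_path \<Gamma>" "pathfinish \<Gamma> = pathstart \<Gamma>" "path_image \<Gamma> \<subseteq> {z. 0 < Im z} - T"
      and def: "\<And>k. half_plane_analytic k \<Longrightarrow> contour_integral \<Gamma> k = contour_integral (part_circlepath 0 r 0 pi) k +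
        contour_integral (linepath (- of_real r) (- of_real \<beta>)) k - contour_integral \<sigma> k +
        contour_integral (linepath (of_real \<beta>) (of_real r)) k"
      using deformation[OF \<sigma> Im \<sigma>T \<beta>(1) \<beta>r(2)] sT rT[OF _ r] by (metis atLeastAtMost_iff)
    have outer: "winding_number \<Gamma> w = 0" if "Im w \<le> 0" for w
      by (rule winding_number_zero_outside[of _ "{z. 0 < Im z}"])
        (use \<Gamma> that in \<open>auto intro: valid_path_imp_path convex_halfspace_Im_gt\<close>)
    have inner: "winding_number \<Gamma> w = 0" if w: "w \<in> T" "0 < Im w" for w
    proof -
      let ?q = "\<lambda>\<mu>. 1 / (\<mu> - w\<^sup>2)"
      have wB: "w \<in> B" using w by (auto simp: T_def)
      have ne: "z\<^sup>2 - w\<^sup>2 \<noteq> 0" if "z \<in> H - T" for z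
      proof
        assume "z\<^sup>2 - w\<^sup>2 = 0"
        then have "z = w \<or> z = - w" by (simp add: power2_eq_iff)
        then show False using that w by auto
      qed
      have "continuous_on (H - T) (\<lambda>z. ?q (z\<^sup>2))" using ne by (intro continuous_intros) auto
      moreover have "(\<lambda>z. ?q (z\<^sup>2)) holomorphic_on {z. 0 < Im z} - T" using ne by (intro holomorphic_intros) auto
      ultimately have hn: "half_plane_analytic (\<lambda>z. 2 * z * ?q (z\<^sup>2))" by (rule half_plane_analytic)
      have "w\<^sup>2 \<in> inside (path_image g)" by (rule B(2)[OF wB])
      have wg: "winding_number g (w\<^sup>2) = 1"
        using winding_number_eq[OF valid_path_imp_path[OF vg] sp(2) \<open>w\<^sup>2 \<in> inside (path_image g)\<close> i0] Jordan_inside_outside[OF sp] disj w1 by auto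
      have a: "contour_integral (part_circlepath 0 r 0 pi) (\<lambda>z. 2 * z * ?q (z\<^sup>2)) = 2 * of_real pi * \<i>"
      proof -
        have "cmod (w\<^sup>2) < r\<^sup>2" using rT[OF w(1) r] by (simp add: norm_power power_strict_mono)
        then have "((\<lambda>u. 1 / (u - w\<^sup>2)) has_contour_integral 2 * of_real pi * \<i> * 1) (circlepath 0 (r\<^sup>2))"
          by (intro Cauchy_integral_circlepath_simple) auto
        then show ?thesis unfolding contour_integral_semicircle[of r ?q] by (simp add: contour_integral_unique)
      qed
      have s: "contour_integral \<sigma> (\<lambda>z. 2 * z * ?q (z\<^sup>2)) = 2 * of_real pi * \<i>"
      proof -
        have "((\<lambda>z. 2 * z * ?q (z\<^sup>2)) has_contour_integral contour_integral \<sigma> (\<lambda>z. 2 * z * ?q (z\<^sup>2))) \<sigma>"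
          by (intro has_contour_integral_integral half_plane_contour_integrable[OF hn \<sigma>(1) \<sigma>H])
        from contour_integral_lift[OF \<sigma>(1) sq Im this]
        have "((\<lambda>\<mu>. ?q ((up_sqrt \<mu>)\<^sup>2)) has_contour_integral contour_integral \<sigma> (\<lambda>z. 2 * z * ?q (z\<^sup>2))) g" .
        moreover have "(up_sqrt \<mu>)\<^sup>2 = \<mu>" for \<mu> by (simp add: up_sqrt_def)
        ultimately have "(?q has_contour_integral contour_integral \<sigma> (\<lambda>z. 2 * z * ?q (z\<^sup>2))) g" by simp
        moreover have "w\<^sup>2 \<notin> path_image g" using disj \<open>w\<^sup>2 \<in> inside (path_image g)\<close> by blast
        from has_contour_integral_winding_number[OF vg this]
        have "(?q has_contour_integral 2 * of_real pi * \<i>) g" by (simp add: wg)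
        ultimately show ?thesis by (rule has_contour_integral_unique)
      qed
      have "contour_integral \<Gamma> (\<lambda>z. 2 * z * ?q (z\<^sup>2)) = 0"
        unfolding def[OF hn] a s contour_integral_positive_axis[OF \<beta>(1) \<beta>r(1)] contour_integral_negative_axis[OF \<beta>(1) \<beta>r(1)]
        by simp
      moreover have "((\<lambda>z. 2 * z * ?q (z\<^sup>2)) has_contour_integral 2 * of_real pi * \<i> * winding_number \<Gamma> w + 2 * of_real pi * \<i> * winding_number \<Gamma> (- w)) \<Gamma>"
      proof -
        have "w \<notin> path_image \<Gamma>" "- w \<notin> path_image \<Gamma>" using \<Gamma>(3) w by auto
        then have "((\<lambda>z. 1 / (z - w) + 1 / (z - - w)) has_contour_integral 2 * of_real pi * \<i> * winding_number \<Gamma> w + 2 * of_real pi * \<i> * winding_number \<Gamma> (- w)) \<Gamma>"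
          using has_contour_integral_add[OF has_contour_integral_winding_number[OF \<Gamma>(1), of w] has_contour_integral_winding_number[OF \<Gamma>(1), of "- w"]] by simp
        then show ?thesis
        proof (rule has_contour_integral_eq)
          fix z assume "z \<in> path_image \<Gamma>"
          then have z: "z \<noteq> w" "z \<noteq> - w" "z\<^sup>2 - w\<^sup>2 \<noteq> 0" using \<Gamma>(3) w ne[of z] by force+
          have "z\<^sup>2 - w\<^sup>2 = (z - w) * (z - - w)" by (simp add: power2_eq_square algebra_simps)
          moreover have "z - w \<noteq> 0" "z - - w \<noteq> 0" using z by (auto simp: eq_neg_iff_add_eq_0)
          ultimately show "1 / (z - w) + 1 / (z - - w) = 2 * z * ?q (z\<^sup>2)"
            by (simp only:) (simp add: field_simps)
        qed
      qed
      ultimately have "2 * of_real pi * \<i> * winding_number \<Gamma> w = 0"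
        using outer[of "- w"] w contour_integral_unique by fastforce
      then show ?thesis by simp
    qed
    have "((\<lambda>z. 2 * z * f z) has_contour_integral 0) \<Gamma>"
    proof (rule Cauchy_theorem_global[OF open_domain _ \<Gamma>(1,2,3)])
      show "(\<lambda>z. 2 * z * f z) holomorphic_on {z. 0 < Im z} - T" using kn by (simp add: half_plane_analytic_def)
      show "winding_number \<Gamma> w = 0" if "w \<notin> {z. 0 < Im z} - T" for w
        using inner[of w] outer[of w] that by (cases "0 < Im w") auto
    qed
    then have z: "contour_integral \<Gamma> (\<lambda>z. 2 * z * f z) = 0" by (rule contour_integral_unique)
    have pc: "continuous_on {\<beta>..r} (\<lambda>x. f (of_real x))"
      by (rule continuous_on_compose2[OF fc]) (use sT in \<open>auto intro!: continuous_intros simp: T_def\<close>)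
    have nc: "continuous_on {\<beta>..r} (\<lambda>x. f (- of_real x))"
      by (rule continuous_on_compose2[OF fc]) (use sT in \<open>auto intro!: continuous_intros simp: T_def\<close>)
    show ?thesis
      using z unfolding def[OF kn] C_def[symmetric] contour_integral_positive_axis[OF \<beta>(1) \<beta>r(1)] contour_integral_negative_axis[OF \<beta>(1) \<beta>r(1)]
        integral_square_substitution[OF \<beta>(1) \<beta>r(2) pc] integral_square_substitution[OF \<beta>(1) \<beta>r(2) nc] \<beta>(2)
      by (simp add: algebra_simps add_eq_0_iff)
  qed
  show thesis by (rule that[OF C main])
qed

lemma half_line_integral_limit:
  fixes f :: "real \<Rightarrow> complex"
  assumes b: "0 < b" and f: "continuous_on {b..} f"
    and decay: "\<And>s. R \<le> s \<Longrightarrow> cmod (f s) \<le> K * s powr (-3/2)"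
  obtains U where "(f has_integral U) {b..}" "(\<lambda>n. integral {b..(real n)\<^sup>2} f) \<longlonglongrightarrow> U"
proof -
  obtain m where m: "\<And>s. s \<in> {b..max b R} \<Longrightarrow> cmod (f s) \<le> m"
  proof -
    have "bounded (f ` {b..max b R})"
      by (rule compact_imp_bounded[OF compact_continuous_image[OF continuous_on_subset[OF f]]]) auto
    then show thesis using that unfolding bounded_iff by blast
  qed
  define p where "p = (max b R) powr (-3/2)"
  have p: "0 < p" using b by (simp add: p_def)
  define K' where "K' = max K (m / p)"
  have "cmod (f b) \<le> m" by (rule m) simp
  then have m0: "0 \<le> m" by (meson norm_ge_zero order_trans)
  have bound: "norm (f s) \<le> K' * s powr (-3/2)" if s: "b \<le> s" for s
  proof (cases "s \<le> max b R")
    case True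
    have "p \<le> s powr (-3/2)" unfolding p_def using s b True by (intro powr_mono2') auto
    then have "m / p * p \<le> K' * s powr (-3/2)"
      using p m0 by (intro mult_mono) (auto simp: K'_def le_max_iff_disj)
    then show ?thesis using m[of s] s True p by simp
  next
    case False
    have "K * s powr (-3/2) \<le> K' * s powr (-3/2)" by (intro mult_right_mono) (auto simp: K'_def)
    moreover have "R \<le> s" using False by simp
    ultimately show ?thesis using decay[of s] by (meson order_trans)
  qed
  have h: "(\<lambda>s. K' * s powr (-3/2)) integrable_on {b..}"
    using has_integral_integrable[OF has_integral_powr_to_inf[of "-3/2" b]] b by (intro integrable_on_mult_right) simp
  let ?f = "\<lambda>n s. if s \<in> {b..(real n)\<^sup>2} then f s else 0"
  have eq: "{b..(real n)\<^sup>2} \<inter> {b..} = {b..(real n)\<^sup>2}" for n by auto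
  have int: "f integrable_on {b..(real n)\<^sup>2}" for n
    by (intro integrable_continuous_real continuous_on_subset[OF f]) auto
  have 1: "?f n integrable_on {b..}" for n
    using int[of n] by (simp only: integrable_restrict_Int eq)
  have 2: "norm (?f n s) \<le> K' * s powr (-3/2)" if "s \<in> {b..}" for n s
    using bound[of s] that norm_ge_zero[of "f s"] by (auto simp del: norm_ge_zero intro: order_trans[OF norm_ge_zero])
  have 3: "(\<lambda>n. ?f n s) \<longlonglongrightarrow> f s" if s: "s \<in> {b..}" for s
  proof (rule tendsto_eventually)
    obtain N :: nat where N: "max 1 s \<le> real N" using real_arch_simple by blast
    show "\<forall>\<^sub>F n in sequentially. ?f n s = f s"
      using eventually_ge_at_top[of N]
    proof eventually_elim
      case (elim n)
      then have n: "1 \<le> real n" "s \<le> real n" using N by auto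
      have "real n \<le> (real n)\<^sup>2" using n by (intro self_le_power) auto
      then have "s \<le> (real n)\<^sup>2" using n by linarith
      then show ?case using s by simp
    qed
  qed
  note dc = dominated_convergence[where f = ?f and g = f and h = "\<lambda>s. K' * s powr (-3/2)", OF 1 h 2 3]
  have "integral {b..} (?f n) = integral {b..(real n)\<^sup>2} f" for n
    by (simp only: integral_restrict_Int eq)
  then show thesis using that[of "integral {b..} f"] dc by (simp add: integrable_integral)
qed

section \<open>The main equation\<close>

context sl_pair begin

text \<open>
  On the semicircle \<open>F = (\<phi>~(x,\<lambda>) - E(\<rho>\<^sup>2)) / (\<rho>\<^sup>2 - \<lambda>) + O(\<rho>\<^sup>-\<^sup>3)\<close>. The first term is a function of \<open>\<mu>\<close> whose numerator is
  entire, so Cauchy's formula on the full circle applies, and the error contributes \<open>O(1/\<rho>)\<close>.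
\<close>

lemma semicircle_limit:
  "(\<lambda>n. contour_integral (part_circlepath 0 (real n) 0 pi) (\<lambda>z. 2 * z * F z $ i $ j)) \<longlonglongrightarrow>
    2 * of_real pi * \<i> * (\<phi>1 x lam - \<phi> x lam) $ i $ j"
proof -
  define q where "q \<mu> = (\<phi>1 x lam - E \<mu>) $ i $ j" for \<mu>
  let ?\<kappa> = "\<lambda>n. part_circlepath 0 (real n) 0 pi"
  have qh: "q holomorphic_on A" for A
    unfolding q_def using mholo_diff[OF mholo_const E_entire] unfolding mholo_def by (blast intro: holomorphic_on_subset)
  obtain K where K: "0 \<le> K" "eventually (\<lambda>\<rho>. norm (G \<rho> - \<phi>1 x lam) \<le> K * cmod \<rho> powi (-1)) uhp"
    using growsE[OF G_asymptotics] by blast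
  from eventually_conj[OF K(2) eventually_nonsing] obtain R where
    R: "\<And>\<rho>. 0 \<le> Im \<rho> \<Longrightarrow> R \<le> cmod \<rho> \<Longrightarrow> norm (G \<rho> - \<phi>1 x lam) \<le> K * cmod \<rho> powi (-1) \<and> nonsing \<rho>"
    unfolding eventually_uhp by blast
  obtain N :: nat where N: "max (max 1 R) (cmod lam + 1) \<le> real N" using real_arch_simple by blast
  have est: "norm (contour_integral (?\<kappa> n) (\<lambda>z. 2 * z * F z $ i $ j) - 2 * of_real pi * \<i> * q lam)
      \<le> 2 * K * pi * (real n / ((real n)\<^sup>2 - cmod lam))" if n: "N \<le> n" for n
  proof -
    let ?r = "real n"
    have r: "1 \<le> ?r" "R \<le> ?r" "cmod lam < ?r" using n N by auto
    have r2: "cmod lam < ?r\<^sup>2"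
    proof -
      have "?r \<le> ?r\<^sup>2" using r by (intro self_le_power) auto
      then show ?thesis using r by linarith
    qed
    have \<kappa>: "cmod z = ?r" "0 \<le> Im z" if z: "z \<in> path_image (?\<kappa> n)" for z
    proof -
      obtain t where t01: "t \<in> {0..1}" and "z = ?\<kappa> n t" using z unfolding path_image_def by blast
      then have t: "t \<in> {0..1}" "z = ?r * exp (\<i> * of_real (pi * t))"
        by (simp_all add: part_circlepath_def linepath_def mult_ac)
      show "cmod z = ?r" using r by (simp add: t norm_mult)
      have "Im z = ?r * sin (pi * t)" by (simp add: t Im_exp)
      moreover have "0 \<le> sin (pi * t)" using t(1) by (intro sin_ge_zero) auto
      ultimately show "0 \<le> Im z" using r by simp
    qed
    have ne: "z\<^sup>2 - lam \<noteq> 0" if "z \<in> path_image (?\<kappa> n)" for z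
    proof
      assume "z\<^sup>2 - lam = 0"
      then have "cmod (z\<^sup>2) = cmod lam" by simp
      then show False using \<kappa>(1)[OF that] r2 by (simp add: norm_power)
    qed
    have "continuous_on (path_image (?\<kappa> n)) F"
      by (rule continuous_on_subset[OF F_continuous]) (use R \<kappa> r in auto)
    then have Fc: "continuous_on (path_image (?\<kappa> n)) (\<lambda>z. F z $ i $ j)"
      by (rule bounded_linear.continuous_on[OF bounded_linear_entry])
    have qc: "continuous_on (path_image (?\<kappa> n)) (\<lambda>z. q (z\<^sup>2))"
      by (rule continuous_on_compose2[OF holomorphic_on_imp_continuous_on[OF qh[of UNIV]]]) (auto intro!: continuous_intros)
    let ?f1 = "\<lambda>z. 2 * z * F z $ i $ j" and ?f2 = "\<lambda>z. 2 * z * (q (z\<^sup>2) / (z\<^sup>2 - lam))"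
    have i1: "?f1 contour_integrable_on ?\<kappa> n"
      by (intro contour_integrable_continuous_part_circlepath continuous_intros Fc)
    have i2: "?f2 contour_integrable_on ?\<kappa> n"
      by (intro contour_integrable_continuous_part_circlepath continuous_intros qc) (use ne in auto)
    have c2: "contour_integral (?\<kappa> n) ?f2 = 2 * of_real pi * \<i> * q lam"
      unfolding contour_integral_semicircle[of "real n" "\<lambda>\<mu>. q \<mu> / (\<mu> - lam)"]
      by (intro contour_integral_unique Cauchy_integral_circlepath_simple qh) (use r2 in simp)
    have "norm (contour_integral (?\<kappa> n) (\<lambda>z. ?f1 z - ?f2 z)) \<le> 2 * K / (?r\<^sup>2 - cmod lam) * ?r * \<bar>pi - 0\<bar>"
    proof (rule contour_integral_bound_part_circlepath)
      show "(\<lambda>z. ?f1 z - ?f2 z) contour_integrable_on ?\<kappa> n" by (rule contour_integrable_diff[OF i1 i2])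
      show "0 \<le> 2 * K / (?r\<^sup>2 - cmod lam)" using K r2 by simp
      fix z assume z: "z \<in> path_image (?\<kappa> n)"
      have zn: "cmod z = ?r" by (rule \<kappa>(1)[OF z])
      have "(z\<^sup>2 - lam) * F z $ i $ j = (G z - E (z\<^sup>2)) $ i $ j" using F_G_E[of z] by (metis cscale_nth)
      then have "F z $ i $ j = (G z - E (z\<^sup>2)) $ i $ j / (z\<^sup>2 - lam)" using ne[OF z] by (simp add: field_simps)
      then have "F z $ i $ j - q (z\<^sup>2) / (z\<^sup>2 - lam) = (G z - \<phi>1 x lam) $ i $ j / (z\<^sup>2 - lam)"
        by (simp add: q_def flip: diff_divide_distrib)
      then have "?f1 z - ?f2 z = 2 * z * ((G z - \<phi>1 x lam) $ i $ j / (z\<^sup>2 - lam))"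
        by (simp only: right_diff_distrib[symmetric])
      then have "norm (?f1 z - ?f2 z) = 2 * ?r * (cmod ((G z - \<phi>1 x lam) $ i $ j) / cmod (z\<^sup>2 - lam))"
        by (simp add: norm_mult norm_divide zn)
      also have "\<dots> \<le> 2 * ?r * ((K / ?r) / (?r\<^sup>2 - cmod lam))"
      proof (intro mult_left_mono frac_le)
        have "norm (G z - \<phi>1 x lam) \<le> K / ?r" using R[of z] \<kappa>[OF z] r by (simp add: power_int_minus divide_inverse)
        then show "cmod ((G z - \<phi>1 x lam) $ i $ j) \<le> K / ?r" using norm_entry_le order_trans by blast
        show "?r\<^sup>2 - cmod lam \<le> cmod (z\<^sup>2 - lam)" using norm_triangle_ineq2[of "z\<^sup>2" lam] by (simp add: norm_power zn)
      qed (use r2 r K in auto)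
      also have "\<dots> = 2 * K / (?r\<^sup>2 - cmod lam)" using r by simp
      finally show "norm (?f1 z - ?f2 z) \<le> 2 * K / (?r\<^sup>2 - cmod lam)" .
    qed simp
    then show ?thesis unfolding contour_integral_diff[OF i1 i2] c2 by (simp add: mult_ac)
  qed
  have lim: "(\<lambda>n. 2 * K * pi * (real n / ((real n)\<^sup>2 - cmod lam))) \<longlonglongrightarrow> 0"
  proof -
    have "(\<lambda>n. inverse (real n) / (1 - cmod lam * inverse (real n) * inverse (real n))) \<longlonglongrightarrow> 0 / (1 - cmod lam * 0 * 0)"
      by (intro tendsto_intros lim_inverse_n) auto
    moreover have "\<forall>\<^sub>F n in sequentially. inverse (real n) / (1 - cmod lam * inverse (real n) * inverse (real n)) = real n / ((real n)\<^sup>2 - cmod lam)"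
      using eventually_gt_at_top[of 0]
    proof eventually_elim
      case (elim n)
      then have "(real n)\<^sup>2 - cmod lam = (real n)\<^sup>2 * (1 - cmod lam * inverse (real n) * inverse (real n))"
        by (simp add: power2_eq_square field_simps)
      then show ?case using elim by (simp add: power2_eq_square field_simps)
    qed
    ultimately have "(\<lambda>n. real n / ((real n)\<^sup>2 - cmod lam)) \<longlonglongrightarrow> 0"
      using Lim_transform_eventually by fastforce
    from tendsto_mult_left[OF this, of "2 * K * pi"] show ?thesis by simp
  qed
  have "(\<lambda>n. contour_integral (?\<kappa> n) (\<lambda>z. 2 * z * F z $ i $ j) - 2 * of_real pi * \<i> * q lam) \<longlonglongrightarrow> 0"
    by (rule Lim_null_comparison[OF eventually_mono[OF eventually_ge_at_top[of N]] lim]) (rule est)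
  then have "(\<lambda>n. contour_integral (?\<kappa> n) (\<lambda>z. 2 * z * F z $ i $ j)) \<longlonglongrightarrow> 2 * of_real pi * \<i> * q lam"
    by (rule LIM_zero_cancel)
  then show ?thesis by (simp add: q_def E_lam)
qed

lemma main_equation:
  assumes g: "loop_around (Lambda_set A h e \<union> Lambda_set A h1 e1) g"
  shows "has_gamma_integral F ((2 * of_real pi * \<i>) \<odot> (\<phi>1 x lam - \<phi> x lam)) g"
proof -
  obtain b where b: "0 < b" "pathstart g = of_real b" using loop_start[OF g] by blast
  define B where "B = {\<rho> \<in> Omega. \<not> nonsing \<rho>}"
  have dom: "{z. 0 \<le> Im z} - (B \<union> {0}) = {\<rho>. nonsing \<rho>}" "{z. 0 < Im z} - (B \<union> {0}) = {\<rho>. 0 < Im \<rho> \<and> nonsing \<rho>}"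
    by (auto simp: B_def Omega_def nonsing_def)
  have inside: "z\<^sup>2 \<in> inside (path_image g)" if "z \<in> B" for z
  proof -
    have "z\<^sup>2 \<in> Lambda_set A h e \<union> Lambda_set A h1 e1" using that nonsingI unfolding B_def by blast
    then show ?thesis using g by (auto simp: loop_around_def)
  qed
  have axis: "nonsing (of_real (sqrt s))" "nonsing (- of_real (sqrt s))" if "b \<le> s" for s
  proof -
    have "(of_real (sqrt s))\<^sup>2 = (of_real s :: complex)" using that b by (simp flip: of_real_power)
    then have "of_real (sqrt s) \<notin> B" "- of_real (sqrt s) \<notin> B"
      using inside[of "of_real (sqrt s)"] inside[of "- of_real (sqrt s)"] loop_half_line_outside[OF g b(2) that] by auto
    moreover have "0 < sqrt s" using that b by simp
    ultimately show "nonsing (of_real (sqrt s))" "nonsing (- of_real (sqrt s))" by (auto simp: B_def Omega_def)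
  qed
  obtain K where "eventually (\<lambda>\<rho>. norm (exp (2 * (\<i> * \<rho> * of_real x)) \<odot> F \<rho>) \<le> K * cmod \<rho> powi (-3)) uhp"
    using growsE[OF F_decay] by blast
  then obtain R where R: "\<And>\<rho>. 0 \<le> Im \<rho> \<Longrightarrow> R \<le> cmod \<rho> \<Longrightarrow> norm (exp (2 * (\<i> * \<rho> * of_real x)) \<odot> F \<rho>) \<le> K * cmod \<rho> powi (-3)"
    unfolding eventually_uhp by blast
  have decay: "norm (F \<rho>) \<le> K * s powr (-3/2)" if s: "(max R 1)\<^sup>2 \<le> s" and \<rho>: "\<rho> = of_real (sqrt s) \<or> \<rho> = - of_real (sqrt s)" for s \<rho>
  proof -
    have rs: "max R 1 \<le> sqrt s" using s by (intro real_le_rsqrt) auto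
    then have s0: "0 < s" by (smt (verit) real_sqrt_gt_0_iff)
    have n: "cmod \<rho> = sqrt s" and im: "Im \<rho> = 0" using \<rho> s0 by auto
    have "norm (F \<rho>) = norm (exp (2 * (\<i> * \<rho> * of_real x)) \<odot> F \<rho>)" by (simp add: norm_cscale im)
    also have "\<dots> \<le> K * sqrt s powi (-3)" using R[of \<rho>] rs n im by simp
    also have "sqrt s powi (-3) = s powr (-3/2)"
    proof -
      have "sqrt s powi (-3) = inverse (sqrt s ^ 3)" by (simp add: power_int_minus)
      also have "sqrt s ^ 3 = (s powr (1/2)) powr 3" using s0 by (simp add: powr_half_sqrt powr_numeral)
      also have "\<dots> = s powr (3/2)" by (simp add: powr_powr)
      finally show ?thesis by (simp add: powr_minus)
    qed
    finally show ?thesis .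
  qed
  have "\<exists>U C L. ((\<lambda>s. F (of_real (sqrt s)) $ i $ j) has_integral U) {b..} \<and>
      ((\<lambda>\<mu>. F (up_sqrt \<mu>) $ i $ j) has_contour_integral C) g \<and>
      ((\<lambda>s. F (- of_real (sqrt s)) $ i $ j) has_integral L) {b..} \<and>
      2 * of_real pi * \<i> * (\<phi>1 x lam - \<phi> x lam) $ i $ j = - U + C + L" for i j
  proof -
    let ?f = "\<lambda>\<rho>. F \<rho> $ i $ j"
    have fc: "continuous_on {\<rho>. nonsing \<rho>} ?f"
      by (rule bounded_linear.continuous_on[OF bounded_linear_entry F_continuous])
    have fh: "?f holomorphic_on {\<rho>. 0 < Im \<rho> \<and> nonsing \<rho>}" using F_mholo by (simp add: mholo_def)
    have fc': "continuous_on ({z. 0 \<le> Im z} - (B \<union> {0})) ?f" unfolding dom(1) by (rule fc)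
    have fh': "?f holomorphic_on {z. 0 < Im z} - (B \<union> {0})" unfolding dom(2) by (rule fh)
    have B1: "0 \<le> Im z" if "z \<in> B" for z using that by (simp add: B_def Omega_def)
    have B2: "closed (B \<union> {0})" unfolding B_def by (rule singular_closed)
    obtain C R' where C: "((\<lambda>\<mu>. ?f (up_sqrt \<mu>)) has_contour_integral C) g"
      and eq: "\<And>r. R' \<le> r \<Longrightarrow> contour_integral (part_circlepath 0 r 0 pi) (\<lambda>z. 2 * z * ?f z) =
        C - integral {b..r\<^sup>2} (\<lambda>s. ?f (of_real (sqrt s))) + integral {b..r\<^sup>2} (\<lambda>s. ?f (- of_real (sqrt s)))"
      by (rule loop_contour_formula[OF g b B1 inside B2 fc' fh']) blast+
    have cu: "continuous_on {b..} (\<lambda>s. ?f (of_real (sqrt s)))"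
      by (rule continuous_on_compose2[OF fc]) (use axis in \<open>auto intro!: continuous_intros\<close>)
    have cl: "continuous_on {b..} (\<lambda>s. ?f (- of_real (sqrt s)))"
      by (rule continuous_on_compose2[OF fc]) (use axis in \<open>auto intro!: continuous_intros\<close>)
    have du: "cmod (?f (of_real (sqrt s))) \<le> K * s powr (-3/2)" "cmod (?f (- of_real (sqrt s))) \<le> K * s powr (-3/2)"
      if "(max R 1)\<^sup>2 \<le> s" for s
      using decay[OF that] norm_entry_le order_trans by blast+
    obtain U where U: "((\<lambda>s. ?f (of_real (sqrt s))) has_integral U) {b..}" "(\<lambda>n. integral {b..(real n)\<^sup>2} (\<lambda>s. ?f (of_real (sqrt s)))) \<longlonglongrightarrow> U"
      using half_line_integral_limit[OF b(1) cu du(1)] by blast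
    obtain L where L: "((\<lambda>s. ?f (- of_real (sqrt s))) has_integral L) {b..}" "(\<lambda>n. integral {b..(real n)\<^sup>2} (\<lambda>s. ?f (- of_real (sqrt s)))) \<longlonglongrightarrow> L"
      using half_line_integral_limit[OF b(1) cl du(2)] by blast
    have "(\<lambda>n. contour_integral (part_circlepath 0 (real n) 0 pi) (\<lambda>z. 2 * z * ?f z)) \<longlonglongrightarrow> C - U + L"
    proof (rule Lim_transform_eventually)
      show "(\<lambda>n. C - integral {b..(real n)\<^sup>2} (\<lambda>s. ?f (of_real (sqrt s))) + integral {b..(real n)\<^sup>2} (\<lambda>s. ?f (- of_real (sqrt s)))) \<longlonglongrightarrow> C - U + L"
        by (intro tendsto_intros U(2) L(2))
      obtain N :: nat where "R' \<le> real N" using real_arch_simple by blast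
      then show "\<forall>\<^sub>F n in sequentially. C - integral {b..(real n)\<^sup>2} (\<lambda>s. ?f (of_real (sqrt s))) + integral {b..(real n)\<^sup>2} (\<lambda>s. ?f (- of_real (sqrt s))) =
          contour_integral (part_circlepath 0 (real n) 0 pi) (\<lambda>z. 2 * z * ?f z)"
        by (intro eventually_mono[OF eventually_ge_at_top[of N]]) (simp add: eq)
    qed
    from LIMSEQ_unique[OF semicircle_limit this]
    have "2 * of_real pi * \<i> * (\<phi>1 x lam - \<phi> x lam) $ i $ j = - U + C + L" by simp
    then show ?thesis using U(1) C L(1) by blast
  qed
  then obtain U C L where UCL: "\<And>i j. ((\<lambda>s. F (of_real (sqrt s)) $ i $ j) has_integral U i j) {b..} \<and>
      ((\<lambda>\<mu>. F (up_sqrt \<mu>) $ i $ j) has_contour_integral C i j) g \<and>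
      ((\<lambda>s. F (- of_real (sqrt s)) $ i $ j) has_integral L i j) {b..} \<and>
      2 * of_real pi * \<i> * (\<phi>1 x lam - \<phi> x lam) $ i $ j = - U i j + C i j + L i j"
    by metis
  show ?thesis
    unfolding has_gamma_integral_def cut_loop[OF g b(2)]
  proof (rule exI[of _ "\<chi> i j. U i j"], rule exI[of _ "\<chi> i j. C i j"], rule exI[of _ "\<chi> i j. L i j"], intro conjI allI)
    show "((\<lambda>s. F (of_real (sqrt s))) has_integral (\<chi> i j. U i j)) {b..}"
      by (rule has_integral_matrix_entries) (simp add: UCL)
    show "((\<lambda>s. F (of_real (- sqrt s))) has_integral (\<chi> i j. L i j)) {b..}"
      by (rule has_integral_matrix_entries) (simp add: UCL)
    show "((\<lambda>\<mu>. F (up_sqrt \<mu>) $ i $ j) has_contour_integral (\<chi> i j. C i j) $ i $ j) g" for i j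
      by (simp add: UCL)
    show "(2 * of_real pi * \<i>) \<odot> (\<phi>1 x lam - \<phi> x lam) = - (\<chi> i j. U i j) + (\<chi> i j. C i j) + (\<chi> i j. L i j)"
      unfolding vec_eq_iff
    proof (intro allI)
      fix i j
      have "2 * of_real pi * \<i> * (\<phi>1 x lam - \<phi> x lam) $ i $ j = - U i j + C i j + L i j" using UCL by blast
      then show "((2 * of_real pi * \<i>) \<odot> (\<phi>1 x lam - \<phi> x lam)) $ i $ j = (- (\<chi> i j. U i j) + (\<chi> i j. C i j) + (\<chi> i j. L i j)) $ i $ j"
        by simp
    qed
  qed
qed

end

theorem theorem2:
  fixes Q Q1 :: "real \<Rightarrow> complex^'n^'n"
    and A h h1 :: "complex^'n^'n"
    and e e1 \<phi> \<phi>1 \<phi>s1 :: "real \<Rightarrow> complex \<Rightarrow> complex^'n^'n"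
    and g :: "real \<Rightarrow> complex"
    and x :: real and lam :: complex
  assumes "sl_problem Q A h"
    and "sl_problem Q1 A h1"
    and "\<And>\<rho>. \<rho> \<in> Omega \<Longrightarrow> jost_solution Q \<rho> (\<lambda>t. e t \<rho>)"
    and "\<And>\<rho>. \<rho> \<in> Omega \<Longrightarrow> jost_solution Q1 \<rho> (\<lambda>t. e1 t \<rho>)"
    and "\<And>\<mu>. regular_solution Q A h \<mu> (\<lambda>t. \<phi> t \<mu>)"
    and "\<And>\<mu>. regular_solution Q1 A h1 \<mu> (\<lambda>t. \<phi>1 t \<mu>)"
    and "\<And>\<mu>. regular_solution_dual Q1 A h1 \<mu> (\<lambda>t. \<phi>s1 t \<mu>)"
    and "loop_around (Lambda_set A h e \<union> Lambda_set A h1 e1) g"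
    and "x \<ge> 0"
  shows "\<exists>I. has_gamma_integral
               (\<lambda>\<rho>. \<phi> x (\<rho>\<^sup>2) **
                    ((weyl A h e \<rho> - weyl A h1 e1 \<rho>) ** kernel_D \<phi>s1 \<phi>1 x lam (\<rho>\<^sup>2))) I g \<and>
             \<phi>1 x lam = \<phi> x lam + mat (1 / (2 * of_real pi * \<i>)) ** I"
proof -
  have loop: "simple_path g" "pathfinish g = pathstart g"
    and sub: "Lambda_set A h e \<union> Lambda_set A h1 e1 \<subseteq> inside (path_image g)"
    using assms(8) by (auto simp: loop_around_def)
  have "bounded (Lambda_set A h e \<union> Lambda_set A h1 e1)"
    using Jordan_inside_outside[OF loop] bounded_subset[OF _ sub] by blast
  then interpret sl_pair Q Q1 A h h1 e e1 \<phi> \<phi>1 \<phi>s1 x lam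
    using assms by unfold_locales auto
  let ?I = "(2 * of_real pi * \<i>) \<odot> (\<phi>1 x lam - \<phi> x lam)"
  have "has_gamma_integral F ?I g" by (rule main_equation[OF assms(8)])
  moreover have "F = (\<lambda>\<rho>. \<phi> x (\<rho>\<^sup>2) ** ((weyl A h e \<rho> - weyl A h1 e1 \<rho>) ** kernel_D \<phi>s1 \<phi>1 x lam (\<rho>\<^sup>2)))"
    by (simp add: fun_eq_iff F_def D_def)
  moreover have "\<phi>1 x lam = \<phi> x lam + mat (1 / (2 * of_real pi * \<i>)) ** ?I"
    by (simp add: mat_mult_left cscale_cscale)
  ultimately show ?thesis by auto
qed

end
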